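(* Let $k$ be a positive integer, and let $\theta(\tau)=\sum_{n=-\infty}^{\infty}q^{n^2}$. (1) Let $\ell_2=\frac{k-1}{2}$ if $k$ is odd and $\ell_2=\frac{k-2}{2}$ if $k$ is even. Define $$ F_{k,2}(\tau)=\begin{cases} {\displaystyle\frac{E_{k,\chi_{-2}}^{\infty}(\tau)+(-8)^{(k-1)/2}E_{k,\chi_{-2}}^{0}(\tau)}{1+\delta_{k,1}}}&\text{if $k$ is odd,}\\[2ex] {\displaystyle\frac{(-1)^{\frac{k}{2}}E_{k}(\tau)-(-1)^{\frac{k}{2}}E_{k}(2\tau)-2^{\frac{k}{2}}E_{k}(4\tau)+8^{\frac{k}{2}}E_{k}(8\tau)}{2^{\frac{k}{2}}(2^{k}-1)}}&\text{if $k$ is even,} \end{cases} $$ and $x_2(\tau)=\left(\frac{\eta_1\eta_8}{\eta_2\eta_4}\right)^8$. Then there are unique rational numbers $c_{j,k,2}$ depending on $j$ and $k$ such that $$\left(\theta(\tau)\theta(2\tau)\right)^{k}=F_{k,2}(\tau)+\left(\theta(\tau)\theta(2\tau)\right)^{k}\sum_{j=1}^{\ell_{2}}c_{j,k,2}\,x_{2}(\tau)^{j}.$$ (2) Let $\ell_4=k-2$ if $k$ is odd and $\ell_4=k-1$ if $k$ is even (empty sum if $\ell_4\le0$). Define $$ F_{k,4}(\tau)=\begin{cases} \frac{1}{2}\left(E_{1,\chi_{-4}}^{\infty}(\tau)-E_{1,\chi_{-4}}^{\infty}(2\tau)+2E_{1,\chi_{-4}}^{\infty}(4\tau)\right)&\text{if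 $k=1$,}\\[1ex] \frac{1}{2}\Big((-1)^{\frac{k+1}{2}}E_{k,\chi_{-4}}^{\infty}(\tau)-(-1)^{\frac{k+1}{2}}E_{k,\chi_{-4}}^{\infty}(2\tau)+2E_{k,\chi_{-4}}^{\infty}(4\tau)&\\ \qquad-(-1)^{\frac{k+1}{2}}E_{k,\chi_{-4}}^{0}(\tau)+2^{k-1}E_{k,\chi_{-4}}^{0}(2\tau)-2^{2k-1}E_{k,\chi_{-4}}^{0}(4\tau)\Big)&\text{if $k\ge3$ is odd,}\\[1ex] {\displaystyle\frac{(-1)^{\frac{k}{2}}E_{k}(\tau)-(-1)^{\frac{k}{2}}E_{k}(2\tau)-2^{k}E_{k}(8\tau)+4^{k}E_{k}(16\tau)}{2^{k}(2^{k}-1)}}&\text{if $k$ is even,} \end{cases} $$ and $x_4(\tau)=\frac{(\eta_1\eta_4\eta_{16})^4}{(\eta_2\eta_8)^6}$. Then there are unique rational numbers $c_{j,k,4}$ depending on $j$ and $k$ such that $$\left(\theta(\tau)\theta(4\tau)\right)^{k}=F_{k,4}(\tau)+\left(\theta(\tau)\theta(4\tau)\right)^{k}\sum_{j=1}^{\ell_{4}}c_{j,k,4}\,x_{4}(\tau)^{j}.$$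
   Context: $\tau$ lies in the upper half plane, $q=e^{2\pi i\tau}$, $\eta(\tau)=q^{1/24}\prod_{j\ge1}(1-q^j)$, $\eta_m=\eta(m\tau)$. $\chi_D=\left(\frac{D}{\cdot}\right)$ is the Kronecker symbol, $\delta_{\cdot,\cdot}$ the Kronecker delta, $B_k$ the $k$-th Bernoulli number. Divisor functions: $\sigma_k(n)=\sum_{d\mid n}d^k$, $\sigma^{\infty}_{k,\chi_D}(n)=\sum_{d\mid n}\chi_D(d)d^k$, $\sigma^{0}_{k,\chi_D}(n)=\sum_{d\mid n}\chi_D(n/d)d^k$. Generalized Bernoulli numbers: $\frac{t}{e^{8t}-1}\sum_{j=1}^{8}\chi_{-2}(j)e^{jt}=\sum_{n\ge0}B_{n,8}\frac{t^n}{n!}$ and $\frac{t}{e^{4t}-1}\sum_{j=1}^{4}\chi_{-4}(j)e^{jt}=\sum_{n\ge0}B_{n,4}\frac{t^n}{n!}$. Eisenstein series (as $q$-series): $E_k(\tau)=1-\frac{2k}{B_k}\sum_{n\ge1}\sigma_{k-1}(n)q^n$; $E^{\infty}_{k,\chi_{-2}}(\tau)=1-\frac{2k}{B_{k,8}}\sum_{n\ge1}\sigma^{\infty}_{k-1,\chi_{-2}}(n)q^n$, $E^{0}_{k,\chi_{-2}}(\tau)=\delta_{k,1}-\frac{2k}{B_{k,8}}\sum_{n\ge1}\sigma^{0}_{k-1,\chi_{-2}}(n)q^n$ (weight $k$ on $\Gamma_0(8)$ with character $\chi_{-2}$); $E^{\infty}_{k,\chi_{-4}}(\tau)=1-\frac{2k}{B_{k,4}}\sum_{n\ge1}\sigma^{\infty}_{k-1,\chi_{-4}}(n)q^n$,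 $E^{0}_{k,\chi_{-4}}(\tau)=\delta_{k,1}-\frac{2k}{B_{k,4}}\sum_{n\ge1}\sigma^{0}_{k-1,\chi_{-4}}(n)q^n$ (weight $k$ on $\Gamma_0(4)$ with character $\chi_{-4}$). *)

theory Defs
  imports
    "HOL-Analysis.Analysis"
    "HOL-Computational_Algebra.Computational_Algebra"
    "HOL-Number_Theory.Residues"
begin

text \<open>
  The Kronecker symbol \<open>(a/n)\<close>: the multiplicative extension of the Legendre symbol in the
  lower argument, with \<open>(a/2) = 0, 1, -1\<close> according to whether \<open>a\<close> is even,
  \<open>\<plusminus>1\<close> or \<open>\<plusminus>3\<close> modulo 8, and \<open>(a/-1)\<close> the sign of \<open>a\<close> (with \<open>(0/-1) = 1\<close>).
\<close>

definition Kronecker_prime :: "int \<Rightarrow> int \<Rightarrow> int" where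
  "Kronecker_prime a p =
     (if p = 2 then if even a then 0 else if a mod 8 \<in> {1, 7} then 1 else -1
      else Legendre a p)"

definition Kronecker :: "int \<Rightarrow> int \<Rightarrow> int" where
  "Kronecker a n =
     (if n = 0 then if \<bar>a\<bar> = 1 then 1 else 0
      else (if n < 0 \<and> a < 0 then -1 else 1) *
           (\<Prod>p\<in>prime_factors n. Kronecker_prime a p ^ multiplicity p n))"

definition chi :: "int \<Rightarrow> nat \<Rightarrow> int" where
  "chi D n = Kronecker D (int n)"

text \<open>
  Bernoulli numbers, read off from their exponential generating functions. The series
  \<open>fps_exp c - 1\<close> has zero constant term, but so has \<open>fps_X\<close>, and division of formal power
  series cancels this common factor.
\<close>

definition Bernoulli :: "nat \<Rightarrow> rat" where
  "Bernoulli n = fact n * fps_nth (fps_X / (fps_exp 1 - 1)) n"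

text \<open>The modulus \<open>N\<close> is \<open>8\<close> for \<open>D = -2\<close> and \<open>4\<close> for \<open>D = -4\<close>.\<close>

definition gen_Bernoulli :: "int \<Rightarrow> nat \<Rightarrow> nat \<Rightarrow> rat" where
  "gen_Bernoulli D N n =
     fact n * fps_nth (fps_X / (fps_exp (of_nat N) - 1) *
       (\<Sum>j=1..N. fps_const (of_int (chi D j)) * fps_exp (of_nat j))) n"

definition div_sum :: "nat \<Rightarrow> nat \<Rightarrow> nat" where
  "div_sum k n = (\<Sum>d | d dvd n. d ^ k)"

definition div_sum_inf :: "int \<Rightarrow> nat \<Rightarrow> nat \<Rightarrow> int" where
  "div_sum_inf D k n = (\<Sum>d | d dvd n. chi D d * int d ^ k)"

definition div_sum_zero :: "int \<Rightarrow> nat \<Rightarrow> nat \<Rightarrow> int" where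
  "div_sum_zero D k n = (\<Sum>d | d dvd n. chi D (n div d) * int d ^ k)"

definition nome :: "complex \<Rightarrow> complex" where
  "nome \<tau> = exp (2 * of_real pi * \<i> * \<tau>)"

text \<open>
  All functions of \<open>\<tau>\<close> below are meant for \<open>Im \<tau> > 0\<close>, and the Eisenstein series for \<open>k \<ge> 1\<close>.
  \<open>q\<^sup>1\<^sup>/\<^sup>2\<^sup>4\<close> denotes \<open>exp (2\<pi>i\<tau>/24)\<close>.
\<close>

definition eta :: "complex \<Rightarrow> complex" where
  "eta \<tau> = exp (2 * of_real pi * \<i> * \<tau> / 24) * (\<Prod>j. 1 - nome \<tau> ^ Suc j)"

definition theta :: "complex \<Rightarrow> complex" where
  "theta \<tau> = (\<Sum>\<^sub>\<infinity>n::int. nome \<tau> powi (n ^ 2))"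

text \<open>Only used for even \<open>k\<close>, where \<open>Bernoulli k \<noteq> 0\<close>.\<close>

definition Eis :: "nat \<Rightarrow> complex \<Rightarrow> complex" where
  "Eis k \<tau> = 1 - 2 * of_nat k / of_rat (Bernoulli k) *
     (\<Sum>n. of_nat (div_sum (k - 1) (Suc n)) * nome \<tau> ^ Suc n)"

definition Eis_inf :: "int \<Rightarrow> nat \<Rightarrow> nat \<Rightarrow> complex \<Rightarrow> complex" where
  "Eis_inf D N k \<tau> = 1 - 2 * of_nat k / of_rat (gen_Bernoulli D N k) *
     (\<Sum>n. of_int (div_sum_inf D (k - 1) (Suc n)) * nome \<tau> ^ Suc n)"

definition Eis_zero :: "int \<Rightarrow> nat \<Rightarrow> nat \<Rightarrow> complex \<Rightarrow> complex" where
  "Eis_zero D N k \<tau> =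
     (if k = 1 then 1 else 0) - 2 * of_nat k / of_rat (gen_Bernoulli D N k) *
     (\<Sum>n. of_int (div_sum_zero D (k - 1) (Suc n)) * nome \<tau> ^ Suc n)"

definition ell2 :: "nat \<Rightarrow> nat" where
  "ell2 k = (if odd k then (k - 1) div 2 else (k - 2) div 2)"

definition F2 :: "nat \<Rightarrow> complex \<Rightarrow> complex" where
  "F2 k \<tau> =
     (if odd k then
        (Eis_inf (-2) 8 k \<tau> + (-8) ^ ((k - 1) div 2) * Eis_zero (-2) 8 k \<tau>) /
        (1 + (if k = 1 then 1 else 0))
      else
        ((-1) ^ (k div 2) * Eis k \<tau> - (-1) ^ (k div 2) * Eis k (2 * \<tau>)
         - 2 ^ (k div 2) * Eis k (4 * \<tau>) + 8 ^ (k div 2) * Eis k (8 * \<tau>)) /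
        (2 ^ (k div 2) * (2 ^ k - 1)))"

definition x2 :: "complex \<Rightarrow> complex" where
  "x2 \<tau> = ((eta \<tau> * eta (8 * \<tau>)) / (eta (2 * \<tau>) * eta (4 * \<tau>))) ^ 8"

text \<open>For \<open>k = 1\<close> the value \<open>k - 2 = -1\<close> is truncated to \<open>0\<close>; the sum up to it is empty either way.\<close>

definition ell4 :: "nat \<Rightarrow> nat" where
  "ell4 k = (if odd k then k - 2 else k - 1)"

definition F4 :: "nat \<Rightarrow> complex \<Rightarrow> complex" where
  "F4 k \<tau> =
     (if k = 1 then
        1 / 2 * (Eis_inf (-4) 4 1 \<tau> - Eis_inf (-4) 4 1 (2 * \<tau>) + 2 * Eis_inf (-4) 4 1 (4 * \<tau>))
      else if odd k then
        1 / 2 * ((-1) ^ ((k + 1) div 2) * Eis_inf (-4) 4 k \<tau>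
                 - (-1) ^ ((k + 1) div 2) * Eis_inf (-4) 4 k (2 * \<tau>)
                 + 2 * Eis_inf (-4) 4 k (4 * \<tau>)
                 - (-1) ^ ((k + 1) div 2) * Eis_zero (-4) 4 k \<tau>
                 + 2 ^ (k - 1) * Eis_zero (-4) 4 k (2 * \<tau>)
                 - 2 ^ (2 * k - 1) * Eis_zero (-4) 4 k (4 * \<tau>))
      else
        ((-1) ^ (k div 2) * Eis k \<tau> - (-1) ^ (k div 2) * Eis k (2 * \<tau>)
         - 2 ^ k * Eis k (8 * \<tau>) + 4 ^ k * Eis k (16 * \<tau>)) /
        (2 ^ k * (2 ^ k - 1)))"

definition x4 :: "complex \<Rightarrow> complex" where
  "x4 \<tau> = (eta \<tau> * eta (4 * \<tau>) * eta (16 * \<tau>)) ^ 4 / (eta (2 * \<tau>) * eta (8 * \<tau>)) ^ 6"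

end

theory Submission
  imports Defs "HOL-Complex_Analysis.Complex_Analysis" "HOL-Number_Theory.Number_Theory"
begin

text \<open>
  Write \<open>q = exp (- l)\<close>, \<open>a = \<theta>(q)\<close> and \<open>b = \<theta>(- q)\<close>. The series
  \<open>D(z) = \<Sum>n. exp (n z) / cosh (n l)\<close> and \<open>D(z) = \<Sum>m. sech (z + m l)\<close> satisfy, up to scaling of \<open>z\<close>,
  an equation \<open>D'' = \<alpha> D - 2 D\<^sup>3\<close>, whose coefficient \<open>\<alpha>\<close> is a polynomial in \<open>a\<close> and \<open>b\<close>, by
  telescoping of \<open>tanh\<close> in the convolutions \<open>D\<^sup>2\<close> and \<open>D\<^sup>3\<close>. Hence their even derivatives, and those
  of \<open>D\<^sup>2\<close>, at the points \<open>0\<close>, \<open>i \<pi>\<close>, \<open>i \<pi> / 4\<close> are homogeneous polynomials in \<open>a\<close> and \<open>b\<close>; expanded in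
  \<open>q\<close> they are the Eisenstein series of the theorem.

  Replacing \<open>(a, b)\<close> by \<open>(a + b, a - b)\<close> turns the first kind of series into the second one, so each \<open>F\<close>
  is, up to a constant (and, in part (1) for odd \<open>k\<close>, a factor \<open>\<theta>(\<tau>) \<theta>(2 \<tau>)\<close>), a form
  \<open>\<Phi>(a, b) + \<Phi>(a + b, a - b) / 2\<^sup>k\<close>. Such a form equals \<open>(a (a + b) / 2)\<^sup>k\<close> times a polynomial
  in the invariant \<open>b (a - b) / (2 a (a + b))\<close> of the involution \<open>u \<mapsto> (1 - u) / (1 + u)\<close>, and its order of
  vanishing at \<open>u = - 1\<close> lowers the degree of the polynomial. By Jacobi's product formulas the invariant
  is \<open>x\<^sub>4\<close>, and \<open>2 x\<^sub>2\<close> for \<open>(a\<^sup>2, b\<^sup>2)\<close> in place of \<open>(a, b)\<close>. The constant term is \<open>1\<close> by the limit \<open>q \<rightarrow> 0\<close>.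
\<close>

section \<open>Exponential sums over the integers\<close>

text \<open>No dimension count or valence formula for modular forms is used: once both sides are
  polynomials in \<open>a\<close> and \<open>b\<close>, only algebra remains. Nor does an inversion
  formula for theta enter. With \<open>A = a\<^sup>2\<close> and \<open>B = b\<^sup>2\<close>, the
  dual series for the doubled parameter has the values \<open>(A + B) / 2\<close> at
  \<open>0\<close> and \<open>(A - B) / 2\<close> at its half period; this is where the pair
  \<open>(a + b, a - b)\<close> comes from. The secant series gives \<open>A\<close> and
  \<open>B\<close> only as sums of \<open>sech\<close>. They are recognised as squares of theta
  constants because they satisfy the relations of the arithmetic-geometric mean, which admit a
  single power series with given first coefficients. Matching Eisenstein series with derivatives
  divides by Bernoulli numbers, so these must not vanish. For the characters this follows from the
  parity of Euler-type numbers, for the ordinary ones from the signs of the tangent coefficients.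
  For \<open>D\<^sup>2\<close> the differentiated series lose a constant, so weight 2 has to be
  computed from the undifferentiated squares.\<close>

lemma power_le_fact_exp:
  assumes "x \<ge> (0::real)"
  shows "x ^ j \<le> fact j * exp x"
proof -
  have "summable (\<lambda>n. x ^ n /\<^sub>R fact n)" by (rule summable_exp_generic)
  then have "(\<Sum>i\<in>{j}. x ^ i /\<^sub>R fact i) \<le> exp x"
    unfolding exp_def using assms by (intro sum_le_suminf) auto
  then show ?thesis by (simp add: field_simps)
qed

lemma summable_on_exp_int:
  assumes "\<rho> > (0::real)"
  shows "(\<lambda>n::int. exp (- \<rho> * \<bar>real_of_int n\<bar>)) summable_on UNIV"
proof -
  have s: "summable (\<lambda>n. exp (- \<rho> * real n))"
  proof -
    have "(\<lambda>n. exp (- \<rho> * real n)) = (\<lambda>n. exp (- \<rho>) ^ n)"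
      by (simp add: exp_of_nat_mult[symmetric] mult.commute)
    then show ?thesis using assms by (simp add: summable_geometric)
  qed
  then have s': "(\<lambda>n. exp (- \<rho> * real n)) summable_on UNIV"
    by (intro norm_summable_imp_summable_on) simp
  have 1: "(\<lambda>n::int. exp (- \<rho> * \<bar>real_of_int n\<bar>)) summable_on {0..}"
    by (rule iffD1[OF summable_on_reindex_bij_witness[of UNIV nat int] s']) auto
  have 2: "(\<lambda>n::int. exp (- \<rho> * \<bar>real_of_int n\<bar>)) summable_on {..0}"
    by (rule iffD1[OF summable_on_reindex_bij_witness[of UNIV "\<lambda>n. nat (-n)" "\<lambda>n. - int n"] s']) auto
  have "(UNIV::int set) = {0..} \<union> {..0}" by auto
  then show ?thesis using summable_on_union[OF 1 2] by simp
qed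

text \<open>Half of the rate absorbs the power, the other half gives convergence.\<close>

lemma summable_on_power_exp_int:
  assumes "\<rho> > (0::real)"
  shows "(\<lambda>n::int. \<bar>real_of_int n\<bar> ^ j * exp (- \<rho> * \<bar>real_of_int n\<bar>)) summable_on UNIV"
proof -
  have "(\<lambda>n::int. fact j * (2/\<rho>)^j * exp (- (\<rho>/2) * \<bar>real_of_int n\<bar>)) summable_on UNIV"
    using assms by (intro summable_on_cmult_right summable_on_exp_int) simp
  then show ?thesis
  proof (rule summable_on_comparison_test, goal_cases)
    case (1 n)
    let ?x = "\<bar>real_of_int n\<bar>"
    have "(\<rho>/2 * ?x) ^ j \<le> fact j * exp (\<rho>/2 * ?x)"
      using assms by (intro power_le_fact_exp) simp
    then have "?x ^ j \<le> (2/\<rho>)^j * (fact j * exp (\<rho>/2 * ?x))"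
      using assms by (simp add: power_mult_distrib power_divide field_simps)
    then have "?x ^ j * exp (- \<rho> * ?x) \<le> (2/\<rho>)^j * (fact j * exp (\<rho>/2 * ?x)) * exp (- \<rho> * ?x)"
      by (intro mult_right_mono) auto
    also have e: "exp (- \<rho> * ?x) = exp (- (\<rho>/2) * ?x) * exp (- (\<rho>/2) * ?x)"
      by (simp add: exp_add[symmetric])
    also have "(2/\<rho>)^j * (fact j * exp (\<rho>/2 * ?x)) * (exp (- (\<rho>/2) * ?x) * exp (- (\<rho>/2) * ?x))
        = fact j * (2/\<rho>)^j * exp (- (\<rho>/2) * ?x) * (exp (\<rho>/2 * ?x) * exp (- (\<rho>/2) * ?x))"
      by (simp only: mult_ac)
    also have "exp (\<rho>/2 * ?x) * exp (- (\<rho>/2) * ?x) = 1"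
      by (simp add: exp_add[symmetric])
    finally show ?case by (simp only: mult_1_right e[symmetric])
  qed auto
qed

text \<open>The rate is part of the predicate because it is the half-width of the strip
  \<open>\<bar>Re z\<bar> < \<rho>\<close> in which \<open>exp_series\<close> converges and may be
  differentiated.\<close>

definition exp_decay :: "real \<Rightarrow> (int \<Rightarrow> complex) \<Rightarrow> bool" where
  "exp_decay \<rho> c \<longleftrightarrow> (\<exists>K. \<forall>n. norm (c n) \<le> K * exp (- \<rho> * \<bar>real_of_int n\<bar>))"

text \<open>The index \<open>j\<close> counts derivatives in \<open>z\<close>, each of which brings
  down a factor \<open>n\<close>.\<close>

definition exp_series :: "(int \<Rightarrow> complex) \<Rightarrow> nat \<Rightarrow> complex \<Rightarrow> complex" where
  "exp_series c j z = (\<Sum>\<^sub>\<infinity>n. c n * of_int n ^ j * exp (of_int n * z))"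

lemma norm_exp_int_le: "norm (exp (of_int n * z)) \<le> exp (\<bar>real_of_int n\<bar> * \<bar>Re z\<bar>)"
proof -
  have "real_of_int n * Re z \<le> \<bar>real_of_int n * Re z\<bar>" by simp
  then show ?thesis by (simp add: abs_mult)
qed

lemma exp_decay_bound:
  assumes "exp_decay \<rho> c" "\<sigma> < \<rho>"
  obtains g where "g summable_on UNIV"
    "\<And>n z. \<bar>Re z\<bar> \<le> \<sigma> \<Longrightarrow> norm (c n * of_int n ^ j * exp (of_int n * z)) \<le> g n"
proof -
  obtain K where K: "\<And>n. norm (c n) \<le> K * exp (- \<rho> * \<bar>real_of_int n\<bar>)"
    using assms(1) unfolding exp_decay_def by blast
  let ?g = "\<lambda>n::int. K * (\<bar>real_of_int n\<bar> ^ j * exp (- (\<rho> - \<sigma>) * \<bar>real_of_int n\<bar>))"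
  show ?thesis
  proof (rule that[of ?g])
    show "?g summable_on UNIV"
      using assms(2) by (intro summable_on_cmult_right summable_on_power_exp_int) simp
    fix n z assume z: "\<bar>Re z\<bar> \<le> \<sigma>"
    have "norm (exp (of_int n * z)) \<le> exp (\<bar>real_of_int n\<bar> * \<sigma>)"
      by (rule order_trans[OF norm_exp_int_le]) (use z in \<open>auto intro: mult_left_mono\<close>)
    then have "norm (c n * of_int n ^ j * exp (of_int n * z)) \<le>
        (K * exp (- \<rho> * \<bar>real_of_int n\<bar>)) * \<bar>real_of_int n\<bar> ^ j * exp (\<bar>real_of_int n\<bar> * \<sigma>)"
      unfolding norm_mult norm_power norm_of_int
      by (intro mult_mono K order_refl mult_nonneg_nonneg order_trans[OF norm_ge_zero K]) auto
    also have "\<dots> = ?g n" by (simp add: exp_minus exp_diff field_simps exp_add)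
    finally show "norm (c n * of_int n ^ j * exp (of_int n * z)) \<le> ?g n" .
  qed
qed

lemma summable_on_norm_le:
  fixes f :: "'a \<Rightarrow> complex"
  assumes "g summable_on A" "\<And>x. x \<in> A \<Longrightarrow> norm (f x) \<le> g x"
  shows "f summable_on A"
  by (rule abs_summable_summable[OF summable_on_comparison_test[OF assms(1)]]) (use assms in auto)

lemma exp_series_summable:
  assumes "exp_decay \<rho> c" "\<bar>Re z\<bar> < \<rho>"
  shows "(\<lambda>n. c n * of_int n ^ j * exp (of_int n * z)) summable_on UNIV"
proof -
  obtain g where "g summable_on UNIV"
    "\<And>n w. \<bar>Re w\<bar> \<le> \<bar>Re z\<bar> \<Longrightarrow> norm (c n * of_int n ^ j * exp (of_int n * w)) \<le> g n"
    using exp_decay_bound[OF assms] by blast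
  then show ?thesis by (intro summable_on_norm_le[of g]) auto
qed

lemma infsum_int_decode:
  fixes f :: "int \<Rightarrow> complex"
  assumes "f summable_on UNIV"
  shows "infsum f UNIV = (\<Sum>n. f (int_decode n))"
proof -
  have "((\<lambda>n. f (int_decode n)) has_sum infsum f UNIV) UNIV"
    using has_sum_reindex_bij_betw[OF bij_int_decode, of f "infsum f UNIV"] assms
    by (simp add: has_sum_infsum)
  from has_sum_imp_sums[OF this] show ?thesis by (simp add: sums_iff)
qed

text \<open>The differentiated series has a majorant that is uniform on a slightly narrower strip;
  enumerating the integers by \<open>int_decode\<close> makes termwise differentiation of ordinary
  series applicable.\<close>

lemma exp_series_deriv:
  assumes "exp_decay \<rho> c" "\<bar>Re z\<bar> < \<rho>"
  shows "(exp_series c j has_field_derivative exp_series c (Suc j) z) (at z)"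
proof -
  define \<sigma> where "\<sigma> = (\<bar>Re z\<bar> + \<rho>) / 2"
  have \<sigma>: "\<bar>Re z\<bar> < \<sigma>" "\<sigma> < \<rho>" using assms(2) by (auto simp: \<sigma>_def)
  define S where "S = {w. - \<sigma> < Re w \<and> Re w < \<sigma>}"
  have S: "S = {w. Re w > - \<sigma>} \<inter> {w. Re w < \<sigma>}" by (auto simp: S_def)
  have cS: "convex S" unfolding S by (intro convex_Int convex_halfspace_Re_gt convex_halfspace_Re_lt)
  have oS: "open S" unfolding S by (intro open_Int open_halfspace_Re_gt open_halfspace_Re_lt)
  have zS: "z \<in> S" using \<sigma> by (auto simp: S_def)
  obtain g where g: "g summable_on UNIV"
    "\<And>n z. \<bar>Re z\<bar> \<le> \<sigma> \<Longrightarrow> norm (c n * of_int n ^ Suc j * exp (of_int n * z)) \<le> g n"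
    using exp_decay_bound[OF assms(1) \<sigma>(2), of "Suc j"] by metis
  define F where "F = (\<lambda>i n w. c n * of_int n ^ i * exp (of_int n * w))"
  have sg: "summable (\<lambda>n. g (int_decode n))"
    using g(1) summable_on_reindex_bij_betw[OF bij_int_decode, of g] summable_on_imp_summable by blast
  have uc: "uniformly_convergent_on S (\<lambda>n w. \<Sum>i<n. F (Suc j) (int_decode i) w)"
    by (rule Weierstrass_m_test'[OF _ sg]) (use g(2) in \<open>auto simp: S_def F_def\<close>)
  have sm: "F i n w = c n * of_int n ^ i * exp (of_int n * w)" for i n w by (simp add: F_def)
  have summ: "(\<lambda>n. F i n w) summable_on UNIV" if "w \<in> S" for i w
    unfolding F_def by (rule exp_series_summable[OF assms(1)]) (use that \<sigma> in \<open>auto simp: S_def\<close>)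
  have sumc: "summable (\<lambda>n. F j (int_decode n) z)"
    using summ[OF zS] summable_on_reindex_bij_betw[OF bij_int_decode, of "\<lambda>n. F j n z"] summable_on_imp_summable by blast
  have "((\<lambda>w. \<Sum>n. F j (int_decode n) w) has_field_derivative (\<Sum>n. F (Suc j) (int_decode n) z)) (at z)"
  proof (rule has_field_derivative_series'(2)[where S = S and x = z and ?x0.0 = z
        and f = "\<lambda>n. F j (int_decode n)" and f' = "\<lambda>n. F (Suc j) (int_decode n)"])
    show "(F j (int_decode n) has_field_derivative F (Suc j) (int_decode n) w) (at w within S)" for n w
      unfolding F_def by (auto intro!: derivative_eq_intros)
  qed (use cS uc zS sumc oS in \<open>auto simp: interior_open\<close>)
  then have "((\<lambda>w. \<Sum>n. F j (int_decode n) w) has_field_derivative exp_series c (Suc j) z) (at z)"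
    using infsum_int_decode[OF summ[OF zS, of "Suc j"]] by (simp add: exp_series_def F_def)
  then show ?thesis
    by (rule has_field_derivative_transform_within_open[OF _ oS zS])
       (use infsum_int_decode[OF summ] in \<open>simp add: exp_series_def F_def\<close>)
qed

section \<open>Reflection, telescoping and products of sums over the integers\<close>

lemma infsum_shift_int: "infsum (\<lambda>a::int. f (a + s)) UNIV = (infsum f UNIV :: complex)"
  by (rule infsum_reindex_bij_witness[of UNIV "\<lambda>a. a - s" "\<lambda>a. a + s"]) auto

lemma summable_shift_int: "(\<lambda>a::int. f (a + s)) summable_on UNIV \<longleftrightarrow> (f :: int \<Rightarrow> complex) summable_on UNIV"
  by (rule summable_on_reindex_bij_witness[of UNIV "\<lambda>a. a - s" "\<lambda>a. a + s"]) auto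

lemma infsum_minus_int: "infsum (\<lambda>a::int. f (- a)) UNIV = (infsum f UNIV :: complex)"
  by (rule infsum_reindex_bij_witness[of UNIV uminus uminus]) auto

lemma infsum_odd_int:
  assumes "\<And>a::int. f (- a) = - (f a :: complex)"
  shows "infsum f UNIV = 0"
proof -
  have "infsum f UNIV = infsum (\<lambda>a. - f a) UNIV"
    using infsum_minus_int[of f] assms by simp
  also have "\<dots> = - infsum f UNIV" by (rule infsum_uminus)
  finally show ?thesis by simp
qed

lemma infsum_int_telescope:
  fixes t :: "int \<Rightarrow> complex"
  assumes sm: "(\<lambda>a. t (a + 1) - t a) summable_on UNIV"
    and L: "(\<lambda>n. t (int n)) \<longlonglongrightarrow> L" and M: "(\<lambda>n. t (- int n)) \<longlonglongrightarrow> M"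
  shows "infsum (\<lambda>a. t (a + 1) - t a) UNIV = L - M"
proof -
  let ?f = "\<lambda>a. t (a + 1) - t a"
  have U: "(UNIV::int set) = {0..} \<union> {..-1}" by auto
  have s1: "?f summable_on {0..}" and s2: "?f summable_on {..-1}"
    using sm by (auto intro: summable_on_subset_banach)
  have b1: "((\<lambda>n. ?f (int n)) has_sum infsum ?f {0..}) UNIV"
    by (rule iffD2[OF has_sum_reindex_bij_witness[of UNIV nat int] has_sum_infsum[OF s1]]) auto
  have "(\<lambda>n. ?f (int n)) sums (L - t 0)"
    using telescope_sums[OF L] by (simp add: add.commute)
  then have e1: "infsum ?f {0..} = L - t 0" using has_sum_imp_sums[OF b1] sums_unique2 by blast
  have b2: "((\<lambda>n. ?f (- int n - 1)) has_sum infsum ?f {..-1}) UNIV"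
    by (rule iffD2[OF has_sum_reindex_bij_witness[of UNIV "\<lambda>a. nat (- a - 1)" "\<lambda>n. - int n - 1"] has_sum_infsum[OF s2]]) auto
  have "(\<lambda>n. ?f (- int n - 1)) sums (t 0 - M)"
  proof -
    have "?f (- int n - 1) = t (- int n) - t (- int (Suc n))" for n
      by (rule arg_cong2[where f = "(-)"]; rule arg_cong[where f = t]; simp)
    then show ?thesis using telescope_sums'[OF M] by simp
  qed
  then have e2: "infsum ?f {..-1} = t 0 - M" using has_sum_imp_sums[OF b2] sums_unique2 by blast
  have "infsum ?f UNIV = infsum ?f {0..} + infsum ?f {..-1}"
    unfolding U by (rule infsum_Un_disjoint[OF s1 s2]) auto
  then show ?thesis using e1 e2 by simp
qed

text \<open>A shift by \<open>s \<ge> 0\<close> is a chain of \<open>s\<close> unit telescopes; for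
  negative \<open>s\<close> the identity for \<open>- s\<close> is translated and negated.\<close>

lemma infsum_int_telescope_shift:
  fixes t :: "int \<Rightarrow> complex"
  assumes sm: "(\<lambda>a. t (a + 1) - t a) summable_on UNIV"
    and L: "(\<lambda>n. t (int n)) \<longlonglongrightarrow> L" and M: "(\<lambda>n. t (- int n)) \<longlonglongrightarrow> M"
  shows "((\<lambda>a. t (a + s) - t a) has_sum of_int s * (L - M)) UNIV"
proof -
  have one: "((\<lambda>a. t (a + 1) - t a) has_sum (L - M)) UNIV"
    using infsum_int_telescope[OF assms] sm by (simp add: has_sum_iff)
  have nn: "((\<lambda>a. t (a + int n) - t a) has_sum of_nat n * (L - M)) UNIV" for n
  proof (induction n)
    case (Suc n)
    have "((\<lambda>a. t (a + int n + 1) - t (a + int n)) has_sum (L - M)) UNIV"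
      by (rule iffD2[OF has_sum_reindex_bij_witness[of UNIV "\<lambda>a. a - int n" "\<lambda>a. a + int n"] one]) auto
    from has_sum_add[OF Suc this] show ?case by (simp add: algebra_simps)
  qed simp
  show ?thesis
  proof (cases "s \<ge> 0")
    case True
    then show ?thesis using nn[of "nat s"] by simp
  next
    case False
    have "((\<lambda>a. t (a + s) - t (a + s + int (nat (-s)))) has_sum - (of_nat (nat (-s)) * (L - M))) UNIV"
      using has_sum_uminusI[OF iffD2[OF has_sum_reindex_bij_witness[of UNIV "\<lambda>a. a - s" "\<lambda>a. a + s"] nn[of "nat (-s)"], of "\<lambda>a. t (a + s + int (nat (-s))) - t (a + s)"]]
      by auto
    then show ?thesis using False by simp
  qed
qed

lemma product_summable_real:
  fixes f :: "'a \<Rightarrow> real" and g :: "'b \<Rightarrow> real"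
  assumes "f summable_on A" "g summable_on B" "\<And>x. f x \<ge> 0" "\<And>x. g x \<ge> 0"
  shows "(\<lambda>(x, y). f x * g y) summable_on (A \<times> B)"
  by (intro summable_on_SigmaI[where g = "\<lambda>x. f x * infsum g B"])
     (use assms in \<open>auto intro!: has_sum_cmult_right summable_on_cmult_left\<close>)

lemma product_summable:
  fixes f :: "'a \<Rightarrow> complex" and g :: "'b \<Rightarrow> complex"
  assumes "f summable_on A" "g summable_on B"
  shows "(\<lambda>(x, y). f x * g y) summable_on (A \<times> B)"
proof -
  have "(\<lambda>x. norm (f x)) summable_on A" "(\<lambda>y. norm (g y)) summable_on B"
    using assms summable_on_iff_abs_summable_on_complex by blast+
  then have "(\<lambda>(x, y). norm (f x) * norm (g y)) summable_on (A \<times> B)"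
    by (intro product_summable_real) auto
  then show ?thesis
    by (rule summable_on_norm_le) (auto simp: norm_mult)
qed

lemma product_infsum:
  fixes f :: "'a \<Rightarrow> complex" and g :: "'b \<Rightarrow> complex"
  assumes "f summable_on A" "g summable_on B"
  shows "infsum (\<lambda>(x, y). f x * g y) (A \<times> B) = infsum f A * infsum g B"
proof -
  have "infsum (\<lambda>(x, y). f x * g y) (A \<times> B) = infsum (\<lambda>x. infsum (\<lambda>y. f x * g y) B) A"
    using infsum_Sigma'_banach[OF product_summable[OF assms]] by simp
  also have "\<dots> = infsum f A * infsum g B"
    by (simp add: infsum_cmult_right' infsum_cmult_left')
  finally show ?thesis .
qed

text \<open>Indexing pairs by their difference \<open>s\<close> turns a product of two series into a
  sum of correlations over \<open>s\<close>. The squares and cubes of both kinds of secant series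
  start from this form.\<close>

lemma product_infsum_shift:
  fixes f g :: "int \<Rightarrow> complex"
  assumes "f summable_on UNIV" "g summable_on UNIV"
  shows "infsum f UNIV * infsum g UNIV = infsum (\<lambda>s. infsum (\<lambda>a. f a * g (a + s)) UNIV) UNIV"
    and "(\<lambda>(s, a). f a * g (a + s)) summable_on UNIV"
    and "(\<lambda>s. infsum (\<lambda>a. f a * g (a + s)) UNIV) summable_on UNIV"
proof -
  have 0: "(\<lambda>(x, y). f x * g y) summable_on UNIV"
    using product_summable[OF assms] by simp
  have bij: "(\<lambda>(s, a). f a * g (a + s)) summable_on UNIV \<longleftrightarrow> (\<lambda>(x, y). f x * g y) summable_on UNIV"
    by (rule summable_on_reindex_bij_witness[of UNIV "\<lambda>(a, b). (b - a, a)" "\<lambda>(s, a). (a, a + s)"]) auto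
  then show 1: "(\<lambda>(s, a). f a * g (a + s)) summable_on UNIV" using 0 by simp
  have "infsum (\<lambda>(s, a). f a * g (a + s)) UNIV = infsum (\<lambda>(x, y). f x * g y) UNIV"
    by (rule infsum_reindex_bij_witness[of UNIV "\<lambda>(a, b). (b - a, a)" "\<lambda>(s, a). (a, a + s)"]) auto
  also have "\<dots> = infsum f UNIV * infsum g UNIV"
    using product_infsum[OF assms] by simp
  finally show "infsum f UNIV * infsum g UNIV = infsum (\<lambda>s. infsum (\<lambda>a. f a * g (a + s)) UNIV) UNIV"
    using infsum_Sigma'_banach[of "\<lambda>s a. f a * g (a + s)" UNIV "\<lambda>_. UNIV"] 1 by simp
  show "(\<lambda>s. infsum (\<lambda>a. f a * g (a + s)) UNIV) summable_on UNIV"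
    using summable_on_Sigma_banach[of "\<lambda>s a. f a * g (a + s)" UNIV "\<lambda>_. UNIV"] 1 by simp
qed

section \<open>Decay of 1/cosh and 1/sinh along a lattice line\<close>

lemma norm_exp_sum_ge:
  fixes w \<epsilon> :: complex
  assumes "norm \<epsilon> = 1" "\<bar>Re w\<bar> \<ge> \<delta>"
  shows "norm (exp w + \<epsilon> * exp (- w)) \<ge> exp \<bar>Re w\<bar> * (1 - exp (- 2 * \<delta>))"
proof -
  have "norm (exp w + \<epsilon> * exp (- w)) \<ge> exp \<bar>Re w\<bar> - exp (- \<bar>Re w\<bar>)"
  proof (cases "Re w \<ge> 0")
    case True
    then show ?thesis using norm_diff_ineq[of "exp w" "\<epsilon> * exp (- w)"] assms(1)
      by (simp add: norm_mult)
  next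
    case False
    then show ?thesis using norm_diff_ineq[of "\<epsilon> * exp (- w)" "exp w"] assms(1)
      by (simp add: norm_mult add.commute)
  qed
  moreover have "exp \<bar>Re w\<bar> - exp (- \<bar>Re w\<bar>) = exp \<bar>Re w\<bar> * (1 - exp (- 2 * \<bar>Re w\<bar>))"
    by (simp add: right_diff_distrib exp_add[symmetric])
  moreover have "exp \<bar>Re w\<bar> * (1 - exp (- 2 * \<bar>Re w\<bar>)) \<ge> exp \<bar>Re w\<bar> * (1 - exp (- 2 * \<delta>))"
    using assms(2) by (intro mult_left_mono) auto
  ultimately show ?thesis by linarith
qed

lemma norm_cosh_ge:
  fixes w :: complex
  assumes "\<bar>Re w\<bar> \<ge> \<delta>"
  shows "norm (cosh w) \<ge> exp \<bar>Re w\<bar> * ((1 - exp (- 2 * \<delta>)) / 2)"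
    and "norm (sinh w) \<ge> exp \<bar>Re w\<bar> * ((1 - exp (- 2 * \<delta>)) / 2)"
  using norm_exp_sum_ge[of 1 \<delta> w] norm_exp_sum_ge[of "-1" \<delta> w] assms
  by (auto simp: cosh_field_def sinh_field_def norm_divide)

text \<open>All zeros of \<open>cosh\<close> and \<open>sinh\<close> lie on the imaginary axis;
  inside the strip, a shift by a nonzero multiple of \<open>w\<close> keeps a fixed distance from
  it.\<close>

lemma strip_Re_ge:
  fixes w z :: complex
  assumes "\<bar>Re z\<bar> < Re w" "m \<noteq> (0::int)"
  shows "\<bar>Re (z + of_int m * w)\<bar> \<ge> \<bar>real_of_int m\<bar> * Re w - \<bar>Re z\<bar>"
    and "\<bar>Re (z + of_int m * w)\<bar> \<ge> Re w - \<bar>Re z\<bar>"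
proof -
  have "\<bar>real_of_int m\<bar> * Re w = \<bar>Re (of_int m * w)\<bar>" using assms by (simp add: abs_mult)
  then show 1: "\<bar>Re (z + of_int m * w)\<bar> \<ge> \<bar>real_of_int m\<bar> * Re w - \<bar>Re z\<bar>" by simp
  have "\<bar>real_of_int m\<bar> \<ge> 1" using assms(2) by linarith
  then have "\<bar>real_of_int m\<bar> * Re w \<ge> 1 * Re w" using assms(1) by (intro mult_right_mono) auto
  with 1 show "\<bar>Re (z + of_int m * w)\<bar> \<ge> Re w - \<bar>Re z\<bar>" by linarith
qed

lemma strip_nonzero:
  fixes w z :: complex
  assumes "\<bar>Re z\<bar> < Re w" "m \<noteq> (0::int)"
  shows "cosh (z + of_int m * w) \<noteq> 0" "sinh (z + of_int m * w) \<noteq> 0"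
proof -
  let ?d = "Re w - \<bar>Re z\<bar>"
  have "exp \<bar>Re (z + of_int m * w)\<bar> * ((1 - exp (- 2 * ?d)) / 2) > 0" using assms(1) by simp
  moreover note norm_cosh_ge[OF strip_Re_ge(2)[OF assms]]
  ultimately show "cosh (z + of_int m * w) \<noteq> 0" "sinh (z + of_int m * w) \<noteq> 0"
    by (metis norm_zero not_less)+
qed

lemma exp_decay_strip:
  fixes w z :: complex
  assumes z: "\<bar>Re z\<bar> < Re w"
  shows "exp_decay (Re w) (\<lambda>m. 1 / cosh (z + of_int m * w))"
    and "exp_decay (Re w) (\<lambda>m. 1 / sinh (z + of_int m * w))"
proof -
  let ?d = "Re w - \<bar>Re z\<bar>"
  let ?k = "(1 - exp (- 2 * ?d)) / 2"
  have k: "?k > 0" using z by simp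
  have gen: "exp_decay (Re w) (\<lambda>m. 1 / f (z + of_int m * w))"
    if f: "\<And>u. \<bar>Re u\<bar> \<ge> ?d \<Longrightarrow> norm (f u) \<ge> exp \<bar>Re u\<bar> * ?k" for f :: "complex \<Rightarrow> complex"
    unfolding exp_decay_def
  proof (intro exI[of _ "max (norm (1 / f z)) (exp \<bar>Re z\<bar> / ?k)"] allI)
    \<comment> \<open>The first entry of the maximum serves only \<open>m = 0\<close>, where
      \<open>z\<close> may be close to a zero of \<open>f\<close>, or equal to one with
      \<open>1 / f z = 0\<close>.\<close>
    fix m :: int
    show "norm (1 / f (z + of_int m * w)) \<le> max (norm (1 / f z)) (exp \<bar>Re z\<bar> / ?k) * exp (- Re w * \<bar>real_of_int m\<bar>)"
    proof (cases "m = 0")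
      case False
      let ?u = "z + of_int m * w"
      have "exp (\<bar>real_of_int m\<bar> * Re w - \<bar>Re z\<bar>) * ?k \<le> exp \<bar>Re ?u\<bar> * ?k"
        using strip_Re_ge(1)[OF z False] k by (intro mult_right_mono) auto
      also have "\<dots> \<le> norm (f ?u)" by (rule f[OF strip_Re_ge(2)[OF z False]])
      finally have "norm (1 / f ?u) \<le> 1 / (exp (\<bar>real_of_int m\<bar> * Re w - \<bar>Re z\<bar>) * ?k)"
        unfolding norm_divide norm_one using k by (intro frac_le) auto
      also have "\<dots> = exp \<bar>Re z\<bar> / ?k * exp (- Re w * \<bar>real_of_int m\<bar>)"
        by (simp add: exp_diff exp_minus field_simps)
      also have "\<dots> \<le> max (norm (1 / f z)) (exp \<bar>Re z\<bar> / ?k) * exp (- Re w * \<bar>real_of_int m\<bar>)"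
        by (intro mult_right_mono) auto
      finally show ?thesis .
    qed simp
  qed
  show "exp_decay (Re w) (\<lambda>m. 1 / cosh (z + of_int m * w))" by (rule gen[OF norm_cosh_ge(1)])
  show "exp_decay (Re w) (\<lambda>m. 1 / sinh (z + of_int m * w))" by (rule gen[OF norm_cosh_ge(2)])
qed

lemma exp_decay_summable:
  assumes "exp_decay \<rho> c" "\<rho> > 0"
  shows "c summable_on UNIV"
  using exp_series_summable[OF assms(1), of 0 0] assms(2) by simp

lemma exp_decay_mult:
  assumes "exp_decay \<rho> c" "exp_decay \<sigma> d" "\<rho> > 0" "\<sigma> \<ge> 0"
  shows "exp_decay \<rho> (\<lambda>n. c n * d n)"
proof -
  obtain K where K: "\<And>n. norm (c n) \<le> K * exp (- \<rho> * \<bar>real_of_int n\<bar>)"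
    using assms(1) unfolding exp_decay_def by blast
  obtain L where L: "\<And>n. norm (d n) \<le> L * exp (- \<sigma> * \<bar>real_of_int n\<bar>)"
    using assms(2) unfolding exp_decay_def by blast
  have L0: "L \<ge> 0" using order_trans[OF norm_ge_zero L[of 0]] by simp
  have "norm (c n * d n) \<le> K * L * exp (- \<rho> * \<bar>real_of_int n\<bar>)" for n
  proof -
    have "L * exp (- \<sigma> * \<bar>real_of_int n\<bar>) \<le> L * 1"
      using L0 assms(4) by (intro mult_left_mono) auto
    then have "norm (d n) \<le> L" using L[of n] by linarith
    then have "norm (c n) * norm (d n) \<le> (K * exp (- \<rho> * \<bar>real_of_int n\<bar>)) * L"
      using L0 by (intro mult_mono K order_trans[OF norm_ge_zero K]) auto
    then show ?thesis by (simp add: norm_mult mult_ac)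
  qed
  then show ?thesis unfolding exp_decay_def by blast
qed

lemma exp_decay_power:
  assumes "exp_decay \<rho> c" "\<sigma> < \<rho>"
  shows "exp_decay \<sigma> (\<lambda>n. of_int n ^ j * c n)"
proof -
  obtain K where K: "\<And>n. norm (c n) \<le> K * exp (- \<rho> * \<bar>real_of_int n\<bar>)"
    using assms(1) unfolding exp_decay_def by blast
  let ?d = "\<rho> - \<sigma>"
  have "norm (of_int n ^ j * c n) \<le> (K * (fact j / ?d ^ j)) * exp (- \<sigma> * \<bar>real_of_int n\<bar>)" for n
  proof -
    let ?x = "\<bar>real_of_int n\<bar>"
    have "(?d * ?x) ^ j \<le> fact j * exp (?d * ?x)"
      using assms by (intro power_le_fact_exp) simp
    then have "?x ^ j * ?d ^ j \<le> fact j * exp (?d * ?x)"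
      unfolding power_mult_distrib by (simp only: mult.commute)
    then have "?x ^ j \<le> fact j / ?d ^ j * exp (?d * ?x)"
      using assms(2) by (simp add: pos_le_divide_eq)
    then have "?x ^ j * norm (c n) \<le> (fact j / ?d ^ j * exp (?d * ?x)) * (K * exp (- \<rho> * ?x))"
      by (intro mult_mono K) (use assms(2) in auto)
    also have "\<dots> = (K * (fact j / ?d ^ j)) * (exp (?d * ?x) * exp (- \<rho> * ?x))" by (simp only: mult_ac)
    also have "exp (?d * ?x) * exp (- \<rho> * ?x) = exp (- \<sigma> * ?x)"
      by (simp add: exp_add[symmetric] algebra_simps)
    finally show ?thesis by (simp add: norm_mult norm_power)
  qed
  then show ?thesis unfolding exp_decay_def by blast
qed

text \<open>The addition theorem \<open>tanh y - tanh x = sinh (y - x) / (cosh x * cosh y)\<close>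
  makes the unit differences summable, and the limits \<open>1\<close> and \<open>- 1\<close> of
  \<open>tanh\<close> at the two ends produce the factor \<open>2\<close>.\<close>

lemma tanh_telescope:
  fixes w z :: complex
  assumes z: "\<bar>Re z\<bar> < Re w" and z0: "cosh z \<noteq> 0"
  shows "((\<lambda>m. tanh (z + of_int (m + s) * w) - tanh (z + of_int m * w)) has_sum 2 * of_int s) UNIV"
proof -
  have nz: "cosh (z + of_int m * w) \<noteq> 0" for m
    using strip_nonzero[OF z] z0 by (cases "m = 0") auto
  have w: "Re w > 0" using z by linarith
  have dec: "exp_decay (Re w) (\<lambda>m. 1 / cosh (z + of_int m * w))" by (rule exp_decay_strip(1)[OF z])
  have td: "tanh (z + of_int (m + 1) * w) - tanh (z + of_int m * w) =
      sinh w * (1 / cosh (z + of_int m * w) * (1 / cosh (z + of_int (m + 1) * w)))" for m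
  proof -
    have "sinh w = sinh ((z + of_int (m + 1) * w) - (z + of_int m * w))" by (simp add: algebra_simps)
    also have "\<dots> = sinh (z + of_int (m + 1) * w) * cosh (z + of_int m * w) - cosh (z + of_int (m + 1) * w) * sinh (z + of_int m * w)"
      by (rule sinh_diff)
    finally show ?thesis using nz[of m] nz[of "m+1"] by (simp add: tanh_def field_simps)
  qed
  have s1: "(\<lambda>m. 1 / cosh (z + of_int m * w)) summable_on UNIV"
    by (rule exp_decay_summable[OF dec w])
  obtain K where K: "\<And>m. norm (1 / cosh (z + of_int m * w)) \<le> K * exp (- Re w * \<bar>real_of_int m\<bar>)"
    using dec unfolding exp_decay_def by blast
  have K0: "K \<ge> 0" using order_trans[OF norm_ge_zero K[of 0]] by simp
  have bd: "norm (1 / cosh (z + of_int m * w)) \<le> K" for m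
    using K[of m] mult_left_mono[of "exp (- Re w * \<bar>real_of_int m\<bar>)" 1 K] K0 w by simp
  have s2: "(\<lambda>m. tanh (z + of_int (m + 1) * w) - tanh (z + of_int m * w)) summable_on UNIV"
  proof -
    have "exp_decay (Re w) (\<lambda>m. (1 / cosh (z + of_int m * w)) * (1 / cosh (z + of_int (m + 1) * w)))"
      by (rule exp_decay_mult[OF dec _ w, of 0]) (use bd[of "_ + 1"] in \<open>auto simp: exp_decay_def intro!: exI[of _ K]\<close>)
    from exp_decay_summable[OF this w] show ?thesis unfolding td by (rule summable_on_cmult_right)
  qed
  have lim: "(\<lambda>n. exp (- Re w * real n)) \<longlonglongrightarrow> 0"
  proof -
    have "(\<lambda>n. exp (- Re w) ^ n) \<longlonglongrightarrow> 0" using w by (intro LIMSEQ_realpow_zero) auto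
    then show ?thesis by (simp add: exp_of_nat_mult[symmetric] mult.commute)
  qed
  have L: "(\<lambda>n. tanh (z + of_int (int n) * w)) \<longlonglongrightarrow> 1"
  proof (rule LIM_zero_cancel, rule Lim_null_comparison)
    show "\<forall>\<^sub>F n in sequentially. norm (tanh (z + of_int (int n) * w) - 1) \<le> exp (- Re z) * (K * exp (- Re w * real n))"
    proof (rule always_eventually, rule allI)
      fix n :: nat
      let ?u = "z + of_int (int n) * w"
      have "tanh ?u - 1 = - exp (- ?u) * (1 / cosh ?u)"
        using nz[of "int n"] cosh_minus_sinh[of ?u] by (simp add: tanh_def field_simps)
      then have "norm (tanh ?u - 1) = exp (- Re ?u) * norm (1 / cosh ?u)"
        by (simp add: norm_mult norm_divide)
      also have "\<dots> \<le> exp (- Re z) * (K * exp (- Re w * real n))"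
        using K[of "int n"] w by (intro mult_mono) auto
      finally show "norm (tanh ?u - 1) \<le> exp (- Re z) * (K * exp (- Re w * real n))" .
    qed
    show "(\<lambda>n. exp (- Re z) * (K * exp (- Re w * real n))) \<longlonglongrightarrow> 0"
      by (intro tendsto_mult_right_zero lim)
  qed
  have M: "(\<lambda>n. tanh (z + of_int (- int n) * w)) \<longlonglongrightarrow> - 1"
  proof (rule LIM_zero_cancel, rule Lim_null_comparison)
    show "\<forall>\<^sub>F n in sequentially. norm (tanh (z + of_int (- int n) * w) - - 1) \<le> exp (Re z) * (K * exp (- Re w * real n))"
    proof (rule always_eventually, rule allI)
      fix n :: nat
      let ?u = "z + of_int (- int n) * w"
      have "tanh ?u - - 1 = exp ?u * (1 / cosh ?u)"
        using nz[of "- int n"] sinh_plus_cosh[of ?u] by (simp add: tanh_def field_simps)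
      then have "norm (tanh ?u - - 1) = exp (Re ?u) * norm (1 / cosh ?u)"
        by (simp add: norm_mult norm_divide)
      also have "\<dots> \<le> exp (Re z) * (K * exp (- Re w * real n))"
        using K[of "- int n"] w by (intro mult_mono) auto
      finally show "norm (tanh ?u - - 1) \<le> exp (Re z) * (K * exp (- Re w * real n))" .
    qed
    show "(\<lambda>n. exp (Re z) * (K * exp (- Re w * real n))) \<longlonglongrightarrow> 0"
      by (intro tendsto_mult_right_zero lim)
  qed
  show ?thesis
    using infsum_int_telescope_shift[of "\<lambda>m. tanh (z + of_int m * w)", OF s2 L M, of s] by (simp add: mult.commute)
qed

section \<open>The secant series\<close>

text \<open>By the addition theorem for \<open>sinh\<close>, a product of two \<open>sech\<close> at
  distance \<open>s * w\<close> is a difference of \<open>tanh\<close> divided by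
  \<open>sinh (s * w)\<close>, so it telescopes. At \<open>s = 0\<close> the last summand is
  \<open>0 / 0 = 0\<close> and only the squares remain.\<close>

lemma sech_corr:
  fixes w z :: complex
  assumes z: "\<bar>Re z\<bar> < Re w" and z0: "cosh z \<noteq> 0"
  defines "T \<equiv> \<lambda>m. 1 / cosh (z + of_int m * w)"
  shows "infsum (\<lambda>m. T m * T (m + s)) UNIV =
      (if s = 0 then infsum (\<lambda>m. T m ^ 2) UNIV else 0) + 2 * of_int s / sinh (of_int s * w)"
proof (cases "s = 0")
  case False
  have nz: "cosh (z + of_int m * w) \<noteq> 0" for m
    using strip_nonzero[OF z] z0 by (cases "m = 0") auto
  have sz: "sinh (of_int s * w) \<noteq> 0" using strip_nonzero(2)[of 0 w s] False z by simp
  have "T m * T (m + s) = (tanh (z + of_int (m + s) * w) - tanh (z + of_int m * w)) * (1 / sinh (of_int s * w))" for m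
  proof -
    have "sinh (of_int s * w) = sinh ((z + of_int (m + s) * w) - (z + of_int m * w))" by (simp add: algebra_simps)
    also have "\<dots> = sinh (z + of_int (m + s) * w) * cosh (z + of_int m * w) - cosh (z + of_int (m + s) * w) * sinh (z + of_int m * w)"
      by (rule sinh_diff)
    finally show ?thesis using nz[of m] nz[of "m+s"] sz by (simp add: T_def tanh_def field_simps)
  qed
  then have "infsum (\<lambda>m. T m * T (m + s)) UNIV = 2 * of_int s * (1 / sinh (of_int s * w))"
    using has_sum_cmult_left[OF tanh_telescope[OF z z0, of s], of "1 / sinh (of_int s * w)"]
    by (simp add: has_sum_iff)
  with False show ?thesis by simp
qed (simp add: power2_eq_square)

lemma has_sum_single_int: "((\<lambda>s::int. if s = 0 then K else (0::complex)) has_sum K) UNIV"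
  by (rule has_sum_finite_neutralI[of "{0}"]) auto

lemma infsum_even_int: "infsum (\<lambda>b::int. if even b then h b else (0::complex)) UNIV = infsum (\<lambda>m. h (2 * m)) UNIV"
proof -
  have "infsum (\<lambda>b. if even b then h b else 0) UNIV = infsum h {b. even b}"
    by (rule infsum_cong_neutral) auto
  also have "\<dots> = infsum (\<lambda>m. h (2 * m)) UNIV"
    by (rule infsum_reindex_bij_witness[of _ "\<lambda>m. 2 * m" "\<lambda>b. b div 2"]) auto
  finally show ?thesis .
qed

definition sgn1 :: "int \<Rightarrow> complex" where "sgn1 n = (if even n then 1 else -1)"

lemma sgn1_simps [simp]: "sgn1 (- n) = sgn1 n" "sgn1 0 = 1" "sgn1 (n + 1) = - sgn1 n" "norm (sgn1 n) = 1"
  by (auto simp: sgn1_def)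

lemma sgn1_add: "sgn1 (m + n) = sgn1 m * sgn1 n"
  by (auto simp: sgn1_def)

lemma int_step_induct:
  fixes P :: "int \<Rightarrow> bool"
  assumes "P 0" "\<And>s. P s \<longleftrightarrow> P (s + 1)"
  shows "P s"
  by (induction s rule: int_induct[of _ 0]) (use assms(1) assms(2) assms(2)[of "_ - 1"] in auto)

lemma exp_int_pi: "exp (of_int n * (\<i> * pi)) = sgn1 n"
  by (induction n rule: int_step_induct) (simp_all add: ring_distribs exp_add)

text \<open>With \<open>q = exp (- l)\<close>, \<open>sechA\<close> and \<open>sechB\<close> will
  turn out to be the squares of the theta series at \<open>q\<close> and \<open>- q\<close>.
  \<open>sechK\<close> and \<open>cschH\<close> are the weight two quantities in which the
  coefficients of the differential equation first appear. \<open>hcsc l 0\<close> is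
  \<open>0\<close> by division by zero.\<close>

definition hsec :: "complex \<Rightarrow> int \<Rightarrow> complex" where "hsec l n = 1 / cosh (of_int n * l)"
definition hcsc :: "complex \<Rightarrow> int \<Rightarrow> complex" where "hcsc l n = 2 * of_int n / sinh (of_int n * l)"
definition sechA :: "complex \<Rightarrow> complex" where "sechA l = infsum (hsec l) UNIV"
definition sechB :: "complex \<Rightarrow> complex" where "sechB l = infsum (\<lambda>n. sgn1 n * hsec l n) UNIV"
definition sechK :: "complex \<Rightarrow> complex" where "sechK l = infsum (\<lambda>n. hsec l n ^ 2) UNIV"
definition cschH :: "complex \<Rightarrow> complex" where "cschH l = infsum (hcsc l) UNIV"

lemma hsec_minus [simp]: "hsec l (- n) = hsec l n" and hcsc_minus [simp]: "hcsc l (- n) = hcsc l n"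
  by (simp_all add: hsec_def hcsc_def)

lemma hsec_0 [simp]: "hsec l 0 = 1" and hcsc_0 [simp]: "hcsc l 0 = 0"
  by (simp_all add: hsec_def hcsc_def)

lemma exp_decay_hsec: "Re l > 0 \<Longrightarrow> exp_decay (Re l) (hsec l)"
  using exp_decay_strip(1)[of 0 l] by (simp add: hsec_def[abs_def])

text \<open>The factor \<open>n\<close> in \<open>hcsc\<close> costs an arbitrarily small part of
  the rate, hence a rate strictly below \<open>Re l\<close>.\<close>

lemma exp_decay_hcsc:
  assumes "Re l > 0" "\<rho> < Re l"
  shows "exp_decay \<rho> (hcsc l)"
proof -
  have "exp_decay (Re l) (\<lambda>n. 1 / sinh (of_int n * l))"
    using exp_decay_strip(2)[of 0 l] assms by simp
  from exp_decay_power[OF this assms(2), of 1]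
  obtain K where K: "\<And>n. norm (of_int n ^ 1 * (1 / sinh (of_int n * l))) \<le> K * exp (- \<rho> * \<bar>real_of_int n\<bar>)"
    unfolding exp_decay_def by blast
  then have "norm (hcsc l n) \<le> (2 * K) * exp (- \<rho> * \<bar>real_of_int n\<bar>)" for n
  proof -
    have "norm (hcsc l n) = 2 * norm (of_int n ^ 1 * (1 / sinh (of_int n * l)))"
      by (simp add: hcsc_def norm_mult norm_divide)
    then show ?thesis using K[of n] by simp
  qed
  then show ?thesis unfolding exp_decay_def by blast
qed

lemma exp_decay_hcsc_half: "Re l > 0 \<Longrightarrow> exp_decay (Re l / 2) (hcsc l)"
  by (rule exp_decay_hcsc) auto

lemma summable_hsec: "Re l > 0 \<Longrightarrow> hsec l summable_on UNIV"
  by (rule exp_decay_summable[OF exp_decay_hsec])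

lemma summable_hcsc: "Re l > 0 \<Longrightarrow> hcsc l summable_on UNIV"
  by (rule exp_decay_summable[OF exp_decay_hcsc_half]) auto

lemma summable_sgn:
  assumes "f summable_on UNIV"
  shows "(\<lambda>n. sgn1 n * f n) summable_on UNIV"
  using assms summable_on_iff_abs_summable_on_complex[of f UNIV]
  by (intro summable_on_norm_le[of "\<lambda>n. norm (f n)"]) (auto simp: norm_mult)

lemma summable_exp_hsec: "\<bar>Re z\<bar> < Re l \<Longrightarrow> (\<lambda>n. hsec l n * exp (of_int n * z)) summable_on UNIV"
  using exp_series_summable[OF exp_decay_hsec, of l z 0] by simp

lemma summable_exp_hcsc:
  assumes "\<bar>Re z\<bar> < Re l"
  shows "(\<lambda>n. hcsc l n * exp (of_int n * z)) summable_on UNIV"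
proof -
  obtain \<rho> where "\<bar>Re z\<bar> < \<rho>" "\<rho> < Re l" using dense assms by blast
  then show ?thesis
    using exp_series_summable[OF exp_decay_hcsc, of l \<rho> z 0] assms by simp
qed

lemma hsec_corr:
  assumes "Re l > 0"
  shows "infsum (\<lambda>m. hsec l m * hsec l (m + s)) UNIV = (if s = 0 then sechK l else 0) + hcsc l s"
  using sech_corr[of 0 l s] assms by (simp add: hsec_def[abs_def] sechK_def hcsc_def)

text \<open>The product of two \<open>sech\<close> series is a convolution whose inner sum telescopes.\<close>

lemma sech_series_square:
  assumes z: "\<bar>Re z\<bar> < Re l"
  shows "exp_series (hsec l) 0 z ^ 2 = sechK l + exp_series (hcsc l) 0 z"
proof -
  have l: "Re l > 0" using z by linarith
  define f where "f = (\<lambda>n. hsec l n * exp (of_int n * z))"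
  have f: "f summable_on UNIV" unfolding f_def by (rule summable_exp_hsec[OF z])
  have f': "(\<lambda>n. f (- n)) summable_on UNIV"
    using f summable_on_reindex_bij_witness[of UNIV uminus uminus UNIV f "\<lambda>n. f (- n)"] by auto
  \<comment> \<open>Reversing the index of the second factor makes the exponentials combine to
    \<open>exp (- s * z)\<close>, which no longer depends on \<open>a\<close>.\<close>
  have "exp_series (hsec l) 0 z ^ 2 = infsum f UNIV * infsum (\<lambda>n. f (- n)) UNIV"
    unfolding infsum_minus_int[of f] by (simp add: exp_series_def f_def power2_eq_square)
  also have "\<dots> = infsum (\<lambda>s. infsum (\<lambda>a. f a * f (- (a + s))) UNIV) UNIV"
    by (rule product_infsum_shift(1)[OF f f'])
  also have "\<dots> = infsum (\<lambda>s. (if s = 0 then sechK l else 0) + hcsc l (- s) * exp (of_int (- s) * z)) UNIV"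
  proof (rule infsum_cong)
    fix s :: int
    have "infsum (\<lambda>a. f a * f (- (a + s))) UNIV = infsum (\<lambda>a. hsec l a * hsec l (a + s) * exp (of_int (- s) * z)) UNIV"
    proof (rule infsum_cong)
      fix a
      have "f a * f (- (a + s)) = hsec l a * hsec l (- (a + s)) * (exp (of_int a * z) * exp (of_int (- (a + s)) * z))"
        by (simp add: f_def mult_ac)
      also have "exp (of_int a * z) * exp (of_int (- (a + s)) * z) = exp (of_int (- s) * z)"
        by (simp add: exp_add[symmetric] algebra_simps)
      finally show "f a * f (- (a + s)) = hsec l a * hsec l (a + s) * exp (of_int (- s) * z)"
        by (simp only: hsec_minus)
    qed
    also have "\<dots> = ((if s = 0 then sechK l else 0) + hcsc l s) * exp (of_int (- s) * z)"
      by (simp only: infsum_cmult_left' hsec_corr[OF l])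
    finally show "infsum (\<lambda>a. f a * f (- (a + s))) UNIV = (if s = 0 then sechK l else 0) + hcsc l (- s) * exp (of_int (- s) * z)"
      by (simp add: algebra_simps)
  qed
  also have "\<dots> = sechK l + infsum (\<lambda>s. hcsc l (- s) * exp (of_int (- s) * z)) UNIV"
  proof -
    have "(\<lambda>s. hcsc l (- s) * exp (of_int (- s) * z)) summable_on UNIV"
      using summable_exp_hcsc[OF z] summable_on_reindex_bij_witness[of UNIV uminus uminus UNIV "\<lambda>n. hcsc l n * exp (of_int n * z)" "\<lambda>s. hcsc l (- s) * exp (of_int (- s) * z)"] by auto
    then show ?thesis
      using infsum_add[OF has_sum_imp_summable[OF has_sum_single_int[of "sechK l"]]] infsumI[OF has_sum_single_int[of "sechK l"]] by simp
  qed
  also have "infsum (\<lambda>s. hcsc l (- s) * exp (of_int (- s) * z)) UNIV = exp_series (hcsc l) 0 z"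
    using infsum_minus_int[of "\<lambda>s. hcsc l s * exp (of_int s * z)"] by (simp add: exp_series_def)
  finally show ?thesis .
qed

lemma cosh_int_nz: "Re l > 0 \<Longrightarrow> cosh (of_int n * l) \<noteq> 0"
  using strip_nonzero(1)[of 0 l n] by (cases "n = 0") auto

lemma sinh_int_nz: "Re l > 0 \<Longrightarrow> n \<noteq> 0 \<Longrightarrow> sinh (of_int n * l) \<noteq> 0"
  using strip_nonzero(2)[of 0 l n] by auto

lemma exp_decay_hsec_step:
  assumes l: "Re l > 0"
  shows "exp_decay (Re l) (\<lambda>b. tanh (of_int (b + 1) * l) - tanh (of_int b * l))"
proof -
  obtain K where K: "\<And>n. norm (hsec l n) \<le> K * exp (- Re l * \<bar>real_of_int n\<bar>)"
    using exp_decay_hsec[OF l] unfolding exp_decay_def by blast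
  have K0: "K \<ge> 0" using order_trans[OF norm_ge_zero K[of 0]] by simp
  have bd: "norm (hsec l m) \<le> K" for m
    using K[of m] mult_left_mono[of "exp (- Re l * \<bar>real_of_int m\<bar>)" 1 K] K0 l by simp
  have "exp_decay (Re l) (\<lambda>m. hsec l m * (sinh l * hsec l (m + 1)))"
  proof (rule exp_decay_mult[OF exp_decay_hsec[OF l] _ l, of 0])
    show "exp_decay 0 (\<lambda>m. sinh l * hsec l (m + 1))"
      unfolding exp_decay_def
      by (intro exI[of _ "norm (sinh l) * K"]) (auto simp: norm_mult intro!: mult_left_mono bd)
  qed simp
  moreover have "hsec l b * (sinh l * hsec l (b + 1)) = tanh (of_int (b + 1) * l) - tanh (of_int b * l)" for b
  proof -
    have "sinh l = sinh (of_int (b + 1) * l - of_int b * l)" by (simp add: algebra_simps)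
    also have "\<dots> = sinh (of_int (b + 1) * l) * cosh (of_int b * l) - cosh (of_int (b + 1) * l) * sinh (of_int b * l)"
      by (rule sinh_diff)
    finally show ?thesis using cosh_int_nz[OF l, of b] cosh_int_nz[OF l, of "b+1"]
      by (simp add: hsec_def tanh_def field_simps)
  qed
  ultimately show ?thesis by simp
qed

text \<open>The reflection \<open>b \<mapsto> - 1 - b\<close> preserves the differences
  \<open>d\<close>, so the first moment \<open>M\<close> satisfies
  \<open>M = - 2 - M\<close>.\<close>

lemma tanh_moment:
  assumes l: "Re l > 0"
  defines "d \<equiv> \<lambda>b. tanh (of_int (b + 1) * l) - tanh (of_int b * l)"
  shows "((\<lambda>b. of_int b * d b) has_sum - 1) UNIV" "(d has_sum 2) UNIV"
proof -
  have dec: "exp_decay (Re l) d" unfolding d_def by (rule exp_decay_hsec_step[OF l])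
  have s: "(\<lambda>b. of_int b * d b) summable_on UNIV"
    using exp_decay_summable[OF exp_decay_power[OF dec, of "Re l / 2" 1]] l by simp
  show d2: "(d has_sum 2) UNIV" using tanh_telescope[of 0 l 1] l by (simp add: d_def)
  have refl: "d (- 1 - b) = d b" for b
  proof -
    have "of_int (- 1 - b + 1) * l = - (of_int b * l)" "of_int (- 1 - b) * l = - (of_int (b + 1) * l)"
      by (simp_all add: algebra_simps)
    then show ?thesis unfolding d_def by (simp only: tanh_minus)  simp
  qed
  have "infsum (\<lambda>b. of_int b * d b) UNIV = infsum (\<lambda>b. of_int (- 1 - b) * d b) UNIV"
    by (rule infsum_reindex_bij_witness[of UNIV "\<lambda>b. - 1 - b" "\<lambda>b. - 1 - b"]) (auto simp: refl)
  also have "\<dots> = infsum (\<lambda>b. - d b - of_int b * d b) UNIV"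
    by (rule infsum_cong) (simp add: algebra_simps)
  also have "\<dots> = - 2 - infsum (\<lambda>b. of_int b * d b) UNIV"
    using infsum_add[of "\<lambda>b. - d b" UNIV "\<lambda>b. - (of_int b * d b)"] s d2
    by (simp add: summable_on_uminus infsum_uminus has_sum_iff)
  finally have "infsum (\<lambda>b. of_int b * d b) UNIV = - 1" by simp
  then show "((\<lambda>b. of_int b * d b) has_sum - 1) UNIV" using s by (simp add: has_sum_iff)
qed

lemma bounded_hsec:
  assumes l: "Re l > 0"
  obtains K where "\<And>n. norm (hsec l n) \<le> K"
proof -
  obtain K where K: "\<And>n. norm (hsec l n) \<le> K * exp (- Re l * \<bar>real_of_int n\<bar>)"
    using exp_decay_hsec[OF l] unfolding exp_decay_def by blast
  have K0: "K \<ge> 0" using order_trans[OF norm_ge_zero K[of 0]] by simp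
  have "norm (hsec l m) \<le> K" for m
    using K[of m] mult_left_mono[of "exp (- Re l * \<bar>real_of_int m\<bar>)" 1 K] K0 l by simp
  then show ?thesis by (rule that)
qed

text \<open>Stepping \<open>s\<close> changes the normalised correlation by a first moment of
  \<open>tanh\<close> differences, which is linear in \<open>s\<close>; hence the correlation is
  quadratic in \<open>s\<close>. Its term in \<open>s\<^sup>2\<close> is what later becomes the
  second derivative of the secant series.\<close>

lemma hcsc_hsec_corr:
  assumes l: "Re l > 0"
  shows "infsum (\<lambda>b. hcsc l b * hsec l (b + s)) UNIV = hsec l s * (2 * cschH (2 * l) + 2 * of_int s ^ 2)"
proof -
  \<comment> \<open>\<open>g s b\<close> is the correlation term divided by \<open>hsec l s\<close>,
    rewritten by the addition theorem for \<open>cosh\<close> so that \<open>s\<close> occurs only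
    inside one \<open>tanh\<close>.\<close>
  define g where "g = (\<lambda>s b. 2 * of_int b * (cosh (of_int b * l) / sinh (of_int b * l) - tanh (of_int (b + s) * l)))"
  have eq: "hcsc l b * hsec l (b + s) = hsec l s * g s b" for s b
  proof (cases "b = 0")
    case False
    have "cosh (of_int s * l) = cosh (of_int (b + s) * l - of_int b * l)" by (simp add: algebra_simps)
    also have "\<dots> = cosh (of_int (b + s) * l) * cosh (of_int b * l) - sinh (of_int (b + s) * l) * sinh (of_int b * l)"
      by (rule cosh_diff)
    finally have "cosh (of_int b * l) / sinh (of_int b * l) - tanh (of_int (b + s) * l) =
        cosh (of_int s * l) / (sinh (of_int b * l) * cosh (of_int (b + s) * l))"
      using cosh_int_nz[OF l, of "b+s"] sinh_int_nz[OF l False]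
      by (simp add: tanh_def divide_simps mult.commute)
    then show ?thesis using cosh_int_nz[OF l, of s] by (simp only: g_def) (simp add: hsec_def hcsc_def)
  qed (simp add: g_def)
  obtain K where K: "\<And>n. norm (hsec l n) \<le> K" using bounded_hsec[OF l] by blast
  have hs: "hsec l s \<noteq> 0" for s using cosh_int_nz[OF l, of s] by (simp add: hsec_def)
  have sm: "(\<lambda>b. hcsc l b * hsec l (b + s)) summable_on UNIV" for s
  proof -
    have "exp_decay (Re l / 2) (\<lambda>b. hcsc l b * hsec l (b + s))"
      by (rule exp_decay_mult[OF exp_decay_hcsc_half[OF l], of 0]) (use K l in \<open>auto simp: exp_decay_def\<close>)
    then show ?thesis by (rule exp_decay_summable) (use l in simp)
  qed
  have smg: "g s summable_on UNIV" for s
    using summable_on_cmult_right[OF sm[of s], of "1 / hsec l s"] hs[of s] by (simp add: eq[of _ s])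
  \<comment> \<open>The increments \<open>4 * s + 2\<close> add up to \<open>2 * s\<^sup>2\<close>,
    for negative \<open>s\<close> as well.\<close>
  have step: "infsum (g (s + 1)) UNIV = infsum (g s) UNIV + (4 * of_int s + 2)" for s
  proof -
    define d where "d = (\<lambda>b. tanh (of_int (b + 1) * l) - tanh (of_int b * l))"
    have m: "((\<lambda>b. of_int b * d b) has_sum - 1) UNIV" "(d has_sum 2) UNIV"
      unfolding d_def by (rule tanh_moment[OF l])+
    have "((\<lambda>b. - 2 * (of_int b * d b) + 2 * of_int s * d b) has_sum - 2 * (- 1) + 2 * of_int s * 2) UNIV"
      by (intro has_sum_add has_sum_cmult_right m)
    then have "((\<lambda>b. - 2 * (of_int (b + s) * d (b + s)) + 2 * of_int s * d (b + s)) has_sum - 2 * (- 1) + 2 * of_int s * 2) UNIV"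
      by (rule iffD2[OF has_sum_reindex_bij_witness[of UNIV "\<lambda>a. a - s" "\<lambda>a. a + s"], rotated -1]) auto
    moreover have "- 2 * (of_int (b + s) * d (b + s)) + 2 * of_int s * d (b + s) = g (s + 1) b - g s b" for b
      by (simp add: g_def d_def algebra_simps)
    ultimately have "((\<lambda>b. g (s + 1) b - g s b) has_sum - 2 * (- 1) + 2 * of_int s * 2) UNIV" by simp
    from has_sum_add[OF has_sum_infsum[OF smg[of s]] this]
    have "((\<lambda>b. g (s + 1) b) has_sum infsum (g s) UNIV + (- 2 * (- 1) + 2 * of_int s * 2)) UNIV" by simp
    then show ?thesis by (simp add: has_sum_iff algebra_simps)
  qed
  have g0: "infsum (g 0) UNIV = 2 * cschH (2 * l)"
  proof -
    have "g 0 b = 2 * hcsc (2 * l) b" for b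
    proof (cases "b = 0")
      case False
      have "sinh (of_int b * (2 * l)) = 2 * sinh (of_int b * l) * cosh (of_int b * l)"
        using sinh_double[of "of_int b * l"] by (simp add: mult_ac)
      moreover have "g 0 b = hcsc l b * hsec l b" using eq[of b 0] by simp
      ultimately show ?thesis using cosh_int_nz[OF l, of b] sinh_int_nz[OF l False]
        by (simp add: hsec_def hcsc_def field_simps)
    qed (simp add: g_def)
    then have "g 0 = (\<lambda>b. 2 * hcsc (2 * l) b)" by blast
    then show ?thesis by (simp add: infsum_cmult_right' cschH_def)
  qed
  have "infsum (g s) UNIV = 2 * cschH (2 * l) + 2 * of_int s ^ 2"
    by (induction s rule: int_step_induct) (simp_all add: g0 step power2_eq_square algebra_simps)
  then show ?thesis using infsum_cmult_right'[of "hsec l s" "g s" UNIV] by (simp add: eq)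
qed

text \<open>Multiplying the square identity once more by the series brings in the correlation of
  \<open>hcsc\<close> with \<open>hsec\<close>; its quadratic part in \<open>s\<close> is the second
  derivative. This is the differential equation before rescaling \<open>z\<close>.\<close>

lemma sech_series_cube:
  assumes z: "\<bar>Re z\<bar> < Re l"
  shows "exp_series (hsec l) 0 z ^ 3 =
    (sechK l + 2 * cschH (2 * l)) * exp_series (hsec l) 0 z + 2 * exp_series (hsec l) 2 z"
proof -
  have l: "Re l > 0" using z by linarith
  define f where "f = (\<lambda>n. hcsc l n * exp (of_int n * z))"
  define g where "g = (\<lambda>n. hsec l n * exp (of_int n * z))"
  have f: "f summable_on UNIV" unfolding f_def by (rule summable_exp_hcsc[OF z])
  have g: "g summable_on UNIV" unfolding g_def by (rule summable_exp_hsec[OF z])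
  have g2: "(\<lambda>n. hsec l n * of_int n ^ 2 * exp (of_int n * z)) summable_on UNIV"
    using exp_series_summable[OF exp_decay_hsec[OF l] z] .
  have g': "(\<lambda>n. g (- n)) summable_on UNIV"
    using g summable_on_reindex_bij_witness[of UNIV uminus uminus UNIV g "\<lambda>n. g (- n)"] by auto
  let ?G = "2 * cschH (2 * l)"
  have "exp_series (hcsc l) 0 z * exp_series (hsec l) 0 z = infsum f UNIV * infsum (\<lambda>n. g (- n)) UNIV"
    unfolding infsum_minus_int[of g] by (simp add: exp_series_def f_def g_def)
  also have "\<dots> = infsum (\<lambda>s. infsum (\<lambda>a. f a * g (- (a + s))) UNIV) UNIV"
    by (rule product_infsum_shift(1)[OF f g'])
  also have "\<dots> = infsum (\<lambda>s. ?G * g (- s) + 2 * (hsec l (- s) * of_int (- s) ^ 2 * exp (of_int (- s) * z))) UNIV"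
  proof (rule infsum_cong)
    fix s :: int
    have "infsum (\<lambda>a. f a * g (- (a + s))) UNIV = infsum (\<lambda>a. hcsc l a * hsec l (a + s) * exp (of_int (- s) * z)) UNIV"
    proof (rule infsum_cong)
      fix a
      have "f a * g (- (a + s)) = hcsc l a * hsec l (- (a + s)) * (exp (of_int a * z) * exp (of_int (- (a + s)) * z))"
        by (simp add: f_def g_def mult_ac)
      also have "exp (of_int a * z) * exp (of_int (- (a + s)) * z) = exp (of_int (- s) * z)"
        by (simp add: exp_add[symmetric] algebra_simps)
      finally show "f a * g (- (a + s)) = hcsc l a * hsec l (a + s) * exp (of_int (- s) * z)"
        by (simp only: hsec_minus)
    qed
    also have "\<dots> = hsec l s * (?G + 2 * of_int s ^ 2) * exp (of_int (- s) * z)"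
      by (simp only: infsum_cmult_left' hcsc_hsec_corr[OF l])
    finally show "infsum (\<lambda>a. f a * g (- (a + s))) UNIV = ?G * g (- s) + 2 * (hsec l (- s) * of_int (- s) ^ 2 * exp (of_int (- s) * z))"
      by (simp add: g_def algebra_simps)
  qed
  also have "\<dots> = infsum (\<lambda>s. ?G * g s + 2 * (hsec l s * of_int s ^ 2 * exp (of_int s * z))) UNIV"
    by (rule infsum_minus_int)
  also have "\<dots> = ?G * infsum g UNIV + 2 * exp_series (hsec l) 2 z"
    by (subst infsum_add) (auto intro!: summable_on_cmult_right g g2 simp: infsum_cmult_right' exp_series_def)
  finally have e: "exp_series (hcsc l) 0 z * exp_series (hsec l) 0 z = ?G * exp_series (hsec l) 0 z + 2 * exp_series (hsec l) 2 z"
    by (simp add: g_def exp_series_def)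
  have "exp_series (hsec l) 0 z ^ 3 = exp_series (hsec l) 0 z ^ 2 * exp_series (hsec l) 0 z"
    by (simp add: power3_eq_cube power2_eq_square)
  then show ?thesis unfolding sech_series_square[OF z] using e by (simp add: algebra_simps)
qed

lemma summable_hsec_sq: "Re l > 0 \<Longrightarrow> (\<lambda>n. hsec l n ^ 2) summable_on UNIV"
  using exp_decay_summable[OF exp_decay_mult[OF exp_decay_hsec exp_decay_hsec]]
  by (simp add: power2_eq_square)

lemma exp_series_hsec_0: "exp_series (hsec l) 0 0 = sechA l"
  by (simp add: exp_series_def sechA_def)

lemma exp_series_pi: "exp_series c 0 (\<i> * pi) = infsum (\<lambda>n. sgn1 n * c n) UNIV"
  by (simp add: exp_series_def exp_int_pi mult.commute)

lemma sechA_square: "Re l > 0 \<Longrightarrow> sechA l ^ 2 = sechK l + cschH l"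
  using sech_series_square[of 0 l] by (simp add: exp_series_def sechA_def cschH_def)

lemma sechB_square: "Re l > 0 \<Longrightarrow> sechB l ^ 2 = sechK l + infsum (\<lambda>n. sgn1 n * hcsc l n) UNIV"
  using sech_series_square[of "\<i> * pi" l] by (simp add: exp_series_pi sechB_def)

lemma infsum_add_sgn:
  assumes "h summable_on UNIV"
  shows "infsum h UNIV + infsum (\<lambda>n. sgn1 n * h n) UNIV = 2 * infsum (\<lambda>m. h (2 * m)) UNIV"
proof -
  have "infsum h UNIV + infsum (\<lambda>n. sgn1 n * h n) UNIV = infsum (\<lambda>n. h n + sgn1 n * h n) UNIV"
    by (rule infsum_add[symmetric, OF assms summable_sgn[OF assms]])
  also have "\<dots> = infsum (\<lambda>n. 2 * (if even n then h n else 0)) UNIV"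
    by (rule infsum_cong) (simp add: sgn1_def)
  also have "\<dots> = 2 * infsum (\<lambda>m. h (2 * m)) UNIV"
    by (simp only: infsum_cmult_right' infsum_even_int)
  finally show ?thesis .
qed

lemma hsec_double: "hsec (2 * l) m = hsec l (2 * m)"
  by (simp add: hsec_def mult_ac)

lemma hcsc_double: "hcsc (2 * l) m = hcsc l (2 * m) / 2"
  by (simp add: hcsc_def mult_ac)

lemma sechA_double: "Re l > 0 \<Longrightarrow> sechA (2 * l) = (sechA l + sechB l) / 2"
  using infsum_add_sgn[OF summable_hsec, of l]
  by (simp add: sechA_def sechB_def hsec_double[abs_def])

lemma cschH_double:
  "Re l > 0 \<Longrightarrow> 4 * cschH (2 * l) = cschH l + infsum (\<lambda>n. sgn1 n * hcsc l n) UNIV"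
proof -
  assume "Re l > 0"
  then have "cschH l + infsum (\<lambda>n. sgn1 n * hcsc l n) UNIV = 2 * infsum (\<lambda>m. 2 * hcsc (2 * l) m) UNIV"
    using infsum_add_sgn[OF summable_hcsc, of l] by (simp add: cschH_def hcsc_double)
  then show ?thesis unfolding infsum_cmult_right' by (simp add: cschH_def)
qed

text \<open>Adding the square identities at \<open>0\<close> and at \<open>\<i> * pi\<close> leaves
  the even indices of the cosecant series, that is, the series for \<open>2 * l\<close>. So the
  coefficient of the cubic equation is a quadratic form in \<open>sechA\<close> and
  \<open>sechB\<close>.\<close>

lemma sechA_sechB_squares:
  "Re l > 0 \<Longrightarrow> 2 * (sechK l + 2 * cschH (2 * l)) = sechA l ^ 2 + sechB l ^ 2"
  using cschH_double[of l] by (simp add: sechA_square sechB_square algebra_simps)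

text \<open>For \<open>s = 1\<close> the reflection \<open>a \<mapsto> - 1 - a\<close> preserves the
  difference of \<open>tanh\<close> but reverses the sign; other shifts differ by a translate of
  this vanishing sum.\<close>

lemma sgn_tanh_telescope:
  assumes l: "Re l > 0"
  shows "infsum (\<lambda>a. sgn1 a * (tanh (of_int (a + s) * l) - tanh (of_int a * l))) UNIV = 0"
proof -
  define t where "t = (\<lambda>a::int. tanh (of_int a * l))"
  have t: "t (- a) = - t a" for a by (simp add: t_def)
  have sm: "(\<lambda>a. t (a + s) - t a) summable_on UNIV" for s
    using tanh_telescope[of 0 l s] l by (simp add: t_def has_sum_iff)
  have w1: "infsum (\<lambda>a. sgn1 a * (t (a + 1) - t a)) UNIV = 0"
  proof -
    have "infsum (\<lambda>a. sgn1 a * (t (a + 1) - t a)) UNIV = infsum (\<lambda>a. - (sgn1 a * (t (a + 1) - t a))) UNIV"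
    proof (rule infsum_reindex_bij_witness[of UNIV "\<lambda>b. - 1 - b" "\<lambda>b. - 1 - b"])
      fix a :: int
      have "sgn1 (- 1 - a) = - sgn1 a" by (auto simp: sgn1_def)
      moreover have "t (- 1 - a) = - t (a + 1)" "t (- 1 - a + 1) = - t a"
        using t[of "a + 1"] t[of a] by (simp_all add: algebra_simps)
      ultimately show "- (sgn1 (- 1 - a) * (t (- 1 - a + 1) - t (- 1 - a))) = sgn1 a * (t (a + 1) - t a)"
        by (simp add: algebra_simps)
    qed auto
    then show ?thesis by (simp add: infsum_uminus)
  qed
  have step: "infsum (\<lambda>a. sgn1 a * (t (a + (s + 1)) - t a)) UNIV = infsum (\<lambda>a. sgn1 a * (t (a + s) - t a)) UNIV" for s
  proof -
    define h where "h = (\<lambda>a. sgn1 a * (t (a + 1) - t a))"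
    have h: "h summable_on UNIV" unfolding h_def by (rule summable_sgn[OF sm])
    have "infsum (\<lambda>a. sgn1 a * (t (a + (s + 1)) - t a)) UNIV =
        infsum (\<lambda>a. sgn1 a * (t (a + s) - t a) + sgn1 s * h (a + s)) UNIV"
    proof (rule infsum_cong)
      fix a
      have "sgn1 s * sgn1 (a + s) = sgn1 a" by (auto simp: sgn1_def)
      then have "sgn1 s * h (a + s) = sgn1 a * (t (a + (s + 1)) - t (a + s))"
        by (simp add: h_def add.assoc flip: mult.assoc)
      then show "sgn1 a * (t (a + (s + 1)) - t a) = sgn1 a * (t (a + s) - t a) + sgn1 s * h (a + s)"
        by (simp add: algebra_simps)
    qed
    also have "\<dots> = infsum (\<lambda>a. sgn1 a * (t (a + s) - t a)) UNIV + sgn1 s * infsum (\<lambda>a. h (a + s)) UNIV"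
      by (subst infsum_add) (auto intro!: summable_sgn sm summable_on_cmult_right iffD2[OF summable_shift_int] h simp: infsum_cmult_right')
    also have "infsum (\<lambda>a. h (a + s)) UNIV = 0" unfolding infsum_shift_int using w1 by (simp add: h_def)
    finally show ?thesis by simp
  qed
  have "infsum (\<lambda>a. sgn1 a * (t (a + s) - t a)) UNIV = 0"
    by (induction s rule: int_step_induct) (simp_all add: step)
  then show ?thesis by (simp add: t_def)
qed

text \<open>In the product of the plain and the alternating series all correlations with
  \<open>s \<noteq> 0\<close> vanish, so only the alternating sum of squares on the diagonal
  survives.\<close>

lemma sechA_mult_sechB:
  assumes l: "Re l > 0"
  shows "sechA l * sechB l = 2 * sechK (2 * l) - sechK l"
proof -
  define f where "f = (\<lambda>n. sgn1 n * hsec l n)"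
  have f: "f summable_on UNIV" unfolding f_def by (rule summable_sgn[OF summable_hsec[OF l]])
  define S where "S = infsum (\<lambda>n. sgn1 n * hsec l n ^ 2) UNIV"
  have "sechB l * sechA l = infsum (\<lambda>s. infsum (\<lambda>a. f a * hsec l (a + s)) UNIV) UNIV"
    unfolding sechA_def sechB_def f_def[symmetric]
    by (rule product_infsum_shift(1)[OF f summable_hsec[OF l]])
  also have "\<dots> = infsum (\<lambda>s::int. if s = 0 then S else 0) UNIV"
  proof (rule infsum_cong)
    fix s :: int
    show "infsum (\<lambda>a. f a * hsec l (a + s)) UNIV = (if s = 0 then S else 0)"
    proof (cases "s = 0")
      case False
      have "f a * hsec l (a + s) = sgn1 a * (tanh (of_int (a + s) * l) - tanh (of_int a * l)) * (1 / sinh (of_int s * l))" for a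
      proof -
        have "sinh (of_int s * l) = sinh (of_int (a + s) * l - of_int a * l)" by (simp add: algebra_simps)
        also have "\<dots> = sinh (of_int (a + s) * l) * cosh (of_int a * l) - cosh (of_int (a + s) * l) * sinh (of_int a * l)"
          by (rule sinh_diff)
        finally have "hsec l a * hsec l (a + s) = (tanh (of_int (a + s) * l) - tanh (of_int a * l)) * (1 / sinh (of_int s * l))"
          using cosh_int_nz[OF l, of a] cosh_int_nz[OF l, of "a+s"] sinh_int_nz[OF l False]
          by (simp add: hsec_def tanh_def field_simps)
        then show ?thesis by (simp only: f_def mult.assoc)
      qed
      then have "infsum (\<lambda>a. f a * hsec l (a + s)) UNIV = 0"
        by (simp only: infsum_cmult_left' sgn_tanh_telescope[OF l] mult_zero_left)
      then show ?thesis using False by simp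
    qed (simp add: f_def S_def power2_eq_square mult_ac)
  qed
  also have "\<dots> = S" by (rule infsumI[OF has_sum_single_int])
  also have "S = 2 * sechK (2 * l) - sechK l"
    unfolding S_def sechK_def hsec_double using infsum_add_sgn[OF summable_hsec_sq[OF l]]
    by (simp add: eq_diff_eq add.commute)
  finally show ?thesis by (simp add: mult.commute)
qed

text \<open>The value of the secant series for \<open>2 * l\<close> at the point
  \<open>z = l\<close>; it will be identified as the theta product of part (1).\<close>

definition sechS :: "complex \<Rightarrow> complex" where
  "sechS l = infsum (\<lambda>n. cosh (of_int n * l) / cosh (2 * (of_int n * l))) UNIV"

lemma infsum_symmetrize:
  assumes "f summable_on (UNIV :: int set)"
  shows "infsum f UNIV = infsum (\<lambda>n. (f n + f (- n)) / 2 :: complex) UNIV"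
proof -
  have "(\<lambda>n. f (- n)) summable_on UNIV"
    using assms summable_on_reindex_bij_witness[of UNIV uminus uminus UNIV f "\<lambda>n. f (- n)"] by auto
  then have "infsum (\<lambda>n. f n + f (- n)) UNIV = 2 * infsum f UNIV"
    by (simp add: infsum_add[OF assms] infsum_minus_int[of f])
  then show ?thesis using infsum_cmult_left'[where f = "\<lambda>n. f n + f (- n)" and c = "1/2" and A = UNIV] by simp
qed

lemma exp_series_hsec_quarter:
  assumes l: "Re l > 0"
  shows "exp_series (hsec (2 * l)) 0 l = sechS l"
proof -
  have "exp_series (hsec (2 * l)) 0 l = infsum (\<lambda>n. hsec (2 * l) n * exp (of_int n * l)) UNIV"
    by (simp add: exp_series_def)
  also have "\<dots> = infsum (\<lambda>n. (hsec (2 * l) n * exp (of_int n * l) + hsec (2 * l) (- n) * exp (of_int (- n) * l)) / 2) UNIV"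
    by (rule infsum_symmetrize) (use l in \<open>auto intro!: summable_exp_hsec\<close>)
  also have "\<dots> = sechS l"
    unfolding sechS_def hsec_minus
  proof (rule infsum_cong)
    fix n
    have "exp (of_int n * l) + exp (of_int (- n) * l) = 2 * cosh (of_int n * l)"
      by (simp add: cosh_field_def)
    moreover have "(hsec (2 * l) n * exp (of_int n * l) + hsec (2 * l) n * exp (of_int (- n) * l)) / 2
        = (exp (of_int n * l) + exp (of_int (- n) * l)) * hsec (2 * l) n / 2" by (simp add: algebra_simps)
    ultimately show "(hsec (2 * l) n * exp (of_int n * l) + hsec (2 * l) n * exp (of_int (- n) * l)) / 2
        = cosh (of_int n * l) / cosh (2 * (of_int n * l))"
      by (simp add: hsec_def mult_ac)
  qed
  finally show ?thesis .
qed

text \<open>At \<open>z = l\<close> the factor \<open>cosh (n * l)\<close> cancels against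
  \<open>sinh (2 * n * l)\<close>, which leaves half the cosecant series for \<open>l\<close>; the
  relations between \<open>sechK\<close>, \<open>sechA\<close> and \<open>sechB\<close> do the
  rest.\<close>

lemma sechS_square:
  assumes l: "Re l > 0"
  shows "sechS l ^ 2 = sechA l * sechA (2 * l)"
proof -
  have "sechS l ^ 2 = sechK (2 * l) + exp_series (hcsc (2 * l)) 0 l"
    using sech_series_square[of l "2 * l"] l by (simp add: exp_series_hsec_quarter)
  also have "exp_series (hcsc (2 * l)) 0 l = infsum (\<lambda>n. hcsc (2 * l) n * exp (of_int n * l)) UNIV"
    by (simp add: exp_series_def)
  also have "\<dots> = infsum (\<lambda>n. hcsc l n * (1 / 2)) UNIV"
  proof (subst infsum_symmetrize)
    show "(\<lambda>n. hcsc (2 * l) n * exp (of_int n * l)) summable_on UNIV"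
      using l by (intro summable_exp_hcsc) auto
    show "infsum (\<lambda>n. (hcsc (2 * l) n * exp (of_int n * l) + hcsc (2 * l) (- n) * exp (of_int (- n) * l)) / 2) UNIV =
        infsum (\<lambda>n. hcsc l n * (1 / 2)) UNIV"
    proof (rule infsum_cong)
      fix n :: int
      have e: "exp (of_int n * l) + exp (of_int (- n) * l) = 2 * cosh (of_int n * l)"
        by (simp add: cosh_field_def)
      have "sinh (of_int n * (2 * l)) = 2 * sinh (of_int n * l) * cosh (of_int n * l)"
        using sinh_double[of "of_int n * l"] by (simp add: mult_ac)
      moreover have "(hcsc (2 * l) n * exp (of_int n * l) + hcsc (2 * l) (- n) * exp (of_int (- n) * l)) / 2
          = hcsc (2 * l) n * (exp (of_int n * l) + exp (of_int (- n) * l)) / 2"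
        unfolding hcsc_minus by (simp add: algebra_simps)
      ultimately show "(hcsc (2 * l) n * exp (of_int n * l) + hcsc (2 * l) (- n) * exp (of_int (- n) * l)) / 2 = hcsc l n * (1 / 2)"
        unfolding e using cosh_int_nz[OF l, of n] by (simp add: hcsc_def)
    qed
  qed
  also have "\<dots> = cschH l / 2" by (simp add: infsum_cmult_left' cschH_def del: times_divide_eq_right)
  finally have "2 * sechS l ^ 2 = 2 * sechK (2 * l) + cschH l" by simp
  also have "\<dots> = sechA l ^ 2 + sechA l * sechB l"
    by (simp add: sechA_mult_sechB[OF l] sechA_square[OF l])
  also have "\<dots> = 2 * (sechA l * sechA (2 * l))"
    unfolding sechA_double[OF l] by (simp add: power2_eq_square algebra_simps)
  finally show ?thesis by simp
qed

section \<open>Square and cube of the bilateral secant series\<close>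

definition bisech :: "complex \<Rightarrow> complex \<Rightarrow> complex" where
  "bisech w z = infsum (\<lambda>m. 1 / cosh (z + of_int m * w)) UNIV"

lemma bisech_0: "bisech w 0 = sechA w"
  by (simp add: bisech_def sechA_def hsec_def[abs_def])

lemma summable_strip:
  assumes "\<bar>Re z\<bar> < Re w"
  shows "(\<lambda>m. 1 / cosh (z + of_int m * w)) summable_on UNIV"
  by (rule exp_decay_summable[OF exp_decay_strip(1)[OF assms]]) (use assms in linarith)

lemma bisech_square:
  assumes z: "\<bar>Re z\<bar> < Re w" and z0: "cosh z \<noteq> 0"
  shows "bisech w z ^ 2 = infsum (\<lambda>m. (1 / cosh (z + of_int m * w)) ^ 2) UNIV + cschH w"
proof -
  have w: "Re w > 0" using z by linarith
  define K where "K = infsum (\<lambda>m. (1 / cosh (z + of_int m * w)) ^ 2) UNIV"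
  have "bisech w z ^ 2 = infsum (\<lambda>s. (if s = 0 then K else 0) + hcsc w s) UNIV"
    unfolding bisech_def power2_eq_square K_def
    by (subst product_infsum_shift(1)[OF summable_strip[OF z] summable_strip[OF z]])
       (simp only: sech_corr[OF z z0] hcsc_def power2_eq_square)
  also have "\<dots> = K + cschH w"
    using infsum_add[OF has_sum_imp_summable[OF has_sum_single_int[of K]] summable_hcsc[OF w]]
      infsumI[OF has_sum_single_int[of K]] by (simp add: cschH_def)
  finally show ?thesis by (simp add: K_def)
qed

text \<open>The product \<open>T m ^ 2 * T (m + s)\<close> is split into partial fractions. After
  summation over \<open>m\<close>, the contributions of \<open>T m\<close> and
  \<open>T (m + s)\<close> differ only by their coefficients, and the \<open>tanh\<close> term has a
  coefficient that is odd in \<open>s\<close>.\<close>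

lemma bisech_cube:
  assumes z: "\<bar>Re z\<bar> < Re w" and z0: "cosh z \<noteq> 0"
  shows "bisech w z ^ 3 = infsum (\<lambda>m. (1 / cosh (z + of_int m * w)) ^ 3) UNIV
     + (cschH w + (sechK (w / 2) - 1) / 2) * bisech w z"
proof -
  have w: "Re w > 0" using z by linarith
  define T where "T = (\<lambda>m. 1 / cosh (z + of_int m * w))"
  define U where "U = (\<lambda>m. tanh (z + of_int m * w))"
  \<comment> \<open>Coefficients of the partial fractions; all three are \<open>0\<close> at
    \<open>s = 0\<close> by division by zero, so that case is corrected separately.\<close>
  define p where "p = (\<lambda>s::int. cosh (of_int s * w) / sinh (of_int s * w) * (1 / sinh (of_int s * w)))"
  define r where "r = (\<lambda>s::int. 1 / sinh (of_int s * w) * (1 / sinh (of_int s * w)))"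
  define i where "i = (\<lambda>s::int. 1 / sinh (of_int s * w))"
  have nz: "cosh (z + of_int m * w) \<noteq> 0" for m
    using strip_nonzero[OF z] z0 by (cases "m = 0") auto
  have dT: "exp_decay (Re w) T" unfolding T_def by (rule exp_decay_strip(1)[OF z])
  have sT: "T summable_on UNIV" by (rule exp_decay_summable[OF dT w])
  have dT2: "exp_decay (Re w) (\<lambda>m. T m ^ 2)"
    using exp_decay_mult[OF dT dT] w by (simp add: power2_eq_square)
  have sT2: "(\<lambda>m. T m ^ 2) summable_on UNIV" by (rule exp_decay_summable[OF dT2 w])
  have di: "exp_decay (Re w) i" using exp_decay_strip(2)[of 0 w] w by (simp add: i_def)
  have si: "i summable_on UNIV" by (rule exp_decay_summable[OF di w])
  have dr: "exp_decay (Re w) r" using exp_decay_mult[OF di di w] w by (simp add: r_def i_def)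
  have sr: "r summable_on UNIV" by (rule exp_decay_summable[OF dr w])
  \<comment> \<open>The quotient \<open>(cosh x - 1) / sinh x ^ 2\<close> is
    \<open>1 / (cosh x + 1)\<close>, a squared secant of the half argument. This is why
    \<open>w / 2\<close> enters the constant.\<close>
  have pr: "p s - r s = (if s = 0 then 0 else (hsec (w / 2) s) ^ 2 / 2)" for s
  proof (cases "s = 0")
    case False
    let ?h = "of_int s * (w / 2)"
    have c: "cosh (of_int s * w) = 2 * cosh ?h ^ 2 - 1" "sinh (of_int s * w) ^ 2 = cosh (of_int s * w) ^ 2 - 1"
      using cosh_double_cosh[of ?h] sinh_square_eq[of "of_int s * w"] by (simp_all add: mult_ac)
    have n: "sinh (of_int s * w) \<noteq> 0" "cosh ?h \<noteq> 0"
      using sinh_int_nz[OF w False] cosh_int_nz[of "w/2" s] w by auto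
    have "p s - r s = (cosh (of_int s * w) - 1) / sinh (of_int s * w) ^ 2"
      by (simp add: p_def r_def power2_eq_square diff_divide_distrib)
    also have "\<dots> = 1 / (cosh (of_int s * w) + 1)"
    proof -
      have "sinh (of_int s * w) ^ 2 = (cosh (of_int s * w) - 1) * (cosh (of_int s * w) + 1)"
        unfolding c(2) by (simp add: algebra_simps power2_eq_square)
      then show ?thesis using n(1) by (metis mult_eq_0_iff nonzero_divide_mult_cancel_left power_not_zero)
    qed
    also have "\<dots> = (hsec (w / 2) s) ^ 2 / 2" using n(2) by (simp add: c(1) hsec_def power_one_over)
    finally show ?thesis using False by simp
  qed (simp add: p_def r_def)
  have sh: "(\<lambda>s. if s = 0 then 0 else (hsec (w / 2) s) ^ 2 / 2) summable_on UNIV"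
    and ih: "infsum (\<lambda>s. if s = 0 then 0 else (hsec (w / 2) s) ^ 2 / 2) UNIV = (sechK (w / 2) - 1) / 2"
  proof -
    have 1: "((\<lambda>s. (hsec (w / 2) s) ^ 2) has_sum sechK (w / 2)) UNIV"
      using summable_hsec_sq[of "w/2"] w by (simp add: sechK_def)
    have "((\<lambda>s. if s = 0 then 0 else (hsec (w / 2) s) ^ 2 / 2) has_sum (sechK (w / 2) - 1) / 2) UNIV"
    proof -
      have "(\<lambda>s. ((hsec (w / 2) s) ^ 2 + (if s = 0 then - 1 else 0)) * (1 / 2)) = (\<lambda>s. if s = 0 then 0 else (hsec (w / 2) s) ^ 2 / 2)"
        by (rule ext) simp
      with has_sum_cmult_left[OF has_sum_add[OF 1 has_sum_single_int[of "-1"]], of "1/2"]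
      show ?thesis by simp
    qed
    then show "(\<lambda>s. if s = 0 then 0 else (hsec (w / 2) s) ^ 2 / 2) summable_on UNIV"
      "infsum (\<lambda>s. if s = 0 then 0 else (hsec (w / 2) s) ^ 2 / 2) UNIV = (sechK (w / 2) - 1) / 2"
      by (simp_all add: has_sum_iff)
  qed
  have sp: "p summable_on UNIV"
  proof -
    have "(\<lambda>s. (if s = 0 then 0 else (hsec (w / 2) s) ^ 2 / 2) + r s) summable_on UNIV"
      by (intro summable_on_add sh sr)
    then show ?thesis by (simp add: pr[symmetric])
  qed
  have ipr: "infsum p UNIV - infsum r UNIV = (sechK (w / 2) - 1) / 2"
  proof -
    have "infsum p UNIV = infsum (\<lambda>s. (if s = 0 then 0 else (hsec (w / 2) s) ^ 2 / 2) + r s) UNIV"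
      by (simp add: pr[symmetric])
    also have "\<dots> = (sechK (w / 2) - 1) / 2 + infsum r UNIV" by (simp only: infsum_add[OF sh sr] ih)
    finally show ?thesis by simp
  qed
  \<comment> \<open>Oddness in \<open>s\<close> removes the sum of \<open>T m * U m\<close>, which
    has no expression in the other quantities.\<close>
  have io: "infsum i UNIV = 0" by (rule infsum_odd_int) (simp add: i_def)
  have pt: "T m ^ 2 * T (m + s) = p s * T m - r s * T (m + s) - i s * (T m * U m) + (if s = 0 then T m ^ 3 else 0)" for m s
  proof (cases "s = 0")
    case False
    let ?x = "z + of_int m * w" and ?y = "z + of_int (m + s) * w"
    have y: "?x = ?y - of_int s * w" and s: "of_int s * w = ?y - ?x" by (simp_all add: algebra_simps)
    have n: "sinh (of_int s * w) \<noteq> 0" by (rule sinh_int_nz[OF w False])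
    have c: "cosh ?x = cosh ?y * cosh (of_int s * w) - sinh ?y * sinh (of_int s * w)"
      using cosh_diff[of ?y "of_int s * w"] y by metis
    have d: "sinh (of_int s * w) = sinh ?y * cosh ?x - cosh ?y * sinh ?x"
      using sinh_diff[of ?y ?x] s by metis
    have sy: "sinh ?y * sinh (of_int s * w) = cosh ?y * cosh (of_int s * w) - cosh ?x"
      using c by simp
    define X Y A B S C where "X = cosh ?x" and "Y = cosh ?y" and "A = sinh ?x" and "B = sinh ?y"
      and "S = sinh (of_int s * w)" and "C = cosh (of_int s * w)"
    have nn: "X \<noteq> 0" "Y \<noteq> 0" "S \<noteq> 0" using nz[of m] nz[of "m+s"] n by (simp_all add: X_def Y_def S_def)
    have e1: "S = B * X - Y * A" and e2: "B * S = Y * C - X"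
      using d sy by (simp_all add: X_def Y_def S_def A_def B_def C_def)
    have "S * S = (B * S) * X - Y * A * S"
      by (subst (2) e1) (simp add: algebra_simps)
    then have "S * S = (Y * C - X) * X - Y * A * S" by (simp only: e2)
    then have "1 / X ^ 2 * (1 / Y) = ((Y * C - X) * X - Y * A * S) / (S * S * (X ^ 2 * Y))"
      using nn by (metis divide_divide_eq_left' divide_self mult.commute mult_eq_0_iff times_divide_times_eq mult_1)
    also have "\<dots> = C / S * (1 / S) * (1 / X) - 1 / S * (1 / S) * (1 / Y) - 1 / S * (1 / X * (A / X))"
      using nn by (simp add: field_simps power2_eq_square)
    finally have "1 / X ^ 2 * (1 / Y) = C / S * (1 / S) * (1 / X) - 1 / S * (1 / S) * (1 / Y) - 1 / S * (1 / X * (A / X))" .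
    then show ?thesis using False
      by (simp add: T_def U_def p_def r_def i_def tanh_def X_def Y_def A_def B_def S_def C_def power_one_over)
  qed (simp add: p_def r_def i_def power3_eq_cube power2_eq_square)
  have sTU: "(\<lambda>m. T m * U m) summable_on UNIV"
  proof (rule summable_on_norm_le)
    show "(\<lambda>m. norm (T m) + norm (T m ^ 2)) summable_on UNIV"
      using sT[unfolded summable_on_iff_abs_summable_on_complex] sT2[unfolded summable_on_iff_abs_summable_on_complex]
      by (intro summable_on_add)
    fix m
    \<comment> \<open>This bounds \<open>tanh\<close> by \<open>1 + norm (T m)\<close>, which
      suffices for summability.\<close>
    have "U m ^ 2 = 1 - T m ^ 2"
      using nz[of m] sinh_square_eq[of "z + of_int m * w"]
      by (simp add: U_def T_def tanh_def power_divide diff_divide_distrib)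
    then have "norm (U m) ^ 2 \<le> 1 + norm (T m) ^ 2"
      using norm_triangle_ineq4[of 1 "T m ^ 2"] by (metis norm_one norm_power)
    also have "\<dots> \<le> (1 + norm (T m)) ^ 2" by (simp add: power2_eq_square algebra_simps)
    finally have "norm (U m) \<le> 1 + norm (T m)" by (rule power2_le_imp_le) simp
    then have "norm (T m) * norm (U m) \<le> norm (T m) * (1 + norm (T m))" by (intro mult_left_mono) auto
    then show "norm (T m * U m) \<le> norm (T m) + norm (T m ^ 2)"
      by (simp add: norm_mult norm_power power2_eq_square algebra_simps)
  qed
  have "bisech w z ^ 3 = infsum (\<lambda>m. T m ^ 2) UNIV * infsum T UNIV + cschH w * bisech w z"
    unfolding power3_eq_cube using bisech_square[OF z z0]
    by (simp add: power2_eq_square bisech_def T_def algebra_simps)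
  also have "infsum (\<lambda>m. T m ^ 2) UNIV * infsum T UNIV = infsum (\<lambda>s. infsum (\<lambda>m. T m ^ 2 * T (m + s)) UNIV) UNIV"
    by (rule product_infsum_shift(1)[OF sT2 sT])
  also have "\<dots> = infsum (\<lambda>s. p s * infsum T UNIV - r s * infsum T UNIV - i s * infsum (\<lambda>m. T m * U m) UNIV
       + (if s = 0 then infsum (\<lambda>m. T m ^ 3) UNIV else 0)) UNIV"
  proof (rule infsum_cong)
    fix s :: int
    have dT3: "exp_decay (Re w) (\<lambda>m. T m ^ 3)"
      using exp_decay_mult[OF dT2 dT] w by (simp add: power2_eq_square power3_eq_cube)
    have s3: "(\<lambda>m. if s = 0 then T m ^ 3 else 0) summable_on UNIV"
      by (cases "s = 0") (auto intro: exp_decay_summable[OF dT3 w])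
    have a: "((\<lambda>m. p s * T m) has_sum p s * infsum T UNIV) UNIV"
      by (intro has_sum_cmult_right has_sum_infsum sT)
    have b: "((\<lambda>m. - r s * T (m + s)) has_sum - r s * infsum T UNIV) UNIV"
      using has_sum_cmult_right[OF has_sum_infsum[OF iffD2[OF summable_shift_int[of T s] sT]], of "- r s"]
      unfolding infsum_shift_int .
    have c: "((\<lambda>m. - i s * (T m * U m)) has_sum - i s * infsum (\<lambda>m. T m * U m) UNIV) UNIV"
      by (intro has_sum_cmult_right has_sum_infsum sTU)
    have d: "((\<lambda>m. if s = 0 then T m ^ 3 else 0) has_sum (if s = 0 then infsum (\<lambda>m. T m ^ 3) UNIV else 0)) UNIV"
      using has_sum_infsum[OF s3] by (cases "s = 0") auto
    have "((\<lambda>m. T m ^ 2 * T (m + s)) has_sum p s * infsum T UNIV - r s * infsum T UNIV - i s * infsum (\<lambda>m. T m * U m) UNIV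
       + (if s = 0 then infsum (\<lambda>m. T m ^ 3) UNIV else 0)) UNIV"
      using has_sum_add[OF has_sum_add[OF has_sum_add[OF a b] c] d] unfolding pt by simp
    then show "infsum (\<lambda>m. T m ^ 2 * T (m + s)) UNIV = p s * infsum T UNIV - r s * infsum T UNIV - i s * infsum (\<lambda>m. T m * U m) UNIV
       + (if s = 0 then infsum (\<lambda>m. T m ^ 3) UNIV else 0)" by (rule infsumI)
  qed
  also have "\<dots> = infsum p UNIV * infsum T UNIV - infsum r UNIV * infsum T UNIV - infsum i UNIV * infsum (\<lambda>m. T m * U m) UNIV
       + infsum (\<lambda>m. T m ^ 3) UNIV"
  proof (rule infsumI)
    have m: "((\<lambda>s. - f s * c) has_sum - infsum f UNIV * c) UNIV" if "f summable_on UNIV" for f :: "int \<Rightarrow> complex" and c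
      using has_sum_cmult_left[OF has_sum_infsum[OF that], of "- c"] by simp
    show "((\<lambda>s. p s * infsum T UNIV - r s * infsum T UNIV - i s * infsum (\<lambda>m. T m * U m) UNIV
       + (if s = 0 then infsum (\<lambda>m. T m ^ 3) UNIV else 0)) has_sum
      (infsum p UNIV * infsum T UNIV - infsum r UNIV * infsum T UNIV - infsum i UNIV * infsum (\<lambda>m. T m * U m) UNIV
       + infsum (\<lambda>m. T m ^ 3) UNIV)) UNIV"
      using has_sum_add[OF has_sum_add[OF has_sum_add[OF has_sum_cmult_left[OF has_sum_infsum[OF sp]] m[OF sr]] m[OF si]] has_sum_single_int]
      by simp
  qed
  also have "\<dots> = (infsum p UNIV - infsum r UNIV) * bisech w z + infsum (\<lambda>m. T m ^ 3) UNIV"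
    by (simp add: io bisech_def T_def algebra_simps)
  finally show ?thesis unfolding ipr by (simp add: T_def algebra_simps)
qed

section \<open>The characters modulo 4 and 8\<close>

text \<open>Residue descriptions of the symbols \<open>(-4/n)\<close> and, in \<open>chi8\<close>,
  \<open>(-2/n)\<close>, for which multiplicativity is a finite check.\<close>

definition chi4 :: "nat \<Rightarrow> int" where
  "chi4 n = (if n mod 4 = 1 then 1 else if n mod 4 = 3 then -1 else 0)"

definition chi8 :: "nat \<Rightarrow> int" where
  "chi8 n = (if n mod 8 \<in> {1, 3} then 1 else if n mod 8 \<in> {5, 7} then -1 else 0)"

lemma chi4_mult: "chi4 (m * n) = chi4 m * chi4 n"
proof -
  have "m mod 4 \<in> {0,1,2,3}" "n mod 4 \<in> {0,1,2,3}" by auto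
  moreover have "(m * n) mod 4 = ((m mod 4) * (n mod 4)) mod 4" by (simp add: mod_mult_eq)
  ultimately show ?thesis unfolding chi4_def by auto
qed

lemma chi8_mult: "chi8 (m * n) = chi8 m * chi8 n"
proof -
  have red: "chi8 k = chi8 (k mod 8)" for k by (simp add: chi8_def)
  have "\<forall>a\<in>set [0..<8]. \<forall>b\<in>set [0..<8]. chi8 (a * b) = chi8 a * chi8 b" by code_simp
  then have "chi8 ((m mod 8) * (n mod 8)) = chi8 (m mod 8) * chi8 (n mod 8)" by auto
  then show ?thesis using red[of "m * n"] red[of "(m mod 8) * (n mod 8)"] red[of m] red[of n]
    by (simp add: mod_mult_eq)
qed

lemma multiplicity_int_of_nat:
  assumes "n > 0" "prime (p::nat)"
  shows "multiplicity (int p) (int n) = multiplicity p n"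
proof (rule multiplicity_eqI)
  show "int p ^ multiplicity p n dvd int n"
    using multiplicity_dvd[of p n] by (metis int_dvd_int_iff of_nat_power)
  have "\<not> p ^ Suc (multiplicity p n) dvd n"
    using assms prime_gt_1_nat[of p] by (simp add: power_dvd_iff_le_multiplicity del: power_Suc)
  then show "\<not> int p ^ Suc (multiplicity p n) dvd int n"
    by (metis int_dvd_int_iff of_nat_power)
qed

text \<open>Both sides are completely multiplicative, so agreement at the primes is enough.\<close>

lemma chi_eqI:
  assumes mult: "\<And>m n. c (m * n) = c m * c n" and one: "c 1 = 1"
    and p: "\<And>p. prime p \<Longrightarrow> Kronecker_prime D (int p) = c p" and n: "n > 0"
  shows "chi D n = c n"
proof -
  have pow: "c (m ^ k) = c m ^ k" for m k by (induction k) (simp_all add: mult one[simplified])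
  have prod: "c (prod f A) = (\<Prod>x\<in>A. c (f x))" if "finite A" for A :: "nat set" and f
    using that by (induction A rule: finite_induct) (simp_all add: mult one[simplified])
  have pf: "prime_factors (int n) = int ` prime_factors n"
  proof (intro equalityI subsetI)
    fix x assume "x \<in> prime_factors (int n)"
    then have x: "prime x" "x dvd int n" by auto
    then obtain y where y: "x = int y" using prime_ge_0_int nonneg_int_cases by metis
    with x n show "x \<in> int ` prime_factors n" by (auto simp: prime_factors_dvd)
  qed (use n in \<open>auto simp: prime_factors_dvd\<close>)
  have "chi D n = (\<Prod>p\<in>prime_factors (int n). Kronecker_prime D p ^ multiplicity p (int n))"
    using n by (simp add: chi_def Kronecker_def)
  also have "\<dots> = (\<Prod>p\<in>prime_factors n. Kronecker_prime D (int p) ^ multiplicity (int p) (int n))"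
    unfolding pf by (subst prod.reindex) auto
  also have "\<dots> = (\<Prod>p\<in>prime_factors n. c (p ^ multiplicity p n))"
    by (intro prod.cong refl) (use n in \<open>auto simp: p pow multiplicity_int_of_nat prime_factors_multiplicity\<close>)
  also have "\<dots> = c (\<Prod>p\<in>prime_factors n. p ^ multiplicity p n)"
    by (rule prod[symmetric]) simp
  also have "(\<Prod>p\<in>prime_factors n. p ^ multiplicity p n) = n"
    using n prime_factorization_nat[of n] by simp
  finally show ?thesis .
qed

lemma Legendre_cong: "[a = b] (mod p) \<Longrightarrow> Legendre a p = Legendre b p"
proof -
  assume ab: "[a = b] (mod p)"
  have "[a = c] (mod p) \<longleftrightarrow> [b = c] (mod p)" "[c = a] (mod p) \<longleftrightarrow> [c = b] (mod p)" for c
    using ab by (meson cong_sym cong_trans)+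
  then show ?thesis by (simp add: Legendre_def QuadRes_def)
qed

lemma odd_prime_mod4:
  assumes "prime p" "p \<noteq> (2::nat)"
  shows "p > 2" "odd p"
  using assms prime_gt_1_nat[of p] prime_odd_nat[of p] by linarith+

text \<open>Euler's criterion, with the power of \<open>4 = 2\<^sup>2\<close> removed by Fermat's
  theorem, leaves the sign \<open>(-1) ^ ((p - 1) / 2)\<close>.\<close>

lemma Kronecker_prime_minus4:
  assumes "prime p"
  shows "Kronecker_prime (-4) (int p) = chi4 p"
proof (cases "p = 2")
  case False
  note p = odd_prime_mod4[OF assms False]
  obtain m where m: "p = 2 * m + 1" using p(2) by (elim oddE)
  have "\<not> p dvd 2" using p by (auto dest: dvd_imp_le)
  then have cop: "[(2::nat) ^ (p - 1) = 1] (mod p)" using assms by (intro fermat_theorem) auto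
  then have two: "[(2::int) ^ (p - 1) = 1] (mod int p)"
    using cong_int_iff[of "2 ^ (p - 1)" 1 p] by simp
  have "[Legendre (-4) p = (-4) ^ ((p - 1) div 2)] (mod p)"
    by (rule euler_criterion[OF assms p(1)])
  also have "(-4::int) ^ ((p - 1) div 2) = (-1) ^ m * 2 ^ (p - 1)"
    by (simp add: m power_mult power_mult_distrib[symmetric])
  also have "[(-1) ^ m * 2 ^ (p - 1) = (-1) ^ m * 1] (mod int p)"
    by (rule cong_mult[OF cong_refl two])
  finally have c: "[Legendre (-4) p = (-1) ^ m] (mod int p)" by simp
  have "Legendre (-4) p = (-1) ^ m"
  proof (rule ccontr)
    assume ne: "Legendre (-4) p \<noteq> (-1) ^ m"
    \<comment> \<open>Two values that differ by at most \<open>2\<close> and agree modulo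
      \<open>p > 2\<close> are equal.\<close>
    have "\<bar>Legendre (-4) p - (-1) ^ m\<bar> \<le> 2" "Legendre (-4) p \<in> {-1,0,1}"
      by (cases "even m"; simp add: Legendre_def)+
    moreover have "int p dvd Legendre (-4) p - (-1) ^ m" using c by (simp add: cong_iff_dvd_diff)
    ultimately show False using ne p(1) dvd_imp_le_int[of "Legendre (-4) p - (-1) ^ m" "int p"] by auto
  qed
  moreover have "chi4 p = (-1) ^ m"
  proof (cases "even m")
    case True then obtain k where "m = 2 * k" by blast
    then have "p mod 4 = 1" using m by presburger
    then show ?thesis using True by (simp add: chi4_def)
  next
    case od: False then obtain k where "m = 2 * k + 1" by (elim oddE)
    then have "p mod 4 = 3" using m by presburger
    then show ?thesis using od by (simp add: chi4_def)
  qed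
  ultimately show ?thesis using False by (simp add: Kronecker_prime_def)
qed (simp add: Kronecker_prime_def chi4_def)

text \<open>Gauss's lemma counts the residues that leave the lower half; for the multiplier
  \<open>- 2\<close> this set is explicit.\<close>

lemma Kronecker_prime_minus2:
  assumes "prime p"
  shows "Kronecker_prime (-2) (int p) = chi8 p"
proof (cases "p = 2")
  case False
  note p = odd_prime_mod4[OF assms False]
  have nd: "\<not> int p dvd 2" using p by (auto dest: zdvd_imp_le)
  \<comment> \<open>The multiplier has to be positive, so \<open>- 2\<close> is represented by
    \<open>p - 2\<close>.\<close>
  interpret G: GAUSS p "int p - 2"
  proof
    have "[int p - 2 = - 2] (mod int p)" by (simp add: cong_iff_dvd_diff)
    then show "[int p - 2 \<noteq> 0] (mod int p)"
      using nd by (metis cong_0_iff cong_dvd_iff dvd_minus_iff)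
  qed (use assms p in auto)
  obtain m where m: "p = 2 * m + 1" using p(2) by (elim oddE)
  have m0: "m \<ge> 1" using m p by simp
  have C: "G.C = (\<lambda>x. int p - 2 * x) ` {0<..int m}"
    unfolding G.C_def G.B_def G.A_def image_image
  proof (intro image_cong)
    fix x assume x: "x \<in> {0<..int m}"
    have "x * (int p - 2) mod int p = (int p - 2 * x + (x - 1) * int p) mod int p"
      by (simp add: algebra_simps)
    also have "\<dots> = (int p - 2 * x) mod int p" by simp
    also have "\<dots> = int p - 2 * x" by (rule mod_pos_pos_trivial) (use x m in auto)
    finally show "x * (int p - 2) mod int p = int p - 2 * x" .
  qed (simp add: m)
  \<comment> \<open>With \<open>p = 2 * m + 1\<close>, the residue \<open>p - 2 * x\<close> exceeds
    \<open>m\<close> exactly for \<open>x \<le> m div 2\<close>.\<close>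
  have E: "G.E = (\<lambda>x. int p - 2 * x) ` {0<..int (m div 2)}"
    unfolding G.E_def C using m by (auto simp: image_iff)
  have "card G.E = m div 2" unfolding E by (subst card_image) (auto simp: inj_on_def)
  then have "Legendre (int p - 2) p = (-1) ^ (m div 2)" using G.gauss_lemma by simp
  moreover have "Legendre (int p - 2) p = Legendre (-2) p"
    by (rule Legendre_cong) (simp add: cong_iff_dvd_diff)
  moreover have "chi8 p = (-1) ^ (m div 2)"
  proof -
    have "m mod 4 \<in> {0,1,2,3}" by auto
    moreover have "m = 4 * (m div 4) + m mod 4" by simp
    moreover have "m div 2 = 2 * (m div 4) + (m mod 4) div 2" by presburger
    moreover have "p mod 8 = 2 * (m mod 4) + 1" unfolding m by presburger
    ultimately show ?thesis by (auto simp: chi8_def power_add power_mult)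
  qed
  ultimately show ?thesis using False by (simp add: Kronecker_prime_def)
qed (simp add: Kronecker_prime_def chi8_def)

lemma chi_minus4: "n > 0 \<Longrightarrow> chi (-4) n = chi4 n"
  by (rule chi_eqI) (auto simp: chi4_mult Kronecker_prime_minus4 chi4_def[of "Suc 0"])

lemma chi_minus2: "n > 0 \<Longrightarrow> chi (-2) n = chi8 n"
  by (rule chi_eqI) (auto simp: chi8_mult Kronecker_prime_minus2 chi8_def[of "Suc 0"])

section \<open>The dual secant series\<close>

text \<open>Even multiples of \<open>l\<close> form the lattice of \<open>2 * l\<close>, odd
  multiples its translate by the half period \<open>l\<close>.\<close>

lemma bisech_half:
  assumes that: "\<bar>Re z\<bar> < Re l"
  shows "bisech (2 * l) (z + l) = bisech l z - bisech (2 * l) z"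
proof -
  define T where "T = (\<lambda>m. 1 / cosh (z + of_int m * l))"
  have sT: "T summable_on UNIV" unfolding T_def by (rule summable_strip[OF that])
  have "infsum T UNIV = infsum T {m. even m} + infsum T {m. odd m}"
    using infsum_Un_disjoint[of T "{m. even m}" "{m. odd m}"]
      summable_on_subset_banach[OF sT, of "{m. even m}"] summable_on_subset_banach[OF sT, of "{m. odd m}"]
    by (simp add: Un_def disjoint_iff)
  moreover have "infsum T {m. even m} = bisech (2 * l) z"
    unfolding bisech_def by (rule infsum_reindex_bij_witness[of _ "\<lambda>m. 2 * m" "\<lambda>b. b div 2"]) (auto simp: T_def mult_ac elim!: evenE)
  moreover have "infsum T {m. odd m} = bisech (2 * l) (z + l)"
    unfolding bisech_def
    by (rule infsum_reindex_bij_witness[of _ "\<lambda>m. 2 * m + 1" "\<lambda>b. (b - 1) div 2"]) (auto simp: T_def algebra_simps elim!: oddE)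
  ultimately show ?thesis by (simp add: bisech_def T_def)
qed

lemma bisech_half_0: "Re l > 0 \<Longrightarrow> bisech (2 * l) l = sechA l - sechA (2 * l)"
  using bisech_half[of 0 l] by (simp add: bisech_0)

lemma infsum_odd_part:
  assumes "h summable_on (UNIV :: int set)"
  shows "infsum (\<lambda>m. h (2 * m + 1)) UNIV = infsum h UNIV - (infsum (\<lambda>m. h (2 * m)) UNIV :: complex)"
proof -
  have "infsum h UNIV = infsum h {m. even m} + infsum h {m. odd m}"
    using infsum_Un_disjoint[of h "{m. even m}" "{m. odd m}"]
      summable_on_subset_banach[OF assms, of "{m. even m}"] summable_on_subset_banach[OF assms, of "{m. odd m}"]
    by (simp add: Un_def disjoint_iff)
  moreover have "infsum h {m. even m} = infsum (\<lambda>m. h (2 * m)) UNIV"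
    by (rule infsum_reindex_bij_witness[of _ "\<lambda>m. 2 * m" "\<lambda>b. b div 2"]) auto
  moreover have "infsum h {m. odd m} = infsum (\<lambda>m. h (2 * m + 1)) UNIV"
    by (rule infsum_reindex_bij_witness[of _ "\<lambda>m. 2 * m + 1" "\<lambda>b. (b - 1) div 2"]) (auto simp: algebra_simps)
  ultimately show ?thesis by simp
qed

text \<open>The square identity for \<open>bisech\<close> at \<open>0\<close> and at the half
  period; their sum contains exactly the combination that stands in the cubic identity for the
  parameter \<open>2 * l\<close>.\<close>

lemma bisech_alpha_sechA:
  assumes l: "Re l > 0"
  shows "1 + 2 * (cschH (2 * l) + (sechK l - 1) / 2) = sechA (2 * l) ^ 2 + (sechA l - sechA (2 * l)) ^ 2"
proof -
  have "cosh l \<noteq> 0" using cosh_int_nz[OF l, of 1] by simp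
  then have "bisech (2 * l) l ^ 2 = infsum (\<lambda>m. (1 / cosh (l + of_int m * (2 * l))) ^ 2) UNIV + cschH (2 * l)"
    using l by (intro bisech_square) auto
  also have "(\<lambda>m. (1 / cosh (l + of_int m * (2 * l))) ^ 2) = (\<lambda>m. hsec l (2 * m + 1) ^ 2)"
    by (rule ext) (simp add: hsec_def algebra_simps)
  also have "infsum \<dots> UNIV = sechK l - sechK (2 * l)"
    using infsum_odd_part[OF summable_hsec_sq[OF l]] by (simp add: sechK_def hsec_double)
  finally have "(sechA l - sechA (2 * l)) ^ 2 = sechK l - sechK (2 * l) + cschH (2 * l)"
    by (simp add: bisech_half_0[OF l])
  moreover have "sechA (2 * l) ^ 2 = sechK (2 * l) + cschH (2 * l)"
    using l by (intro sechA_square) simp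
  ultimately show ?thesis by (simp add: field_simps)
qed

text \<open>At \<open>\<i> * pi / 4\<close> both \<open>cosh\<close> and \<open>sinh\<close> have
  modulus \<open>1 / sqrt 2\<close>, and the two shifted values of \<open>cosh x\<close> multiply to
  \<open>cosh (2 * x) / 2\<close>.\<close>

lemma cosh_quarter:
  assumes that: "cosh (2 * x) \<noteq> 0"
  shows "1 / cosh (x + \<i> * pi / 4) + 1 / cosh (- x + \<i> * pi / 4) = 2 * sqrt 2 * (cosh x / cosh (2 * (x::complex)))"
proof -
  have c: "cosh (\<i> * pi / 4) = 1 / complex_of_real (sqrt 2)" "sinh (\<i> * pi / 4) = \<i> / complex_of_real (sqrt 2)"
  proof -
    have *: "exp (\<i> * pi / 4) = (1 + \<i>) / sqrt 2" "exp (- (\<i> * pi / 4)) = (1 - \<i>) / sqrt 2"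
    proof -
      have s: "sqrt 2 / 2 = 1 / sqrt (2::real)" by (simp add: field_simps)
      have e: "exp (\<i> * pi / 4) = cis (pi / 4)" "exp (- (\<i> * pi / 4)) = cis (- pi / 4)"
        by (simp_all add: cis_conv_exp)
      show "exp (\<i> * pi / 4) = (1 + \<i>) / sqrt 2" "exp (- (\<i> * pi / 4)) = (1 - \<i>) / sqrt 2"
        unfolding e by (simp_all add: complex_eq_iff cos_45 sin_45 s)
    qed
    show "cosh (\<i> * pi / 4) = 1 / complex_of_real (sqrt 2)" "sinh (\<i> * pi / 4) = \<i> / complex_of_real (sqrt 2)"
      unfolding cosh_field_def sinh_field_def * by (simp_all add: field_simps)
  qed
  define r where "r = complex_of_real (sqrt 2)"
  have r: "r * r = 2" "r \<noteq> 0" by (simp_all add: r_def flip: of_real_mult)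
  define C S where "C = cosh x" and "S = sinh x"
  have CS: "C * C - S * S = 1" using hyperbolic_pythagoras[of x] by (simp add: C_def S_def power2_eq_square)
  have c2: "cosh (2 * x) = C * C + S * S" using cosh_double[of x] by (simp add: C_def S_def power2_eq_square)
  have a: "cosh (x + \<i> * pi / 4) = (C + \<i> * S) / r" "cosh (- x + \<i> * pi / 4) = (C - \<i> * S) / r"
    unfolding cosh_add c by (simp_all add: C_def S_def r_def field_simps)
  have p: "(C + \<i> * S) * (C - \<i> * S) = cosh (2 * x)" unfolding c2 by (simp add: algebra_simps)
  then have nz: "C + \<i> * S \<noteq> 0" "C - \<i> * S \<noteq> 0" using that by auto
  have "1 / ((C + \<i> * S) / r) + 1 / ((C - \<i> * S) / r) = r * (2 * C) / ((C + \<i> * S) * (C - \<i> * S))"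
    using nz r by (simp add: add_divide_eq_iff divide_add_eq_iff) (simp add: field_simps)
  then show ?thesis unfolding a p by (simp add: C_def r_def mult_ac)
qed

lemma bisech_quarter:
  assumes l: "Re l > 0"
  shows "bisech l (\<i> * pi / 4) = sqrt 2 * sechS l"
proof -
  have sm: "(\<lambda>m. 1 / cosh (\<i> * pi / 4 + of_int m * l)) summable_on UNIV"
    by (rule summable_strip) (use l in simp)
  have "bisech l (\<i> * pi / 4) = infsum (\<lambda>m. (1 / cosh (\<i> * pi / 4 + of_int m * l) + 1 / cosh (\<i> * pi / 4 + of_int (- m) * l)) / 2) UNIV"
    unfolding bisech_def by (rule infsum_symmetrize[OF sm])
  also have "\<dots> = infsum (\<lambda>m. sqrt 2 * (cosh (of_int m * l) / cosh (2 * (of_int m * l)))) UNIV"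
  proof (rule infsum_cong)
    fix m :: int
    have "cosh (2 * (of_int m * l)) \<noteq> 0" using cosh_int_nz[OF l, of "2 * m"] by (simp add: mult_ac)
    from cosh_quarter[OF this]
    show "(1 / cosh (\<i> * pi / 4 + of_int m * l) + 1 / cosh (\<i> * pi / 4 + of_int (- m) * l)) / 2 = sqrt 2 * (cosh (of_int m * l) / cosh (2 * (of_int m * l)))"
      by (simp add: add.commute)
  qed
  also have "\<dots> = sqrt 2 * sechS l" by (simp only: infsum_cmult_right' sechS_def)
  finally show ?thesis .
qed

section \<open>Exponential expansion of bilateral sums\<close>

definition geo_coeff :: "(nat \<Rightarrow> complex) \<Rightarrow> complex \<Rightarrow> int \<Rightarrow> complex" where
  "geo_coeff a w n = a (nat \<bar>n\<bar>) * (exp (- (of_nat (nat \<bar>n\<bar>) * w)) / (1 - exp (- (of_nat (nat \<bar>n\<bar>) * w))))"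

lemma has_sum_geometric_exp:
  assumes "Re u > 0"
  shows "((\<lambda>m. exp (- (of_nat m * u))) has_sum exp (- u) / (1 - exp (- u :: complex))) {1..}"
proof -
  have "norm (exp (- u)) < 1" using assms by simp
  from has_sum_geometric_from_1[OF this]
  show ?thesis by (simp add: exp_of_nat_mult[symmetric])
qed

lemma exp_decay_geo_coeff:
  assumes w: "Re w > 0" and a0: "a 0 = 0" and a: "\<And>n. norm (a n) \<le> K * real n ^ p" and \<rho>: "\<rho> < Re w"
  shows "exp_decay \<rho> (geo_coeff a w)"
proof -
  define d where "d = 1 - exp (- Re w)"
  have d: "d > 0" using w by (simp add: d_def)
  have dec: "exp_decay (Re w) (\<lambda>n. of_real (exp (- Re w * \<bar>real_of_int n\<bar>)))"
    unfolding exp_decay_def by (intro exI[of _ 1]) auto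
  obtain L where L: "\<And>n. norm (of_int n ^ p * complex_of_real (exp (- Re w * \<bar>real_of_int n\<bar>))) \<le> L * exp (- \<rho> * \<bar>real_of_int n\<bar>)"
    using exp_decay_power[OF dec \<rho>, of p] unfolding exp_decay_def by blast
  have L: "\<bar>real_of_int n\<bar> ^ p * exp (- Re w * \<bar>real_of_int n\<bar>) \<le> L * exp (- \<rho> * \<bar>real_of_int n\<bar>)" for n
    using L[of n] by (simp add: norm_mult norm_power)
  have "norm (geo_coeff a w n) \<le> \<bar>K\<bar> / d * L * exp (- \<rho> * \<bar>real_of_int n\<bar>)" for n
  proof (cases "n = 0")
    case True
    have "L \<ge> 0" using order_trans[OF mult_nonneg_nonneg[OF zero_le_power[OF abs_ge_zero] exp_ge_zero] L[of 0]] by simp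
    then show ?thesis using True a0 d by (simp add: geo_coeff_def)
  next
    case False
    let ?m = "nat \<bar>n\<bar>"
    have m: "?m \<ge> 1" "real ?m = \<bar>real_of_int n\<bar>" using False by auto
    let ?e = "exp (- (of_nat ?m * w))"
    have ne: "norm ?e = exp (- Re w * \<bar>real_of_int n\<bar>)" using m by (simp add: mult.commute)
    have "exp (- Re w * \<bar>real_of_int n\<bar>) \<le> exp (- Re w)" using m w by simp
    moreover have "norm (1::complex) - norm ?e \<le> norm (1 - ?e)" by (rule norm_triangle_ineq2)
    ultimately have dn: "d \<le> norm (1 - ?e)" unfolding ne d_def norm_one by linarith
    then have "norm (?e / (1 - ?e)) \<le> exp (- Re w * \<bar>real_of_int n\<bar>) / d"
      unfolding norm_divide ne using d dn by (intro divide_left_mono mult_pos_pos) (auto simp del: of_nat_nat)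
    moreover have "norm (a ?m) \<le> \<bar>K\<bar> * \<bar>real_of_int n\<bar> ^ p"
      using a[of ?m] m(2) by (smt (verit) mult_right_mono zero_le_power abs_ge_zero)
    ultimately have "norm (geo_coeff a w n) \<le> (\<bar>K\<bar> * \<bar>real_of_int n\<bar> ^ p) * (exp (- Re w * \<bar>real_of_int n\<bar>) / d)"
      unfolding geo_coeff_def norm_mult by (intro mult_mono) auto
    also have "\<dots> = \<bar>K\<bar> / d * (\<bar>real_of_int n\<bar> ^ p * exp (- Re w * \<bar>real_of_int n\<bar>))" by simp
    also have "\<dots> \<le> \<bar>K\<bar> / d * (L * exp (- \<rho> * \<bar>real_of_int n\<bar>))"
      using d by (intro mult_left_mono L) auto
    finally show ?thesis by (simp add: mult_ac)
  qed
  then show ?thesis unfolding exp_decay_def by blast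
qed

text \<open>Away from \<open>m = 0\<close> every term is expanded in decaying exponentials and the
  two sums are interchanged; the geometric sums over \<open>m\<close> form \<open>geo_coeff\<close>.
  Positive \<open>m\<close> contribute the nonpositive \<open>n\<close>, negative \<open>m\<close>
  the others by evenness. The term \<open>m = 0\<close> stays closed, since its argument may lie
  outside the half plane of expansion.\<close>

lemma bilateral_expansion:
  fixes \<phi> :: "complex \<Rightarrow> complex"
  assumes z: "\<bar>Re z\<bar> < Re w"
    and a0: "a 0 = 0" and a: "\<And>n. norm (a n) \<le> K * real n ^ p"
    and \<phi>: "\<And>x. Re x > 0 \<Longrightarrow> ((\<lambda>j. a j * exp (- (of_nat j * x))) has_sum \<phi> x) UNIV"
    and even: "\<And>x. \<phi> (- x) = \<phi> x"
  shows "((\<lambda>m. \<phi> (z + of_int m * w)) has_sum \<phi> z + exp_series (geo_coeff a w) 0 z) UNIV"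
proof -
  have w: "Re w > 0" using z by linarith
  define \<rho> where "\<rho> = Re w"
  define G where "G = (\<lambda>(n::int, m::nat). a (nat \<bar>n\<bar>) * exp (of_int n * z) * exp (- (of_nat m * (of_nat (nat \<bar>n\<bar>) * w))))"
  have K0: "K \<ge> 0" using order_trans[OF norm_ge_zero a[of 1]] by simp
  have Gs: "G summable_on (UNIV \<times> {1..})"
  proof (rule summable_on_norm_le)
    have 1: "(\<lambda>n::int. K * (\<bar>real_of_int n\<bar> ^ p * exp (- (\<rho> - \<bar>Re z\<bar>) * \<bar>real_of_int n\<bar>))) summable_on UNIV"
      by (intro summable_on_cmult_right summable_on_power_exp_int) (use z in \<open>simp add: \<rho>_def\<close>)
    have 2: "(\<lambda>m::nat. exp \<rho> * exp (- \<rho> * real m)) summable_on {1..}"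
    proof -
      have "(\<lambda>n::int. exp (- \<rho> * \<bar>real_of_int n\<bar>)) summable_on {1..}"
        using summable_on_exp_int[of \<rho>] w by (auto simp: \<rho>_def intro: summable_on_subset_banach)
      then have "(\<lambda>m::nat. exp (- \<rho> * real m)) summable_on {1..}"
        by (rule iffD2[OF summable_on_reindex_bij_witness[of "{1..}" nat int "{1..}"], rotated -1]) auto
      then show ?thesis by (rule summable_on_cmult_right)
    qed
    show "(\<lambda>(n::int, m::nat). K * (\<bar>real_of_int n\<bar> ^ p * exp (- (\<rho> - \<bar>Re z\<bar>) * \<bar>real_of_int n\<bar>)) * (exp \<rho> * exp (- \<rho> * real m))) summable_on (UNIV \<times> {1..})"
      by (rule product_summable_real[OF 1 2]) (use K0 in auto)
    fix x assume "x \<in> (UNIV :: int set) \<times> {1::nat..}"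
    then obtain n m where x: "x = (n, m)" "m \<ge> 1" by auto
    show "norm (G x) \<le> (case x of (n, m) \<Rightarrow> K * (\<bar>real_of_int n\<bar> ^ p * exp (- (\<rho> - \<bar>Re z\<bar>) * \<bar>real_of_int n\<bar>)) * (exp \<rho> * exp (- \<rho> * real m)))"
    proof (cases "n = 0")
      case False
      let ?N = "\<bar>real_of_int n\<bar>"
      have N: "real (nat \<bar>n\<bar>) = ?N" "?N \<ge> 1" using False by auto
      have "norm (G x) = norm (a (nat \<bar>n\<bar>)) * norm (exp (of_int n * z)) * exp (- (real m * (?N * \<rho>)))"
        using N by (simp add: x G_def norm_mult \<rho>_def)
      also have "\<dots> \<le> (K * ?N ^ p) * exp (?N * \<bar>Re z\<bar>) * exp (- ?N * \<rho> - \<rho> * real m + \<rho>)"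
      proof (intro mult_mono)
        show "norm (a (nat \<bar>n\<bar>)) \<le> K * ?N ^ p" using a[of "nat \<bar>n\<bar>"] N by simp
        \<comment> \<open>For \<open>m, N \<ge> 1\<close> this replaces the exponent
          \<open>m * N\<close> by \<open>m + N - 1\<close>, so that a product majorant
          suffices.\<close>
        have "(real m - 1) * (?N - 1) * \<rho> \<ge> 0" using x N w by (intro mult_nonneg_nonneg) (auto simp: \<rho>_def)
        then show "exp (- (real m * (?N * \<rho>))) \<le> exp (- ?N * \<rho> - \<rho> * real m + \<rho>)"
          by (simp add: algebra_simps)
        show "norm (exp (of_int n * z)) \<le> exp (?N * \<bar>Re z\<bar>)" by (rule norm_exp_int_le)
      qed (use K0 in auto)
      also have "\<dots> = K * (?N ^ p * exp (- (\<rho> - \<bar>Re z\<bar>) * ?N)) * (exp \<rho> * exp (- \<rho> * real m))"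
        by (simp add: exp_add exp_diff exp_minus field_simps)
      finally show ?thesis by (simp add: x)
    qed (use K0 in \<open>simp add: x G_def a0\<close>)
  qed
  have inner1: "((\<lambda>m. G (n, m)) has_sum geo_coeff a w n * exp (of_int n * z)) {1..}" for n
  proof (cases "n = 0")
    case False
    have "Re (of_nat (nat \<bar>n\<bar>) * w) > 0" using False w by simp
    from has_sum_cmult_right[OF has_sum_geometric_exp[OF this], of "a (nat \<bar>n\<bar>) * exp (of_int n * z)"]
    show ?thesis by (simp add: G_def geo_coeff_def mult_ac)
  qed (simp add: G_def geo_coeff_def a0)
  define u where "u = (\<lambda>m::int. \<phi> (z + of_int m * w))"
  have inner2: "((\<lambda>n. G (n, m)) has_sum u (int m)) {..0}" "((\<lambda>n. G (n, m)) has_sum u (- int m)) {1..}"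
    if m: "m \<ge> 1" for m
  proof -
    have Re: "Re (z + of_nat m * w) > 0" "Re (- z + of_nat m * w) > 0"
    proof -
      have "real m * Re w \<ge> 1 * Re w" using m w by (intro mult_right_mono) auto
      then show "Re (z + of_nat m * w) > 0" "Re (- z + of_nat m * w) > 0" using z by auto
    qed
    show "((\<lambda>n. G (n, m)) has_sum u (int m)) {..0}"
      unfolding u_def
      by (rule iffD1[OF has_sum_reindex_bij_witness[of UNIV "\<lambda>n. nat (- n)" "\<lambda>j. - int j" "{..0}"] \<phi>[OF Re(1)]])
         (auto simp: G_def mult.assoc exp_add[symmetric] algebra_simps)
    have h2: "((\<lambda>n. G (n, m)) has_sum \<phi> (- z + of_nat m * w)) {0..}"
      by (rule iffD1[OF has_sum_reindex_bij_witness[of UNIV "\<lambda>n. nat n" "\<lambda>j. int j" "{0..}"] \<phi>[OF Re(2)]])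
         (auto simp: G_def mult.assoc exp_add[symmetric] algebra_simps)
    \<comment> \<open>The index \<open>n = 0\<close> carries the coefficient \<open>a 0 = 0\<close>;
      dropping it makes the two half ranges disjoint.\<close>
    have h2': "((\<lambda>n. G (n, m)) has_sum \<phi> (- z + of_nat m * w)) {1..}"
      by (rule iffD2[OF has_sum_cong_neutral h2]) (auto simp: G_def a0)
    moreover have "\<phi> (- z + of_nat m * w) = u (- int m)"
      using even[of "z + of_int (- int m) * w"] by (simp add: u_def algebra_simps)
    ultimately show "((\<lambda>n. G (n, m)) has_sum u (- int m)) {1..}" by simp
  qed
  have tot: "(G has_sum exp_series (geo_coeff a w) 0 z) (UNIV \<times> {1..})"
  proof -
    have "infsum G (UNIV \<times> {1..}) = infsum (\<lambda>n. geo_coeff a w n * exp (of_int n * z)) UNIV"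
      using infsum_Sigma_banach[of G UNIV "\<lambda>_. {1..}"] Gs infsumI[OF inner1] by simp
    then show ?thesis using Gs by (simp add: has_sum_iff exp_series_def)
  qed
  define S where "S = (\<lambda>N. infsum G (N \<times> {1..}))"
  have SG: "(G has_sum S N) (N \<times> {1..})" for N
    unfolding S_def by (rule has_sum_infsum, rule summable_on_subset_banach[OF Gs]) auto
  have swap: "((\<lambda>(m, n). G (n, m)) has_sum S N) ({1..} \<times> N)" for N
    by (rule iffD1[OF has_sum_reindex_bij_witness[of "N \<times> {1..}" "\<lambda>(m, n). (n, m)" "\<lambda>(n, m). (m, n)"] SG]) auto
  have p1: "((\<lambda>m. u (int m)) has_sum S {..0}) {1..}"
    using has_sum_Sigma'[OF swap[of "{..0}"], of "\<lambda>m. u (int m)"] inner2(1) by auto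
  have p2: "((\<lambda>m. u (- int m)) has_sum S {1..}) {1..}"
    using has_sum_Sigma'[OF swap[of "{1..}"], of "\<lambda>m. u (- int m)"] inner2(2) by auto
  have "(G has_sum S {..0} + S {1..}) ({..0} \<times> {1..} \<union> {1..} \<times> {1..})"
    by (rule has_sum_Un_disjoint[OF SG SG]) auto
  moreover have "{..0} \<times> {1..} \<union> {1..} \<times> {1..} = (UNIV :: int set) \<times> {1::nat..}" by auto
  ultimately have S12: "S {..0} + S {1..} = exp_series (geo_coeff a w) 0 z"
    using tot has_sum_unique by fastforce
  have q1: "(u has_sum S {..0}) {1..}"
    by (rule iffD1[OF has_sum_reindex_bij_witness[of "{1..}" nat int "{1..}"] p1]) auto
  have q2: "(u has_sum S {1..}) {..-1}"
    by (rule iffD1[OF has_sum_reindex_bij_witness[of "{1..}" "\<lambda>n. nat (- n)" "\<lambda>m. - int m" "{..-1}"] p2]) auto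
  have q0: "(u has_sum \<phi> z) {0}" by (rule has_sum_finiteI) (auto simp: u_def)
  have "(u has_sum (S {..0} + S {1..}) + \<phi> z) (({1..} \<union> {..-1}) \<union> {0})"
    by (intro has_sum_Un_disjoint q1 q2 q0) auto
  moreover have "({1..} \<union> {..-1}) \<union> {0} = (UNIV :: int set)" by auto
  ultimately show ?thesis unfolding S12 u_def by (simp add: add.commute)
qed

section \<open>Even derivatives along the elliptic differential equation\<close>

definition ode_op :: "complex \<Rightarrow> complex \<Rightarrow> complex \<Rightarrow> complex poly \<Rightarrow> complex poly" where
  "ode_op e \<alpha> \<gamma> g = [:e * \<alpha>, - 2 * e:] * g
     + [:(2 + 4 * e) * \<gamma>, (4 + 4 * e) * \<alpha>, - (6 + 4 * e):] * pderiv g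
     + [:0, 4 * \<gamma>, 4 * \<alpha>, - 4:] * pderiv (pderiv g)"

definition ode_val :: "complex \<Rightarrow> nat \<Rightarrow> complex \<Rightarrow> complex \<Rightarrow> complex poly \<Rightarrow> complex \<Rightarrow> complex" where
  "ode_val e n \<alpha> \<gamma> p x = poly ((ode_op e \<alpha> \<gamma> ^^ n) p) x"

lemma poly_ode_op:
  "poly (ode_op e \<alpha> \<gamma> g) x = e * (\<alpha> - 2 * x) * poly g x
     + ((2 + 4 * e) * \<gamma> + (4 + 4 * e) * \<alpha> * x - (6 + 4 * e) * x\<^sup>2) * poly (pderiv g) x
     + 4 * x * (\<gamma> + \<alpha> * x - x\<^sup>2) * poly (pderiv (pderiv g)) x"
  by (simp add: ode_op_def algebra_simps power2_eq_square)

text \<open>If \<open>f'' = \<alpha> f - 2 f\<^sup>3\<close> and hence \<open>f'\<^sup>2 = \<gamma> + \<alpha> f\<^sup>2 - f\<^sup>4\<close>, then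
  \<open>(f\<^sup>e g(f\<^sup>2))'' = f\<^sup>e (ode_op e \<alpha> \<gamma> g)(f\<^sup>2)\<close> for \<open>e \<in> {0, 1}\<close>.\<close>

lemma ode_even_derivatives:
  fixes f h :: "nat \<Rightarrow> complex \<Rightarrow> complex" and e :: nat
  assumes S: "open S" and e: "e \<le> 1"
    and df: "\<And>j z. z \<in> S \<Longrightarrow> (f j has_field_derivative f (Suc j) z) (at z)"
    and dh: "\<And>j z. z \<in> S \<Longrightarrow> (h j has_field_derivative h (Suc j) z) (at z)"
    and f2: "\<And>z. z \<in> S \<Longrightarrow> f 2 z = \<alpha> * f 0 z - 2 * f 0 z ^ 3"
    and f1: "\<And>z. z \<in> S \<Longrightarrow> f 1 z ^ 2 = \<gamma> + \<alpha> * f 0 z ^ 2 - f 0 z ^ 4"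
    and h0: "\<And>z. z \<in> S \<Longrightarrow> h 0 z = f 0 z ^ e * poly p (f 0 z ^ 2)"
    and z: "z \<in> S"
  shows "h (2 * n) z = f 0 z ^ e * ode_val (of_nat e) n \<alpha> \<gamma> p (f 0 z ^ 2)"
  using z
proof (induction n arbitrary: z)
  case 0
  then show ?case by (simp add: ode_val_def h0)
next
  case (Suc n)
  define P where "P = (ode_op (of_nat e) \<alpha> \<gamma> ^^ n) p"
  define y where "y = f 0"
  define P1 where "P1 = pderiv P"
  define P2 where "P2 = pderiv P1"
  have e2: "e = 0 \<or> e = 1" using e by auto
  have dy: "(y has_field_derivative f 1 w) (at w)" if "w \<in> S" for w
    using df[OF that, of 0] by (simp add: y_def)
  have dy1: "(f 1 has_field_derivative \<alpha> * y w - 2 * y w ^ 3) (at w)" if "w \<in> S" for w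
    using df[OF that, of 1] f2[OF that] by (simp add: y_def numeral_2_eq_2)
  have IH: "h (2 * n) w = y w ^ e * poly P (y w ^ 2)" if "w \<in> S" for w
    using Suc.IH[OF that] by (simp add: P_def y_def ode_val_def)
  \<comment> \<open>An odd derivative always has the factor \<open>f'\<close>; differentiating it
    again yields \<open>f''\<close> and \<open>f'\<^sup>2\<close>, and both are polynomials in
    \<open>f\<close>.\<close>
  define D where "D = (\<lambda>w. f 1 w * (of_nat e * poly P (y w ^ 2) + 2 * y w ^ (e + 1) * poly P1 (y w ^ 2)))"
  have D: "h (Suc (2 * n)) w = D w" if w: "w \<in> S" for w
  proof -
    have "((\<lambda>w. y w ^ e * poly P (y w ^ 2)) has_field_derivative D w) (at w)"
      using e2
    proof
      assume "e = 0"
      then show ?thesis unfolding D_def P1_def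
        by (auto intro!: derivative_eq_intros dy[OF w] simp: algebra_simps)
    next
      assume "e = 1"
      then show ?thesis unfolding D_def P1_def
        by (auto intro!: derivative_eq_intros dy[OF w] simp: algebra_simps power2_eq_square)
    qed
    then have "(h (2 * n) has_field_derivative D w) (at w)"
      by (rule has_field_derivative_transform_within_open[OF _ S w]) (simp add: IH)
    then show ?thesis using dh[OF w, of "2 * n"] DERIV_unique by blast
  qed
  let ?z = z
  have f1z: "f 1 ?z ^ 2 = \<gamma> + \<alpha> * y ?z ^ 2 - y ?z ^ 4" using f1[OF Suc.prems] by (simp add: y_def)
  have f1z': "f 1 ?z * (f 1 ?z * x) = (\<gamma> + \<alpha> * y ?z ^ 2 - y ?z ^ 4) * x" for x
    unfolding f1z[symmetric] by (simp add: power2_eq_square)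
  have "(D has_field_derivative y ?z ^ e * poly (ode_op (of_nat e) \<alpha> \<gamma> P) (y ?z ^ 2)) (at ?z)"
    using e2
  proof
    assume e0: "e = 0"
    have "(D has_field_derivative (\<alpha> * y z - 2 * y z ^ 3) * (2 * y z * poly P1 (y z ^ 2))
       + f 1 z * (2 * f 1 z * poly P1 (y z ^ 2) + 2 * y z * (poly P2 (y z ^ 2) * (2 * y z * f 1 z)))) (at z)"
      unfolding D_def P2_def
      by (auto intro!: derivative_eq_intros dy[OF Suc.prems] dy1[OF Suc.prems, unfolded One_nat_def] simp: e0 algebra_simps power2_eq_square)
    also have "(\<alpha> * y z - 2 * y z ^ 3) * (2 * y z * poly P1 (y z ^ 2))
       + f 1 z * (2 * f 1 z * poly P1 (y z ^ 2) + 2 * y z * (poly P2 (y z ^ 2) * (2 * y z * f 1 z)))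
      = (\<alpha> * y z - 2 * y z ^ 3) * (2 * y z * poly P1 (y z ^ 2))
       + f 1 z ^ 2 * (2 * poly P1 (y z ^ 2) + 4 * y z ^ 2 * poly P2 (y z ^ 2))"
      by (simp add: algebra_simps power2_eq_square)
    also have "\<dots> = y z ^ e * poly (ode_op (of_nat e) \<alpha> \<gamma> P) (y z ^ 2)"
      unfolding f1z poly_ode_op e0 P2_def P1_def by (simp add: algebra_simps power2_eq_square power3_eq_cube power4_eq_xxxx)
    finally show ?thesis .
  next
    assume e1: "e = 1"
    have "(D has_field_derivative (\<alpha> * y z - 2 * y z ^ 3) * (poly P (y z ^ 2) + 2 * y z ^ 2 * poly P1 (y z ^ 2))
       + f 1 z * (poly P1 (y z ^ 2) * (2 * y z * f 1 z) + 4 * y z * f 1 z * poly P1 (y z ^ 2) + 2 * y z ^ 2 * (poly P2 (y z ^ 2) * (2 * y z * f 1 z)))) (at z)"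
      unfolding D_def P2_def P1_def
      by (auto intro!: derivative_eq_intros dy[OF Suc.prems] dy1[OF Suc.prems, unfolded One_nat_def] simp: e1 algebra_simps power2_eq_square)
    also have "(\<alpha> * y z - 2 * y z ^ 3) * (poly P (y z ^ 2) + 2 * y z ^ 2 * poly P1 (y z ^ 2))
       + f 1 z * (poly P1 (y z ^ 2) * (2 * y z * f 1 z) + 4 * y z * f 1 z * poly P1 (y z ^ 2) + 2 * y z ^ 2 * (poly P2 (y z ^ 2) * (2 * y z * f 1 z)))
      = (\<alpha> * y z - 2 * y z ^ 3) * (poly P (y z ^ 2) + 2 * y z ^ 2 * poly P1 (y z ^ 2))
       + f 1 z ^ 2 * (6 * y z * poly P1 (y z ^ 2) + 4 * y z ^ 3 * poly P2 (y z ^ 2))"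
      by (simp add: algebra_simps power2_eq_square power3_eq_cube)
    also have "\<dots> = y z ^ e * poly (ode_op (of_nat e) \<alpha> \<gamma> P) (y z ^ 2)"
      unfolding f1z poly_ode_op e1 P2_def P1_def by (simp add: algebra_simps power2_eq_square power3_eq_cube power4_eq_xxxx)
    finally show ?thesis .
  qed
  then have "(h (Suc (2 * n)) has_field_derivative y z ^ e * poly (ode_op (of_nat e) \<alpha> \<gamma> P) (y z ^ 2)) (at z)"
    by (rule has_field_derivative_transform_within_open[OF _ S Suc.prems]) (simp add: D)
  then have "h (Suc (Suc (2 * n))) z = y z ^ e * poly (ode_op (of_nat e) \<alpha> \<gamma> P) (y z ^ 2)"
    using dh[OF Suc.prems, of "Suc (2 * n)"] DERIV_unique by blast
  then show ?case by (simp add: ode_val_def P_def y_def)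
qed

text \<open>The derivative of \<open>f'\<^sup>2 - \<alpha> * f\<^sup>2 + f\<^sup>4\<close> is
  \<open>2 * f'\<close> times the differential equation; the constant is read off at a point where
  \<open>f'\<close> vanishes.\<close>

lemma ode_first_integral:
  fixes f :: "nat \<Rightarrow> complex \<Rightarrow> complex"
  assumes S: "open S" "convex S"
    and df: "\<And>j z. z \<in> S \<Longrightarrow> (f j has_field_derivative f (Suc j) z) (at z)"
    and f2: "\<And>z. z \<in> S \<Longrightarrow> f 2 z = \<alpha> * f 0 z - 2 * f 0 z ^ 3"
    and z0: "z0 \<in> S" "f 1 z0 = 0" and z: "z \<in> S"
  shows "f 1 z ^ 2 = (f 0 z0 ^ 4 - \<alpha> * f 0 z0 ^ 2) + \<alpha> * f 0 z ^ 2 - f 0 z ^ 4"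
proof -
  define F where "F = (\<lambda>z. f 1 z ^ 2 - \<alpha> * f 0 z ^ 2 + f 0 z ^ 4)"
  have "(F has_field_derivative 0) (at w within S)" if w: "w \<in> S" for w
  proof -
    have "(F has_field_derivative (2 * f 1 w * f 2 w - \<alpha> * (2 * f 0 w * f 1 w) + 4 * f 0 w ^ 3 * f 1 w)) (at w)"
      unfolding F_def using df[OF w, of 0] df[OF w, of 1]
      by (auto intro!: derivative_eq_intros simp: numeral_2_eq_2 algebra_simps)
    also have "2 * f 1 w * f 2 w - \<alpha> * (2 * f 0 w * f 1 w) + 4 * f 0 w ^ 3 * f 1 w = 0"
      unfolding f2[OF w] by (simp add: algebra_simps)
    finally show ?thesis by (rule has_field_derivative_at_within)
  qed
  then have "\<exists>c. \<forall>w\<in>S. F w = c"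
    by (intro has_field_derivative_zero_constant[OF S(2)]) auto
  then have "F z = F z0" using z z0 by auto
  then show ?thesis using z0(2) by (simp add: F_def algebra_simps)
qed

section \<open>Forms invariant under the change of theta constants\<close>

definition ratcoeffs :: "complex poly \<Rightarrow> bool" where
  "ratcoeffs p \<longleftrightarrow> (\<forall>n. poly.coeff p n \<in> \<rat>)"

text \<open>A predicate on functions rather than on polynomials, since the invariance conditions are
  functional equations with a rational substitution.\<close>

definition ratpoly :: "(complex \<Rightarrow> complex) \<Rightarrow> bool" where
  "ratpoly f \<longleftrightarrow> (\<exists>p. ratcoeffs p \<and> f = poly p)"

lemma ratcoeffs_intros:
  "c \<in> \<rat> \<Longrightarrow> ratcoeffs [:c:]"
  "ratcoeffs p \<Longrightarrow> ratcoeffs q \<Longrightarrow> ratcoeffs (p + q)"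
  "ratcoeffs p \<Longrightarrow> ratcoeffs q \<Longrightarrow> ratcoeffs (p - q)"
  "ratcoeffs p \<Longrightarrow> ratcoeffs q \<Longrightarrow> ratcoeffs (p * q)"
  "c \<in> \<rat> \<Longrightarrow> ratcoeffs p \<Longrightarrow> ratcoeffs (Polynomial.smult c p)"
  "c \<in> \<rat> \<Longrightarrow> ratcoeffs p \<Longrightarrow> ratcoeffs (pCons c p)"
  "ratcoeffs p \<Longrightarrow> ratcoeffs (pderiv p)"
  by (auto simp: ratcoeffs_def coeff_mult coeff_pderiv coeff_pCons split: nat.splits intro!: Rats_sum Rats_mult Rats_add)

lemma ratcoeffs_0 [simp]: "ratcoeffs 0" and ratcoeffs_1 [simp]: "ratcoeffs 1"
  by (auto simp: ratcoeffs_def)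

lemma ratpoly_const [intro]: "c \<in> \<rat> \<Longrightarrow> ratpoly (\<lambda>_. c)"
  unfolding ratpoly_def by (intro exI[of _ "[:c:]"]) (auto intro!: ratcoeffs_intros)

lemma ratpoly_id [intro]: "ratpoly (\<lambda>u. u)"
  unfolding ratpoly_def by (intro exI[of _ "[:0, 1:]"]) (auto intro!: ratcoeffs_intros)

lemma ratpoly_add [intro]: "ratpoly f \<Longrightarrow> ratpoly g \<Longrightarrow> ratpoly (\<lambda>u. f u + g u)"
  and ratpoly_diff [intro]: "ratpoly f \<Longrightarrow> ratpoly g \<Longrightarrow> ratpoly (\<lambda>u. f u - g u)"
  and ratpoly_mult [intro]: "ratpoly f \<Longrightarrow> ratpoly g \<Longrightarrow> ratpoly (\<lambda>u. f u * g u)"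
  unfolding ratpoly_def
  by (elim exE conjE; rule exI, rule conjI, erule (1) ratcoeffs_intros, simp add: fun_eq_iff)+

lemma ratpoly_minus [intro]: "ratpoly f \<Longrightarrow> ratpoly (\<lambda>u. - f u)"
  using ratpoly_diff[OF ratpoly_const[OF Rats_0], of f] by simp

lemma ratpoly_power [intro]: "ratpoly f \<Longrightarrow> ratpoly (\<lambda>u. f u ^ n)"
  by (induction n) auto

lemma ratpoly_divide [intro]: "c \<in> \<rat> \<Longrightarrow> ratpoly f \<Longrightarrow> ratpoly (\<lambda>u. f u / c)"
  using ratpoly_mult[OF _ ratpoly_const[OF Rats_inverse], of f c] by (simp add: divide_inverse)

lemma ratpoly_sum: "(\<And>i. i \<in> A \<Longrightarrow> ratpoly (f i)) \<Longrightarrow> ratpoly (\<lambda>u. \<Sum>i\<in>A. f i u)"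
  by (induction A rule: infinite_finite_induct) auto

text \<open>Polynomials in a second variable whose coefficients are rational polynomials in
  \<open>u\<close>. The uniform degree bound makes evaluation at a rational polynomial a finite sum
  of such polynomials.\<close>

definition ratpolypoly :: "(complex \<Rightarrow> complex poly) \<Rightarrow> bool" where
  "ratpolypoly P \<longleftrightarrow> (\<exists>N. \<forall>u. Polynomial.degree (P u) \<le> N) \<and> (\<forall>m. ratpoly (\<lambda>u. poly.coeff (P u) m))"

lemma ratpolypoly_poly:
  assumes "ratpolypoly P" "ratpoly f"
  shows "ratpoly (\<lambda>u. poly (P u) (f u))"
proof -
  obtain N where N: "\<And>u. Polynomial.degree (P u) \<le> N" and c: "\<And>m. ratpoly (\<lambda>u. poly.coeff (P u) m)"
    using assms(1) unfolding ratpolypoly_def by blast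
  have "poly (P u) (f u) = (\<Sum>m\<le>N. poly.coeff (P u) m * f u ^ m)" for u
    unfolding poly_altdef by (rule sum.mono_neutral_left) (use N[of u] in \<open>auto simp: coeff_eq_0\<close>)
  then show ?thesis using c assms(2) by (auto intro!: ratpoly_sum)
qed

lemma ratpolypoly_const: "ratcoeffs p \<Longrightarrow> ratpolypoly (\<lambda>_. p)"
  unfolding ratpolypoly_def ratcoeffs_def by auto

lemma ratpolypolyI:
  "(\<And>u. Polynomial.degree (P u) \<le> N) \<Longrightarrow> (\<And>m. ratpoly (\<lambda>u. poly.coeff (P u) m)) \<Longrightarrow> ratpolypoly P"
  unfolding ratpolypoly_def by blast

lemma ratpolypoly_add:
  assumes "ratpolypoly P" "ratpolypoly Q"
  shows "ratpolypoly (\<lambda>u. P u + Q u)"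
proof -
  obtain M N where "\<And>u. Polynomial.degree (P u) \<le> M" "\<And>u. Polynomial.degree (Q u) \<le> N"
    using assms unfolding ratpolypoly_def by blast
  then have "Polynomial.degree (P u + Q u) \<le> max M N" for u
    by (intro degree_add_le) (auto simp: le_max_iff_disj)
  then show ?thesis using assms by (intro ratpolypolyI) (auto simp: ratpolypoly_def)
qed

lemma ratpolypoly_smult: "ratpoly f \<Longrightarrow> ratpolypoly P \<Longrightarrow> ratpolypoly (\<lambda>u. Polynomial.smult (f u) (P u))"
  unfolding ratpolypoly_def by (auto intro: order_trans[OF degree_smult_le])

lemma ratpolypoly_shift:
  assumes "ratpolypoly P"
  shows "ratpolypoly (\<lambda>u. pCons 0 (P u))"
proof -
  obtain N where "\<And>u. Polynomial.degree (P u) \<le> N" using assms unfolding ratpolypoly_def by blast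
  then have "Polynomial.degree (pCons 0 (P u)) \<le> Suc N" for u
    by (intro order_trans[OF degree_pCons_le]) simp
  moreover have "ratpoly (\<lambda>u. poly.coeff (pCons 0 (P u)) m)" for m
    using assms by (cases m) (auto simp: ratpolypoly_def)
  ultimately show ?thesis by (rule ratpolypolyI)
qed

lemma ratpolypoly_pderiv:
  assumes "ratpolypoly P"
  shows "ratpolypoly (\<lambda>u. pderiv (P u))"
proof -
  obtain N where N: "\<And>u. Polynomial.degree (P u) \<le> N" using assms unfolding ratpolypoly_def by blast
  have "Polynomial.degree (pderiv (P u)) \<le> N" for u
    using N[of u] degree_pderiv[of "P u"] by linarith
  moreover have "ratpoly (\<lambda>u. poly.coeff (pderiv (P u)) m)" for m
    unfolding coeff_pderiv
    by (intro ratpoly_mult ratpoly_const Rats_of_nat) (use assms in \<open>auto simp: ratpolypoly_def\<close>)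
  ultimately show ?thesis by (intro ratpolypolyI) auto
qed

lemma ratpolypoly_pCons_mult:
  assumes "ratpoly c" "ratpolypoly (\<lambda>u. q u * P u)" "ratpolypoly P"
  shows "ratpolypoly (\<lambda>u. pCons (c u) (q u) * P u)"
  using assms by (simp add: ratpolypoly_add ratpolypoly_smult ratpolypoly_shift)

lemma ratpolypoly_ode_op:
  assumes "e \<in> \<rat>" "ratpoly \<alpha>" "ratpoly \<gamma>" "ratpolypoly P"
  shows "ratpolypoly (\<lambda>u. ode_op e (\<alpha> u) (\<gamma> u) (P u))"
proof -
  have 0: "ratpolypoly (\<lambda>u. 0 * Q u)" for Q by (simp add: ratpolypoly_const)
  show ?thesis unfolding ode_op_def
    by (intro ratpolypoly_add ratpolypoly_pCons_mult ratpolypoly_pderiv assms 0 ratpoly_mult ratpoly_const)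
       (use assms(1) in auto)
qed

lemma ratpoly_ode_val:
  assumes "e \<in> \<rat>" "ratpoly \<alpha>" "ratpoly \<gamma>" "ratcoeffs p" "ratpoly f"
  shows "ratpoly (\<lambda>u. ode_val e n (\<alpha> u) (\<gamma> u) p (f u))"
proof -
  have "ratpolypoly (\<lambda>u. (ode_op e (\<alpha> u) (\<gamma> u) ^^ n) p)"
    by (induction n) (auto intro: ratpolypoly_const ratpolypoly_ode_op assms)
  then show ?thesis unfolding ode_val_def by (rule ratpolypoly_poly) fact
qed

text \<open>The operator is homogeneous of degree one when \<open>x\<close> and
  \<open>\<alpha>\<close> have degree one and \<open>\<gamma>\<close> degree two; each application
  contributes one power of \<open>t\<close>.\<close>

lemma ode_val_scale:
  assumes "\<And>x. poly p (t * x) = t ^ d * poly p x"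
  shows "ode_val e n (t * \<alpha>) (t\<^sup>2 * \<gamma>) p (t * x) = t ^ (n + d) * ode_val e n \<alpha> \<gamma> p x"
proof -
  have "pcompose ((ode_op e (t * \<alpha>) (t\<^sup>2 * \<gamma>) ^^ n) p) [:0, t:] = Polynomial.smult (t ^ (n + d)) ((ode_op e \<alpha> \<gamma> ^^ n) p)"
  proof (induction n)
    case 0
    show ?case by (rule iffD1[OF poly_eq_poly_eq_iff], rule ext) (simp add: poly_pcompose assms mult.commute[of _ t])
  next
    case (Suc n)
    define P where "P = (ode_op e (t * \<alpha>) (t\<^sup>2 * \<gamma>) ^^ n) p"
    define Q where "Q = (ode_op e \<alpha> \<gamma> ^^ n) p"
    have PQ: "pcompose P [:0, t:] = Polynomial.smult (t ^ (n + d)) Q" using Suc.IH by (simp add: P_def Q_def)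
    have p0: "poly P (t * x) = t ^ (n + d) * poly Q x" for x
      using arg_cong[OF PQ, of "\<lambda>p. poly p x"] by (simp add: poly_pcompose mult.commute)
    have p1: "t * poly (pderiv P) (t * x) = t ^ (n + d) * poly (pderiv Q) x" for x
      using arg_cong[OF PQ, of "\<lambda>p. poly (pderiv p) x"]
      by (simp add: poly_pcompose pderiv_pcompose pderiv_smult pderiv_pCons mult.commute)
    have p2: "t * (t * poly (pderiv (pderiv P)) (t * x)) = t ^ (n + d) * poly (pderiv (pderiv Q)) x" for x
      using arg_cong[OF PQ, of "\<lambda>p. poly (pderiv (pderiv p)) x"]
      by (simp add: poly_pcompose pderiv_pcompose pderiv_smult pderiv_pCons pderiv_mult mult_ac)
    have "poly (ode_op e (t * \<alpha>) (t\<^sup>2 * \<gamma>) P) (t * x) = t * t ^ (n + d) * poly (ode_op e \<alpha> \<gamma> Q) x" for x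
    proof -
      have "poly (ode_op e (t * \<alpha>) (t\<^sup>2 * \<gamma>) P) (t * x) =
          t * (e * (\<alpha> - 2 * x) * poly P (t * x)
          + ((2 + 4 * e) * \<gamma> + (4 + 4 * e) * \<alpha> * x - (6 + 4 * e) * x\<^sup>2) * (t * poly (pderiv P) (t * x))
          + 4 * x * (\<gamma> + \<alpha> * x - x\<^sup>2) * (t * (t * poly (pderiv (pderiv P)) (t * x))))"
        unfolding poly_ode_op by (simp add: algebra_simps power2_eq_square)
      then show ?thesis unfolding p0 p1 p2 poly_ode_op by (simp add: algebra_simps)
    qed
    then show ?case
      by (intro iffD1[OF poly_eq_poly_eq_iff] ext) (simp add: poly_pcompose P_def Q_def mult.commute[of _ t])
  qed
  from arg_cong[OF this, of "\<lambda>p. poly p x"] show ?thesis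
    by (simp add: ode_val_def poly_pcompose mult.commute)
qed

text \<open>Synthetic division by \<open>u - c\<close> keeps the coefficients rational when
  \<open>c\<close> is rational.\<close>

lemma ratpoly_dvd:
  assumes "ratpoly f" "c \<in> \<rat>" "f c = 0"
  obtains g where "ratpoly g" "\<And>u. f u = (u - c) * g u"
proof -
  obtain p where p: "ratcoeffs p" "f = poly p" using assms(1) unfolding ratpoly_def by blast
  have "\<forall>n. poly.coeff (synthetic_div p c) n \<in> \<rat>"
    using p(1)
  proof (induction p)
    case (pCons a p)
    then have "ratcoeffs p" unfolding ratcoeffs_def by (metis coeff_pCons_Suc)
    moreover from this have "poly p c \<in> \<rat>"
      unfolding poly_altdef ratcoeffs_def using assms(2) by (intro Rats_sum Rats_mult Rats_power) auto
    ultimately show ?case using pCons.IH by (auto simp: coeff_pCons split: nat.splits)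
  qed simp
  then have "ratpoly (poly (synthetic_div p c))" unfolding ratpoly_def ratcoeffs_def by blast
  moreover have "f u = (u - c) * poly (synthetic_div p c) u" for u
    using arg_cong[OF synthetic_div_correct'[of c p], of "\<lambda>r. poly r u"] assms(3) p(2)
    by (simp add: algebra_simps)
  ultimately show ?thesis using that by blast
qed

lemma isCont_zero_at:
  fixes F :: "complex \<Rightarrow> complex"
  assumes "isCont F a" "\<forall>\<^sub>F u in at a. F u = 0"
  shows "F a = 0"
proof -
  have "(F \<longlongrightarrow> 0) (at a)" by (rule tendsto_eventually[OF assms(2)])
  moreover have "(F \<longlongrightarrow> F a) (at a)" using assms(1) by (simp add: isCont_def)
  ultimately show ?thesis using tendsto_unique[of "at a" F] by auto
qed

lemma cancel_common_term:
  fixes A :: complex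
  assumes "A * (c * B + X) = C * (c * D + Y)" "A * B = s" "C * D = s"
  shows "A * X = C * Y"
proof -
  have "c * (A * B) + A * X = c * (C * D) + C * Y"
    using assms(1) by (simp add: distrib_left mult.left_commute)
  then show ?thesis unfolding assms(2,3) by simp
qed

text \<open>Invariants of the involution \<open>u \<mapsto> (1 - u) / (1 + u)\<close>: subtracting a multiple of the weight
  \<open>k\<close> power of \<open>(1 + u) / 2\<close> creates zeros at the swapped points \<open>0\<close> and \<open>1\<close>.\<close>

lemma invariant_form:
  assumes "ratpoly \<psi>"
    and "\<And>u. u \<noteq> - 1 \<Longrightarrow> 2 ^ k * \<psi> u = (1 + u) ^ (2 * k) * \<psi> ((1 - u) / (1 + u))"
  shows "\<exists>c. ratcoeffs c \<and> Polynomial.degree c \<le> k \<and>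
    (\<forall>u. u \<noteq> - 1 \<longrightarrow> \<psi> u = ((1 + u) / 2) ^ k * poly c (u * (1 - u) / (2 * (1 + u))))"
  using assms
proof (induction k arbitrary: \<psi>)
  case 0
  obtain p where p: "ratcoeffs p" "\<psi> = poly p" using 0(1) unfolding ratpoly_def by blast
  define d where "d = Polynomial.degree p"
  define r where "r = (\<Sum>i\<le>d. Polynomial.smult (poly.coeff p i) ([:1, -1:] ^ i * [:1, 1:] ^ (d - i)))"
  have r: "(1 + u) ^ d * poly p u = poly r u" if "u \<noteq> - 1" for u
  proof -
    have u: "1 + u \<noteq> 0" using that by (metis add.commute add_eq_0_iff)
    have "poly p u = poly p ((1 - u) / (1 + u))" using 0(2)[OF that] p by simp
    also have "(1 + u) ^ d * \<dots> = (\<Sum>i\<le>d. poly.coeff p i * ((1 - u) ^ i * (1 + u) ^ (d - i)))"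
      unfolding poly_altdef d_def[symmetric] sum_distrib_left
    proof (rule sum.cong)
      fix i assume "i \<in> {..d}"
      then have "(1 + u) ^ d = (1 + u) ^ i * (1 + u) ^ (d - i)" by (simp flip: power_add)
      then show "(1 + u) ^ d * (poly.coeff p i * ((1 - u) / (1 + u)) ^ i) = poly.coeff p i * ((1 - u) ^ i * (1 + u) ^ (d - i))"
        using u by (simp add: power_divide)
    qed simp
    also have "\<dots> = poly r u" by (simp add: r_def poly_sum algebra_simps)
    finally show ?thesis .
  qed
  \<comment> \<open>In \<open>(1 + u) ^ d * p u = r u\<close>, continuity allows
    \<open>u = - 1\<close>: the left side vanishes for \<open>d > 0\<close>, while the right side is
    \<open>2 ^ d\<close> times the leading coefficient. So \<open>p\<close> is constant.\<close>
  have "(1 + (- 1)) ^ d * poly p (- 1) - poly r (- 1) = 0"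
    by (rule isCont_zero_at[where F = "\<lambda>u. (1 + u) ^ d * poly p u - poly r u"])
       (auto intro!: continuous_intros eventually_at_ball[of 1, THEN eventually_mono] simp: r eventually_at_filter)
  moreover have "poly r (- 1) = poly.coeff p d * 2 ^ d"
  proof -
    have "poly r (- 1) = (\<Sum>i\<le>d. poly.coeff p i * (2 ^ i * 0 ^ (d - i)))" by (simp add: r_def poly_sum)
    also have "\<dots> = (\<Sum>i\<in>{d}. poly.coeff p i * (2 ^ i * 0 ^ (d - i)))"
      by (rule sum.mono_neutral_right) auto
    finally show ?thesis by simp
  qed
  ultimately have "d = 0 \<or> poly.coeff p d = 0" by (cases "d = 0") (auto simp: power_0_left)
  then have "d = 0" unfolding d_def using leading_coeff_0_iff[of p] by auto
  then show ?case using p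
    by (intro exI[of _ p]) (auto simp: d_def elim: degree_eq_zeroE)
next
  case (Suc k)
  obtain p where p: "ratcoeffs p" "\<psi> = poly p" using Suc.prems(1) unfolding ratpoly_def by blast
  \<comment> \<open>At \<open>u = 1\<close> the weight factor \<open>(1 + u) / 2\<close> equals
    \<open>1\<close>, so this is the multiple to be subtracted.\<close>
  define c0 where "c0 = \<psi> 1"
  have c0: "c0 \<in> \<rat>" unfolding c0_def p(2) poly_altdef using p(1) by (auto intro!: Rats_sum simp: ratcoeffs_def)
  define \<psi>1 where "\<psi>1 = (\<lambda>u. 4 * (c0 * ((1 + u) / 2) ^ Suc k - \<psi> u))"
  have rp: "ratpoly \<psi>1" unfolding \<psi>1_def
    by (intro ratpoly_mult ratpoly_diff ratpoly_power ratpoly_divide ratpoly_add ratpoly_const ratpoly_id c0 Suc.prems(1)) auto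
  \<comment> \<open>The involution swaps \<open>0\<close> and \<open>1\<close>, so the functional
    equation forces the zero at \<open>0\<close> along with the one at \<open>1\<close>.\<close>
  have z0: "\<psi>1 0 = 0" using Suc.prems(2)[of 0] by (simp add: \<psi>1_def c0_def power_one_over field_simps)
  obtain g where g: "ratpoly g" "\<And>u. \<psi>1 u = (u - 0) * g u" using ratpoly_dvd[OF rp Rats_0 z0] by blast
  have "\<psi>1 1 = 0" by (simp add: \<psi>1_def c0_def)
  then have "g 1 = 0" using g(2)[of 1] by simp
  then obtain \<xi> where \<xi>: "ratpoly \<xi>" "\<And>u. g u = (u - 1) * \<xi> u" using ratpoly_dvd[OF g(1) Rats_1] by blast
  have eq: "\<psi> u = c0 * ((1 + u) / 2) ^ Suc k + u * (1 - u) / 4 * \<xi> u" for u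
    using g(2)[of u] \<xi>(2)[of u] by (simp add: \<psi>1_def field_simps)
  obtain q where q: "\<xi> = poly q" using \<xi>(1) unfolding ratpoly_def by blast
  have inv: "2 ^ k * \<xi> u = (1 + u) ^ (2 * k) * \<xi> ((1 - u) / (1 + u))" if u: "u \<noteq> - 1" for u
  proof -
    define F where "F = (\<lambda>u. 2 ^ k * \<xi> u - (1 + u) ^ (2 * k) * \<xi> ((1 - u) / (1 + u)))"
    \<comment> \<open>The functional equation of \<open>\<xi>\<close> follows by cancelling the
      factor \<open>v * (1 - v)\<close>; the excluded points are recovered by continuity.\<close>
    have gen: "F v = 0" if v: "v \<noteq> - 1" "v \<noteq> 0" "v \<noteq> 1" for v
    proof -
      let ?w = "(1 - v) / (1 + v)"
      define s where "s = 1 + v"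
      have s: "s \<noteq> 0" "v = s - 1" using v by (auto simp: s_def add_eq_0_iff)
      have w1: "1 + ?w = 2 / s" and ww: "?w * (1 - ?w) = 2 * (v * (1 - v)) / s ^ 2"
        using s by (simp_all add: field_simps power2_eq_square s(2))
      have "2 ^ Suc k * (c0 * (s / 2) ^ Suc k + v * (1 - v) / 4 * \<xi> v) =
          s ^ (2 * Suc k) * (c0 * (1 / s) ^ Suc k + (2 * (v * (1 - v)) / s ^ 2) / 4 * \<xi> ?w)"
      proof -
        have ev: "\<psi> v = c0 * (s / 2) ^ Suc k + v * (1 - v) / 4 * \<xi> v" unfolding s_def by (rule eq)
        have w12: "(1 + ?w) / 2 = 1 / s" unfolding w1 by simp
        have ew: "\<psi> ?w = c0 * (1 / s) ^ Suc k + (2 * (v * (1 - v)) / s ^ 2) / 4 * \<xi> ?w"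
          using eq[of ?w] unfolding ww w12 .
        show ?thesis using Suc.prems(2)[OF v(1)] unfolding ev ew by (simp only: s_def)
      qed
      note main = this
      have AB: "2 ^ Suc k * (s / 2) ^ Suc k = s ^ Suc k" by (simp add: power_divide)
      have CD: "s ^ (2 * Suc k) * (1 / s) ^ Suc k = s ^ Suc k"
      proof -
        have "s ^ (2 * Suc k) = s ^ Suc k * s ^ Suc k" by (simp only: mult_2 power_add)
        moreover have "s ^ Suc k * (1 / s) ^ Suc k = 1" using s by (simp flip: power_mult_distrib del: power_Suc)
        ultimately show ?thesis by (simp only: mult.assoc mult_1_right)
      qed
      have S2: "s ^ (2 * Suc k) = s ^ (2 * k) * s ^ 2" by (simp add: power2_eq_square mult_ac)
      have H1: "2 ^ Suc k * (v * (1 - v) / 4 * \<xi> v) = s ^ (2 * k) * s ^ 2 * ((2 * (v * (1 - v)) / s ^ 2) / 4 * \<xi> ?w)"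
        using cancel_common_term[OF main AB CD] unfolding S2 .
      have H2: "2 ^ Suc k * (E / 4 * x) = E * (2 ^ k * x) / 2" for E x :: complex by simp
      have H3: "s ^ (2 * k) * s ^ 2 * ((2 * E / s ^ 2) / 4 * y) = E * (s ^ (2 * k) * y) / 2" for E y :: complex
        using s(1) by (simp add: field_simps)
      have "(v * (1 - v)) * (2 ^ k * \<xi> v) / 2 = (v * (1 - v)) * (s ^ (2 * k) * \<xi> ?w) / 2"
        using H1 unfolding H2 H3 .
      then show ?thesis using v by (simp add: F_def s_def)
    qed
    have "F u = 0"
    proof (rule isCont_zero_at[where F = F and a = u])
      have "1 + u \<noteq> 0" using u by (metis add.commute add_eq_0_iff)
      then show "isCont F u" unfolding F_def q by (auto intro!: continuous_intros)
      show "\<forall>\<^sub>F v in at u. F v = 0"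
      proof -
        have "\<not> u islimpt {- 1, 0, 1}" by (rule islimpt_finite) simp
        then have "\<forall>\<^sub>F v in at u. v \<notin> {- 1, 0, 1}" by (simp add: islimpt_iff_eventually)
        then show ?thesis by eventually_elim (auto intro: gen)
      qed
    qed
    then show ?thesis by (simp add: F_def)
  qed
  obtain c where c: "ratcoeffs c" "Polynomial.degree c \<le> k"
    "\<And>u. u \<noteq> - 1 \<Longrightarrow> \<xi> u = ((1 + u) / 2) ^ k * poly c (u * (1 - u) / (2 * (1 + u)))"
    using Suc.IH[OF \<xi>(1) inv] by blast
  show ?case
  proof (intro exI[of _ "pCons c0 c"] conjI allI impI)
    show "ratcoeffs (pCons c0 c)" using c(1) c0 by (auto intro: ratcoeffs_intros)
    show "Polynomial.degree (pCons c0 c) \<le> Suc k" using c(2) by (intro order_trans[OF degree_pCons_le]) simp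
    fix u :: complex assume u: "u \<noteq> - 1"
    have "1 + u \<noteq> 0" using u by (metis add.commute add_eq_0_iff)
    define y where "y = u * (1 - u) / (2 * (1 + u))"
    define p where "p = (1 + u) / 2"
    \<comment> \<open>The split-off factor is one weight factor times the invariant
      \<open>y\<close>, so the recursion adds one coefficient to \<open>c\<close>.\<close>
    have h: "u * (1 - u) / 4 = p * y"
    proof -
      have "X / 4 = s / 2 * (X / (2 * s))" if "s \<noteq> 0" for X s :: complex using that by simp
      from this[OF \<open>1 + u \<noteq> 0\<close>] show ?thesis unfolding p_def y_def .
    qed
    have "\<psi> u = c0 * p ^ Suc k + p * y * (p ^ k * poly c y)"
      unfolding eq c(3)[OF u] h p_def[symmetric] y_def[symmetric] ..
    then show "\<psi> u = ((1 + u) / 2) ^ Suc k * poly (pCons c0 c) (u * (1 - u) / (2 * (1 + u)))"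
      unfolding y_def[symmetric] p_def[symmetric] by (simp add: algebra_simps)
  qed
qed

text \<open>The substitution \<open>(a, b) \<mapsto> (a + b, a - b)\<close> squares to
  multiplication by \<open>2\<close>, so symmetrizing gives an invariant form, in
  \<open>u = b / a\<close> an invariant of the involution. A factor \<open>(1 + u) ^ e\<close> is
  itself covariant; removing it lowers the weight from \<open>k\<close> to \<open>k - e\<close>, and
  the degree with it.\<close>

lemma form_symmetrization:
  fixes \<Phi> :: "complex \<Rightarrow> complex \<Rightarrow> complex"
  assumes hom: "\<And>t a b. \<Phi> (t * a) (t * b) = t ^ (2 * k) * \<Phi> a b"
    and e: "e \<le> k" and \<xi>: "ratpoly \<xi>"
    and fac: "\<And>u. \<Phi> 1 u + \<Phi> (1 + u) (1 - u) / 2 ^ k = (1 + u) ^ e * \<xi> u"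
  shows "\<exists>c. ratcoeffs c \<and> Polynomial.degree c \<le> k - e \<and> (\<forall>a b. a \<noteq> 0 \<longrightarrow> a + b \<noteq> 0 \<longrightarrow>
    \<Phi> a b + \<Phi> (a + b) (a - b) / 2 ^ k = (a * (a + b) / 2) ^ k * poly c (b * (a - b) / (2 * a * (a + b))))"
proof -
  have inv: "2 ^ (k - e) * \<xi> u = (1 + u) ^ (2 * (k - e)) * \<xi> ((1 - u) / (1 + u))" if u: "u \<noteq> - 1" for u
  proof -
    define s where "s = 1 + u"
    define w where "w = (1 - u) / s"
    have s: "s \<noteq> 0" using u by (auto simp: s_def add_eq_0_iff)
    have w1: "1 + w = 2 / s" "1 - w = 2 * u / s" using s by (simp_all add: w_def s_def field_simps)
    have pw: "s ^ (2 * k) = s ^ (2 * (k - e)) * (s ^ e * s ^ e)" "(2::complex) ^ k = 2 ^ (k - e) * 2 ^ e"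
    proof -
      have "2 * k = 2 * (k - e) + (e + e)" "k = (k - e) + e" using e by auto
      then show "s ^ (2 * k) = s ^ (2 * (k - e)) * (s ^ e * s ^ e)" "(2::complex) ^ k = 2 ^ (k - e) * 2 ^ e"
        by (metis power_add)+
    qed
    have "s ^ (2 * k) * (\<Phi> 1 w + \<Phi> (1 + w) (1 - w) / 2 ^ k) = \<Phi> s (1 - u) + 2 ^ k * \<Phi> 1 u"
    proof -
      have "\<Phi> (s * 1) (s * w) = s ^ (2 * k) * \<Phi> 1 w" by (rule hom)
      then have 1: "s ^ (2 * k) * \<Phi> 1 w = \<Phi> s (1 - u)" using s by (simp add: w_def)
      have "\<Phi> (2 / s * 1) (2 / s * u) = (2 / s) ^ (2 * k) * \<Phi> 1 u" by (rule hom)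
      then have "\<Phi> (1 + w) (1 - w) = (2 / s) ^ (2 * k) * \<Phi> 1 u" by (simp add: w1)
      moreover have "s ^ (2 * k) * (2 / s) ^ (2 * k) = 2 ^ k * 2 ^ k"
        using s by (simp add: power_divide mult_2 power_add)
      ultimately have "s ^ (2 * k) * \<Phi> (1 + w) (1 - w) = 2 ^ k * 2 ^ k * \<Phi> 1 u" by (simp flip: mult.assoc)
      with 1 show ?thesis by (simp add: distrib_left)
    qed
    also have "\<dots> = 2 ^ k * (\<Phi> 1 u + \<Phi> (1 + u) (1 - u) / 2 ^ k)" by (simp add: s_def distrib_left)
    finally have "s ^ (2 * k) * ((1 + w) ^ e * \<xi> w) = 2 ^ k * ((1 + u) ^ e * \<xi> u)"
      by (simp only: fac)
    then have "s ^ (2 * k) * ((2 / s) ^ e * \<xi> w) = 2 ^ k * (s ^ e * \<xi> u)"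
      by (simp only: w1 s_def)
    moreover have "s ^ (2 * k) * ((2 / s) ^ e * \<xi> w) = 2 ^ e * s ^ e * (s ^ (2 * (k - e)) * \<xi> w)"
      using s unfolding pw by (simp add: power_divide field_simps)
    moreover have "2 ^ k * (s ^ e * \<xi> u) = 2 ^ e * s ^ e * (2 ^ (k - e) * \<xi> u)"
      unfolding pw by simp
    ultimately have "2 ^ e * s ^ e * (s ^ (2 * (k - e)) * \<xi> w) = 2 ^ e * s ^ e * (2 ^ (k - e) * \<xi> u)" by simp
    then show ?thesis using s by (simp add: w_def s_def)
  qed
  obtain c where c: "ratcoeffs c" "Polynomial.degree c \<le> k - e"
    "\<And>u. u \<noteq> - 1 \<Longrightarrow> \<xi> u = ((1 + u) / 2) ^ (k - e) * poly c (u * (1 - u) / (2 * (1 + u)))"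
    using invariant_form[OF \<xi> inv] by blast
  show ?thesis
  proof (intro exI[of _ "Polynomial.smult (2 ^ e) c"] conjI allI impI)
    \<comment> \<open>The constant \<open>2 ^ e\<close> turns \<open>(1 + u) ^ e\<close> into the
      missing powers of \<open>(1 + u) / 2\<close>.\<close>
    show "ratcoeffs (Polynomial.smult (2 ^ e) c)" using c(1) by (auto intro: ratcoeffs_intros)
    show "Polynomial.degree (Polynomial.smult (2 ^ e) c) \<le> k - e" using c(2) by simp
    fix a b :: complex assume ab: "a \<noteq> 0" "a + b \<noteq> 0"
    define u where "u = b / a"
    have b: "b = a * u" using ab by (simp add: u_def)
    have "a + b = a * (1 + u)" unfolding b by (simp add: algebra_simps)
    then have u1: "1 + u \<noteq> 0" "u \<noteq> - 1" using ab by auto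
    have "\<Phi> a b = \<Phi> (a * 1) (a * u)" by (simp add: b)
    then have p1: "\<Phi> a b = a ^ (2 * k) * \<Phi> 1 u" by (simp only: hom)
    have "\<Phi> (a + b) (a - b) = \<Phi> (a * (1 + u)) (a * (1 - u))" by (simp add: b algebra_simps)
    then have p2: "\<Phi> (a + b) (a - b) = a ^ (2 * k) * \<Phi> (1 + u) (1 - u)" by (simp only: hom)
    have "\<Phi> a b + \<Phi> (a + b) (a - b) / 2 ^ k = a ^ (2 * k) * (\<Phi> 1 u + \<Phi> (1 + u) (1 - u) / 2 ^ k)"
      unfolding p1 p2 by (simp add: distrib_left)
    also have "\<dots> = a ^ (2 * k) * ((1 + u) ^ e * (((1 + u) / 2) ^ (k - e) * poly c (u * (1 - u) / (2 * (1 + u)))))"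
      unfolding fac c(3)[OF u1(2)] ..
    also have "u * (1 - u) / (2 * (1 + u)) = b * (a - b) / (2 * a * (a + b))"
    proof -
      have "b * (a - b) = a\<^sup>2 * (u * (1 - u))" "2 * a * (a + b) = a\<^sup>2 * (2 * (1 + u))"
        by (simp_all add: b algebra_simps power2_eq_square)
      then show ?thesis using ab by simp
    qed
    also have "a ^ (2 * k) * ((1 + u) ^ e * (((1 + u) / 2) ^ (k - e) * X)) = (a * (a + b) / 2) ^ k * (2 ^ e * X)" for X
    proof -
      have "a * (a + b) / 2 = a\<^sup>2 * ((1 + u) / 2)" by (simp add: b algebra_simps power2_eq_square)
      then have "(a * (a + b) / 2) ^ k = a ^ (2 * k) * ((1 + u) / 2) ^ k"
        by (simp only: power_mult_distrib power_mult)
      also have "((1 + u) / 2) ^ k = ((1 + u) / 2) ^ e * ((1 + u) / 2) ^ (k - e)"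
        using e by (simp flip: power_add)
      finally show ?thesis by (simp add: power_divide)
    qed
    finally show "\<Phi> a b + \<Phi> (a + b) (a - b) / 2 ^ k = (a * (a + b) / 2) ^ k * poly (Polynomial.smult (2 ^ e) c) (b * (a - b) / (2 * a * (a + b)))"
      by simp
  qed
qed

section \<open>Higher derivatives of the secant series\<close>

lemma exp_series_odd_0:
  assumes "odd j" "\<And>n. c (- n) = c n"
  shows "exp_series c j 0 = 0"
  unfolding exp_series_def by (rule infsum_odd_int) (use assms in simp)

lemma convex_strip: "convex {z. \<bar>Re z\<bar> < r}" "open {z. \<bar>Re z\<bar> < r}"
proof -
  have "{z. \<bar>Re z\<bar> < r} = {z. Re z > - r} \<inter> {z. Re z < r}" by auto
  then show "convex {z. \<bar>Re z\<bar> < r}" "open {z. \<bar>Re z\<bar> < r}"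
    by (auto intro!: convex_Int convex_halfspace_Re_gt convex_halfspace_Re_lt open_Int open_halfspace_Re_gt open_halfspace_Re_lt)
qed

lemma convex_strip_Im: "convex {z. \<bar>Im z\<bar> < r}" "open {z. \<bar>Im z\<bar> < r}"
proof -
  have "{z. \<bar>Im z\<bar> < r} = {z. Im z > - r} \<inter> {z. Im z < r}" by auto
  then show "convex {z. \<bar>Im z\<bar> < r}" "open {z. \<bar>Im z\<bar> < r}"
    by (auto intro!: convex_Int convex_halfspace_Im_gt convex_halfspace_Im_lt open_Int open_halfspace_Im_gt open_halfspace_Im_lt)
qed

lemma exp_series_scaled_deriv:
  assumes "exp_decay \<rho> c" "\<bar>Re (a * z)\<bar> < \<rho>"
  shows "((\<lambda>z. a ^ j * exp_series c j (a * z)) has_field_derivative a ^ Suc j * exp_series c (Suc j) (a * z)) (at z)"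
proof -
  have "((\<lambda>z. exp_series c j (a * z)) has_field_derivative exp_series c (Suc j) (a * z) * a) (at z)"
    by (rule DERIV_chain2[where f = "exp_series c j" and g = "\<lambda>z. a * z", OF exp_series_deriv[OF assms]])
       (auto intro!: derivative_eq_intros)
  from DERIV_cmult[OF this, of "a ^ j"] show ?thesis by (simp add: mult_ac)
qed

lemma i2_power: "(2 * \<i>) ^ (2 * n) = (- 4) ^ n"
  by (simp add: power_mult power2_eq_square)

text \<open>Stated for a series \<open>K + exp_series d\<close> that is either the secant series or
  its square, so that one proof serves both; the constant \<open>K\<close> survives only in order
  zero.\<close>

lemma sech_series_even_derivatives:
  assumes z: "\<bar>Re z\<bar> < Re l" and e: "e \<le> 1"
    and h: "\<And>z. \<bar>Re z\<bar> < Re l \<Longrightarrow> \<exists>\<rho>>\<bar>Re z\<bar>. exp_decay \<rho> d"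
    and h0: "\<And>z. \<bar>Re z\<bar> < Re l \<Longrightarrow> K + exp_series d 0 z = exp_series (hsec l) 0 z ^ e * poly p (exp_series (hsec l) 0 z ^ 2)"
  defines "D \<equiv> exp_series (hsec l) 0 z"
  shows "(if n = 0 then K else 0) + (- 4) ^ n * exp_series d (2 * n) z
    = D ^ e * ode_val (of_nat e) n (sechA l ^ 2 + sechB l ^ 2) (- (sechA l ^ 2 * sechB l ^ 2)) p (D ^ 2)"
proof -
  have l: "Re l > 0" using z by linarith
  define \<alpha> where "\<alpha> = sechA l ^ 2 + sechB l ^ 2"
  define S where "S = {z. \<bar>Im z\<bar> < Re l / 2}"
  have S: "open S" "convex S" unfolding S_def by (rule convex_strip_Im)+
  have ReS: "\<bar>Re (2 * \<i> * w)\<bar> < Re l" if "w \<in> S" for w using that by (simp add: S_def)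
  \<comment> \<open>The substitution \<open>z = 2 * \<i> * w\<close> normalises the cubic equation
    to \<open>f'' = \<alpha> * f - 2 * f\<^sup>3\<close> and turns the vertical strip into a
    horizontal one.\<close>
  define f where "f = (\<lambda>j w. (2 * \<i>) ^ j * exp_series (hsec l) j (2 * \<i> * w))"
  define g where "g = (\<lambda>j w. (if j = 0 then K else 0) + (2 * \<i>) ^ j * exp_series d j (2 * \<i> * w))"
  have df: "(f j has_field_derivative f (Suc j) w) (at w)" if "w \<in> S" for j w
    unfolding f_def by (rule exp_series_scaled_deriv[OF exp_decay_hsec[OF l] ReS[OF that]])
  have dg: "(g j has_field_derivative g (Suc j) w) (at w)" if w: "w \<in> S" for j w
  proof -
    obtain \<rho> where r: "\<rho> > \<bar>Re (2 * \<i> * w)\<bar>" "exp_decay \<rho> d" using h[OF ReS[OF w]] by blast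
    have "((\<lambda>w. (if j = 0 then K else 0) + (2 * \<i>) ^ j * exp_series d j (2 * \<i> * w)) has_field_derivative 0 + (2 * \<i>) ^ Suc j * exp_series d (Suc j) (2 * \<i> * w)) (at w)"
      by (intro DERIV_add DERIV_const exp_series_scaled_deriv[OF r(2,1)])
    then show ?thesis unfolding g_def by simp
  qed
  have f2: "f 2 w = \<alpha> * f 0 w - 2 * f 0 w ^ 3" if "w \<in> S" for w
  proof -
    have "f 2 w = - 4 * exp_series (hsec l) 2 (2 * \<i> * w)" by (simp add: f_def power2_eq_square)
    also have "\<dots> = 2 * (sechK l + 2 * cschH (2 * l)) * f 0 w - 2 * f 0 w ^ 3"
      using sech_series_cube[OF ReS[OF that]] by (simp add: f_def)
    finally show ?thesis unfolding sechA_sechB_squares[OF l] \<alpha>_def .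
  qed
  have S0: "0 \<in> S" using l by (simp add: S_def)
  have f10: "f 1 0 = 0" using exp_series_odd_0[of 1 "hsec l"] by (simp add: f_def)
  have f00: "f 0 0 = sechA l" by (simp add: f_def exp_series_hsec_0)
  \<comment> \<open>At \<open>0\<close> the derivative vanishes and the value is
    \<open>sechA l\<close>, so the constant is \<open>A\<^sup>4 - (A\<^sup>2 + B\<^sup>2) *
    A\<^sup>2 = - A\<^sup>2 * B\<^sup>2\<close>.\<close>
  have f1: "f 1 w ^ 2 = - (sechA l ^ 2 * sechB l ^ 2) + \<alpha> * f 0 w ^ 2 - f 0 w ^ 4" if "w \<in> S" for w
    using ode_first_integral[OF S df f2 S0 f10 that] unfolding f00
    by (simp add: \<alpha>_def power2_eq_square power4_eq_xxxx algebra_simps)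
  have g0: "g 0 w = f 0 w ^ e * poly p (f 0 w ^ 2)" if "w \<in> S" for w
    using h0[OF ReS[OF that]] by (simp add: g_def f_def)
  define z' where "z' = z / (2 * \<i>)"
  have z': "2 * \<i> * z' = z" by (simp add: z'_def)
  have z'S: "z' \<in> S"
  proof -
    have "Im z' = - Re z / 2" using arg_cong[OF z', of Re] by simp
    then show ?thesis using z by (simp add: S_def)
  qed
  have "g (2 * n) z' = f 0 z' ^ e * ode_val (of_nat e) n \<alpha> (- (sechA l ^ 2 * sechB l ^ 2)) p (f 0 z' ^ 2)"
    by (rule ode_even_derivatives[OF S(1) e df dg f2 f1 g0 z'S])
  then show ?thesis by (simp only: g_def f_def z' i2_power D_def \<alpha>_def) simp
qed

lemma sech_series_derivatives:
  assumes z: "\<bar>Re z\<bar> < Re l"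
  defines "D \<equiv> exp_series (hsec l) 0 z"
  shows "(- 4) ^ n * exp_series (hsec l) (2 * n) z
    = D * ode_val 1 n (sechA l ^ 2 + sechB l ^ 2) (- (sechA l ^ 2 * sechB l ^ 2)) 1 (D ^ 2)"
proof -
  have l: "Re l > 0" using z by linarith
  have "\<exists>\<rho>>\<bar>Re z\<bar>. exp_decay \<rho> (hsec l)" if "\<bar>Re z\<bar> < Re l" for z
    using exp_decay_hsec[OF l] that by blast
  from sech_series_even_derivatives[of z l 1 "hsec l" 0 1 n, OF z _ this]
  show ?thesis by (simp add: D_def)
qed

lemma sech_series_square_derivatives:
  assumes l: "Re l > 0" and n: "n \<ge> 1"
  shows "(- 4) ^ n * exp_series (hcsc l) (2 * n) 0
    = ode_val 0 n (sechA l ^ 2 + sechB l ^ 2) (- (sechA l ^ 2 * sechB l ^ 2)) [:0, 1:] (sechA l ^ 2)"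
proof -
  have "\<exists>\<rho>>\<bar>Re z\<bar>. exp_decay \<rho> (hcsc l)" if "\<bar>Re z\<bar> < Re l" for z
    using dense[OF that] exp_decay_hcsc[OF l] by blast
  from sech_series_even_derivatives[of 0 l 0 "hcsc l" "sechK l" "[:0, 1:]" n, OF _ _ this]
  show ?thesis using sech_series_square[of _ l] l n by (simp add: exp_series_hsec_0)
qed

section \<open>Derivatives of sech and of the dual series\<close>

definition sechder :: "nat \<Rightarrow> complex \<Rightarrow> complex" where
  "sechder j = (deriv ^^ j) (\<lambda>z. 1 / cosh z)"

definition sech2der :: "nat \<Rightarrow> complex \<Rightarrow> complex" where
  "sech2der j = (deriv ^^ j) (\<lambda>z. (1 / cosh z)\<^sup>2)"

lemma open_cosh_nonzero: "open {z::complex. cosh z \<noteq> 0}"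
proof -
  have "open (cosh -` (- {0::complex}))"
    by (intro open_vimage) (auto intro!: continuous_intros)
  then show ?thesis by (simp add: vimage_def Compl_eq)
qed

lemma holomorphic_sech: "(\<lambda>z. 1 / cosh z) holomorphic_on {z. cosh z \<noteq> 0}"
proof -
  have "cosh holomorphic_on (UNIV :: complex set)"
    unfolding holomorphic_on_def field_differentiable_def
    by (auto intro!: derivative_eq_intros exI)
  then show ?thesis by (intro holomorphic_on_divide) (auto intro: holomorphic_on_subset)
qed

lemma sechder_deriv:
  assumes "cosh z \<noteq> 0"
  shows "(sechder j has_field_derivative sechder (Suc j) z) (at z)"
    and "(sech2der j has_field_derivative sech2der (Suc j) z) (at z)"
proof -
  have "(\<lambda>z. (1 / cosh z)\<^sup>2) holomorphic_on {z. cosh z \<noteq> 0}"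
    by (intro holomorphic_on_power holomorphic_sech)
  then have "(deriv ^^ j) (\<lambda>z. 1 / cosh z) holomorphic_on {z. cosh z \<noteq> 0}"
    "(deriv ^^ j) (\<lambda>z. (1 / cosh z)\<^sup>2) holomorphic_on {z. cosh z \<noteq> 0}"
    by (intro holomorphic_higher_deriv holomorphic_sech open_cosh_nonzero; assumption)+
  then show "(sechder j has_field_derivative sechder (Suc j) z) (at z)"
    "(sech2der j has_field_derivative sech2der (Suc j) z) (at z)"
    using holomorphic_derivI[OF _ open_cosh_nonzero, of _ z] assms by (auto simp: sechder_def sech2der_def)
qed

text \<open>The single secant solves the degenerate case of the same equation; this is what makes
  the second derivative of \<open>bisech\<close> computable term by term.\<close>

lemma sechder_2:
  assumes "cosh z \<noteq> 0"
  shows "sechder 2 z = sechder 0 z - 2 * sechder 0 z ^ 3"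
proof -
  have s1: "sechder 1 w = - sinh w / cosh w ^ 2" if "cosh w \<noteq> 0" for w
  proof -
    have "(sechder 0 has_field_derivative - sinh w / cosh w ^ 2) (at w)"
      unfolding sechder_def using that by (auto intro!: derivative_eq_intros simp: power2_eq_square)
    then show ?thesis using sechder_deriv(1)[OF that, of 0] DERIV_unique by fastforce
  qed
  have "((\<lambda>w. - sinh w / cosh w ^ 2) has_field_derivative (2 * sinh z ^ 2 - cosh z ^ 2) / cosh z ^ 3) (at z)"
    using assms by (auto intro!: derivative_eq_intros simp: field_simps power2_eq_square power3_eq_cube)
  then have "(sechder 1 has_field_derivative (2 * sinh z ^ 2 - cosh z ^ 2) / cosh z ^ 3) (at z)"
    by (rule has_field_derivative_transform_within_open[OF _ open_cosh_nonzero]) (use assms s1 in auto)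
  then have "sechder 2 z = (2 * sinh z ^ 2 - cosh z ^ 2) / cosh z ^ 3"
    using sechder_deriv(1)[OF assms, of 1] DERIV_unique by (metis numeral_2_eq_2 One_nat_def)
  also have "2 * sinh z ^ 2 - cosh z ^ 2 = cosh z ^ 2 - 2" by (simp add: sinh_square_eq)
  also have "(cosh z ^ 2 - 2) / cosh z ^ 3 = sechder 0 z - 2 * sechder 0 z ^ 3"
    using assms by (simp add: sechder_def field_simps power2_eq_square power3_eq_cube)
  finally show ?thesis .
qed

definition sech_coeff :: "nat \<Rightarrow> complex" where "sech_coeff j = 2 * of_int (chi4 j)"

lemma chi4_parity: "chi4 (2 * i) = 0" "chi4 (2 * i + 1) = (-1) ^ i"
proof -
  show "chi4 (2 * i) = 0" unfolding chi4_def by presburger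
  show "chi4 (2 * i + 1) = (-1) ^ i"
  proof (cases "even i")
    case True then obtain k where "i = 2 * k" by blast
    then have "(2 * i + 1) mod 4 = 1" by presburger
    then show ?thesis using True by (simp add: chi4_def)
  next
    case od: False then obtain k where "i = 2 * k + 1" by (elim oddE)
    then have "(2 * i + 1) mod 4 = 3" by presburger
    then show ?thesis using od by (simp add: chi4_def)
  qed
qed

lemma Re_pos_cosh_nz: "Re x > 0 \<Longrightarrow> cosh (x::complex) \<noteq> 0"
  using cosh_int_nz[of x 1] by simp

lemma exp_neg_nat: "exp (- (of_nat m * x)) = exp (- x) ^ m" for x :: complex
  using exp_of_nat_mult[of m "- x"] by simp

lemma has_sum_sech:
  assumes x: "Re x > 0"
  shows "((\<lambda>j. sech_coeff j * exp (- (of_nat j * x))) has_sum 1 / cosh x) UNIV"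
proof -
  define y where "y = exp (- x)"
  have y: "norm y < 1" using x by (simp add: y_def)
  then have y2: "norm (- (y\<^sup>2)) < 1" by (simp add: norm_power power_less_one_iff)
  have "(\<lambda>i. (- (y\<^sup>2)) ^ i) sums (1 / (1 - - (y\<^sup>2)))" by (rule geometric_sums[OF y2])
  then have "((\<lambda>i. (- (y\<^sup>2)) ^ i) has_sum 1 / (1 - - (y\<^sup>2))) UNIV"
    using y2 by (intro norm_summable_imp_has_sum) (simp_all add: norm_power summable_geometric)
  from has_sum_cmult_right[OF this, of "2 * y"]
  have "((\<lambda>i. 2 * y * (- (y\<^sup>2)) ^ i) has_sum 2 * y / (1 + y\<^sup>2)) UNIV" by simp
  then have "((\<lambda>j. sech_coeff j * exp (- (of_nat j * x))) has_sum 2 * y / (1 + y\<^sup>2)) {j. odd j}"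
  proof (rule iffD1[OF has_sum_reindex_bij_witness[of UNIV "\<lambda>j. j div 2" "\<lambda>i. 2 * i + 1" "{j. odd j}"], rotated -1])
    fix i :: nat
    have "exp (- (of_nat (2 * i + 1) * x)) = y ^ (2 * i + 1)"
      unfolding y_def by (rule exp_neg_nat)
    then show "sech_coeff (2 * i + 1) * exp (- (of_nat (2 * i + 1) * x)) = 2 * y * (- (y\<^sup>2)) ^ i"
      unfolding sech_coeff_def chi4_parity power_minus[of "y\<^sup>2"] by (simp add: power_mult)
  qed auto
  moreover have "2 * y / (1 + y\<^sup>2) = 1 / cosh x"
  proof -
    have "exp x * y = 1" by (simp add: y_def exp_add[symmetric])
    then have "cosh x * (2 * y) = 1 + y\<^sup>2"
      by (simp add: cosh_field_def y_def[symmetric] algebra_simps power2_eq_square)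
    then show ?thesis using Re_pos_cosh_nz[OF x] by (metis y_def exp_not_eq_zero mult_eq_0_iff nonzero_divide_mult_cancel_right zero_neq_numeral)
  qed
  ultimately have "((\<lambda>j. sech_coeff j * exp (- (of_nat j * x))) has_sum 1 / cosh x) {j. odd j}" by simp
  then show ?thesis
    by (rule iffD1[OF has_sum_cong_neutral, rotated -1]) (use chi4_parity(1) in \<open>auto simp: sech_coeff_def elim!: evenE\<close>)
qed

lemma norm_sech_coeff: "norm (sech_coeff n * of_nat n ^ p) \<le> 2 * real n ^ p"
proof -
  have "norm (of_int (chi4 n) :: complex) \<le> 1" by (auto simp: chi4_def)
  then show ?thesis by (simp add: sech_coeff_def norm_mult norm_power mult_right_mono)
qed

lemma sech_coeff_0: "sech_coeff 0 = 0"
  by (simp add: sech_coeff_def chi4_def)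

text \<open>The expansion of \<open>sech\<close> may be differentiated termwise: around
  \<open>x\<close> it is an \<open>exp_series\<close> in the displacement \<open>z\<close>.\<close>

lemma has_sum_sechder_2:
  assumes x: "Re x > 0"
  shows "((\<lambda>j. sech_coeff j * of_nat j ^ 2 * exp (- (of_nat j * x))) has_sum sechder 2 x) UNIV"
proof -
  \<comment> \<open>Only nonpositive indices occur, and the value at \<open>x\<close> is absorbed
    into the coefficients, so \<open>Re x\<close> becomes the rate of decay.\<close>
  define c where "c = (\<lambda>n::int. if n \<le> 0 then sech_coeff (nat (- n)) * exp (- (of_nat (nat (- n)) * x)) else 0)"
  have dec: "exp_decay (Re x) c"
    unfolding exp_decay_def
  proof (intro exI[of _ 2] allI)
    fix n
    show "norm (c n) \<le> 2 * exp (- Re x * \<bar>real_of_int n\<bar>)"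
      using norm_sech_coeff[of "nat (- n)" 0] by (auto simp: c_def norm_mult mult.commute intro!: mult_mono)
  qed
  have es: "((\<lambda>i. sech_coeff i * exp (- (of_nat i * x)) * (- of_nat i) ^ j * exp (- (of_nat i * z))) has_sum exp_series c j z) UNIV"
    if "\<bar>Re z\<bar> < Re x" for j z
  proof -
    have "((\<lambda>n. c n * of_int n ^ j * exp (of_int n * z)) has_sum exp_series c j z) UNIV"
      unfolding exp_series_def by (intro has_sum_infsum exp_series_summable[OF dec that])
    then have "((\<lambda>n. c n * of_int n ^ j * exp (of_int n * z)) has_sum exp_series c j z) {..0}"
      by (rule iffD2[OF has_sum_cong_neutral, rotated -1]) (auto simp: c_def)
    then show ?thesis
      by (rule iffD2[OF has_sum_reindex_bij_witness[of UNIV "\<lambda>n. nat (- n)" "\<lambda>i. - int i" "{..0}"], rotated -1])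
         (auto simp: c_def)
  qed
  define S where "S = {z. \<bar>Re z\<bar> < Re x}"
  have S: "open S" "0 \<in> S" using x convex_strip(2) by (auto simp: S_def)
  have e0: "exp_series c 0 z = sechder 0 (x + z)" if "z \<in> S" for z
  proof -
    have "Re (x + z) > 0" using that by (auto simp: S_def)
    from has_sum_sech[OF this] have "((\<lambda>i. sech_coeff i * exp (- (of_nat i * x)) * (- of_nat i) ^ 0 * exp (- (of_nat i * z))) has_sum 1 / cosh (x + z)) UNIV"
      by (simp add: mult.assoc exp_add[symmetric] algebra_simps)
    then show ?thesis using has_sum_unique[OF es[of z 0]] that by (auto simp: S_def sechder_def)
  qed
  have nz: "cosh (x + z) \<noteq> 0" if "z \<in> S" for z
    by (rule Re_pos_cosh_nz) (use that in \<open>auto simp: S_def\<close>)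
  have dd: "((\<lambda>z. sechder j (x + z)) has_field_derivative sechder (Suc j) (x + z)) (at z)" if "z \<in> S" for j z
  proof -
    have "((\<lambda>z. x + z) has_field_derivative 1) (at z)" by (auto intro!: derivative_eq_intros)
    from DERIV_chain2[where f = "sechder j" and g = "\<lambda>z. x + z", OF sechder_deriv(1)[OF nz[OF that]] this]
    show ?thesis by simp
  qed
  have e1: "exp_series c j z = sechder j (x + z)" if "z \<in> S" for j z
    using that
  proof (induction j arbitrary: z)
    case (Suc j)
    have "(exp_series c j has_field_derivative exp_series c (Suc j) z) (at z)"
      by (rule exp_series_deriv[OF dec]) (use Suc.prems in \<open>simp add: S_def\<close>)
    moreover have "(exp_series c j has_field_derivative sechder (Suc j) (x + z)) (at z)"
      by (rule has_field_derivative_transform_within_open[OF dd S(1) Suc.prems]) (use Suc in auto)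
    ultimately show ?case by (rule DERIV_unique)
  qed (rule e0)
  show ?thesis using es[of 0 2] e1[OF S(2), of 2] x by (simp add: mult_ac)
qed

text \<open>The square of \<open>sech x\<close> is the derivative of a geometric series in
  \<open>- exp (- 2 * x)\<close>, hence only even exponents.\<close>

definition sech2_coeff :: "nat \<Rightarrow> complex" where
  "sech2_coeff j = (if even j then 2 * (-1) ^ (j div 2 + 1) * of_nat j else 0)"

lemma has_sum_sech2:
  assumes x: "Re x > 0"
  shows "((\<lambda>j. sech2_coeff j * exp (- (of_nat j * x))) has_sum (1 / cosh x)\<^sup>2) UNIV"
proof -
  define y where "y = exp (- x)"
  have y: "norm y < 1" using x by (simp add: y_def)
  define v where "v = - (y\<^sup>2)"
  have v: "norm v < 1" using y by (simp add: v_def norm_power power_less_one_iff)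
  have "(\<lambda>n. of_nat (Suc n) * v ^ n) sums (1 / (1 - v)\<^sup>2)" by (rule geometric_deriv_sums[OF v])
  moreover have "summable (\<lambda>n. norm (of_nat (Suc n) * v ^ n))"
  proof -
    have "summable (\<lambda>n. of_nat (Suc n) * norm v ^ n)"
      using geometric_deriv_sums[of "norm v"] v by (auto simp: sums_iff)
    then show ?thesis by (simp add: norm_mult norm_power del: of_nat_Suc)
  qed
  ultimately have "((\<lambda>n. of_nat (Suc n) * v ^ n) has_sum 1 / (1 - v)\<^sup>2) UNIV"
    by (intro norm_summable_imp_has_sum)
  from has_sum_cmult_right[OF this, of "4 * y\<^sup>2"]
  have "((\<lambda>n. 4 * y\<^sup>2 * (of_nat (Suc n) * v ^ n)) has_sum 4 * y\<^sup>2 / (1 - v)\<^sup>2) UNIV" by simp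
  then have "((\<lambda>j. sech2_coeff j * exp (- (of_nat j * x))) has_sum 4 * y\<^sup>2 / (1 - v)\<^sup>2) {j. even j \<and> j > 0}"
  proof (rule iffD1[OF has_sum_reindex_bij_witness[of UNIV "\<lambda>j. j div 2 - 1" "\<lambda>i. 2 * Suc i" "{j. even j \<and> j > 0}"], rotated -1])
    fix i :: nat
    have "exp (- (of_nat (2 * Suc i) * x)) = y ^ (2 * Suc i)"
      unfolding y_def by (rule exp_neg_nat)
    moreover have "v ^ i = (-1) ^ i * y ^ (2 * i)" unfolding v_def power_minus[of "y\<^sup>2"] by (simp add: power_mult)
    moreover have "y ^ (2 * Suc i) = y\<^sup>2 * y ^ (2 * i)" by (simp add: power2_eq_square)
    moreover have "sech2_coeff (2 * Suc i) = 4 * (-1) ^ i * of_nat (Suc i)" by (simp add: sech2_coeff_def)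
    ultimately show "sech2_coeff (2 * Suc i) * exp (- (of_nat (2 * Suc i) * x)) = 4 * y\<^sup>2 * (of_nat (Suc i) * v ^ i)"
      by (simp only: mult_ac)
  qed (auto simp: elim!: evenE)
  moreover have "4 * y\<^sup>2 / (1 - v)\<^sup>2 = (1 / cosh x)\<^sup>2"
  proof -
    have "exp x * y = 1" by (simp add: y_def exp_add[symmetric])
    then have c: "cosh x * (2 * y) = 1 - v"
      by (simp add: cosh_field_def y_def[symmetric] v_def algebra_simps power2_eq_square)
    have "y \<noteq> 0" by (simp add: y_def)
    then have "2 * y / (1 - v) = 1 / cosh x" unfolding c[symmetric] using Re_pos_cosh_nz[OF x] by (simp add: field_simps)
    then have "(2 * y / (1 - v))\<^sup>2 = (1 / cosh x)\<^sup>2" by simp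
    then show ?thesis by (simp add: power_divide power_mult_distrib)
  qed
  ultimately have "((\<lambda>j. sech2_coeff j * exp (- (of_nat j * x))) has_sum (1 / cosh x)\<^sup>2) {j. even j \<and> j > 0}" by simp
  then show ?thesis
    by (rule iffD1[OF has_sum_cong_neutral, rotated -1]) (auto simp: sech2_coeff_def)
qed

lemma geo_coeff_even: "geo_coeff a w (- n) = geo_coeff a w n"
  by (simp add: geo_coeff_def)

lemma exp_series_geo_coeff_power:
  "exp_series (geo_coeff (\<lambda>j. a j * of_nat j ^ 2) w) 0 z = exp_series (geo_coeff a w) 2 z"
  unfolding exp_series_def
proof (rule infsum_cong)
  fix n :: int
  have "(of_nat (nat \<bar>n\<bar>) :: complex) ^ 2 = of_int n ^ 2"
  proof -
    have "(of_nat (nat \<bar>n\<bar>) :: complex) = of_int \<bar>n\<bar>" by (rule of_nat_nat) simp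
    then have "(of_nat (nat \<bar>n\<bar>) :: complex) ^ 2 = of_int (\<bar>n\<bar> ^ 2)" by (simp only: of_int_power)
    then show ?thesis unfolding power2_abs by (simp only: of_int_power)
  qed
  then show "geo_coeff (\<lambda>j. a j * of_nat j ^ 2) w n * of_int n ^ 0 * exp (of_int n * z) = geo_coeff a w n * of_int n ^ 2 * exp (of_int n * z)"
    by (simp add: geo_coeff_def mult_ac)
qed

lemma norm_sech_coeff': "norm (sech_coeff n) \<le> 2 * real n ^ 1"
  using norm_sech_coeff[of n 0] sech_coeff_0 by (cases "n = 0") auto

lemma norm_sech2_coeff: "norm (sech2_coeff n) \<le> 2 * real n ^ 1"
  by (simp add: sech2_coeff_def norm_mult norm_power)

lemma sech2_coeff_0: "sech2_coeff 0 = 0"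
  by (simp add: sech2_coeff_def)

lemma exp_decay_geo_sech:
  assumes "\<rho> < Re w" "Re w > 0"
  shows "exp_decay \<rho> (geo_coeff sech_coeff w)" "exp_decay \<rho> (geo_coeff sech2_coeff w)"
  using exp_decay_geo_coeff[OF assms(2) sech_coeff_0 norm_sech_coeff' assms(1)]
    exp_decay_geo_coeff[OF assms(2) sech2_coeff_0 norm_sech2_coeff assms(1)] by simp_all

text \<open>The derivative of order \<open>j\<close> of \<open>bisech\<close>, with the middle term
  in closed form and all other terms collected in an exponential series. Evaluated at
  \<open>0\<close>, the latter is a Lambert series and the former a Bernoulli-type constant.\<close>

definition bisech_chain :: "complex \<Rightarrow> nat \<Rightarrow> complex \<Rightarrow> complex" where
  "bisech_chain w j z = sechder j z + exp_series (geo_coeff sech_coeff w) j z"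

lemma bisech_chain_0: "\<bar>Re z\<bar> < Re w \<Longrightarrow> bisech_chain w 0 z = bisech w z"
  using bilateral_expansion[of z w sech_coeff 2 1 "\<lambda>x. 1 / cosh x", OF _ sech_coeff_0 norm_sech_coeff' has_sum_sech]
  by (simp add: bisech_chain_def bisech_def sechder_def has_sum_iff)

lemma bisech_chain_deriv:
  assumes "\<bar>Re z\<bar> < Re w" "cosh z \<noteq> 0"
  shows "(bisech_chain w j has_field_derivative bisech_chain w (Suc j) z) (at z)"
proof -
  obtain \<rho> where "\<bar>Re z\<bar> < \<rho>" "\<rho> < Re w" using dense assms(1) by blast
  moreover from this have "Re w > 0" by linarith
  ultimately show ?thesis unfolding bisech_chain_def
    by (intro DERIV_add sechder_deriv(1) assms(2) exp_series_deriv exp_decay_geo_sech(1))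
qed

definition bisech_alpha :: "complex \<Rightarrow> complex" where
  "bisech_alpha w = sechA w ^ 2 + (sechA (w / 2) - sechA w) ^ 2"

text \<open>Termwise, \<open>sech'' = sech - 2 * sech\<^sup>3\<close>; the sum of the cubes is
  eliminated by \<open>bisech_cube\<close>.\<close>

lemma bisech_chain_2:
  assumes z: "\<bar>Re z\<bar> < Re w" and z0: "cosh z \<noteq> 0"
  shows "bisech_chain w 2 z = bisech_alpha w * bisech_chain w 0 z - 2 * bisech_chain w 0 z ^ 3"
proof -
  have w: "Re w > 0" using z by linarith
  define T where "T = (\<lambda>m. 1 / cosh (z + of_int m * w))"
  define \<phi> where "\<phi> = (\<lambda>x::complex. 1 / cosh x - 2 * (1 / cosh x) ^ 3)"
  have "((\<lambda>j. sech_coeff j * of_nat j ^ 2 * exp (- (of_nat j * x))) has_sum \<phi> x) UNIV" if "Re x > 0" for x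
    using has_sum_sechder_2[OF that] sechder_2[OF Re_pos_cosh_nz[OF that]] by (simp add: \<phi>_def sechder_def)
  from bilateral_expansion[of z w "\<lambda>j. sech_coeff j * of_nat j ^ 2" 2 2 \<phi>, OF z _ norm_sech_coeff this]
  have "((\<lambda>m. \<phi> (z + of_int m * w)) has_sum \<phi> z + exp_series (geo_coeff sech_coeff w) 2 z) UNIV"
    by (simp add: sech_coeff_0 \<phi>_def exp_series_geo_coeff_power)
  moreover have "\<phi> z = sechder 2 z" using sechder_2[OF z0] by (simp add: \<phi>_def sechder_def)
  ultimately have 1: "((\<lambda>m. T m - 2 * T m ^ 3) has_sum bisech_chain w 2 z) UNIV"
    by (simp add: bisech_chain_def \<phi>_def T_def)
  have dT: "exp_decay (Re w) T" unfolding T_def by (rule exp_decay_strip(1)[OF z])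
  have dT3: "exp_decay (Re w) (\<lambda>m. T m ^ 3)"
    using exp_decay_mult[OF exp_decay_mult[OF dT dT] dT] w by (simp add: power3_eq_cube)
  have "((\<lambda>m. T m + - 2 * T m ^ 3) has_sum infsum T UNIV + - 2 * infsum (\<lambda>m. T m ^ 3) UNIV) UNIV"
    by (intro has_sum_add has_sum_cmult_right has_sum_infsum exp_decay_summable[OF dT w] exp_decay_summable[OF dT3 w])
  then have "bisech_chain w 2 z = infsum T UNIV - 2 * infsum (\<lambda>m. T m ^ 3) UNIV"
    using has_sum_unique[OF 1] by simp
  also have "\<dots> = (1 + 2 * (cschH w + (sechK (w / 2) - 1) / 2)) * bisech w z - 2 * bisech w z ^ 3"
    unfolding bisech_cube[OF z z0] by (simp add: T_def bisech_def algebra_simps)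
  also have "1 + 2 * (cschH w + (sechK (w / 2) - 1) / 2) = bisech_alpha w"
    using bisech_alpha_sechA[of "w / 2"] w by (simp add: bisech_alpha_def)
  finally show ?thesis by (simp add: bisech_chain_0[OF z])
qed

lemma cosh_nz_Im: "\<bar>Im z\<bar> < pi / 2 \<Longrightarrow> cosh z \<noteq> 0"
proof -
  assume "\<bar>Im z\<bar> < pi / 2"
  then have "cos (Im z) > 0" by (intro cos_gt_zero_pi) auto
  moreover have "Re (cosh z) = cosh (Re z) * cos (Im z)"
    by (simp add: cosh_field_def Re_exp algebra_simps add_divide_distrib)
  ultimately have "Re (cosh z) > 0" by simp
  then show ?thesis by auto
qed

lemma sechder_odd_0:
  assumes "odd j" shows "sechder j 0 = 0"
proof -
  define S where "S = {z. \<bar>Im z\<bar> < pi / 2}"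
  have S: "open S" "0 \<in> S" unfolding S_def by (rule convex_strip_Im(2)) simp
  have "sechder j (- z) = (- 1) ^ j * sechder j z" if "z \<in> S" for z
    using that
  proof (induction j arbitrary: z)
    case 0 then show ?case by (simp add: sechder_def)
  next
    case (Suc j)
    have nz: "cosh z \<noteq> 0" "cosh (- z) \<noteq> 0" using cosh_nz_Im[of z] Suc.prems by (auto simp: S_def)
    have "((\<lambda>z. sechder j (- z)) has_field_derivative sechder (Suc j) (- z) * - 1) (at z)"
      by (rule DERIV_chain2[where f = "sechder j" and g = uminus, OF sechder_deriv(1)[OF nz(2)]])
         (auto intro!: derivative_eq_intros)
    moreover have "((\<lambda>z. sechder j (- z)) has_field_derivative (- 1) ^ j * sechder (Suc j) z) (at z)"
      by (rule has_field_derivative_transform_within_open[OF DERIV_cmult[OF sechder_deriv(1)[OF nz(1)]] S(1) Suc.prems])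
         (simp add: Suc.IH)
    ultimately have e: "sechder (Suc j) (- z) * - 1 = (- 1) ^ j * sechder (Suc j) z" by (rule DERIV_unique)
    have "sechder (Suc j) (- z) = - (sechder (Suc j) (- z) * - 1)" by simp
    also have "\<dots> = (- 1) ^ Suc j * sechder (Suc j) z" unfolding e by simp
    finally show ?case .
  qed
  from this[OF S(2)] show ?thesis using assms by simp
qed

definition bisech_gamma :: "complex \<Rightarrow> complex" where
  "bisech_gamma w = - (sechA w ^ 2 * (sechA (w / 2) - sechA w) ^ 2)"

text \<open>The restriction on \<open>Im z\<close> keeps \<open>z\<close> away from the poles of the
  middle term; the first integral is normalised at \<open>0\<close>, where the chain has the value
  \<open>sechA w\<close> and an odd derivative.\<close>

lemma bisech_derivatives:
  assumes z: "\<bar>Re z\<bar> < Re w" "\<bar>Im z\<bar> < pi / 2"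
  shows "bisech_chain w (2 * n) z = bisech w z * ode_val 1 n (bisech_alpha w) (bisech_gamma w) 1 (bisech w z ^ 2)"
    and "n \<ge> 1 \<Longrightarrow> sech2der (2 * n) z + exp_series (geo_coeff sech2_coeff w) (2 * n) z
      = ode_val 0 n (bisech_alpha w) (bisech_gamma w) [:0, 1:] (bisech w z ^ 2)"
proof -
  have w: "Re w > 0" using z by linarith
  define S where "S = {z. \<bar>Re z\<bar> < Re w} \<inter> {z. \<bar>Im z\<bar> < pi / 2}"
  have S: "open S" "convex S" unfolding S_def by (intro open_Int convex_Int convex_strip convex_strip_Im)+
  have in_S: "\<bar>Re u\<bar> < Re w" "cosh u \<noteq> 0" if "u \<in> S" for u
    using that cosh_nz_Im by (auto simp: S_def)
  have df: "(bisech_chain w j has_field_derivative bisech_chain w (Suc j) u) (at u)" if "u \<in> S" for j u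
    by (rule bisech_chain_deriv[OF in_S[OF that]])
  have f2: "bisech_chain w 2 u = bisech_alpha w * bisech_chain w 0 u - 2 * bisech_chain w 0 u ^ 3" if "u \<in> S" for u
    by (rule bisech_chain_2[OF in_S[OF that]])
  have S0: "0 \<in> S" and zS: "z \<in> S" using w z by (auto simp: S_def)
  have f10: "bisech_chain w 1 0 = 0"
    using sechder_odd_0[of 1] exp_series_odd_0[of 1 "geo_coeff sech_coeff w"] by (simp add: bisech_chain_def geo_coeff_even)
  have f00: "bisech_chain w 0 0 = sechA w" using bisech_chain_0[of 0 w] w by (simp add: bisech_0)
  have f1: "bisech_chain w 1 u ^ 2 = bisech_gamma w + bisech_alpha w * bisech_chain w 0 u ^ 2 - bisech_chain w 0 u ^ 4" if "u \<in> S" for u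
    using ode_first_integral[OF S df f2 S0 f10 that] unfolding f00
    by (simp add: bisech_alpha_def bisech_gamma_def power2_eq_square power4_eq_xxxx algebra_simps)
  have "bisech_chain w (2 * n) z = bisech_chain w 0 z ^ 1 * ode_val (of_nat 1) n (bisech_alpha w) (bisech_gamma w) 1 (bisech_chain w 0 z ^ 2)"
    by (rule ode_even_derivatives[where S = S and f = "bisech_chain w" and h = "bisech_chain w", OF S(1) _ df df f2 f1 _ zS]) auto
  then show "bisech_chain w (2 * n) z = bisech w z * ode_val 1 n (bisech_alpha w) (bisech_gamma w) 1 (bisech w z ^ 2)"
    using bisech_chain_0[OF z(1)] by simp
  \<comment> \<open>The squared series exceeds the sum of squared secants by the constant
    \<open>cschH w\<close>, which disappears under differentiation; hence \<open>n \<ge> 1\<close>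
    in the second claim.\<close>
  define g where "g = (\<lambda>j u. sech2der j u + (if j = 0 then cschH w else 0) + exp_series (geo_coeff sech2_coeff w) j u)"
  have dg: "(g j has_field_derivative g (Suc j) u) (at u)" if u: "u \<in> S" for j u
  proof -
    obtain \<rho> where r: "\<bar>Re u\<bar> < \<rho>" "\<rho> < Re w" using dense in_S(1)[OF u] by blast
    have "((\<lambda>u. sech2der j u + (if j = 0 then cschH w else 0) + exp_series (geo_coeff sech2_coeff w) j u) has_field_derivative
      (sech2der (Suc j) u + 0 + exp_series (geo_coeff sech2_coeff w) (Suc j) u)) (at u)"
      by (intro DERIV_add DERIV_const sechder_deriv(2) in_S(2)[OF u] exp_series_deriv[OF _ r(1)] exp_decay_geo_sech(2) r(2) w)
    then show ?thesis by (simp add: g_def)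
  qed
  have g0: "g 0 u = bisech_chain w 0 u ^ 0 * poly [:0, 1:] (bisech_chain w 0 u ^ 2)" if u: "u \<in> S" for u
  proof -
    have "infsum (\<lambda>m. (1 / cosh (u + of_int m * w))\<^sup>2) UNIV = (1 / cosh u)\<^sup>2 + exp_series (geo_coeff sech2_coeff w) 0 u"
      using bilateral_expansion[of u w sech2_coeff 2 1 "\<lambda>x. (1 / cosh x)\<^sup>2", OF in_S(1)[OF u] sech2_coeff_0 norm_sech2_coeff has_sum_sech2]
      by (simp add: has_sum_iff)
    then show ?thesis using bisech_square[OF in_S[OF u]] bisech_chain_0[OF in_S(1)[OF u]]
      by (simp add: g_def sech2der_def)
  qed
  have "g (2 * n) z = bisech_chain w 0 z ^ 0 * ode_val (of_nat 0) n (bisech_alpha w) (bisech_gamma w) [:0, 1:] (bisech_chain w 0 z ^ 2)"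
    by (rule ode_even_derivatives[where S = S and f = "bisech_chain w" and h = g, OF S(1) _ df dg f2 f1 g0 zS]) auto
  then show "n \<ge> 1 \<Longrightarrow> sech2der (2 * n) z + exp_series (geo_coeff sech2_coeff w) (2 * n) z
      = ode_val 0 n (bisech_alpha w) (bisech_gamma w) [:0, 1:] (bisech w z ^ 2)"
    using bisech_chain_0[OF z(1)] by (simp add: g_def)
qed

text \<open>Around the half period the series for \<open>2 * l\<close> is the difference of the
  series for \<open>l\<close> and for \<open>2 * l\<close> around \<open>0\<close>. Their middle
  terms cancel, so only Lambert series remain, and the half period is again a point where the first
  derivative vanishes.\<close>

lemma bisech_half_derivatives:
  assumes l: "Re l > 0"
  shows "exp_series (geo_coeff sech_coeff l) (2 * n) 0 - exp_series (geo_coeff sech_coeff (2 * l)) (2 * n) 0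
    = (sechA l - sechA (2 * l)) * ode_val 1 n (bisech_alpha (2 * l)) (bisech_gamma (2 * l)) 1 ((sechA l - sechA (2 * l)) ^ 2)"
proof -
  define S where "S = {z. \<bar>Re z\<bar> < Re l}"
  have S: "open S" "convex S" unfolding S_def by (rule convex_strip)+
  have in_S: "\<bar>Re (u + l)\<bar> < Re (2 * l)" "cosh (u + l) \<noteq> 0" if "u \<in> S" for u
    using that Re_pos_cosh_nz[of "u + l"] by (auto simp: S_def)
  define f where "f = (\<lambda>j u. exp_series (geo_coeff sech_coeff l) j u - exp_series (geo_coeff sech_coeff (2 * l)) j u)"
  have df: "(f j has_field_derivative f (Suc j) u) (at u)" if u: "u \<in> S" for j u
  proof -
    obtain \<rho> where r: "\<bar>Re u\<bar> < \<rho>" "\<rho> < Re l" using dense u by (auto simp: S_def)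
    then show ?thesis unfolding f_def using l
      by (intro DERIV_diff exp_series_deriv[OF _ r(1)] exp_decay_geo_sech(1)) auto
  qed
  have f0: "f 0 u = bisech_chain (2 * l) 0 (u + l)" if u: "u \<in> S" for u
  proof -
    have u': "\<bar>Re u\<bar> < Re l" "\<bar>Re u\<bar> < Re (2 * l)" using u l by (auto simp: S_def)
    have "f 0 u = bisech_chain l 0 u - bisech_chain (2 * l) 0 u" by (simp add: f_def bisech_chain_def)
    then show ?thesis
      using bisech_chain_0[OF u'(1)] bisech_chain_0[OF u'(2)] bisech_half[OF u'(1)] bisech_chain_0[OF in_S(1)[OF u]] by simp
  qed
  have dc: "((\<lambda>u. bisech_chain (2 * l) j (u + l)) has_field_derivative bisech_chain (2 * l) (Suc j) (u + l)) (at u)" if "u \<in> S" for j u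
  proof -
    have "((\<lambda>z. z + l) has_field_derivative 1) (at u)" by (auto intro!: derivative_eq_intros)
    from DERIV_chain2[where f = "bisech_chain (2 * l) j" and g = "\<lambda>z. z + l", OF bisech_chain_deriv[OF in_S[OF that]] this]
    show ?thesis by simp
  qed
  have fj: "f j u = bisech_chain (2 * l) j (u + l)" if "u \<in> S" for j u
    using that
  proof (induction j arbitrary: u)
    case (Suc j)
    have "(f j has_field_derivative bisech_chain (2 * l) (Suc j) (u + l)) (at u)"
      by (rule has_field_derivative_transform_within_open[OF dc S(1) Suc.prems]) (use Suc in auto)
    with df[OF Suc.prems] show ?case by (rule DERIV_unique)
  qed (rule f0)
  have f2: "f 2 u = bisech_alpha (2 * l) * f 0 u - 2 * f 0 u ^ 3" if "u \<in> S" for u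
    unfolding fj[OF that] by (rule bisech_chain_2[OF in_S[OF that]])
  have S0: "0 \<in> S" using l by (simp add: S_def)
  have f10: "f 1 0 = 0"
    using exp_series_odd_0[of 1 "geo_coeff sech_coeff _"] by (simp add: f_def geo_coeff_even)
  have f00: "f 0 0 = sechA l - sechA (2 * l)"
    using fj[OF S0, of 0] bisech_chain_0[OF in_S(1)[OF S0]] bisech_half_0[OF l] by simp
  have f1: "f 1 u ^ 2 = bisech_gamma (2 * l) + bisech_alpha (2 * l) * f 0 u ^ 2 - f 0 u ^ 4" if "u \<in> S" for u
    using ode_first_integral[OF S df f2 S0 f10 that] unfolding f00
    by (simp add: bisech_alpha_def bisech_gamma_def power2_eq_square power4_eq_xxxx algebra_simps)
  have "f (2 * n) 0 = f 0 0 ^ 1 * ode_val (of_nat 1) n (bisech_alpha (2 * l)) (bisech_gamma (2 * l)) 1 (f 0 0 ^ 2)"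
    by (rule ode_even_derivatives[where S = S and f = f and h = f, OF S(1) _ df df f2 f1 _ S0]) auto
  then show ?thesis unfolding f00 by (simp add: f_def)
qed

section \<open>Lambert series\<close>

text \<open>The weight \<open>\<alpha>\<close> sits on the divisor and \<open>\<beta>\<close> on the
  codivisor. Powers always go to \<open>\<alpha>\<close>, and a character goes to one of the two
  places.\<close>

definition lambert :: "(nat \<Rightarrow> complex) \<Rightarrow> (nat \<Rightarrow> complex) \<Rightarrow> complex \<Rightarrow> complex" where
  "lambert \<alpha> \<beta> q = infsum (\<lambda>(d, m). \<alpha> d * \<beta> m * q ^ (d * m)) ({1..} \<times> {1..})"

lemma summable_on_power_geo:
  assumes "0 < r" "r < (1::real)"
  shows "(\<lambda>n::nat. real n ^ p * r ^ n) summable_on {1..}"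
proof -
  define \<rho> where "\<rho> = - ln r"
  have \<rho>: "\<rho> > 0" "r = exp (- \<rho>)" using assms by (auto simp: \<rho>_def)
  have "(\<lambda>n::int. \<bar>real_of_int n\<bar> ^ p * exp (- \<rho> * \<bar>real_of_int n\<bar>)) summable_on {1..}"
    by (rule summable_on_subset_banach[OF summable_on_power_exp_int[OF \<rho>(1)]]) simp
  then show ?thesis
    by (rule iffD2[OF summable_on_reindex_bij_witness[of "{1..}" nat int "{1..}"], rotated -1])
       (auto simp: \<rho>(2) exp_of_nat_mult[symmetric] mult.commute)
qed

lemma lambert_summable:
  fixes \<alpha> \<beta> :: "nat \<Rightarrow> complex"
  assumes q: "norm q < 1" and a: "\<And>n. norm (\<alpha> n) \<le> K * real n ^ p" and b: "\<And>n. norm (\<beta> n) \<le> M"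
  shows "(\<lambda>(d, m). \<alpha> d * \<beta> m * q ^ (d * m)) summable_on ({1..} \<times> {1..})"
proof -
  obtain r where r: "norm q < r" "r < 1" using dense q by blast
  have r0: "r > 0" using r by (smt (verit) norm_ge_zero)
  have K0: "K \<ge> 0" using order_trans[OF norm_ge_zero a[of 1]] by simp
  have M0: "M \<ge> 0" using order_trans[OF norm_ge_zero b[of 1]] by simp
  show ?thesis
  proof (rule summable_on_norm_le)
    show "(\<lambda>(d, m). (K * (real d ^ p * r ^ d)) * (M / r * (real m ^ 0 * r ^ m))) summable_on ({1..} \<times> {1..})"
    proof (rule product_summable_real)
      show "(\<lambda>d. K * (real d ^ p * r ^ d)) summable_on {1..}" "(\<lambda>m. M / r * (real m ^ 0 * r ^ m)) summable_on {1..}"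
        by (intro summable_on_cmult_right summable_on_power_geo r0 r(2))+
    qed (use r0 K0 M0 in auto)
    fix x assume "x \<in> {1::nat..} \<times> {1::nat..}"
    then obtain d m where x: "x = (d, m)" "d \<ge> 1" "m \<ge> 1" by auto
    \<comment> \<open>Trades the exponent \<open>d * m\<close> for \<open>d + m - 1\<close> and so
      provides a product majorant.\<close>
    have "d + m \<le> d * m + 1" using x by (cases d; cases m) auto
    then have "r * r ^ (d * m) \<le> r ^ d * r ^ m"
      unfolding power_add[symmetric] power_Suc[symmetric] using r r0 by (intro power_decreasing) auto
    then have "r ^ (d * m) \<le> r ^ d * r ^ m / r" using r0 by (simp add: field_simps)
    then have qq: "norm q ^ (d * m) \<le> r ^ d * r ^ m / r"
      using power_mono[of "norm q" r "d * m"] r by simp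
    have "norm (\<alpha> d * \<beta> m * q ^ (d * m)) \<le> (K * real d ^ p) * M * (r ^ d * r ^ m / r)"
      unfolding norm_mult norm_power by (intro mult_mono a b qq) (use K0 M0 in auto)
    then show "norm (case x of (d, m) \<Rightarrow> \<alpha> d * \<beta> m * q ^ (d * m)) \<le> (case x of (d, m) \<Rightarrow> (K * (real d ^ p * r ^ d)) * (M / r * (real m ^ 0 * r ^ m)))"
      by (simp add: x mult_ac)
  qed
qed

lemma lambert_divisor_sum:
  assumes q: "norm q < 1" and a: "\<And>n. norm (\<alpha> n) \<le> K * real n ^ p" and b: "\<And>n. norm (\<beta> n) \<le> M"
  shows "((\<lambda>n. (\<Sum>d | d dvd n. \<alpha> d * \<beta> (n div d)) * q ^ n) has_sum lambert \<alpha> \<beta> q) {1..}"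
proof -
  let ?G = "\<lambda>(d, m). \<alpha> d * \<beta> m * q ^ (d * m)"
  have 1: "(?G has_sum lambert \<alpha> \<beta> q) ({1..} \<times> {1..})"
    unfolding lambert_def by (rule has_sum_infsum[OF lambert_summable[OF assms]])
  have 2: "((\<lambda>(n, d). \<alpha> d * \<beta> (n div d) * q ^ n) has_sum lambert \<alpha> \<beta> q) (SIGMA n:{1..}. {d. d dvd n})"
    by (rule iffD1[OF has_sum_reindex_bij_witness[of "{1..} \<times> {1..}" "\<lambda>(n, d). (d, n div d)" "\<lambda>(d, m). (d * m, d)"] 1])
       (auto simp: dvd_imp_le elim!: dvdE intro: Suc_leI)
  have "((\<lambda>n. \<Sum>d | d dvd n. \<alpha> d * \<beta> (n div d) * q ^ n) has_sum lambert \<alpha> \<beta> q) {1..}"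
    by (rule has_sum_Sigma'[OF 2]) (auto intro!: has_sum_finiteI)
  then show ?thesis by (simp add: sum_distrib_right)
qed

lemma lambert_suminf:
  assumes q: "norm q < 1" and a: "\<And>n. norm (\<alpha> n) \<le> K * real n ^ p" and b: "\<And>n. norm (\<beta> n) \<le> M"
  shows "(\<lambda>n. (\<Sum>d | d dvd Suc n. \<alpha> d * \<beta> (Suc n div d)) * q ^ Suc n) sums lambert \<alpha> \<beta> q"
proof -
  have "((\<lambda>n. (\<Sum>d | d dvd Suc n. \<alpha> d * \<beta> (Suc n div d)) * q ^ Suc n) has_sum lambert \<alpha> \<beta> q) UNIV"
    by (rule iffD2[OF has_sum_reindex_bij_witness[of UNIV "\<lambda>n. n - 1" Suc "{1..}"] lambert_divisor_sum[OF assms]]) auto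
  then show ?thesis by (rule has_sum_imp_sums)
qed

lemma lambert_iterated:
  assumes q: "norm q < 1" and a: "\<And>n. norm (\<alpha> n) \<le> K * real n ^ p" and b: "\<And>n. norm (\<beta> n) \<le> M"
    and B: "\<And>d. d \<ge> 1 \<Longrightarrow> ((\<lambda>m. \<beta> m * q ^ (d * m)) has_sum B d) {1..}"
  shows "((\<lambda>d. \<alpha> d * B d) has_sum lambert \<alpha> \<beta> q) {1..}"
proof -
  have 1: "((\<lambda>(d, m). \<alpha> d * \<beta> m * q ^ (d * m)) has_sum lambert \<alpha> \<beta> q) ({1..} \<times> {1..})"
    unfolding lambert_def by (rule has_sum_infsum[OF lambert_summable[OF q a b]])
  show ?thesis
    by (rule has_sum_Sigma'[OF 1]) (use has_sum_cmult_right[OF B] in \<open>auto simp: mult.assoc\<close>)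
qed

lemma infsum_int_even:
  assumes f: "f summable_on (UNIV :: int set)" and even: "\<And>n. f (- n) = f n"
    and pos: "((\<lambda>n. f (int n)) has_sum S) {1..}"
  shows "infsum f UNIV = f 0 + 2 * (S :: complex)"
proof -
  have q1: "(f has_sum S) {1..}"
    by (rule iffD1[OF has_sum_reindex_bij_witness[of "{1..}" nat int "{1..}"] pos]) auto
  have q2: "(f has_sum S) {..-1}"
    by (rule iffD1[OF has_sum_reindex_bij_witness[of "{1..}" "\<lambda>n. nat (- n)" "\<lambda>m. - int m" "{..-1}"] pos]) (auto simp: even)
  have q0: "(f has_sum f 0) {0}" by (rule has_sum_finiteI) auto
  have "(f has_sum (S + S) + f 0) (({1..} \<union> {..-1}) \<union> {0})"
    by (intro has_sum_Un_disjoint q1 q2 q0) auto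
  moreover have "({1..} \<union> {..-1}) \<union> {0} = (UNIV :: int set)" by auto
  ultimately show ?thesis by (simp add: has_sum_iff)
qed

section \<open>Secant series as Lambert series\<close>

abbreviation "npow j \<equiv> (\<lambda>n. of_nat n ^ j :: complex)"
abbreviation "one_fun \<equiv> (\<lambda>_. 1 :: complex)"
abbreviation "c4 \<equiv> (\<lambda>n. of_int (chi4 n) :: complex)"
abbreviation "c8 \<equiv> (\<lambda>n. of_int (chi8 n) :: complex)"

lemma npow_bound: "norm (npow j n) \<le> 1 * real n ^ j"
  by (simp add: norm_power)

lemma chi_bound: "norm (c4 n) \<le> 1" "norm (c8 n) \<le> 1"
  by (auto simp: chi4_def chi8_def)

lemma one_bound: "norm (one_fun n) \<le> 1" by simp

lemma cnpow_bound: "norm (c4 n * npow j n) \<le> 1 * real n ^ j" "norm (c8 n * npow j n) \<le> 1 * real n ^ j"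
  using chi_bound[of n] by (auto simp: norm_mult norm_power intro!: mult_right_mono mult_left_le_one_le)

lemma exp_neg_mult: "exp (- (of_nat m * (of_nat d * l))) = exp (- l) ^ (d * m)" for l :: complex
  by (simp add: exp_neg_nat[symmetric] mult_ac)

lemma chi4_inner:
  assumes l: "Re l > 0" and d: "d \<ge> 1"
  shows "((\<lambda>m. c4 m * exp (- l) ^ (d * m)) has_sum hsec l (int d) / 2) {1..}"
proof -
  have "Re (of_nat d * l) > 0" using l d by simp
  from has_sum_cmult_right[OF has_sum_sech[OF this], of "1 / 2"]
  have "((\<lambda>m. c4 m * exp (- l) ^ (d * m)) has_sum hsec l (int d) / 2) UNIV"
    unfolding exp_neg_mult by (simp add: sech_coeff_def hsec_def mult.commute)
  then show ?thesis by (rule iffD2[OF has_sum_cong_neutral, rotated -1]) (auto simp: chi4_def not_less_eq_eq)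
qed

lemma one_inner:
  assumes l: "Re l > 0" and d: "d \<ge> 1"
  shows "((\<lambda>m. one_fun m * exp (- l) ^ (d * m)) has_sum exp (- (of_nat d * l)) / (1 - exp (- (of_nat d * l)))) {1..}"
proof -
  have "Re (of_nat d * l) > 0" using l d by simp
  from has_sum_geometric_exp[OF this] show ?thesis unfolding exp_neg_mult by simp
qed

lemma Re_pos_norm_exp: "Re l > 0 \<Longrightarrow> norm (exp (- l)) < 1" by simp

lemma exp_series_0_summable: "exp_decay \<rho> c \<Longrightarrow> \<rho> > 0 \<Longrightarrow> (\<lambda>n. c n * of_int n ^ j) summable_on UNIV"
  using exp_series_summable[of \<rho> c 0 j] by simp

text \<open>Expanding each coefficient \<open>1 / cosh (d * l)\<close> puts the character on the
  codivisor \<open>m\<close>, as in \<open>E\<^sup>0\<close>.\<close>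

lemma sech_lambert:
  assumes l: "Re l > 0" and j: "even j"
  shows "exp_series (hsec l) j 0 = (if j = 0 then 1 else 0) + 4 * lambert (npow j) c4 (exp (- l))"
proof -
  have "((\<lambda>d. npow j d * (hsec l (int d) / 2)) has_sum lambert (npow j) c4 (exp (- l))) {1..}"
    by (rule lambert_iterated[OF Re_pos_norm_exp[OF l] npow_bound chi_bound(1) chi4_inner[OF l]])
  from has_sum_cmult_right[OF this, of 2]
  have 1: "((\<lambda>d. hsec l (int d) * of_int (int d) ^ j) has_sum 2 * lambert (npow j) c4 (exp (- l))) {1..}"
    by (simp add: mult_ac)
  show ?thesis unfolding exp_series_def
    using infsum_int_even[OF exp_series_0_summable[OF exp_decay_hsec[OF l] l] _ 1] j by (auto simp: mult_ac)
qed

text \<open>Here the character sits on the divisor \<open>d\<close>, so the dual series produces the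
  other kind of Eisenstein series.\<close>

lemma sech_dual_lambert:
  assumes w: "Re w > 0" and j: "even j"
  shows "exp_series (geo_coeff sech_coeff w) j 0 = 4 * lambert (\<lambda>n. c4 n * npow j n) one_fun (exp (- w))"
proof -
  have "((\<lambda>d. (c4 d * npow j d) * (exp (- (of_nat d * w)) / (1 - exp (- (of_nat d * w))))) has_sum lambert (\<lambda>n. c4 n * npow j n) one_fun (exp (- w))) {1..}"
    by (rule lambert_iterated[OF Re_pos_norm_exp[OF w] cnpow_bound(1) one_bound one_inner[OF w]])
  from has_sum_cmult_right[OF this, of 2]
  have 1: "((\<lambda>d. geo_coeff sech_coeff w (int d) * of_int (int d) ^ j) has_sum 2 * lambert (\<lambda>n. c4 n * npow j n) one_fun (exp (- w))) {1..}"
    by (simp add: geo_coeff_def sech_coeff_def mult_ac)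
  have dec: "exp_decay (Re w / 2) (geo_coeff sech_coeff w)" using w by (intro exp_decay_geo_sech) auto
  show ?thesis unfolding exp_series_def
    using infsum_int_even[OF exp_series_0_summable[OF dec] _ 1] j w
    by (auto simp: geo_coeff_even) (simp add: geo_coeff_def sech_coeff_0)
qed

text \<open>With \<open>y = exp (- d * l)\<close>,
  \<open>1 / sinh (d * l) = 2 * y / (1 - y\<^sup>2)\<close> is a difference of geometric sums for
  \<open>q\<close> and \<open>q\<^sup>2\<close>; the factor \<open>n\<close> in \<open>hcsc\<close>
  raises the power to \<open>j + 1\<close>.\<close>

lemma csch_lambert:
  assumes l: "Re l > 0" and j: "even j"
  shows "exp_series (hcsc l) j 0 = 8 * (lambert (npow (j + 1)) one_fun (exp (- l)) - lambert (npow (j + 1)) one_fun (exp (- (2 * l))))"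
proof -
  let ?L = "\<lambda>l. lambert (npow (j + 1)) one_fun (exp (- l))"
  have h: "((\<lambda>d. npow (j + 1) d * (exp (- (of_nat d * u)) / (1 - exp (- (of_nat d * u))))) has_sum ?L u) {1..}"
    if "Re u > 0" for u
    by (rule lambert_iterated[OF Re_pos_norm_exp[OF that] npow_bound one_bound one_inner[OF that]])
  have "Re (2 * l) > 0" using l by simp
  from has_sum_cmult_right[OF has_sum_add[OF h[OF l] has_sum_cmult_right[OF h[OF this], of "- 1"]], of 4]
  have s: "((\<lambda>d. 4 * (npow (j + 1) d * (exp (- (of_nat d * l)) / (1 - exp (- (of_nat d * l)))) +
      - 1 * (npow (j + 1) d * (exp (- (of_nat d * (2 * l))) / (1 - exp (- (of_nat d * (2 * l)))))))) has_sum
      4 * (?L l + - 1 * ?L (2 * l))) {1..}" .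
  have 1: "((\<lambda>d. hcsc l (int d) * of_int (int d) ^ j) has_sum 4 * (?L l + - 1 * ?L (2 * l))) {1..}"
  proof (rule iffD1[OF has_sum_cong s])
    fix d :: nat assume d: "d \<in> {1..}"
    define y where "y = exp (- (of_nat d * l))"
    have y: "norm y < 1" using l d by (simp add: y_def)
    then have y1: "1 - y \<noteq> 0" "1 - y * y \<noteq> 0" "1 + y \<noteq> 0"
    proof -
      have "norm (y * y) < 1" using y mult_strict_mono[of "norm y" 1 "norm y" 1] by (simp add: norm_mult)
      then show "1 - y \<noteq> 0" "1 - y * y \<noteq> 0" "1 + y \<noteq> 0" using y
        by (auto simp: add_eq_0_iff)
    qed
    have y2: "exp (- (of_nat d * (2 * l))) = y * y" by (simp add: y_def exp_add[symmetric] algebra_simps)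
    have "exp (of_nat d * l) * y = 1" by (simp add: y_def exp_add[symmetric])
    then have s: "sinh (of_nat d * l) * (2 * y) = 1 - y * y"
    proof -
      have "sinh (of_nat d * l) * (2 * y) = exp (of_nat d * l) * y - y * y"
        unfolding sinh_field_def y_def[symmetric] by (simp add: left_diff_distrib)
      then show ?thesis using \<open>exp (of_nat d * l) * y = 1\<close> by simp
    qed
    have y0: "y \<noteq> 0" by (simp add: y_def)
    have e: "1 / sinh (of_nat d * l) = 2 * (y / (1 - y) - y * y / (1 - y * y))"
    proof -
      have "1 / sinh (of_nat d * l) = 2 * y / (1 - y * y)"
        using s y1 y0 by (metis divide_divide_eq_right mult_eq_0_iff nonzero_divide_mult_cancel_right zero_neq_numeral mult_1 divide_self_if)
      also have "\<dots> = 2 * (y / (1 - y) - y * y / (1 - y * y))"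
        using y1 by (simp add: divide_simps) (simp add: algebra_simps)
      finally show ?thesis .
    qed
    have "hcsc l (int d) * of_int (int d) ^ j = 2 * npow (j + 1) d * (1 / sinh (of_nat d * l))"
      by (simp add: hcsc_def)
    then show "4 * (npow (j + 1) d * (exp (- (of_nat d * l)) / (1 - exp (- (of_nat d * l)))) +
      - 1 * (npow (j + 1) d * (exp (- (of_nat d * (2 * l))) / (1 - exp (- (of_nat d * (2 * l))))))) =
      hcsc l (int d) * of_int (int d) ^ j"
      unfolding e y2 y_def[symmetric] by (simp add: algebra_simps)
  qed
  have "exp_series (hcsc l) j 0 = 0 + 2 * (4 * (?L l + - 1 * ?L (2 * l)))"
    unfolding exp_series_def
    using infsum_int_even[OF exp_series_0_summable[OF exp_decay_hcsc_half[OF l]] _ 1] j l by simp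
  then show ?thesis by simp
qed

text \<open>The alternating sign amounts to subtracting twice the even indices, and
  \<open>i = 2 * i'\<close> gives the factor \<open>2 ^ j\<close> and doubles
  \<open>w\<close>.\<close>

lemma lambert_even_twist:
  assumes w: "Re w > 0"
  shows "((\<lambda>i. (-1) ^ (i + 1) * npow j i * (exp (- (of_nat i * w)) / (1 - exp (- (of_nat i * w))))) has_sum
    lambert (npow j) one_fun (exp (- w)) - 2 ^ (j + 1) * lambert (npow j) one_fun (exp (- (2 * w)))) {1..}"
proof -
  let ?h = "\<lambda>w i. npow j i * (exp (- (of_nat i * w)) / (1 - exp (- (of_nat i * w))))"
  have h: "(?h u has_sum lambert (npow j) one_fun (exp (- u))) {1..}" if "Re u > 0" for u
    by (rule lambert_iterated[OF Re_pos_norm_exp[OF that] npow_bound one_bound one_inner[OF that]])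
  have w2: "Re (2 * w) > 0" using w by simp
  have "((\<lambda>i. 2 ^ (j + 1) * ?h (2 * w) i) has_sum 2 ^ (j + 1) * lambert (npow j) one_fun (exp (- (2 * w)))) {1..}"
    by (rule has_sum_cmult_right[OF h[OF w2]])
  then have "((\<lambda>i. 2 * ?h w i) has_sum 2 ^ (j + 1) * lambert (npow j) one_fun (exp (- (2 * w)))) {i. even i \<and> i \<ge> 1}"
    by (rule iffD1[OF has_sum_reindex_bij_witness[of "{1..}" "\<lambda>i. i div 2" "\<lambda>i. 2 * i" "{i. even i \<and> i \<ge> 1}"], rotated -1])
       (auto simp: power_mult_distrib mult_ac elim!: evenE)
  then have e: "((\<lambda>i. if even i then 2 * ?h w i else 0) has_sum 2 ^ (j + 1) * lambert (npow j) one_fun (exp (- (2 * w)))) {1..}"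
    by (rule iffD1[OF has_sum_cong_neutral, rotated -1]) auto
  have "((\<lambda>i. ?h w i + - 1 * (if even i then 2 * ?h w i else 0)) has_sum
     lambert (npow j) one_fun (exp (- w)) + - 1 * (2 ^ (j + 1) * lambert (npow j) one_fun (exp (- (2 * w))))) {1..}"
    by (rule has_sum_add[OF h[OF w] has_sum_cmult_right[OF e]])
  moreover have "?h w i + - 1 * (if even i then 2 * ?h w i else 0) = (-1) ^ (i + 1) * npow j i * (exp (- (of_nat i * w)) / (1 - exp (- (of_nat i * w))))" for i
    by (cases "even i") auto
  ultimately show ?thesis by simp
qed

lemma sech2_dual_lambert:
  assumes w: "Re w > 0" and j: "even j"
  shows "exp_series (geo_coeff sech2_coeff w) j 0 =
    2 ^ (j + 3) * (lambert (npow (j + 1)) one_fun (exp (- (2 * w))) - 2 ^ (j + 2) * lambert (npow (j + 1)) one_fun (exp (- (4 * w))))"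
proof -
  let ?T = "lambert (npow (j + 1)) one_fun (exp (- (2 * w))) - 2 ^ (j + 2) * lambert (npow (j + 1)) one_fun (exp (- (4 * w)))"
  have "Re (2 * w) > 0" using w by simp
  from has_sum_cmult_right[OF lambert_even_twist[OF this, of "j + 1"], of "2 ^ (j + 2)"]
  have "((\<lambda>i. 2 ^ (j + 2) * ((-1) ^ (i + 1) * npow (j + 1) i * (exp (- (of_nat i * (2 * w))) / (1 - exp (- (of_nat i * (2 * w))))))) has_sum
     2 ^ (j + 2) * ?T) {1..}" by (simp add: mult.assoc[symmetric])
  then have "((\<lambda>d. geo_coeff sech2_coeff w (int d) * of_int (int d) ^ j) has_sum 2 ^ (j + 2) * ?T) {i. even i \<and> i \<ge> 1}"
  proof (rule iffD1[OF has_sum_reindex_bij_witness[of "{1..}" "\<lambda>i. i div 2" "\<lambda>i. 2 * i" "{i. even i \<and> i \<ge> 1}"], rotated -1])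
    fix i :: nat
    have n: "nat \<bar>int (2 * i)\<bar> = 2 * i" by (simp only: abs_of_nat nat_int)
    have c: "sech2_coeff (2 * i) = 4 * (-1) ^ (i + 1) * of_nat i" by (simp add: sech2_coeff_def)
    have e: "of_nat (2 * i) * w = of_nat i * (2 * w)" by simp
    show "geo_coeff sech2_coeff w (int (2 * i)) * of_int (int (2 * i)) ^ j =
       2 ^ (j + 2) * ((-1) ^ (i + 1) * npow (j + 1) i * (exp (- (of_nat i * (2 * w))) / (1 - exp (- (of_nat i * (2 * w))))))"
      unfolding geo_coeff_def n c e by (simp add: power_add power_mult_distrib mult_ac)
  qed (auto elim!: evenE)
  then have 1: "((\<lambda>d. geo_coeff sech2_coeff w (int d) * of_int (int d) ^ j) has_sum 2 ^ (j + 2) * ?T) {1..}"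
    by (rule iffD1[OF has_sum_cong_neutral, rotated -1]) (auto simp: geo_coeff_def sech2_coeff_def)
  have dec: "exp_decay (Re w / 2) (geo_coeff sech2_coeff w)" using w by (intro exp_decay_geo_sech) auto
  have "exp_series (geo_coeff sech2_coeff w) j 0 = geo_coeff sech2_coeff w 0 * of_int 0 ^ j + 2 * (2 ^ (j + 2) * ?T)"
    unfolding exp_series_def
    using infsum_int_even[OF exp_series_0_summable[OF dec] _ 1] j w by (auto simp: geo_coeff_even)
  then show ?thesis by (simp add: geo_coeff_def sech2_coeff_0 power_add)
qed

text \<open>Evaluation at \<open>\<i> * pi / 4\<close> multiplies the coefficient of index
  \<open>j\<close> by a cosine, and this turns the character modulo 4 into the one modulo 8.\<close>

lemma chi4_cos: "real_of_int (chi4 j) * (sqrt 2 * cos (real j * (pi / 4))) = real_of_int (chi8 j)"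
proof -
  define r k where "r = j mod 8" and "k = j div 8"
  have j: "j = 8 * k + r" by (simp add: r_def k_def)
  have "real j * (pi / 4) = real r * (pi / 4) + 2 * pi * real k" by (simp add: j algebra_simps)
  then have c: "cos (real j * (pi / 4)) = cos (real r * (pi / 4))"
    by (metis cos_int_2pin sin_int_2pin cos_add mult.right_neutral mult_zero_right diff_zero of_int_of_nat_eq)
  have "(8 * k + r) mod 8 = r mod 8" by simp
  moreover have "(8 * k + r) mod 4 = r mod 4" by presburger
  ultimately have x: "chi4 j = chi4 r" "chi8 j = chi8 r" unfolding chi4_def chi8_def j by simp_all
  have c3: "cos (3 * pi / 4) = - cos (pi / 4)" using cos_pi_minus[of "pi / 4"] by (simp add: field_simps)
  have c5: "cos (5 * pi / 4) = - cos (pi / 4)" using cos_periodic_pi[of "pi / 4"] by (simp add: field_simps)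
  have c7: "cos (7 * pi / 4) = cos (pi / 4)" using cos_2pi_minus[of "pi / 4"] by (simp add: field_simps)
  have "r < 8" by (simp add: r_def)
  then have "r \<in> {0,1,2,3,4,5,6,7}" by auto
  then show ?thesis unfolding c x
    by (elim insertE) (auto simp: chi4_def chi8_def c3 c5 c7 cos_45)
qed

lemma exp_quarter_sum:
  "exp (of_int n * (\<i> * pi / 4)) + exp (of_int (- n) * (\<i> * pi / 4)) = of_real (2 * cos (real_of_int n * (pi / 4)))"
proof -
  have e: "exp (of_int n * (\<i> * pi / 4)) = cis (real_of_int n * (pi / 4))" for n :: int
    by (simp add: cis_conv_exp mult_ac)
  show ?thesis unfolding e by (simp add: complex_eq_iff)
qed

lemma cosh_ratio:
  assumes x: "Re x > 0"
  shows "((\<lambda>m. c8 m * exp (- (of_nat m * x))) has_sum cosh x / cosh (2 * x)) UNIV"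
proof -
  let ?s = "complex_of_real (sqrt 2)"
  have c2: "cosh (2 * x) \<noteq> 0" using x by (intro Re_pos_cosh_nz) simp
  have h: "((\<lambda>j. sech_coeff j * exp (- (of_nat j * u))) has_sum 1 / cosh u) UNIV" if "Re u > 0" for u
    by (rule has_sum_sech[OF that])
  have "1 / cosh (- x + \<i> * pi / 4) = 1 / cosh (x - \<i> * pi / 4)"
    using cosh_minus[of "x - \<i> * pi / 4"] by simp
  then have q: "1 / cosh (x + \<i> * pi / 4) + 1 / cosh (x - \<i> * pi / 4) = 2 * ?s * (cosh x / cosh (2 * x))"
    using cosh_quarter[OF c2] by simp
  have "((\<lambda>j. sech_coeff j * exp (- (of_nat j * (x + \<i> * pi / 4))) + sech_coeff j * exp (- (of_nat j * (x - \<i> * pi / 4)))) has_sum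
      2 * ?s * (cosh x / cosh (2 * x))) UNIV"
    unfolding q[symmetric] by (intro has_sum_add h) (use x in auto)
  from has_sum_cmult_right[OF this, of "1 / (2 * ?s)"]
  have "((\<lambda>j. 1 / (2 * ?s) * (sech_coeff j * exp (- (of_nat j * (x + \<i> * pi / 4))) + sech_coeff j * exp (- (of_nat j * (x - \<i> * pi / 4))))) has_sum
      cosh x / cosh (2 * x)) UNIV" by simp
  moreover have "1 / (2 * ?s) * (sech_coeff j * exp (- (of_nat j * (x + \<i> * pi / 4))) + sech_coeff j * exp (- (of_nat j * (x - \<i> * pi / 4))))
     = c8 j * exp (- (of_nat j * x))" for j
  proof -
    have "sech_coeff j * exp (- (of_nat j * (x + \<i> * pi / 4))) + sech_coeff j * exp (- (of_nat j * (x - \<i> * pi / 4)))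
      = sech_coeff j * exp (- (of_nat j * x)) * (exp (of_int (int j) * (\<i> * pi / 4)) + exp (of_int (- int j) * (\<i> * pi / 4)))"
      by (simp add: exp_add[symmetric] algebra_simps)
    also have "\<dots> = sech_coeff j * exp (- (of_nat j * x)) * of_real (2 * cos (real j * (pi / 4)))"
      unfolding exp_quarter_sum by simp
    also have "1 / (2 * ?s) * \<dots> = of_real (real_of_int (chi4 j) * (2 / sqrt 2 * cos (real j * (pi / 4)))) * exp (- (of_nat j * x))"
      by (simp add: sech_coeff_def)
    also have "2 / sqrt 2 = sqrt 2" by (rule real_div_sqrt) simp
    finally show ?thesis unfolding chi4_cos by simp
  qed
  ultimately show ?thesis by simp
qed

lemma sechS_lambert:
  assumes l: "Re l > 0" and j: "even j"
  shows "exp_series (hsec (2 * l)) j l = (if j = 0 then 1 else 0) + 2 * lambert (npow j) c8 (exp (- l))"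
proof -
  define f where "f = (\<lambda>n. hsec (2 * l) n * of_int n ^ j * exp (of_int n * l))"
  have sf: "f summable_on UNIV"
    unfolding f_def using l by (intro exp_series_summable[OF exp_decay_hsec]) auto
  define g where "g = (\<lambda>n. (f n + f (- n)) / 2)"
  have g: "g n = of_int n ^ j * (cosh (of_int n * l) / cosh (2 * (of_int n * l)))" for n
  proof -
    have e: "exp (of_int n * l) + exp (of_int (- n) * l) = 2 * cosh (of_int n * l)" by (simp add: cosh_field_def)
    have "f n + f (- n) = hsec (2 * l) n * of_int n ^ j * (exp (of_int n * l) + exp (of_int (- n) * l))"
      using j by (simp add: f_def algebra_simps)
    then show ?thesis unfolding e by (simp add: g_def hsec_def mult_ac)
  qed
  have sg: "g summable_on UNIV"
  proof -
    have "(\<lambda>n. f (- n)) summable_on UNIV"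
      using sf summable_on_reindex_bij_witness[of UNIV uminus uminus UNIV f "\<lambda>n. f (- n)"] by auto
    from summable_on_cmult_left[OF summable_on_add[OF sf this], of "1 / 2"] show ?thesis by (simp add: g_def)
  qed
  have inner: "((\<lambda>m. c8 m * exp (- l) ^ (d * m)) has_sum cosh (of_nat d * l) / cosh (2 * (of_nat d * l))) {1..}" if d: "d \<ge> 1" for d
  proof -
    have "Re (of_nat d * l) > 0" using l d by simp
    from cosh_ratio[OF this]
    have "((\<lambda>m. c8 m * exp (- l) ^ (d * m)) has_sum cosh (of_nat d * l) / cosh (2 * (of_nat d * l))) UNIV"
      unfolding exp_neg_mult .
    then show ?thesis by (rule iffD2[OF has_sum_cong_neutral, rotated -1]) (auto simp: chi8_def not_less_eq_eq)
  qed
  have "((\<lambda>d. npow j d * (cosh (of_nat d * l) / cosh (2 * (of_nat d * l)))) has_sum lambert (npow j) c8 (exp (- l))) {1..}"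
    by (rule lambert_iterated[OF Re_pos_norm_exp[OF l] npow_bound chi_bound(2) inner])
  then have 1: "((\<lambda>d. g (int d)) has_sum lambert (npow j) c8 (exp (- l))) {1..}"
    by (simp add: g)
  have "exp_series (hsec (2 * l)) j l = infsum f UNIV" by (simp add: exp_series_def f_def)
  also have "\<dots> = infsum g UNIV" unfolding g_def by (rule infsum_symmetrize[OF sf])
  also have "\<dots> = g 0 + 2 * lambert (npow j) c8 (exp (- l))"
    by (rule infsum_int_even[OF sg _ 1]) (simp add: g_def add.commute)
  finally show ?thesis by (simp add: g)
qed

lemma sech_dual_quarter_lambert:
  assumes w: "Re w > 0" and j: "even j"
  shows "exp_series (geo_coeff sech_coeff w) j (\<i> * pi / 4) = 2 * sqrt 2 * lambert (\<lambda>n. c8 n * npow j n) one_fun (exp (- w))"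
proof -
  let ?q = "\<lambda>d. exp (- (of_nat d * w)) / (1 - exp (- (of_nat d * w)))"
  have dec: "exp_decay (Re w / 2) (geo_coeff sech_coeff w)" using w by (intro exp_decay_geo_sech) auto
  define f where "f = (\<lambda>n. geo_coeff sech_coeff w n * of_int n ^ j * exp (of_int n * (\<i> * pi / 4)))"
  have sf: "f summable_on UNIV"
    unfolding f_def using w by (intro exp_series_summable[OF dec]) auto
  define g where "g = (\<lambda>n. (f n + f (- n)) / 2)"
  have g: "g n = geo_coeff sech_coeff w n * of_int n ^ j * of_real (cos (real_of_int n * (pi / 4)))" for n
  proof -
    have "f n + f (- n) = geo_coeff sech_coeff w n * of_int n ^ j * (exp (of_int n * (\<i> * pi / 4)) + exp (of_int (- n) * (\<i> * pi / 4)))"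
      using j by (simp add: f_def algebra_simps geo_coeff_even)
    then show ?thesis unfolding exp_quarter_sum by (simp add: g_def)
  qed
  have sg: "g summable_on UNIV"
  proof -
    have "(\<lambda>n. f (- n)) summable_on UNIV"
      using sf summable_on_reindex_bij_witness[of UNIV uminus uminus UNIV f "\<lambda>n. f (- n)"] by auto
    from summable_on_cmult_left[OF summable_on_add[OF sf this], of "1 / 2"] show ?thesis by (simp add: g_def)
  qed
  have gd: "g (int d) = sqrt 2 * (c8 d * npow j d * ?q d)" for d
  proof -
    have "g (int d) = of_real (real_of_int (chi4 d) * (2 * cos (real d * (pi / 4)))) * (npow j d * ?q d)"
      by (simp add: g geo_coeff_def sech_coeff_def)
    also have "real_of_int (chi4 d) * (2 * cos (real d * (pi / 4))) = sqrt 2 * (real_of_int (chi4 d) * (sqrt 2 * cos (real d * (pi / 4))))"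
      by (simp add: mult_ac flip: mult.assoc[of "sqrt 2" "sqrt 2"])
    also have "\<dots> = sqrt 2 * real_of_int (chi8 d)" unfolding chi4_cos ..
    finally show ?thesis by simp
  qed
  have "((\<lambda>d. (c8 d * npow j d) * ?q d) has_sum lambert (\<lambda>n. c8 n * npow j n) one_fun (exp (- w))) {1..}"
    by (rule lambert_iterated[OF Re_pos_norm_exp[OF w] cnpow_bound(2) one_bound one_inner[OF w]])
  from has_sum_cmult_right[OF this, of "sqrt 2"]
  have 1: "((\<lambda>d. g (int d)) has_sum sqrt 2 * lambert (\<lambda>n. c8 n * npow j n) one_fun (exp (- w))) {1..}"
    by (simp only: gd)
  have "exp_series (geo_coeff sech_coeff w) j (\<i> * pi / 4) = infsum f UNIV" by (simp add: exp_series_def f_def)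
  also have "\<dots> = infsum g UNIV" unfolding g_def by (rule infsum_symmetrize[OF sf])
  also have "\<dots> = g 0 + 2 * (sqrt 2 * lambert (\<lambda>n. c8 n * npow j n) one_fun (exp (- w)))"
    by (rule infsum_int_even[OF sg _ 1]) (simp add: g_def add.commute)
  also have "g 0 = 0" by (simp add: g geo_coeff_def sech_coeff_0)
  finally show ?thesis by simp
qed

lemma sechK_lambert:
  assumes l: "Re l > 0"
  shows "sechK l = 1 + 8 * (lambert (npow 1) one_fun (exp (- (2 * l))) - 4 * lambert (npow 1) one_fun (exp (- (4 * l))))"
proof -
  have "((\<lambda>m. (1 / cosh (0 + of_int m * l))\<^sup>2) has_sum (1 / cosh 0)\<^sup>2 + exp_series (geo_coeff sech2_coeff l) 0 0) UNIV"
    using bilateral_expansion[of 0 l sech2_coeff 2 1 "\<lambda>x. (1 / cosh x)\<^sup>2", OF _ sech2_coeff_0 norm_sech2_coeff has_sum_sech2] l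
    by simp
  then show ?thesis using sech2_dual_lambert[OF l, of 0] by (simp add: sechK_def hsec_def has_sum_iff)
qed

lemma cschH_lambert:
  assumes l: "Re l > 0"
  shows "cschH l = 8 * (lambert (npow 1) one_fun (exp (- l)) - lambert (npow 1) one_fun (exp (- (2 * l))))"
  using csch_lambert[OF l, of 0] by (simp add: exp_series_def cschH_def)

text \<open>The geometric mean step, found by comparing Lambert series of weight two;
  \<open>sechA_double\<close> is the arithmetic mean step.\<close>

lemma sechB_double_square:
  assumes l: "Re l > 0"
  shows "sechB (2 * l) ^ 2 = sechA l * sechB l"
proof -
  define L where "L = (\<lambda>n. lambert (npow 1) one_fun (exp (- (of_nat n * l))))"
  have l2: "Re (2 * l) > 0" "Re (4 * l) > 0" using l by simp_all
  have K: "sechK l = 1 + 8 * (L 2 - 4 * L 4)" "sechK (2 * l) = 1 + 8 * (L 4 - 4 * L 8)"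
    using sechK_lambert[OF l] sechK_lambert[OF l2(1)] by (simp_all add: L_def)
  have H: "cschH (2 * l) = 8 * (L 2 - L 4)" "cschH (4 * l) = 8 * (L 4 - L 8)"
    using cschH_lambert[OF l2(1)] cschH_lambert[OF l2(2)] by (simp_all add: L_def)
  have "4 * cschH (4 * l) = cschH (2 * l) + infsum (\<lambda>n. sgn1 n * hcsc (2 * l) n) UNIV"
    using cschH_double[OF l2(1)] by simp
  then have "sechB (2 * l) ^ 2 = sechK (2 * l) + (4 * cschH (4 * l) - cschH (2 * l))"
    using sechB_square[OF l2(1)] by simp
  then show ?thesis unfolding sechA_mult_sechB[OF l] K H by simp
qed

section \<open>Theta constants\<close>

text \<open>Unconditional summation on the whole unit disc, so that products and substitutions of
  \<open>q\<close> are rearrangements.\<close>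

definition pseries :: "(complex \<Rightarrow> complex) \<Rightarrow> complex fps \<Rightarrow> bool" where
  "pseries F f \<longleftrightarrow> (\<forall>q. norm q < 1 \<longrightarrow> ((\<lambda>n. fps_nth f n * q ^ n) has_sum F q) UNIV)"

lemma pseriesD: "pseries F f \<Longrightarrow> norm q < 1 \<Longrightarrow> ((\<lambda>n. fps_nth f n * q ^ n) has_sum F q) UNIV"
  by (simp add: pseries_def)

lemma pseries_expansion: "pseries F f \<Longrightarrow> F has_fps_expansion f"
  by (rule has_fps_expansionI)
     (auto intro!: eventually_nhds_in_open[of "ball 0 1", THEN eventually_mono] has_sum_imp_sums simp: pseries_def)

text \<open>The point \<open>q = 0\<close> is exempted because it is not of the form
  \<open>exp (- l)\<close>; the values there agree by continuity.\<close>

lemma pseries_unique: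
  assumes "pseries F f" "pseries G g" "\<And>q. norm q < 1 \<Longrightarrow> q \<noteq> 0 \<Longrightarrow> F q = G q"
  shows "f = g"
proof -
  have F: "F has_fps_expansion f" and G: "G has_fps_expansion g"
    using assms pseries_expansion by blast+
  have "\<forall>\<^sub>F q in at 0. F q = G q"
    using eventually_at_in_open[of "ball 0 1" "0::complex"] by (auto elim!: eventually_mono intro!: assms(3))
  then have "F 0 = G 0"
    using isCont_zero_at[where F = "\<lambda>q. F q - G q" and a = 0] has_fps_expansion_imp_continuous[OF F] has_fps_expansion_imp_continuous[OF G]
    by (auto intro!: continuous_intros)
  then have "\<forall>\<^sub>F q in nhds 0. F q = G q"
    using \<open>\<forall>\<^sub>F q in at 0. F q = G q\<close> eventually_nhds_conv_at by blast
  then have "F has_fps_expansion g"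
    using G by (subst has_fps_expansion_cong) auto
  then show ?thesis using F fps_expansion_unique_complex by blast
qed

lemma pseries_eq: "pseries F f \<Longrightarrow> pseries G f \<Longrightarrow> norm q < 1 \<Longrightarrow> F q = G q"
  using has_sum_unique by (fastforce simp: pseries_def)

lemma pseries_mult:
  assumes F: "pseries F f" and G: "pseries G g"
  shows "pseries (\<lambda>q. F q * G q) (f * g)"
  unfolding pseries_def
proof (intro allI impI)
  fix q :: complex assume q: "norm q < 1"
  let ?a = "\<lambda>n. fps_nth f n * q ^ n" and ?b = "\<lambda>n. fps_nth g n * q ^ n"
  have a: "(?a has_sum F q) UNIV" and b: "(?b has_sum G q) UNIV" using F G q by (auto simp: pseries_def)
  have p: "((\<lambda>(i, j). ?a i * ?b j) has_sum F q * G q) (UNIV \<times> UNIV)"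
    using product_summable[of ?a UNIV ?b UNIV] product_infsum[of ?a UNIV ?b UNIV] a b
    by (simp add: has_sum_iff)
  have "((\<lambda>(n, i). ?a i * ?b (n - i)) has_sum F q * G q) (SIGMA n:UNIV. {..n})"
    by (rule iffD1[OF has_sum_reindex_bij_witness[of "UNIV \<times> UNIV" "\<lambda>(n, i). (i, n - i)" "\<lambda>(i, j). (i + j, i)"] p]) auto
  then have "((\<lambda>n. \<Sum>i\<le>n. ?a i * ?b (n - i)) has_sum F q * G q) UNIV"
    by (rule has_sum_Sigma') (auto intro!: has_sum_finiteI)
  moreover have "(\<Sum>i\<le>n. ?a i * ?b (n - i)) = fps_nth (f * g) n * q ^ n" for n
    unfolding fps_mult_nth sum_distrib_right atMost_atLeast0
    by (rule sum.cong) (auto simp: mult_ac simp flip: power_add)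
  ultimately show "((\<lambda>n. fps_nth (f * g) n * q ^ n) has_sum F q * G q) UNIV" by simp
qed

lemma pseries_add:
  assumes "pseries F f" "pseries G g"
  shows "pseries (\<lambda>q. F q + G q) (f + g)"
  using assms unfolding pseries_def by (auto simp: distrib_right intro!: has_sum_add)

lemma pseries_cmult:
  assumes "pseries F f"
  shows "pseries (\<lambda>q. c * F q) (fps_const c * f)"
  using assms unfolding pseries_def by (auto simp: mult.assoc intro!: has_sum_cmult_right)

definition fps_neg :: "complex fps \<Rightarrow> complex fps" where
  "fps_neg f = Abs_fps (\<lambda>n. (-1) ^ n * fps_nth f n)"

definition fps_sq :: "complex fps \<Rightarrow> complex fps" where
  "fps_sq f = Abs_fps (\<lambda>n. if even n then fps_nth f (n div 2) else 0)"

lemma pseries_neg: "pseries F f \<Longrightarrow> pseries (\<lambda>q. F (- q)) (fps_neg f)"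
  unfolding pseries_def fps_neg_def
proof (intro allI impI)
  fix q :: complex assume *: "\<forall>q. norm q < 1 \<longrightarrow> ((\<lambda>n. fps_nth f n * q ^ n) has_sum F q) UNIV" "norm q < 1"
  then have "((\<lambda>n. fps_nth f n * (- q) ^ n) has_sum F (- q)) UNIV" by (metis norm_minus_cancel)
  then show "((\<lambda>n. fps_nth (Abs_fps (\<lambda>n. (-1) ^ n * fps_nth f n)) n * q ^ n) has_sum F (- q)) UNIV"
    by (simp add: power_minus[of q] mult_ac)
qed

lemma pseries_sq:
  assumes "pseries F f" shows "pseries (\<lambda>q. F (q\<^sup>2)) (fps_sq f)"
  unfolding pseries_def
proof (intro allI impI)
  fix q :: complex assume q: "norm q < 1"
  then have "norm (q\<^sup>2) < 1" by (simp add: norm_power power_less_one_iff)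
  from pseriesD[OF assms this]
  have "((\<lambda>n. fps_nth (fps_sq f) n * q ^ n) has_sum F (q\<^sup>2)) {n. even n}"
    by (rule iffD1[OF has_sum_reindex_bij_witness[of UNIV "\<lambda>n. n div 2" "\<lambda>n. 2 * n" "{n. even n}"], rotated -1])
       (auto simp: fps_sq_def power_mult elim!: evenE)
  then show "((\<lambda>n. fps_nth (fps_sq f) n * q ^ n) has_sum F (q\<^sup>2)) UNIV"
    by (rule iffD1[OF has_sum_cong_neutral, rotated -1]) (auto simp: fps_sq_def)
qed

text \<open>The mean relation fixes the even coefficients by earlier ones. An odd coefficient
  \<open>n > 1\<close> is found from coefficient \<open>n + 1\<close> of the product relation, where
  it occurs only in the term \<open>- 2 * f\<^sub>1 * f\<^sub>n\<close>; hence
  \<open>f\<^sub>1 \<noteq> 0\<close>.\<close>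

lemma agm_fps_unique:
  fixes f g :: "complex fps"
  assumes f: "f * fps_neg f = fps_sq (fps_neg f * fps_neg f)" "f + fps_neg f = 2 * fps_sq f" "fps_nth f 0 = 1"
    and g: "g * fps_neg g = fps_sq (fps_neg g * fps_neg g)" "g + fps_neg g = 2 * fps_sq g" "fps_nth g 0 = 1"
    and fg: "fps_nth f 1 = fps_nth g 1" "fps_nth f 1 \<noteq> 0"
  shows "f = g"
proof (rule fps_ext)
  fix n
  show "fps_nth f n = fps_nth g n"
  proof (induction n rule: less_induct)
    case (less n)
    have ev: "fps_nth h m = fps_nth h (m div 2)" if "h + fps_neg h = 2 * fps_sq h" "even m" for h :: "complex fps" and m
    proof -
      have "fps_nth (h + fps_neg h) m = fps_nth (2 * fps_sq h) m" using that by simp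
      then show ?thesis using that(2) by (simp add: fps_neg_def fps_sq_def numeral_fps_const)
    qed
    consider "n = 0" | "n = 1" | "even n" "n > 0" | "odd n" "n > 1" by linarith
    then show ?case
    proof cases
      case 3
      then have "n div 2 < n" by simp
      then show ?thesis using ev[OF f(2) 3(1)] ev[OF g(2) 3(1)] less by simp
    next
      case 4
      define N where "N = n + 1"
      have N: "even N" "N div 2 < n" using 4 by (auto simp: N_def elim!: oddE)
      have fN: "fps_nth f N = fps_nth g N" using ev[OF f(2) N(1)] ev[OF g(2) N(1)] less N(2) by simp
      \<comment> \<open>The four outer summands with indices \<open>0\<close>, \<open>1\<close>,
        \<open>n\<close>, \<open>N\<close> are isolated; all others and the whole right side involve
        only indices below \<open>n\<close>.\<close>
      have co: "2 * fps_nth h 0 * fps_nth h N - 2 * fps_nth h 1 * fps_nth h n + (\<Sum>i\<in>{2..n-1}. (-1) ^ i * fps_nth h (N - i) * fps_nth h i)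
          = (\<Sum>i\<le>N div 2. ((-1) ^ i * fps_nth h i) * ((-1) ^ (N div 2 - i) * fps_nth h (N div 2 - i)))"
        if "h * fps_neg h = fps_sq (fps_neg h * fps_neg h)" for h :: "complex fps"
      proof -
        have "fps_nth (fps_neg h * h) N = (\<Sum>i\<in>{0..N}. (-1) ^ i * fps_nth h (N - i) * fps_nth h i)"
          unfolding fps_mult_nth by (intro sum.cong) (auto simp: fps_neg_def)
        also have "{0..N} = {0, 1, n, N} \<union> {2..n-1}" using 4 by (auto simp: N_def)
        also have "(\<Sum>i\<in>{0, 1, n, N} \<union> {2..n-1}. (-1) ^ i * fps_nth h (N - i) * fps_nth h i) =
           (\<Sum>i\<in>{0, 1, n, N}. (-1) ^ i * fps_nth h (N - i) * fps_nth h i) + (\<Sum>i\<in>{2..n-1}. (-1) ^ i * fps_nth h (N - i) * fps_nth h i)"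
          using 4 by (intro sum.union_disjoint) (auto simp: N_def)
        also have "(\<Sum>i\<in>{0, 1, n, N}. (-1) ^ i * fps_nth h (N - i) * fps_nth h i) = 2 * fps_nth h 0 * fps_nth h N - 2 * fps_nth h 1 * fps_nth h n"
          using 4 by (simp add: N_def)
        finally have "fps_nth (h * fps_neg h) N = 2 * fps_nth h 0 * fps_nth h N - 2 * fps_nth h 1 * fps_nth h n + (\<Sum>i\<in>{2..n-1}. (-1) ^ i * fps_nth h (N - i) * fps_nth h i)"
          by (simp only: mult.commute[of h])
        moreover have "fps_nth (fps_sq (fps_neg h * fps_neg h)) N = (\<Sum>i\<le>N div 2. ((-1) ^ i * fps_nth h i) * ((-1) ^ (N div 2 - i) * fps_nth h (N div 2 - i)))"
          using N(1) by (simp add: fps_sq_def fps_mult_nth fps_neg_def atMost_atLeast0)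
        ultimately show ?thesis using that by simp
      qed
      have "(\<Sum>i\<in>{2..n-1}. (-1) ^ i * fps_nth f (N - i) * fps_nth f i) = (\<Sum>i\<in>{2..n-1}. (-1) ^ i * fps_nth g (N - i) * fps_nth g i)"
        by (intro sum.cong refl) (use 4 in \<open>auto simp: N_def less\<close>)
      moreover have "(\<Sum>i\<le>N div 2. ((-1) ^ i * fps_nth f i) * ((-1) ^ (N div 2 - i) * fps_nth f (N div 2 - i)))
          = (\<Sum>i\<le>N div 2. ((-1) ^ i * fps_nth g i) * ((-1) ^ (N div 2 - i) * fps_nth g (N div 2 - i)))"
      proof (intro sum.cong refl)
        fix i assume "i \<in> {..N div 2}"
        then have "i < n" "N div 2 - i < n" using N(2) by auto
        then show "((-1) ^ i * fps_nth f i) * ((-1) ^ (N div 2 - i) * fps_nth f (N div 2 - i)) = ((-1) ^ i * fps_nth g i) * ((-1) ^ (N div 2 - i) * fps_nth g (N div 2 - i))"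
          using less by simp
      qed
      ultimately have "2 * fps_nth f 1 * fps_nth f n = 2 * fps_nth f 1 * fps_nth g n"
        using co[OF f(1)] co[OF g(1)] fN f(3) g(3) fg(1) by (simp add: algebra_simps)
      then show ?thesis using fg(2) by simp
    qed (use f(3) g(3) fg in auto)
  qed
qed

section \<open>The theta series and sums of two squares\<close>

definition thetaq :: "complex \<Rightarrow> complex" where
  "thetaq q = infsum (\<lambda>n::int. q ^ nat (n\<^sup>2)) UNIV"

lemma nat_sq_int: "nat (n\<^sup>2) = nat \<bar>n\<bar> ^ 2"
  by (metis nat_power_eq abs_ge_zero power2_abs)

lemma summable_thetaq:
  fixes q :: complex
  assumes q: "norm q < 1"
  shows "(\<lambda>n::int. q ^ nat (n\<^sup>2)) summable_on UNIV"
proof -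
  obtain r where r: "norm q < r" "r < 1" using dense q by blast
  have r0: "r > 0" using r by (smt (verit) norm_ge_zero)
  have "- ln r > 0" using r r0 by simp
  from summable_on_exp_int[OF this] show ?thesis
  proof (rule summable_on_norm_le)
    fix n :: int
    have "norm (q ^ nat (n\<^sup>2)) \<le> r ^ nat (n\<^sup>2)" using r unfolding norm_power by (intro power_mono) auto
    also have "\<dots> \<le> r ^ nat \<bar>n\<bar>"
    proof (rule power_decreasing)
      show "nat \<bar>n\<bar> \<le> nat (n\<^sup>2)" unfolding nat_sq_int by (cases "nat \<bar>n\<bar>") (auto simp: power2_eq_square)
    qed (use r r0 in auto)
    also have "r ^ nat \<bar>n\<bar> = exp (- (- ln r) * \<bar>real_of_int n\<bar>)"
      using r0 by (simp add: powr_realpow[symmetric] powr_def mult.commute)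
    finally show "norm (q ^ nat (n\<^sup>2)) \<le> exp (- (- ln r) * \<bar>real_of_int n\<bar>)" .
  qed
qed

lemma sq_parity: "(-1 :: complex) ^ nat (n\<^sup>2) = sgn1 n"
  unfolding nat_sq_int by (auto simp: sgn1_def even_nat_iff)

lemma neg_thetaq: "thetaq (- q) = infsum (\<lambda>n::int. sgn1 n * q ^ nat (n\<^sup>2)) UNIV"
proof -
  have "(- q) ^ nat (n\<^sup>2) = sgn1 n * q ^ nat (n\<^sup>2)" for n :: int
    using power_minus[of q "nat (n\<^sup>2)"] sq_parity[of n] by simp
  then show ?thesis by (simp add: thetaq_def)
qed

definition sum_sq :: "int \<times> int \<Rightarrow> nat" where "sum_sq = (\<lambda>(m, n). nat (m\<^sup>2) + nat (n\<^sup>2))"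

lemma theta_product:
  assumes q: "norm q < 1"
  shows "((\<lambda>(m, n). q ^ sum_sq (m, n)) has_sum thetaq q * thetaq q) UNIV"
    and "((\<lambda>(m, n). sgn1 n * q ^ sum_sq (m, n)) has_sum thetaq q * thetaq (- q)) UNIV"
    and "((\<lambda>(m, n). sgn1 m * sgn1 n * q ^ sum_sq (m, n)) has_sum thetaq (- q) * thetaq (- q)) UNIV"
proof -
  let ?f = "\<lambda>n::int. q ^ nat (n\<^sup>2)" and ?g = "\<lambda>n::int. sgn1 n * q ^ nat (n\<^sup>2)"
  have f: "?f summable_on UNIV" by (rule summable_thetaq[OF q])
  have g: "?g summable_on UNIV" by (rule summable_sgn[OF f])
  have e: "thetaq q = infsum ?f UNIV" "thetaq (- q) = infsum ?g UNIV"
    by (rule thetaq_def, rule neg_thetaq)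
  have gen: "((\<lambda>(m, n). u m * v n) has_sum infsum u UNIV * infsum v UNIV) UNIV"
    if "u summable_on UNIV" "v summable_on UNIV" for u v :: "int \<Rightarrow> complex"
    using product_summable[OF that] product_infsum[OF that] by (simp add: has_sum_iff)
  show "((\<lambda>(m, n). q ^ sum_sq (m, n)) has_sum thetaq q * thetaq q) UNIV"
    using gen[OF f f] unfolding e by (simp add: sum_sq_def power_add case_prod_unfold)
  show "((\<lambda>(m, n). sgn1 n * q ^ sum_sq (m, n)) has_sum thetaq q * thetaq (- q)) UNIV"
    using gen[OF f g] unfolding e by (simp add: sum_sq_def power_add case_prod_unfold mult_ac)
  show "((\<lambda>(m, n). sgn1 m * sgn1 n * q ^ sum_sq (m, n)) has_sum thetaq (- q) * thetaq (- q)) UNIV"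
    using gen[OF g g] unfolding e by (simp add: sum_sq_def power_add case_prod_unfold mult_ac)
qed

lemma sum_sq_rotate: "sum_sq (u + v, u - v) = 2 * sum_sq (u, v)"
proof -
  have "int (sum_sq (u + v, u - v)) = int (2 * sum_sq (u, v))"
    by (simp add: sum_sq_def) (simp add: power2_eq_square algebra_simps)
  then show ?thesis by linarith
qed

lemma half_sum_diff:
  assumes "even (m + n :: int)"
  shows "(m + n) div 2 + (m - n) div 2 = m" "(m + n) div 2 - (m - n) div 2 = n"
    "(m - n) div 2 + (m + n) div 2 = m"
  using assms by presburger+

text \<open>The rotation \<open>(u, v) \<mapsto> (u + v, u - v)\<close> maps the square lattice onto
  the sublattice \<open>m + n\<close> even and doubles the sum of squares.\<close>

lemma rotate_has_sum:
  assumes "(f has_sum S) (UNIV :: (int \<times> int) set)"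
  shows "((\<lambda>(m, n). if even (m + n) then f ((m + n) div 2, (m - n) div 2) else 0) has_sum (S :: complex)) UNIV"
proof -
  have "((\<lambda>(m, n). if even (m + n) then f ((m + n) div 2, (m - n) div 2) else 0) has_sum S) {(m, n). even (m + n)}"
    by (rule iffD1[OF has_sum_reindex_bij_witness[of UNIV "\<lambda>(m, n). ((m + n) div 2, (m - n) div 2)" "\<lambda>(u, v). (u + v, u - v)" "{(m, n). even (m + n)}"] assms])
       (auto simp: half_sum_diff)
  then show ?thesis
    by (rule iffD1[OF has_sum_cong_neutral, rotated -1]) (auto split: if_splits)
qed

lemma even_sum_sq:
  assumes "even (m + n)"
  shows "sum_sq (m, n) = 2 * sum_sq ((m + n) div 2, (m - n) div 2)"
  using sum_sq_rotate[of "(m + n) div 2" "(m - n) div 2"] half_sum_diff[OF assms] by simp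

text \<open>The factor \<open>1 + (-1) ^ (m + n)\<close> selects the rotated sublattice with
  multiplicity \<open>2\<close>.\<close>

lemma thetaq_square_sum:
  assumes q: "norm q < 1"
  shows "thetaq q ^ 2 + thetaq (- q) ^ 2 = 2 * thetaq (q\<^sup>2) ^ 2"
proof -
  have q2: "norm (q\<^sup>2) < 1" using q by (simp add: norm_power power_less_one_iff)
  have "((\<lambda>(m, n). q ^ sum_sq (m, n) + sgn1 m * sgn1 n * q ^ sum_sq (m, n)) has_sum thetaq q * thetaq q + thetaq (- q) * thetaq (- q)) UNIV"
    using has_sum_add[OF theta_product(1,3)[OF q]] by (simp add: case_prod_unfold)
  moreover have "((\<lambda>(m, n). q ^ sum_sq (m, n) + sgn1 m * sgn1 n * q ^ sum_sq (m, n)) has_sum 2 * (thetaq (q\<^sup>2) * thetaq (q\<^sup>2))) UNIV"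
  proof (rule iffD1[OF has_sum_cong has_sum_cmult_right[OF rotate_has_sum[OF theta_product(1)[OF q2]], of 2]])
    fix x :: "int \<times> int"
    obtain m n where x: "x = (m, n)" by force
    show "2 * (case x of (m, n) \<Rightarrow> if even (m + n) then case ((m + n) div 2, (m - n) div 2) of (m, n) \<Rightarrow> (q\<^sup>2) ^ sum_sq (m, n) else 0) =
       (case x of (m, n) \<Rightarrow> q ^ sum_sq (m, n) + sgn1 m * sgn1 n * q ^ sum_sq (m, n))"
      using even_sum_sq[of m n] by (auto simp: x sgn1_def power_mult)
  qed
  ultimately show ?thesis using has_sum_unique by (fastforce simp: power2_eq_square)
qed

text \<open>After symmetrizing in \<open>m\<close> and \<open>n\<close> the sign becomes
  \<open>((-1) ^ m + (-1) ^ n) / 2\<close>, which vanishes off the rotated sublattice; on it, it is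
  the product of the signs of the rotated coordinates.\<close>

lemma thetaq_mult_neg:
  assumes q: "norm q < 1"
  shows "thetaq q * thetaq (- q) = thetaq (- (q\<^sup>2)) ^ 2"
proof -
  have q2: "norm (q\<^sup>2) < 1" using q by (simp add: norm_power power_less_one_iff)
  have h: "((\<lambda>(m, n). sgn1 n * q ^ sum_sq (m, n)) has_sum thetaq q * thetaq (- q)) UNIV"
    by (rule theta_product(2)[OF q])
  have "((\<lambda>(m, n). sgn1 m * q ^ sum_sq (m, n)) has_sum thetaq q * thetaq (- q)) UNIV"
    by (rule iffD1[OF has_sum_reindex_bij_witness[of UNIV "\<lambda>(m, n). (n, m)" "\<lambda>(m, n). (n, m)"] h]) (auto simp: sum_sq_def add.commute)
  from has_sum_cmult_right[OF has_sum_add[OF h this], of "1 / 2"]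
  have "((\<lambda>(m, n). 1 / 2 * (sgn1 n * q ^ sum_sq (m, n) + sgn1 m * q ^ sum_sq (m, n))) has_sum thetaq q * thetaq (- q)) UNIV"
    by (simp add: case_prod_unfold)
  moreover have "((\<lambda>(m, n). 1 / 2 * (sgn1 n * q ^ sum_sq (m, n) + sgn1 m * q ^ sum_sq (m, n))) has_sum thetaq (- (q\<^sup>2)) * thetaq (- (q\<^sup>2))) UNIV"
  proof (rule iffD1[OF has_sum_cong rotate_has_sum[OF theta_product(3)[OF q2]]])
    fix x :: "int \<times> int"
    obtain m n where x: "x = (m, n)" by force
    have s: "sgn1 ((m + n) div 2) * sgn1 ((m - n) div 2) = sgn1 n" if e: "even (m + n)"
      using half_sum_diff(2)[OF e] by (metis sgn1_add diff_conv_add_uminus sgn1_simps(1))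
    show "(case x of (m, n) \<Rightarrow> if even (m + n) then case ((m + n) div 2, (m - n) div 2) of (m, n) \<Rightarrow> sgn1 m * sgn1 n * (q\<^sup>2) ^ sum_sq (m, n) else 0) =
       (case x of (m, n) \<Rightarrow> 1 / 2 * (sgn1 n * q ^ sum_sq (m, n) + sgn1 m * q ^ sum_sq (m, n)))"
    proof (cases "even (m + n)")
      case True
      then have "sgn1 m = sgn1 n" by (auto simp: sgn1_def)
      then show ?thesis using s[OF True] even_sum_sq[OF True] True by (simp add: x power_mult)
    next
      case False
      then have "sgn1 m = - sgn1 n" by (auto simp: sgn1_def)
      then show ?thesis using False by (simp add: x)
    qed
  qed
  ultimately show ?thesis using has_sum_unique by (fastforce simp: power2_eq_square)
qed

lemma pseries_lambert:
  assumes "\<And>n. norm (\<alpha> n) \<le> K * real n ^ p" "\<And>n. norm (\<beta> n) \<le> M"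
  shows "pseries (\<lambda>q. c0 + c * lambert \<alpha> \<beta> q)
    (Abs_fps (\<lambda>n. if n = 0 then c0 else c * (\<Sum>d | d dvd n. \<alpha> d * \<beta> (n div d))))"
  unfolding pseries_def
proof (intro allI impI)
  fix q :: complex assume q: "norm q < 1"
  let ?f = "\<lambda>n. fps_nth (Abs_fps (\<lambda>n. if n = 0 then c0 else c * (\<Sum>d | d dvd n. \<alpha> d * \<beta> (n div d)))) n * q ^ n"
  have 1: "(?f has_sum c * lambert \<alpha> \<beta> q) {1..}"
    using has_sum_cmult_right[OF lambert_divisor_sum[OF q assms], of c]
    by (rule iffD1[OF has_sum_cong, rotated -1]) (auto simp: mult.assoc)
  have 2: "(?f has_sum c0) {0}" by (rule has_sum_finiteI) auto
  have 3: "{0} \<union> {1..} = (UNIV :: nat set)" by auto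
  show "(?f has_sum c0 + c * lambert \<alpha> \<beta> q) UNIV"
    unfolding 3[symmetric] by (rule has_sum_Un_disjoint[OF 2 1]) auto
qed

definition theta_fps :: "complex fps" where
  "theta_fps = Abs_fps (\<lambda>N. of_nat (card {m::int. nat (m\<^sup>2) = N}))"

lemma finite_sqrt_int: "finite {m::int. nat (m\<^sup>2) = N}"
proof (rule finite_subset)
  show "{m::int. nat (m\<^sup>2) = N} \<subseteq> {- int N..int N}"
  proof
    fix m :: int assume "m \<in> {m. nat (m\<^sup>2) = N}"
    then have "int N = \<bar>m\<bar> * \<bar>m\<bar>" by (auto simp: power2_eq_square)
    moreover have "\<bar>m\<bar> \<le> \<bar>m\<bar> * \<bar>m\<bar>" using mult_left_mono[of 1 "\<bar>m\<bar>" "\<bar>m\<bar>"] by (cases "m = 0") simp_all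
    ultimately have "\<bar>m\<bar> \<le> int N" by simp
    then show "m \<in> {- int N..int N}" by auto
  qed
qed simp

lemma pseries_theta: "pseries thetaq theta_fps"
  unfolding pseries_def
proof (intro allI impI)
  fix q :: complex assume q: "norm q < 1"
  have "((\<lambda>n::int. q ^ nat (n\<^sup>2)) has_sum thetaq q) UNIV"
    unfolding thetaq_def by (rule has_sum_infsum[OF summable_thetaq[OF q]])
  then have "((\<lambda>(N, m). q ^ N) has_sum thetaq q) (SIGMA N:UNIV. {m::int. nat (m\<^sup>2) = N})"
    by (rule iffD1[OF has_sum_reindex_bij_witness[of UNIV snd "\<lambda>m. (nat (m\<^sup>2), m)"], rotated -1]) auto
  then have "((\<lambda>N. \<Sum>m | nat (m\<^sup>2) = N. q ^ N) has_sum thetaq q) UNIV"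
    by (rule has_sum_Sigma') (auto intro!: has_sum_finiteI finite_sqrt_int)
  then show "((\<lambda>n. fps_nth theta_fps n * q ^ n) has_sum thetaq q) UNIV"
    by (simp add: theta_fps_def)
qed

lemma theta_fps_0_1: "fps_nth theta_fps 0 = 1" "fps_nth theta_fps 1 = 2"
proof -
  have "{m::int. nat (m\<^sup>2) = 0} = {0}" by auto
  then show "fps_nth theta_fps 0 = 1" by (simp add: theta_fps_def)
  have "{m::int. nat (m\<^sup>2) = 1} = {1, -1}" by (auto simp: nat_eq_iff power2_eq_1_iff)
  then show "fps_nth theta_fps 1 = 2" by (simp add: theta_fps_def)
qed

definition sechAq :: "complex \<Rightarrow> complex" where "sechAq q = 1 + 4 * lambert (npow 0) c4 q"
definition sechSq :: "complex \<Rightarrow> complex" where "sechSq q = 1 + 2 * lambert (npow 0) c8 q"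

lemma sechA_q: "Re l > 0 \<Longrightarrow> sechA l = sechAq (exp (- l))"
  using sech_lambert[of l 0] by (simp add: exp_series_hsec_0 sechAq_def)

lemma sechS_q: "Re l > 0 \<Longrightarrow> sechS l = sechSq (exp (- l))"
  using sechS_lambert[of l 0] by (simp add: exp_series_hsec_quarter sechSq_def)

text \<open>Replacing \<open>l\<close> by \<open>l - \<i> * pi\<close> changes \<open>q\<close> into
  \<open>- q\<close> and multiplies \<open>cosh (n * l)\<close> by \<open>(-1) ^ n\<close>.\<close>

lemma sechB_q:
  assumes "Re l > 0"
  shows "sechB l = sechAq (- exp (- l))"
proof -
  have "hsec (l - \<i> * pi) n = sgn1 n * hsec l n" for n
  proof -
    have "exp (of_int n * (l - \<i> * pi)) = sgn1 n * exp (of_int n * l)"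
      by (simp add: right_diff_distrib exp_diff exp_int_pi) (simp add: sgn1_def)
    moreover have "exp (- (of_int n * (l - \<i> * pi))) = sgn1 n * exp (- (of_int n * l))"
      using exp_int_pi[of n] by (simp add: right_diff_distrib exp_diff exp_minus field_simps)
    ultimately have "cosh (of_int n * (l - \<i> * pi)) = sgn1 n * cosh (of_int n * l)"
      by (simp add: cosh_field_def ring_distribs add_divide_distrib)
    then show ?thesis by (simp add: hsec_def sgn1_def)
  qed
  then have "hsec (l - \<i> * pi) = (\<lambda>n. sgn1 n * hsec l n)" by (rule ext)
  then have "sechB l = sechA (l - \<i> * pi)" by (simp add: sechA_def sechB_def)
  also have "\<dots> = sechAq (exp (- (l - \<i> * pi)))" using assms by (intro sechA_q) simp
  also have "exp (- (l - \<i> * pi)) = - exp (- l)" by (simp add: exp_diff exp_minus inverse_eq_divide)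
  finally show ?thesis .
qed

lemma log_exists:
  assumes "norm q < 1" "q \<noteq> 0"
  obtains l where "Re l > 0" "exp (- l) = q"
proof -
  have "exp (Ln q) = q" using assms by simp
  moreover have "Re (Ln q) < 0" using assms by (simp add: ln_less_zero)
  ultimately show ?thesis using that[of "- Ln q"] by simp
qed

lemma exp_double: "exp (- (2 * l)) = exp (- l) ^ 2" for l :: complex
  by (simp add: exp_double[symmetric])

text \<open>Jacobi's two-square theorem. Both sides satisfy the relations of
  \<open>agm_fps_unique\<close>: the Lambert series by the convolutions, the theta square by
  rotating the lattice.\<close>

lemma two_squares:
  assumes q: "norm q < 1"
  shows "thetaq q ^ 2 = sechAq q"
proof -
  define f where "f = Abs_fps (\<lambda>n. if n = 0 then 1 else 4 * (\<Sum>d | d dvd n. npow 0 d * c4 (n div d)))"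
  define g where "g = theta_fps * theta_fps"
  have F: "pseries sechAq f" unfolding f_def sechAq_def by (rule pseries_lambert[OF npow_bound chi_bound(1)])
  have G: "pseries (\<lambda>q. thetaq q * thetaq q) g" unfolding g_def by (intro pseries_mult pseries_theta)
  have "f = g"
  proof (rule agm_fps_unique)
    note FN = pseries_neg[OF F] and GN = pseries_neg[OF G]
    have two: "fps_const 2 = (2 :: complex fps)" by (simp add: numeral_fps_const)
    show "f * fps_neg f = fps_sq (fps_neg f * fps_neg f)"
    proof (rule pseries_unique[OF pseries_mult[OF F FN] pseries_sq[OF pseries_mult[OF FN FN]]])
      fix q :: complex assume "norm q < 1" "q \<noteq> 0"
      then obtain l where l: "Re l > 0" "exp (- l) = q" by (rule log_exists)
      then have "sechB (2 * l) = sechAq (- (q\<^sup>2))" using sechB_q[of "2 * l"] by (simp add: exp_double)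
      then show "sechAq q * sechAq (- q) = sechAq (- q\<^sup>2) * sechAq (- q\<^sup>2)"
        using sechB_double_square[OF l(1)] sechA_q[OF l(1)] sechB_q[OF l(1)] l(2) by (simp add: power2_eq_square)
    qed
    show "f + fps_neg f = 2 * fps_sq f"
      unfolding two[symmetric]
    proof (rule pseries_unique[OF pseries_add[OF F FN] pseries_cmult[OF pseries_sq[OF F]]])
      fix q :: complex assume "norm q < 1" "q \<noteq> 0"
      then obtain l where l: "Re l > 0" "exp (- l) = q" by (rule log_exists)
      have "sechA (2 * l) = sechAq (q\<^sup>2)" using sechA_q[of "2 * l"] l by (simp add: exp_double)
      then show "sechAq q + sechAq (- q) = 2 * sechAq (q\<^sup>2)"
        using sechA_double[OF l(1)] sechA_q[OF l(1)] sechB_q[OF l(1)] l(2) by simp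
    qed
    show "g * fps_neg g = fps_sq (fps_neg g * fps_neg g)"
    proof (rule pseries_unique[OF pseries_mult[OF G GN] pseries_sq[OF pseries_mult[OF GN GN]]])
      fix q :: complex assume "norm q < 1"
      from thetaq_mult_neg[OF this]
      have "(thetaq q * thetaq (- q)) ^ 2 = (thetaq (- q\<^sup>2) ^ 2) ^ 2" by simp
      then show "thetaq q * thetaq q * (thetaq (- q) * thetaq (- q)) = thetaq (- q\<^sup>2) * thetaq (- q\<^sup>2) * (thetaq (- q\<^sup>2) * thetaq (- q\<^sup>2))"
        by (simp add: power2_eq_square mult_ac)
    qed
    show "g + fps_neg g = 2 * fps_sq g"
      unfolding two[symmetric]
    proof (rule pseries_unique[OF pseries_add[OF G GN] pseries_cmult[OF pseries_sq[OF G]]])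
      fix q :: complex assume "norm q < 1"
      from thetaq_square_sum[OF this]
      show "thetaq q * thetaq q + thetaq (- q) * thetaq (- q) = 2 * (thetaq (q\<^sup>2) * thetaq (q\<^sup>2))"
        by (simp add: power2_eq_square)
    qed
    show "fps_nth f 0 = 1" "fps_nth g 0 = 1" by (simp_all add: f_def g_def theta_fps_0_1)
    have f1: "fps_nth f 1 = 4" by (simp add: f_def chi4_def)
    moreover have "fps_nth g 1 = 4" using theta_fps_0_1 by (simp add: g_def fps_mult_nth_1)
    ultimately show "fps_nth f 1 = fps_nth g 1" "fps_nth f 1 \<noteq> 0" by simp_all
  qed
  then show ?thesis using pseries_eq[OF G _ q, of sechAq] F by (simp add: power2_eq_square)
qed

lemma sechA_theta: "Re l > 0 \<Longrightarrow> sechA l = thetaq (exp (- l)) ^ 2"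
  by (simp add: sechA_q two_squares)

lemma sechB_theta: "Re l > 0 \<Longrightarrow> sechB l = thetaq (- exp (- l)) ^ 2"
  by (simp add: sechB_q two_squares)

text \<open>The convolutions only give the square of this identity. The sign is settled among power
  series, which have no zero divisors: \<open>s + z\<close> has constant term
  \<open>2\<close>.\<close>

lemma sechS_theta:
  assumes l: "Re l > 0"
  shows "sechS l = thetaq (exp (- l)) * thetaq (exp (- l) ^ 2)"
proof -
  define s where "s = Abs_fps (\<lambda>n. if n = 0 then 1 else 2 * (\<Sum>d | d dvd n. npow 0 d * c8 (n div d)))"
  define z where "z = theta_fps * fps_sq theta_fps"
  have S: "pseries sechSq s" unfolding s_def sechSq_def by (rule pseries_lambert[OF npow_bound chi_bound(2)])
  have Z: "pseries (\<lambda>q. thetaq q * thetaq (q\<^sup>2)) z" unfolding z_def by (intro pseries_mult pseries_sq pseries_theta)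
  have "s * s = z * z"
  proof (rule pseries_unique[OF pseries_mult[OF S S] pseries_mult[OF Z Z]])
    fix q :: complex assume q: "norm q < 1" "q \<noteq> 0"
    then obtain l where l: "Re l > 0" "exp (- l) = q" by (rule log_exists)
    have "sechSq q ^ 2 = sechA l * sechA (2 * l)" using sechS_square[OF l(1)] sechS_q[OF l(1)] l(2) by simp
    also have "\<dots> = thetaq q ^ 2 * thetaq (q\<^sup>2) ^ 2"
      using sechA_theta[OF l(1)] sechA_theta[of "2 * l"] l by (simp add: exp_double)
    finally show "sechSq q * sechSq q = thetaq q * thetaq (q\<^sup>2) * (thetaq q * thetaq (q\<^sup>2))"
      by (simp add: power2_eq_square mult_ac)
  qed
  then have "(s - z) * (s + z) = 0" by (simp add: algebra_simps)
  moreover have "s + z \<noteq> 0"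
  proof
    assume "s + z = 0"
    then have "fps_nth (s + z) 0 = 0" by simp
    then show False by (simp add: s_def z_def fps_sq_def theta_fps_0_1)
  qed
  ultimately have "s = z" by simp
  then have "sechSq q = thetaq q * thetaq (q\<^sup>2)" if "norm q < 1" for q using pseries_eq[OF S _ that] Z by simp
  then show ?thesis using l by (simp add: sechS_q)
qed

lemma thetaq_split:
  assumes q: "norm q < 1"
  shows "thetaq q + thetaq (- q) = 2 * thetaq (q ^ 4)"
    "thetaq q - thetaq (- q) = 2 * q * infsum (\<lambda>m::int. (q ^ 4) ^ nat (m * (m + 1))) UNIV"
proof -
  let ?f = "\<lambda>n::int. q ^ nat (n\<^sup>2)"
  have f: "?f summable_on UNIV" by (rule summable_thetaq[OF q])
  have n1: "nat ((2 * m)\<^sup>2) = 4 * nat (m\<^sup>2)" for m :: int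
    by (simp add: power_mult_distrib nat_mult_distrib)
  have n2: "nat ((2 * m + 1)\<^sup>2) = Suc (4 * nat (m * (m + 1)))" for m :: int
  proof -
    have "0 \<le> m * (m + 1)" by (cases "m \<ge> 0") (auto intro: mult_nonpos_nonpos)
    then have "int (Suc (4 * nat (m * (m + 1)))) = (2 * m + 1)\<^sup>2" by (simp add: power2_eq_square algebra_simps)
    then show ?thesis by (metis nat_int)
  qed
  show 1: "thetaq q + thetaq (- q) = 2 * thetaq (q ^ 4)"
    using infsum_add_sgn[OF f] unfolding neg_thetaq n1 by (simp add: thetaq_def power_mult)
  have "infsum (\<lambda>m. ?f (2 * m + 1)) UNIV = thetaq q - thetaq (q ^ 4)"
    using infsum_odd_part[OF f] unfolding n1 by (simp add: thetaq_def power_mult)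
  moreover have "infsum (\<lambda>m. ?f (2 * m + 1)) UNIV = q * infsum (\<lambda>m::int. (q ^ 4) ^ nat (m * (m + 1))) UNIV"
    unfolding n2 by (simp add: infsum_cmult_right' power_mult)
  ultimately have 2: "thetaq q - thetaq (q ^ 4) = q * infsum (\<lambda>m::int. (q ^ 4) ^ nat (m * (m + 1))) UNIV" by simp
  have "thetaq q - thetaq (- q) = 2 * thetaq q - (thetaq q + thetaq (- q))" by simp
  also have "\<dots> = 2 * (thetaq q - thetaq (q ^ 4))" unfolding 1 by simp
  finally show "thetaq q - thetaq (- q) = 2 * q * infsum (\<lambda>m::int. (q ^ 4) ^ nat (m * (m + 1))) UNIV"
    unfolding 2 by simp
qed

section \<open>Product formulas\<close>

definition qprod :: "complex \<Rightarrow> nat \<Rightarrow> complex" where "qprod Q m = (\<Prod>i<m. 1 - Q ^ Suc i)"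
definition euler :: "complex \<Rightarrow> complex" where "euler Q = (\<Prod>j. 1 - Q ^ Suc j)"

lemma qprod_Suc: "qprod Q (Suc m) = qprod Q m * (1 - Q ^ Suc m)"
  by (simp add: qprod_def)

lemma one_minus_power_nz: "norm (Q::complex) < 1 \<Longrightarrow> 1 - Q ^ Suc i \<noteq> 0"
proof
  assume Q: "norm Q < 1" and "1 - Q ^ Suc i = 0"
  then have "norm (Q ^ Suc i) = 1" by simp
  moreover have "norm (Q ^ Suc i) \<le> norm Q"
    unfolding norm_power using Q power_decreasing[of 1 "Suc i" "norm Q"] by simp
  ultimately show False using Q by simp
qed

lemma qprod_nz: "norm Q < 1 \<Longrightarrow> qprod Q m \<noteq> 0"
  using one_minus_power_nz by (auto simp: qprod_def)

lemma euler_lim: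
  assumes Q: "norm Q < 1"
  shows "(\<lambda>m. qprod Q m) \<longlonglongrightarrow> euler Q" "euler Q \<noteq> 0"
proof -
  have "summable (\<lambda>j. norm Q ^ Suc j)"
    unfolding power_Suc using Q by (intro summable_mult summable_geometric) simp
  then have "summable (\<lambda>j. norm ((1 - Q ^ Suc j) - 1))"
    by (simp add: norm_power del: power_Suc)
  then have c: "convergent_prod (\<lambda>j. 1 - Q ^ Suc j)"
    by (intro abs_convergent_prod_imp_convergent_prod summable_imp_abs_convergent_prod)
  have "(\<lambda>n. \<Prod>i\<le>n. 1 - Q ^ Suc i) \<longlonglongrightarrow> euler Q"
    unfolding euler_def by (rule convergent_prod_LIMSEQ[OF c])
  then have "(\<lambda>n. qprod Q (Suc n)) \<longlonglongrightarrow> euler Q" by (simp add: qprod_def lessThan_Suc_atMost)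
  then show "(\<lambda>m. qprod Q m) \<longlonglongrightarrow> euler Q" by (rule LIMSEQ_imp_Suc)
  show "euler Q \<noteq> 0" unfolding euler_def
    by (rule prodinf_nonzero[OF c one_minus_power_nz[OF Q]])
qed

text \<open>The reciprocal of the finite Euler product, continued by \<open>0\<close> so that the
  recurrence holds for all integers and finite sums may range over all of them.\<close>

definition rq :: "complex \<Rightarrow> int \<Rightarrow> complex" where
  "rq Q m = (if m < 0 then 0 else 1 / qprod Q (nat m))"

lemma rq_step:
  assumes "norm Q < 1"
  shows "rq Q (m - 1) = (1 - Q powi m) * rq Q m"
proof (cases "m > 0")
  case True
  then obtain k where k: "m = int (Suc k)" by (metis Suc_pred zero_less_imp_eq_int)
  then show ?thesis using qprod_nz[OF assms, of k] one_minus_power_nz[OF assms, of k]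
    by (simp add: rq_def qprod_Suc power_int_def nat_add_distrib del: power_Suc)
next
  case False
  then show ?thesis by (cases "m = 0") (simp_all add: rq_def)
qed

text \<open>Up to the factor \<open>qprod (q\<^sup>2) (2 * N)\<close> this is the summand of the
  finite triple product with the Gaussian binomial coefficient \<open>2 N\<close> over
  \<open>N + n\<close>.\<close>

definition jt_term :: "complex \<Rightarrow> complex \<Rightarrow> nat \<Rightarrow> int \<Rightarrow> complex" where
  "jt_term q w N n = q powi (n\<^sup>2) * w powi n * (rq (q\<^sup>2) (int N - n) * rq (q\<^sup>2) (int N + n))"

text \<open>Multiplication by the next factor
  \<open>(1 + w * q ^ (2 * N + 1)) * (1 + q ^ (2 * N + 1) / w)\<close>, written
  coefficientwise.\<close>

lemma jt_rec:
  assumes q: "norm q < 1" "q \<noteq> 0" and w: "w \<noteq> 0"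
  shows "(1 + q ^ (4 * N + 2)) * jt_term q w N n + q ^ (2 * N + 1) * (w * jt_term q w N (n - 1) + jt_term q w N (n + 1) / w)
    = (1 - q ^ (4 * N + 2)) * (1 - q ^ (4 * N + 4)) * jt_term q w (Suc N) n"
proof -
  define Q where "Q = q\<^sup>2"
  have Q: "norm Q < 1" "Q \<noteq> 0" using q by (auto simp: Q_def norm_power power_less_one_iff)
  \<comment> \<open>In terms of \<open>s\<close>, \<open>t\<close> and \<open>Q\<close>, with
    \<open>s * t = q ^ (4 * N + 4)\<close>, the recurrence is a rational identity.\<close>
  define s where "s = Q powi (int N + 1 - n)"
  define t where "t = Q powi (int N + 1 + n)"
  define R where "R = rq Q (int N + 1 - n) * rq Q (int N + 1 + n)"
  define X where "X = q powi (n\<^sup>2) * w powi n"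
  have q2: "q powi (2 * m) = Q powi m" for m using power_int_mult[of q 2 m] by (simp add: Q_def)
  have pw: "Q powi (m - 1) = Q powi m / Q" for m using Q(2) by (simp add: power_int_diff)
  have a1: "rq Q (int N - n) = (1 - s) * rq Q (int N + 1 - n)" "rq Q (int N + n) = (1 - t) * rq Q (int N + 1 + n)"
    using rq_step[OF Q(1), of "int N + 1 - n"] rq_step[OF Q(1), of "int N + 1 + n"] by (simp_all add: s_def t_def algebra_simps)
  have a2: "rq Q (int N + n - 1) = (1 - t / Q) * ((1 - t) * rq Q (int N + 1 + n))"
  proof -
    have "Q powi (int N + n) = t / Q" using pw[of "int N + 1 + n"] by (simp add: t_def add_ac)
    then show ?thesis using rq_step[OF Q(1), of "int N + n"] unfolding a1(2) by simp
  qed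
  have a3: "rq Q (int N - n - 1) = (1 - s / Q) * ((1 - s) * rq Q (int N + 1 - n))"
  proof -
    have "Q powi (int N - n) = s / Q" using pw[of "int N + 1 - n"] by (simp add: s_def algebra_simps)
    then show ?thesis using rq_step[OF Q(1), of "int N - n"] unfolding a1(1) by simp
  qed
  have t0: "jt_term q w N n = X * ((1 - s) * (1 - t) * R)"
    unfolding jt_term_def Q_def[symmetric] a1 by (simp add: X_def R_def mult_ac)
  have tS: "jt_term q w (Suc N) n = X * R"
    unfolding jt_term_def Q_def[symmetric] by (simp add: X_def R_def algebra_simps)
  have qs: "q ^ (2 * N + 1) * q powi ((n - 1)\<^sup>2) = q powi (n\<^sup>2) * s"
  proof -
    have "q ^ (2 * N + 1) * q powi ((n - 1)\<^sup>2) = q powi (int (2 * N + 1) + (n - 1)\<^sup>2)"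
      by (simp only: power_int_add[OF disjI1[OF q(2)]] power_int_of_nat)
    also have "int (2 * N + 1) + (n - 1)\<^sup>2 = n\<^sup>2 + 2 * (int N + 1 - n)" by (simp add: power2_eq_square algebra_simps)
    also have "q powi \<dots> = q powi (n\<^sup>2) * s"
      by (simp only: power_int_add[OF disjI1[OF q(2)]] q2 s_def)
    finally show ?thesis .
  qed
  have qt: "q ^ (2 * N + 1) * q powi ((n + 1)\<^sup>2) = q powi (n\<^sup>2) * t"
  proof -
    have "q ^ (2 * N + 1) * q powi ((n + 1)\<^sup>2) = q powi (int (2 * N + 1) + (n + 1)\<^sup>2)"
      by (simp only: power_int_add[OF disjI1[OF q(2)]] power_int_of_nat)
    also have "int (2 * N + 1) + (n + 1)\<^sup>2 = n\<^sup>2 + 2 * (int N + 1 + n)" by (simp add: power2_eq_square algebra_simps)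
    also have "q powi \<dots> = q powi (n\<^sup>2) * t"
      by (simp only: power_int_add[OF disjI1[OF q(2)]] q2 t_def)
    finally show ?thesis .
  qed
  have w1: "w * w powi (n - 1) = w powi n" "w powi (n + 1) / w = w powi n"
    using w by (simp_all add: power_int_diff power_int_add)
  have tm: "q ^ (2 * N + 1) * (w * jt_term q w N (n - 1)) = X * (s * ((1 - t / Q) * (1 - t)) * R)"
  proof -
    have "q ^ (2 * N + 1) * (w * jt_term q w N (n - 1)) =
       (q ^ (2 * N + 1) * q powi ((n - 1)\<^sup>2)) * (w * w powi (n - 1)) * (rq Q (int N + 1 - n) * rq Q (int N + n - 1))"
      unfolding jt_term_def Q_def[symmetric] by (simp add: algebra_simps)
    then show ?thesis unfolding qs w1 a2 by (simp add: X_def R_def mult_ac)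
  qed
  have tp: "q ^ (2 * N + 1) * (jt_term q w N (n + 1) / w) = X * (t * ((1 - s / Q) * (1 - s)) * R)"
  proof -
    have "q ^ (2 * N + 1) * (jt_term q w N (n + 1) / w) =
       (q ^ (2 * N + 1) * q powi ((n + 1)\<^sup>2)) * (w powi (n + 1) / w) * (rq Q (int N - n - 1) * rq Q (int N + 1 + n))"
      unfolding jt_term_def Q_def[symmetric] by (simp add: algebra_simps)
    then show ?thesis unfolding qt w1 a3 by (simp add: X_def R_def mult_ac)
  qed
  have st: "q ^ (4 * N + 4) = s * t"
  proof -
    have "s * t = Q powi (2 * int N + 2)" unfolding s_def t_def using Q(2) by (subst power_int_add[symmetric]) auto
    also have "\<dots> = Q ^ (2 * N + 2)" by (simp add: power_int_def nat_add_distrib nat_mult_distrib)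
    also have "\<dots> = q ^ (4 * N + 4)" unfolding Q_def power_mult[symmetric] by (rule arg_cong[where f = "power q"]) simp
    finally show ?thesis by simp
  qed
  have stQ: "q ^ (4 * N + 2) = s * t / Q"
  proof -
    have "q ^ (4 * N + 4) = q ^ (4 * N + 2) * Q" unfolding Q_def power_add[symmetric] by (rule arg_cong[where f = "power q"]) simp
    then show ?thesis using st Q(2) by simp
  qed
  show ?thesis unfolding distrib_left tm tp t0 tS st stQ
  proof -
    have "(1 + s * t / Q) * (X * ((1 - s) * (1 - t) * R)) + (X * (s * ((1 - t / Q) * (1 - t)) * R) + X * (t * ((1 - s / Q) * (1 - s)) * R))
      = X * R * ((1 + s * t / Q) * ((1 - s) * (1 - t)) + s * (1 - t / Q) * (1 - t) + t * (1 - s / Q) * (1 - s))"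
      by (simp only: distrib_left distrib_right mult_ac add_ac mult_1_left)
    also have "(1 + s * t / Q) * ((1 - s) * (1 - t)) + s * (1 - t / Q) * (1 - t) + t * (1 - s / Q) * (1 - s) = (1 - s * t / Q) * (1 - s * t)"
      unfolding divide_inverse by (simp add: algebra_simps)
    finally show "(1 + s * t / Q) * (X * ((1 - s) * (1 - t) * R)) + (X * (s * ((1 - t / Q) * (1 - t)) * R) + X * (t * ((1 - s / Q) * (1 - s)) * R))
      = (1 - s * t / Q) * (1 - s * t) * (X * R)" by (simp only: mult_ac)
  qed
qed

lemma jt_finite_support: "n \<notin> {- int N..int N} \<Longrightarrow> jt_term q w N n = 0"
  by (auto simp: jt_term_def rq_def)

lemma jt_summable: "jt_term q w N summable_on UNIV"
proof (rule finite_nonzero_values_imp_summable_on)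
  show "finite {x \<in> UNIV. jt_term q w N x \<noteq> 0}"
    by (rule finite_subset[of _ "{- int N..int N}"]) (use jt_finite_support in blast, simp)
qed

lemma jt_finite:
  assumes q: "norm q < 1" "q \<noteq> 0" and w: "w \<noteq> 0"
  shows "(\<Prod>j<N. (1 + w * q ^ (2 * j + 1)) * (1 + q ^ (2 * j + 1) / w)) = qprod (q\<^sup>2) (2 * N) * infsum (jt_term q w N) UNIV"
proof (induction N)
  case 0
  have "infsum (jt_term q w 0) UNIV = infsum (\<lambda>n::int. if n = 0 then 1 else 0) UNIV"
    by (intro infsum_cong) (auto simp: jt_term_def rq_def qprod_def)
  then show ?case using infsumI[OF has_sum_single_int[of 1]] by (simp add: qprod_def)
next
  case (Suc N)
  let ?T = "jt_term q w N" and ?p = "q ^ (2 * N + 1)"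
  have s: "(?T has_sum infsum ?T UNIV) UNIV" by (rule has_sum_infsum[OF jt_summable])
  have s1: "((\<lambda>n. ?T (n - 1)) has_sum infsum ?T UNIV) UNIV"
    by (rule iffD2[OF has_sum_reindex_bij_witness[of UNIV "\<lambda>n. n + 1" "\<lambda>n. n - 1"] s]) auto
  have s2: "((\<lambda>n. ?T (n + 1)) has_sum infsum ?T UNIV) UNIV"
    by (rule iffD2[OF has_sum_reindex_bij_witness[of UNIV "\<lambda>n. n - 1" "\<lambda>n. n + 1"] s]) auto
  have "((\<lambda>n. (1 + q ^ (4 * N + 2)) * ?T n + ?p * (w * ?T (n - 1) + (1 / w) * ?T (n + 1))) has_sum
     (1 + q ^ (4 * N + 2)) * infsum ?T UNIV + ?p * (w * infsum ?T UNIV + (1 / w) * infsum ?T UNIV)) UNIV"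
    by (intro has_sum_add has_sum_cmult_right s s1 s2)
  moreover have "(1 + q ^ (4 * N + 2)) * ?T n + ?p * (w * ?T (n - 1) + (1 / w) * ?T (n + 1)) = (1 - q ^ (4 * N + 2)) * (1 - q ^ (4 * N + 4)) * jt_term q w (Suc N) n" for n
    using jt_rec[OF q w, of N n] by simp
  ultimately have "(1 - q ^ (4 * N + 2)) * (1 - q ^ (4 * N + 4)) * infsum (jt_term q w (Suc N)) UNIV
     = (1 + q ^ (4 * N + 2)) * infsum ?T UNIV + ?p * (w * infsum ?T UNIV + (1 / w) * infsum ?T UNIV)"
    by (simp add: has_sum_iff infsum_cmult_right')
  also have "\<dots> = ((1 + w * ?p) * (1 + ?p / w)) * infsum ?T UNIV"
  proof -
    have "q ^ (4 * N + 2) = ?p * ?p" by (simp flip: power_add)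
    then have "(1 + w * ?p) * (1 + ?p / w) = (1 + q ^ (4 * N + 2)) + ?p * (w + 1 / w)"
      using w by (simp only:) (simp add: field_simps)
    then show ?thesis by (simp add: algebra_simps)
  qed
  finally have *: "(1 - q ^ (4 * N + 2)) * (1 - q ^ (4 * N + 4)) * infsum (jt_term q w (Suc N)) UNIV = ((1 + w * ?p) * (1 + ?p / w)) * infsum ?T UNIV" .
  have "qprod (q\<^sup>2) (2 * Suc N) = qprod (q\<^sup>2) (2 * N) * ((1 - q ^ (4 * N + 2)) * (1 - q ^ (4 * N + 4)))"
  proof -
    have "(q\<^sup>2) ^ Suc (2 * N) = q ^ (4 * N + 2)" "(q\<^sup>2) ^ Suc (Suc (2 * N)) = q ^ (4 * N + 4)"
      unfolding power_mult[symmetric] by (rule arg_cong[where f = "power q"]; simp)+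
    then show ?thesis by (simp add: qprod_Suc mult_ac del: power_Suc)
  qed
  then have "qprod (q\<^sup>2) (2 * Suc N) * infsum (jt_term q w (Suc N)) UNIV
    = qprod (q\<^sup>2) (2 * N) * (((1 + w * ?p) * (1 + ?p / w)) * infsum ?T UNIV)"
    unfolding *[symmetric] by (simp only: mult.assoc)
  also have "\<dots> = (\<Prod>j<Suc N. (1 + w * q ^ (2 * j + 1)) * (1 + q ^ (2 * j + 1) / w))"
    using Suc.IH by simp
  finally show ?case by simp
qed

text \<open>Tannery's theorem, carried over by an enumeration of the integers.\<close>

lemma infsum_int_dominated:
  fixes a :: "int \<Rightarrow> nat \<Rightarrow> complex"
  assumes "\<And>k. (\<lambda>n. a k n) \<longlonglongrightarrow> b k" "\<And>k n. norm (a k n) \<le> M k" "M summable_on UNIV"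
  shows "(\<lambda>n. infsum (\<lambda>k. a k n) UNIV) \<longlonglongrightarrow> infsum b UNIV"
proof -
  have bM: "norm (b k) \<le> M k" for k
    by (rule tendsto_upperbound[OF tendsto_norm[OF assms(1)]]) (use assms(2) in auto)
  have sM: "summable (\<lambda>i. M (int_decode i))"
    using assms(3) summable_on_reindex_bij_betw[OF bij_int_decode, of M] summable_on_imp_summable by blast
  have "(\<lambda>n. \<Sum>i. a (int_decode i) n) \<longlonglongrightarrow> (\<Sum>i. b (int_decode i))"
    using tannerys_theorem[of "\<lambda>i n. a (int_decode i) n" "\<lambda>i. b (int_decode i)" sequentially "\<lambda>i. M (int_decode i)"]
      assms(1,2) sM by (auto intro!: always_eventually)
  moreover have "infsum (\<lambda>k. a k n) UNIV = (\<Sum>i. a (int_decode i) n)" for n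
    by (rule infsum_int_decode, rule summable_on_norm_le[OF assms(3)]) (use assms(2) in auto)
  moreover have "infsum b UNIV = (\<Sum>i. b (int_decode i))"
    by (rule infsum_int_decode, rule summable_on_norm_le[OF assms(3)]) (use bM in auto)
  ultimately show ?thesis by simp
qed

text \<open>The finite identity passes to the limit by dominated convergence: each \<open>rq\<close>
  tends to \<open>1 / euler (q\<^sup>2)\<close> and is bounded uniformly in \<open>N\<close> and
  \<open>n\<close>.\<close>

theorem jacobi_triple_product:
  assumes q: "norm q < 1" "q \<noteq> 0" and w: "w \<noteq> 0"
    and sm: "(\<lambda>n. q powi (n\<^sup>2) * w powi n) summable_on UNIV"
  shows "(\<lambda>N. \<Prod>j<N. (1 + w * q ^ (2 * j + 1)) * (1 + q ^ (2 * j + 1) / w)) \<longlonglongrightarrow>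
    infsum (\<lambda>n. q powi (n\<^sup>2) * w powi n) UNIV / euler (q\<^sup>2)"
proof -
  define Q where "Q = q\<^sup>2"
  have Q: "norm Q < 1" using q by (simp add: Q_def norm_power power_less_one_iff)
  have qi: "(\<lambda>N. 1 / qprod Q N) \<longlonglongrightarrow> 1 / euler Q"
    by (intro tendsto_divide tendsto_const euler_lim Q)
  then obtain C where C: "\<And>N. norm (1 / qprod Q N) \<le> C"
    using convergent_imp_Bseq[of "\<lambda>N. 1 / qprod Q N"] by (auto simp: convergent_def Bseq_def)
  have C0: "C \<ge> 0" using order_trans[OF norm_ge_zero C] .
  have rC: "norm (rq Q m) \<le> C" for m using C[of "nat m"] C0 by (auto simp: rq_def)
  have rlim: "(\<lambda>N. rq Q (int N + m)) \<longlonglongrightarrow> 1 / euler Q" for m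
  proof -
    have "(\<lambda>N. rq Q (int (N + nat (-m)) + m)) \<longlonglongrightarrow> 1 / euler Q"
    proof -
      have "rq Q (int (N + nat (-m)) + m) = 1 / qprod Q (N + nat m)" for N
        by (cases "m \<ge> 0") (auto simp: rq_def nat_add_distrib)
      then show ?thesis using LIMSEQ_ignore_initial_segment[OF qi, of "nat m"] by simp
    qed
    then show ?thesis by (rule LIMSEQ_offset[where k = "nat (- m)"])
  qed
  have "(\<lambda>N. infsum (\<lambda>n. jt_term q w N n) UNIV) \<longlonglongrightarrow> infsum (\<lambda>n. q powi (n\<^sup>2) * w powi n * (1 / euler Q * (1 / euler Q))) UNIV"
  proof (rule infsum_int_dominated)
    show "(\<lambda>N. jt_term q w N n) \<longlonglongrightarrow> q powi (n\<^sup>2) * w powi n * (1 / euler Q * (1 / euler Q))" for n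
      unfolding jt_term_def Q_def[symmetric] using rlim[of n] rlim[of "- n"]
      by (intro tendsto_mult tendsto_const) simp_all
    show "norm (jt_term q w N n) \<le> norm (q powi (n\<^sup>2) * w powi n) * (C * C)" for n N
      unfolding jt_term_def Q_def[symmetric] norm_mult
      by (intro mult_left_mono mult_mono rC) (use C0 in auto)
    show "(\<lambda>n. norm (q powi (n\<^sup>2) * w powi n) * (C * C)) summable_on UNIV"
      using sm[unfolded summable_on_iff_abs_summable_on_complex] by (rule summable_on_cmult_left)
  qed
  moreover have "(\<lambda>N. qprod Q (2 * N)) \<longlonglongrightarrow> euler Q"
    using LIMSEQ_subseq_LIMSEQ[OF euler_lim(1)[OF Q], of "\<lambda>N. 2 * N"] by (simp add: strict_mono_def o_def)
  ultimately have "(\<lambda>N. qprod Q (2 * N) * infsum (jt_term q w N) UNIV) \<longlonglongrightarrow>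
      euler Q * infsum (\<lambda>n. q powi (n\<^sup>2) * w powi n * (1 / euler Q * (1 / euler Q))) UNIV"
    by (intro tendsto_mult) simp_all
  also have "euler Q * infsum (\<lambda>n. q powi (n\<^sup>2) * w powi n * (1 / euler Q * (1 / euler Q))) UNIV = infsum (\<lambda>n. q powi (n\<^sup>2) * w powi n) UNIV / euler Q"
    using euler_lim(2)[OF Q] by (simp only: infsum_cmult_left') simp
  finally show ?thesis unfolding jt_finite[OF q w] Q_def .
qed

section \<open>Euler products of the theta constants\<close>

lemma odd_prod:
  assumes q: "norm q < 1"
  shows "(\<lambda>N. \<Prod>j<N. 1 - q ^ (2 * j + 1)) \<longlonglongrightarrow> euler q / euler (q\<^sup>2)"
proof -
  have Q: "norm (q\<^sup>2) < 1" using q by (simp add: norm_power power_less_one_iff)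
  have e: "qprod q (2 * N) = qprod (q\<^sup>2) N * (\<Prod>j<N. 1 - q ^ (2 * j + 1))" for N
  proof (induction N)
    case (Suc N)
    have "(q\<^sup>2) ^ Suc N = q ^ Suc (Suc (2 * N))" unfolding power_mult[symmetric] by simp
    then show ?case using Suc by (simp add: qprod_Suc mult_ac del: power_Suc)
  qed (simp add: qprod_def)
  have "(\<lambda>N. qprod q (2 * N) / qprod (q\<^sup>2) N) \<longlonglongrightarrow> euler q / euler (q\<^sup>2)"
    using LIMSEQ_subseq_LIMSEQ[OF euler_lim(1)[OF q], of "\<lambda>N. 2 * N"] euler_lim[OF Q]
    by (intro tendsto_divide) (simp_all add: strict_mono_def o_def)
  then show ?thesis using qprod_nz[OF Q] by (simp add: e)
qed

lemma even_prod:
  assumes q: "norm q < 1"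
  shows "(\<lambda>N. \<Prod>j<N. 1 + q ^ Suc j) \<longlonglongrightarrow> euler (q\<^sup>2) / euler q"
proof -
  have Q: "norm (q\<^sup>2) < 1" using q by (simp add: norm_power power_less_one_iff)
  have e: "qprod (q\<^sup>2) N = qprod q N * (\<Prod>j<N. 1 + q ^ Suc j)" for N
  proof -
    have "1 - (q\<^sup>2) ^ Suc j = (1 - q ^ Suc j) * (1 + q ^ Suc j)" for j
    proof -
      have "(q\<^sup>2) ^ Suc j = q ^ Suc j * q ^ Suc j" by (simp only: power2_eq_square power_mult_distrib)
      then show ?thesis by (simp only:) (simp add: algebra_simps)
    qed
    then show ?thesis unfolding qprod_def by (simp only: prod.distrib)
  qed
  have "(\<lambda>N. qprod (q\<^sup>2) N / qprod q N) \<longlonglongrightarrow> euler (q\<^sup>2) / euler q"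
    by (intro tendsto_divide euler_lim q Q)
  then show ?thesis using qprod_nz[OF q] by (simp add: e)
qed

text \<open>Triple product at \<open>w = 1\<close>; the product of
  \<open>1 + q ^ (2 * j + 1)\<close> is the odd product for \<open>- q\<close>.\<close>

lemma thetaq_euler_neg:
  assumes q: "norm q < 1" "q \<noteq> 0"
  shows "thetaq q * euler (q\<^sup>2) = euler (- q) ^ 2"
proof -
  have Q: "norm (q\<^sup>2) < 1" using q by (simp add: norm_power power_less_one_iff)
  have p: "q powi (n\<^sup>2) * 1 powi n = q ^ nat (n\<^sup>2)" for n :: int by (simp add: power_int_def)
  have L: "(\<lambda>N. \<Prod>j<N. (1 + 1 * q ^ (2 * j + 1)) * (1 + q ^ (2 * j + 1) / 1)) \<longlonglongrightarrow> thetaq q / euler (q\<^sup>2)"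
    using jacobi_triple_product[OF q, of 1] summable_thetaq[OF q(1)] unfolding p thetaq_def by simp
  have "(\<lambda>N. (\<Prod>j<N. 1 - (- q) ^ (2 * j + 1)) * (\<Prod>j<N. 1 - (- q) ^ (2 * j + 1)))
     \<longlonglongrightarrow> (euler (- q) / euler ((- q)\<^sup>2)) * (euler (- q) / euler ((- q)\<^sup>2))"
    using q by (intro tendsto_mult odd_prod) simp_all
  then have "thetaq q / euler (q\<^sup>2) = (euler (- q) / euler (q\<^sup>2)) * (euler (- q) / euler (q\<^sup>2))"
    using L by (intro LIMSEQ_unique[OF L]) (simp add: prod.distrib)
  then have *: "thetaq q / euler (q\<^sup>2) = (euler (- q) / euler (q\<^sup>2)) ^ 2" by (simp only: power2_eq_square)
  have "t * e = b ^ 2" if "t / e = (b / e) ^ 2" "e \<noteq> 0" for t e b :: complex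
  proof -
    have "t * e = (t / e) * e\<^sup>2" using that(2) by (simp add: power2_eq_square)
    then show ?thesis unfolding that(1) using that(2) by (simp add: power_divide)
  qed
  from this[OF * euler_lim(2)[OF Q]] show ?thesis .
qed

text \<open>The second identity removes \<open>euler (- q)\<close>: the odd products for
  \<open>q\<close> and \<open>- q\<close> multiply to the odd product for
  \<open>q\<^sup>2\<close>.\<close>

lemma theta_products:
  assumes q: "norm q < 1" "q \<noteq> 0"
  shows "thetaq (- q) * euler (q\<^sup>2) = euler q ^ 2"
    "thetaq q * euler q ^ 2 * euler (q ^ 4) ^ 2 = euler (q\<^sup>2) ^ 5"
proof -
  have Q: "norm (q\<^sup>2) < 1" "norm (q ^ 4) < 1" using q by (simp_all add: norm_power power_less_one_iff)
  show "thetaq (- q) * euler (q\<^sup>2) = euler q ^ 2" using thetaq_euler_neg[of "- q"] q by simp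
  have "(\<lambda>N. (\<Prod>j<N. 1 - q ^ (2 * j + 1)) * (\<Prod>j<N. 1 - (- q) ^ (2 * j + 1)))
     \<longlonglongrightarrow> (euler q / euler (q\<^sup>2)) * (euler (- q) / euler ((- q)\<^sup>2))"
    using q by (intro tendsto_mult odd_prod) simp_all
  moreover have "(\<Prod>j<N. 1 - q ^ (2 * j + 1)) * (\<Prod>j<N. 1 - (- q) ^ (2 * j + 1)) = (\<Prod>j<N. 1 - (q\<^sup>2) ^ (2 * j + 1))" for N
  proof -
    have "(1 - q ^ (2 * j + 1)) * (1 - (- q) ^ (2 * j + 1)) = 1 - (q\<^sup>2) ^ (2 * j + 1)" for j
    proof -
      have "(- q) ^ (2 * j + 1) = - (q ^ (2 * j + 1))" by simp
      moreover have "(q\<^sup>2) ^ (2 * j + 1) = q ^ (2 * j + 1) * q ^ (2 * j + 1)"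
        by (simp only: power2_eq_square power_mult_distrib)
      ultimately show ?thesis by (simp only:) (simp add: algebra_simps)
    qed
    then show ?thesis unfolding prod.distrib[symmetric] by (intro prod.cong refl)
  qed
  ultimately have "(\<lambda>N. \<Prod>j<N. 1 - (q\<^sup>2) ^ (2 * j + 1)) \<longlonglongrightarrow> (euler q / euler (q\<^sup>2)) * (euler (- q) / euler ((- q)\<^sup>2))"
    by simp
  from LIMSEQ_unique[OF this odd_prod[OF Q(1)]]
  have *: "(euler q / euler (q\<^sup>2)) * (euler (- q) / euler (q\<^sup>2)) = euler (q\<^sup>2) / euler (q ^ 4)"
    unfolding power_mult[symmetric] by simp
  have "t * a ^ 2 * f ^ 2 = e ^ 5"
    if "(a / e) * (b / e) = e / f" "e \<noteq> 0" "f \<noteq> 0" "t * e = b ^ 2" for a b e f t :: complex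
  proof -
    have "a * b * f = ((a / e) * (b / e)) * (e * e * f)" using that(2) by simp
    also have "\<dots> = e ^ 3" unfolding that(1) using that(3) by (simp add: power3_eq_cube)
    finally have h: "a * b * f = e ^ 3" .
    have "e * (t * a ^ 2 * f ^ 2) = (t * e) * a ^ 2 * f ^ 2" by (simp only: mult_ac)
    also have "\<dots> = (a * b * f) ^ 2" unfolding that(4) by (simp only: power_mult_distrib mult_ac)
    also have "\<dots> = e * e ^ 5" unfolding h by (simp flip: power_mult power_Suc)
    finally show ?thesis using that(2) by simp
  qed
  from this[OF * euler_lim(2)[OF Q(1)] euler_lim(2)[OF Q(2)] thetaq_euler_neg[OF q]]
  show "thetaq q * euler q ^ 2 * euler (q ^ 4) ^ 2 = euler (q\<^sup>2) ^ 5" .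
qed

lemma pronic_nonneg: "0 \<le> m * (m + 1)" for m :: int
  by (cases "m \<ge> 0") (auto intro: mult_nonpos_nonpos)

lemma summable_pronic:
  assumes q: "norm q < 1"
  shows "(\<lambda>m::int. (q::complex) ^ nat (m * (m + 1))) summable_on UNIV"
proof -
  let ?r = "complex_of_real (norm q)"
  let ?g = "\<lambda>n::int. norm q ^ nat (n\<^sup>2)"
  have "(\<lambda>n::int. norm (?r ^ nat (n\<^sup>2))) summable_on UNIV"
    using summable_thetaq[of ?r] q unfolding summable_on_iff_abs_summable_on_complex[of "\<lambda>n::int. ?r ^ nat (n\<^sup>2)"] by simp
  then have g: "?g summable_on UNIV" by (simp add: norm_power)
  then have g1: "(\<lambda>n. ?g (n + 1)) summable_on UNIV"
    using summable_on_reindex_bij_betw[of "\<lambda>n. n + 1" UNIV UNIV ?g] by (simp add: bij_plus_right)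
  show ?thesis
  proof (rule summable_on_norm_le[OF summable_on_add[OF g g1]])
    fix m :: int
    have "norm q ^ nat (m * (m + 1)) \<le> ?g m \<or> norm q ^ nat (m * (m + 1)) \<le> ?g (m + 1)"
    proof (cases "m \<ge> 0")
      case True
      then have "nat (m\<^sup>2) \<le> nat (m * (m + 1))" by (intro nat_mono) (simp add: power2_eq_square algebra_simps)
      then show ?thesis using q by (intro disjI1 power_decreasing) auto
    next
      case False
      then have "nat ((m + 1)\<^sup>2) \<le> nat (m * (m + 1))" by (intro nat_mono) (simp add: power2_eq_square algebra_simps)
      then show ?thesis using q by (intro disjI2 power_decreasing) auto
    qed
    moreover have "0 \<le> ?g m" "0 \<le> ?g (m + 1)" by simp_all
    ultimately show "norm (q ^ nat (m * (m + 1))) \<le> ?g m + ?g (m + 1)" unfolding norm_power by linarith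
  qed
qed

text \<open>Triple product at \<open>w = q\<close>, which turns squares into the numbers
  \<open>m * (m + 1)\<close>.\<close>

lemma pronic_product:
  assumes q: "norm q < 1" "q \<noteq> 0"
  shows "infsum (\<lambda>m::int. q ^ nat (m * (m + 1))) UNIV * euler (q\<^sup>2) = 2 * euler (q ^ 4) ^ 2"
proof -
  have Q: "norm (q\<^sup>2) < 1" "norm (q ^ 4) < 1" using q by (simp_all add: norm_power power_less_one_iff)
  let ?S = "infsum (\<lambda>m::int. q ^ nat (m * (m + 1))) UNIV"
  have p: "q powi (n\<^sup>2) * q powi n = q ^ nat (n * (n + 1))" for n :: int
  proof -
    have "q powi (n\<^sup>2) * q powi n = q powi (n * (n + 1))"
      using q(2) by (simp add: power_int_add[symmetric] power2_eq_square distrib_left)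
    then show ?thesis using pronic_nonneg[of n] by (simp add: power_int_def)
  qed
  have L: "(\<lambda>N. \<Prod>j<N. (1 + q * q ^ (2 * j + 1)) * (1 + q ^ (2 * j + 1) / q)) \<longlonglongrightarrow> ?S / euler (q\<^sup>2)"
    using jacobi_triple_product[OF q q(2)] summable_pronic[OF q(1)] unfolding p by simp
  \<comment> \<open>Dividing by \<open>w = q\<close> shifts the second product by one index; its
    first factor is \<open>1 + 1\<close>, the source of the \<open>2\<close>.\<close>
  have e: "(\<Prod>j<Suc N. (1 + q * q ^ (2 * j + 1)) * (1 + q ^ (2 * j + 1) / q))
    = (\<Prod>j<Suc N. 1 + (q\<^sup>2) ^ Suc j) * (2 * (\<Prod>j<N. 1 + (q\<^sup>2) ^ Suc j))" for N
  proof -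
    have "1 + q * q ^ (2 * j + 1) = 1 + (q\<^sup>2) ^ Suc j" "1 + q ^ (2 * j + 1) / q = 1 + (q\<^sup>2) ^ j" for j
      unfolding power_mult[symmetric] using q(2) by (simp_all add: power2_eq_square)
    then have "(\<Prod>j<Suc N. (1 + q * q ^ (2 * j + 1)) * (1 + q ^ (2 * j + 1) / q)) = (\<Prod>j<Suc N. 1 + (q\<^sup>2) ^ Suc j) * (\<Prod>j<Suc N. 1 + (q\<^sup>2) ^ j)"
      by (simp only: prod.distrib)
    then show ?thesis by (simp only: prod.lessThan_Suc_shift[of "\<lambda>j. 1 + (q\<^sup>2) ^ j"]) simp
  qed
  have "(\<lambda>N. (\<Prod>j<Suc N. 1 + (q\<^sup>2) ^ Suc j) * (2 * (\<Prod>j<N. 1 + (q\<^sup>2) ^ Suc j))) \<longlonglongrightarrow>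
     (euler ((q\<^sup>2)\<^sup>2) / euler (q\<^sup>2)) * (2 * (euler ((q\<^sup>2)\<^sup>2) / euler (q\<^sup>2)))"
    by (intro tendsto_mult tendsto_const even_prod[OF Q(1)] LIMSEQ_Suc[OF even_prod[OF Q(1)]])
  then have "?S / euler (q\<^sup>2) = (euler ((q\<^sup>2)\<^sup>2) / euler (q\<^sup>2)) * (2 * (euler ((q\<^sup>2)\<^sup>2) / euler (q\<^sup>2)))"
    unfolding e[symmetric] by (rule LIMSEQ_unique[OF LIMSEQ_Suc[OF L]])
  then have *: "?S / euler (q\<^sup>2) = 2 * (euler (q ^ 4) / euler (q\<^sup>2)) ^ 2"
  proof -
    have "(q\<^sup>2)\<^sup>2 = q ^ 4" by simp
    then show ?thesis using \<open>?S / euler (q\<^sup>2) = _\<close> by (simp only: power2_eq_square[of "_ / _"] mult_ac)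
  qed
  have "S * e = 2 * f ^ 2" if "S / e = 2 * (f / e) ^ 2" "e \<noteq> 0" for S e f :: complex
  proof -
    have "S * e = (S / e) * e\<^sup>2" using that(2) by (simp add: power2_eq_square)
    then show ?thesis unfolding that(1) using that(2) by (simp add: power_divide)
  qed
  from this[OF * euler_lim(2)[OF Q(1)]] show ?thesis .
qed

text \<open>The odd squares are \<open>4 * m * (m + 1) + 1\<close>, so the difference is a pronic
  series in \<open>q ^ 4\<close>.\<close>

lemma theta_difference:
  assumes q: "norm q < 1" "q \<noteq> 0"
  shows "(thetaq q - thetaq (- q)) * euler (q ^ 8) = 4 * q * euler (q ^ 16) ^ 2"
proof -
  have Q: "norm (q ^ 4) < 1" using q by (simp_all add: norm_power power_less_one_iff)
  have e: "(q ^ 4)\<^sup>2 = q ^ 8" "(q ^ 4) ^ 4 = q ^ 16" by (simp_all add: power_mult[symmetric])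
  have "(thetaq q - thetaq (- q)) * euler (q ^ 8) = 2 * q * (infsum (\<lambda>m::int. (q ^ 4) ^ nat (m * (m + 1))) UNIV * euler (q ^ 8))"
    unfolding thetaq_split(2)[OF q(1)] by simp
  also have "\<dots> = 2 * q * (2 * euler (q ^ 16) ^ 2)"
    using pronic_product[OF Q] q(2) unfolding e by simp
  finally show ?thesis by simp
qed

section \<open>Bernoulli numbers\<close>

definition fps_of_rat :: "rat fps \<Rightarrow> complex fps" where
  "fps_of_rat F = Abs_fps (\<lambda>n. of_rat (fps_nth F n))"

lemma fps_of_rat_nth [simp]: "fps_nth (fps_of_rat F) n = of_rat (fps_nth F n)"
  by (simp add: fps_of_rat_def)

lemma fps_of_rat_mult: "fps_of_rat (F * G) = fps_of_rat F * fps_of_rat G"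
  by (rule fps_ext) (simp add: fps_mult_nth of_rat_sum of_rat_mult)

lemma fps_of_rat_diff: "fps_of_rat (F - G) = fps_of_rat F - fps_of_rat G"
  and fps_of_rat_add: "fps_of_rat (F + G) = fps_of_rat F + fps_of_rat G"
  by (rule fps_ext; simp add: of_rat_diff of_rat_add)+

lemma of_rat_fact: "of_rat (fact n) = (fact n :: complex)"
  by (metis of_nat_fact of_rat_of_nat_eq)

lemma fps_of_rat_simps [simp]: "fps_of_rat 0 = 0" "fps_of_rat 1 = 1" "fps_of_rat fps_X = fps_X"
  "fps_of_rat (fps_exp c) = fps_exp (of_rat c)"
  by (rule fps_ext; simp add: of_rat_divide of_rat_power fps_X_def of_rat_fact)+

lemma fps_of_rat_const [simp]: "fps_of_rat (fps_const c) = fps_const (of_rat c)"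
  by (rule fps_ext) simp

lemma fps_of_rat_sum: "fps_of_rat (sum f A) = (\<Sum>x\<in>A. fps_of_rat (f x))"
  by (induction A rule: infinite_finite_induct) (auto simp: fps_of_rat_add)

lemma fps_exp_minus_1_div:
  fixes N :: "'a :: field_char_0"
  assumes "N \<noteq> 0"
  shows "fps_X / (fps_exp N - 1) * (fps_exp N - 1) = (fps_X :: 'a fps)" "fps_exp N - 1 \<noteq> (0 :: 'a fps)"
proof -
  have n1: "fps_nth (fps_exp N - 1 :: 'a fps) 1 \<noteq> 0" using assms by simp
  then show nz: "fps_exp N - 1 \<noteq> (0 :: 'a fps)" by (metis fps_zero_nth)
  have "subdegree (fps_exp N - 1 :: 'a fps) \<le> 1" using n1 by (rule subdegree_leI)
  then have "(fps_exp N - 1 :: 'a fps) dvd fps_X"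
    by (subst fps_dvd_iff[OF nz]) auto
  then show "fps_X / (fps_exp N - 1) * (fps_exp N - 1) = (fps_X :: 'a fps)" by (rule dvd_div_mult_self)
qed

lemma fps_exp_add': "fps_exp a * fps_exp b = (fps_exp (a + b) :: complex fps)"
  by (simp add: fps_exp_add_mult)

section \<open>Nonvanishing Taylor coefficients of sech, cosh z / cosh 2z and tanh\<close>

definition sech_fps :: "complex fps" where "sech_fps = inverse (fps_const (1/2) * (fps_exp 1 + fps_exp (-1)))"

lemma sech_fps: "sech_fps * (fps_exp 1 + fps_exp (-1)) = 2"
proof -
  have "sech_fps * (fps_const (1/2) * (fps_exp 1 + fps_exp (-1))) = 1"
    unfolding sech_fps_def by (rule inverse_mult_eq_1) simp
  then have "fps_const 2 * (sech_fps * (fps_const (1/2) * (fps_exp 1 + fps_exp (-1)))) = fps_const 2" by simp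
  moreover have "fps_const 2 * (sech_fps * (fps_const (1/2) * (fps_exp 1 + fps_exp (-1)))) = (fps_const 2 * fps_const (1/2)) * (sech_fps * (fps_exp 1 + fps_exp (-1)))"
    by (simp only: mult_ac)
  moreover have "fps_const 2 * fps_const (1/2) = (1 :: complex fps)" by (simp only: fps_const_mult) simp
  ultimately show ?thesis by (simp add: numeral_fps_const)
qed

lemma cosh_fps: "(cosh :: complex \<Rightarrow> complex) has_fps_expansion fps_const (1/2) * (fps_exp 1 + fps_exp (-1))"
proof -
  have "(\<lambda>z::complex. 1/2 * (exp (1 * z) + exp ((-1) * z))) has_fps_expansion fps_const (1/2) * (fps_exp 1 + fps_exp (-1))"
    by (intro fps_expansion_intros)
  moreover have "(\<lambda>z::complex. 1/2 * (exp (1 * z) + exp ((-1) * z))) = cosh"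
    by (simp add: fun_eq_iff cosh_field_def)
  ultimately show ?thesis by simp
qed

lemma sech_expansion: "(\<lambda>z::complex. 1 / cosh z) has_fps_expansion sech_fps"
  unfolding sech_fps_def using has_fps_expansion_inverse[OF cosh_fps] by (simp add: inverse_eq_divide)

lemma sechder_fps: "sechder n 0 = fact n * fps_nth sech_fps n"
  using fps_nth_fps_expansion[OF sech_expansion, of n] by (simp add: sechder_def)

lemma sech2der_fps: "sech2der n 0 = fact n * fps_nth (sech_fps * sech_fps) n"
proof -
  have "(\<lambda>z::complex. (1 / cosh z) * (1 / cosh z)) has_fps_expansion sech_fps * sech_fps"
    by (intro has_fps_expansion_mult sech_expansion)
  then have "(\<lambda>z::complex. (1 / cosh z)\<^sup>2) has_fps_expansion sech_fps * sech_fps" by (simp add: power2_eq_square)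
  from fps_nth_fps_expansion[OF this, of n] show ?thesis by (simp add: sech2der_def)
qed

definition quart_fps :: "complex fps" where
  "quart_fps = (fps_const (1/2) * (fps_exp 1 + fps_exp (-1))) * inverse (fps_const (1/2) * (fps_exp 2 + fps_exp (-2)))"

lemma quart_fps: "quart_fps * (fps_exp 4 + 1) = fps_exp 3 + fps_exp 1"
proof -
  let ?D = "fps_const (1/2) * (fps_exp 2 + fps_exp (-2)) :: complex fps"
  have i: "inverse ?D * ?D = 1" by (rule inverse_mult_eq_1) simp
  have "fps_exp 4 + 1 = fps_const 2 * (fps_exp 2 * ?D)"
  proof -
    have "fps_const 2 * (fps_exp 2 * ?D) = (fps_const 2 * fps_const (1/2)) * (fps_exp 2 * fps_exp 2 + fps_exp 2 * fps_exp (-2))"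
      by (simp only: mult_ac distrib_left)
    also have "fps_const 2 * fps_const (1/2) = (1 :: complex fps)" by (simp only: fps_const_mult) simp
    finally show ?thesis by (simp add: fps_exp_add')
  qed
  then have "quart_fps * (fps_exp 4 + 1) = (fps_const 2 * fps_const (1/2)) * (fps_exp 2 * (fps_exp 1 + fps_exp (-1))) * (inverse ?D * ?D)"
    unfolding quart_fps_def by (simp only: mult_ac)
  also have "fps_const 2 * fps_const (1/2) = (1 :: complex fps)" by (simp only: fps_const_mult) simp
  also note i
  finally show ?thesis by (simp add: distrib_left fps_exp_add')
qed

lemma quart_expansion: "(\<lambda>z::complex. cosh z / cosh (2 * z)) has_fps_expansion quart_fps"
proof -
  have "(\<lambda>z::complex. 1/2 * (exp (2 * z) + exp ((-2) * z))) has_fps_expansion fps_const (1/2) * (fps_exp 2 + fps_exp (-2))"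
    by (intro fps_expansion_intros)
  from has_fps_expansion_mult[OF cosh_fps has_fps_expansion_inverse[OF this]]
  show ?thesis by (simp add: quart_fps_def inverse_eq_divide cosh_field_def)
qed

lemma egf_mult_exp:
  fixes F :: "complex fps"
  shows "fact n * fps_nth (F * fps_exp c) n = (\<Sum>j\<le>n. of_nat (n choose j) * c ^ j * (fact (n - j) * fps_nth F (n - j)))"
proof -
  have "fps_nth (F * fps_exp c) n = (\<Sum>j\<le>n. c ^ j / fact j * fps_nth F (n - j))"
    by (subst mult.commute) (simp add: fps_mult_nth atMost_atLeast0)
  then show ?thesis
    by (simp add: sum_distrib_left) (rule sum.cong, auto simp: binomial_fact field_simps)
qed

text \<open>The recursion from \<open>sech * (exp (2 * z) + 1) = 2 * exp z\<close> is integral after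
  division by \<open>2\<close> and determines the parity. This replaces a sign argument for the
  Euler numbers.\<close>

lemma sech_coeff_odd: "\<exists>z::int. sechder n 0 = of_int z \<and> (even n \<longrightarrow> odd z)"
proof (induction n rule: less_induct)
  case (less n)
  define e where "e = (\<lambda>n. sechder n 0)"
  have "\<forall>m. \<exists>z::int. m < n \<longrightarrow> e m = of_int z" using less by (auto simp: e_def)
  then obtain z :: "nat \<Rightarrow> int" where z: "\<And>m. m < n \<Longrightarrow> e m = of_int (z m)" by metis
  define S where "S = (\<Sum>j\<in>{1..n}. int (n choose j) * 2 ^ (j - 1) * z (n - j))"
  have "sech_fps * fps_exp 2 + sech_fps = sech_fps * (fps_exp 1 + fps_exp (-1)) * fps_exp 1"
    by (simp add: distrib_left distrib_right mult.assoc fps_exp_add')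
  also have "\<dots> = 2 * fps_exp 1" by (simp only: sech_fps)
  finally have "fact n * fps_nth (sech_fps * fps_exp 2 + sech_fps) n = 2"
    by (simp add: numeral_fps_const)
  then have "(\<Sum>j\<le>n. of_nat (n choose j) * 2 ^ j * e (n - j)) + e n = 2"
    by (simp add: distrib_left egf_mult_exp e_def sechder_fps)
  moreover have "{..n} = insert 0 {1..n}" by auto
  ultimately have "2 * e n = 2 - (\<Sum>j\<in>{1..n}. of_nat (n choose j) * 2 ^ j * e (n - j))"
    by (simp add: algebra_simps)
  also have "(\<Sum>j\<in>{1..n}. of_nat (n choose j) * 2 ^ j * e (n - j)) = 2 * of_int S"
    unfolding S_def of_int_sum sum_distrib_left
  proof (rule sum.cong)
    fix j assume j: "j \<in> {1..n}"
    then have "(2::complex) ^ j = 2 * 2 ^ (j - 1)" by (cases j) auto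
    then show "of_nat (n choose j) * 2 ^ j * e (n - j) = 2 * of_int (int (n choose j) * 2 ^ (j - 1) * z (n - j))"
      using z[of "n - j"] j by simp
  qed simp
  finally have "2 * e n = 2 * of_int (1 - S)" by (simp add: right_diff_distrib)
  then have en: "e n = of_int (1 - S)" by (simp only: mult_cancel_left) simp
  \<comment> \<open>Only \<open>j = 1\<close> lacks a factor \<open>2\<close>, and there the
    binomial coefficient is \<open>n\<close> itself.\<close>
  have "even S" if n: "even n"
    unfolding S_def
  proof (rule dvd_sum)
    fix j assume j: "j \<in> {1..n}"
    show "even (int (n choose j) * 2 ^ (j - 1) * z (n - j))" using n j by (cases "j = 1") auto
  qed
  then show ?case using en by (intro exI[of _ "1 - S"]) (auto simp: e_def)
qed

lemma sechder_nonzero: "even n \<Longrightarrow> sechder n 0 \<noteq> 0"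
  using sech_coeff_odd[of n] by auto

text \<open>Same recursion with base \<open>4\<close>: twice the coefficient is
  \<open>3 ^ n + 1\<close> modulo \<open>4\<close>, which is \<open>2\<close> for even
  \<open>n\<close>.\<close>

lemma quart_coeff_odd: "\<exists>z::int. fact n * fps_nth quart_fps n = of_int z \<and> (even n \<longrightarrow> odd z)"
proof (induction n rule: less_induct)
  case (less n)
  define e where "e = (\<lambda>n. fact n * fps_nth quart_fps n)"
  have "\<forall>m. \<exists>z::int. m < n \<longrightarrow> e m = of_int z" using less by (auto simp: e_def)
  then obtain z :: "nat \<Rightarrow> int" where z: "\<And>m. m < n \<Longrightarrow> e m = of_int (z m)" by metis
  define S where "S = (\<Sum>j\<in>{1..n}. int (n choose j) * 4 ^ (j - 1) * z (n - j))"
  have "fact n * fps_nth (quart_fps * fps_exp 4 + quart_fps) n = 3 ^ n + 1"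
    using quart_fps by (simp add: distrib_left)
  then have "(\<Sum>j\<le>n. of_nat (n choose j) * 4 ^ j * e (n - j)) + e n = 3 ^ n + 1"
    by (simp add: distrib_left egf_mult_exp e_def)
  moreover have "{..n} = insert 0 {1..n}" by auto
  ultimately have "2 * e n = 3 ^ n + 1 - (\<Sum>j\<in>{1..n}. of_nat (n choose j) * 4 ^ j * e (n - j))"
    by (simp add: algebra_simps)
  also have "(\<Sum>j\<in>{1..n}. of_nat (n choose j) * 4 ^ j * e (n - j)) = 4 * of_int S"
    unfolding S_def of_int_sum sum_distrib_left
  proof (rule sum.cong)
    fix j assume j: "j \<in> {1..n}"
    then have "(4::complex) ^ j = 4 * 4 ^ (j - 1)" by (cases j) auto
    then show "of_nat (n choose j) * 4 ^ j * e (n - j) = 4 * of_int (int (n choose j) * 4 ^ (j - 1) * z (n - j))"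
      using z[of "n - j"] j by simp
  qed simp
  finally have en: "2 * e n = of_int (3 ^ n + 1 - 4 * S)" by simp
  define w where "w = 3 ^ n + 1 - 4 * S"
  have "even (3 ^ n + 1 :: int)" by simp
  then have "even w" unfolding w_def by simp
  then obtain b where b: "w = 2 * b" by blast
  have "e n = of_int b" using en unfolding w_def[symmetric] b by simp
  moreover have "odd b" if n: "even n"
  proof -
    obtain k where k: "n = 2 * k" using n by blast
    have "[(9::int) ^ k = 1 ^ k] (mod 4)" by (rule cong_pow) (simp add: cong_def)
    then have "(3 ^ n :: int) mod 4 = 1" by (simp add: k power_mult cong_def)
    then have "w mod 4 = 2" unfolding w_def by presburger
    then show ?thesis unfolding b by presburger
  qed
  ultimately show ?case by (auto simp: e_def)
qed

lemma quart_nonzero: "even n \<Longrightarrow> fact n * fps_nth quart_fps n \<noteq> 0"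
  using quart_coeff_odd[of n] by auto

definition tanh_fps :: "complex fps" where
  "tanh_fps = (fps_exp 2 - 1) * inverse (fps_exp 2 + 1)"

lemma tanh_fps: "tanh_fps * (fps_exp 2 + 1) = fps_exp 2 - 1"
proof -
  have "inverse (fps_exp 2 + 1) * (fps_exp 2 + 1) = (1 :: complex fps)" by (rule inverse_mult_eq_1) simp
  then show ?thesis by (simp add: tanh_fps_def mult.assoc)
qed

lemma exp2_plus_1_nz: "fps_exp 2 + 1 \<noteq> (0 :: complex fps)"
proof
  assume "fps_exp 2 + 1 = (0 :: complex fps)"
  then have "fps_nth (fps_exp 2 + 1 :: complex fps) 0 = 0" by simp
  then show False by simp
qed

lemma sech_fps_square: "sech_fps * sech_fps * ((fps_exp 2 + 1) * (fps_exp 2 + 1)) = 4 * fps_exp 2"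
proof -
  have e: "fps_exp 2 + 1 = (fps_exp 1 + fps_exp (-1)) * (fps_exp 1 :: complex fps)"
    by (simp add: distrib_right fps_exp_add')
  have "sech_fps * sech_fps * ((fps_exp 2 + 1) * (fps_exp 2 + 1)) =
     (sech_fps * (fps_exp 1 + fps_exp (-1))) * (sech_fps * (fps_exp 1 + fps_exp (-1))) * (fps_exp 1 * fps_exp 1)"
    unfolding e by (simp only: mult_ac)
  then show ?thesis unfolding sech_fps by (simp add: fps_exp_add')
qed

lemma tanh_fps_square: "1 - tanh_fps * tanh_fps = sech_fps * sech_fps"
proof -
  let ?E = "fps_exp 2 + 1 :: complex fps"
  have "(1 - tanh_fps * tanh_fps) * (?E * ?E) = ?E * ?E - (tanh_fps * ?E) * (tanh_fps * ?E)"
    by (simp add: algebra_simps)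
  also have "\<dots> = 4 * fps_exp 2" unfolding tanh_fps by (simp add: algebra_simps)
  finally have "(1 - tanh_fps * tanh_fps) * (?E * ?E) = sech_fps * sech_fps * (?E * ?E)"
    unfolding sech_fps_square .
  then show ?thesis using exp2_plus_1_nz by simp
qed

lemma tanh_fps_deriv: "fps_deriv tanh_fps = 1 - tanh_fps * tanh_fps"
proof -
  let ?E = "fps_exp 2 + 1 :: complex fps"
  have "fps_deriv (tanh_fps * ?E) = fps_const 2 * fps_exp 2" unfolding tanh_fps by simp
  then have d: "fps_deriv tanh_fps * ?E = fps_const 2 * fps_exp 2 - tanh_fps * (fps_const 2 * fps_exp 2)"
    by (simp add: eq_diff_eq add.commute)
  have "fps_deriv tanh_fps * ?E * ?E = fps_const 2 * fps_exp 2 * ?E - (tanh_fps * ?E) * (fps_const 2 * fps_exp 2)"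
    unfolding d by (simp add: algebra_simps)
  also have "\<dots> = 4 * fps_exp 2" unfolding tanh_fps by (simp add: algebra_simps numeral_fps_const flip: fps_const_mult)
  finally have "fps_deriv tanh_fps * (?E * ?E) = sech_fps * sech_fps * (?E * ?E)"
    unfolding sech_fps_square by (simp only: mult.assoc)
  then have "fps_deriv tanh_fps = sech_fps * sech_fps" using exp2_plus_1_nz by simp
  then show ?thesis by (simp add: tanh_fps_square)
qed

lemma sech2der_tanh: "sech2der n 0 = fact (Suc n) * fps_nth tanh_fps (Suc n)"
proof -
  have "fps_nth (sech_fps * sech_fps) n = of_nat (Suc n) * fps_nth tanh_fps (Suc n)"
    using tanh_fps_deriv unfolding tanh_fps_square by (metis fps_deriv_nth Suc_eq_plus1)
  then show ?thesis by (simp add: sech2der_fps)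
qed

text \<open>In the recursion from \<open>tanh' = 1 - tanh\<^sup>2\<close> all products carry the
  same power of \<open>\<i>\<close>, so nothing cancels; for odd \<open>n > 1\<close> the product
  with the linear coefficient is strictly positive. This gives nonzero Bernoulli numbers of even
  index.\<close>

lemma tanh_fps_sign: "\<exists>\<tau>\<ge>0. fps_nth tanh_fps n = - (\<i> ^ (n + 1)) * complex_of_real \<tau> \<and> (odd n \<longrightarrow> \<tau> > 0)"
proof (induction n rule: less_induct)
  case (less n)
  have t0: "fps_nth tanh_fps 0 = 0" by (simp add: tanh_fps_def)
  have step: "of_nat (Suc m) * fps_nth tanh_fps (Suc m) = (if m = 0 then 1 else 0) - (\<Sum>i=0..m. fps_nth tanh_fps i * fps_nth tanh_fps (m - i))" for m
    using arg_cong[OF tanh_fps_deriv, of "\<lambda>f. fps_nth f m"] by (simp add: fps_mult_nth fps_one_nth)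
  consider "n = 0" | "n = 1" | m where "n = Suc m" "m \<ge> 1" by (cases n) force+
  then show ?case
  proof cases
    case 1 then show ?thesis using t0 by (intro exI[of _ 0]) auto
  next
    case 2 then show ?thesis using step[of 0] t0 by (intro exI[of _ 1]) auto
  next
    case 3
    have "\<forall>i. \<exists>\<tau>. i \<le> m \<longrightarrow> \<tau> \<ge> 0 \<and> fps_nth tanh_fps i = - (\<i> ^ (i + 1)) * complex_of_real \<tau> \<and> (odd i \<longrightarrow> \<tau> > 0)"
      using less 3 by (auto simp: less_Suc_eq_le)
    then obtain \<tau> where t: "\<And>i. i \<le> m \<Longrightarrow> \<tau> i \<ge> 0" "\<And>i. i \<le> m \<Longrightarrow> fps_nth tanh_fps i = - (\<i> ^ (i + 1)) * complex_of_real (\<tau> i)"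
      "\<And>i. i \<le> m \<Longrightarrow> odd i \<Longrightarrow> \<tau> i > 0" by metis
    define S where "S = (\<Sum>i=0..m. \<tau> i * \<tau> (m - i))"
    have "(\<Sum>i=0..m. fps_nth tanh_fps i * fps_nth tanh_fps (m - i)) = (\<Sum>i=0..m. \<i> ^ (m + 2) * complex_of_real (\<tau> i * \<tau> (m - i)))"
    proof (rule sum.cong)
      fix i assume "i \<in> {0..m}"
      then have i: "i \<le> m" "m - i \<le> m" "m + 2 = (i + 1) + (m - i + 1)" by auto
      show "fps_nth tanh_fps i * fps_nth tanh_fps (m - i) = \<i> ^ (m + 2) * complex_of_real (\<tau> i * \<tau> (m - i))"
        unfolding t(2)[OF i(1)] t(2)[OF i(2)] i(3) power_add[of \<i> "i + 1"] by simp
    qed simp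
    also have "\<dots> = \<i> ^ (m + 2) * complex_of_real S" by (simp add: S_def sum_distrib_left)
    finally have "of_nat (Suc m) * fps_nth tanh_fps (Suc m) = - (\<i> ^ (m + 2)) * complex_of_real S"
      using step[of m] 3 by simp
    then have "fps_nth tanh_fps n = - (\<i> ^ (n + 1)) * complex_of_real (S / real (Suc m))"
      using 3 by (simp add: field_simps del: of_nat_Suc)
    moreover have S0: "S \<ge> 0" unfolding S_def by (intro sum_nonneg mult_nonneg_nonneg t) auto
    moreover have "S > 0" if "odd n"
    proof -
      have m: "even m" "1 \<le> m" "m - 1 \<le> m" "odd (m - 1)" using that 3 by auto
      have "\<tau> 1 * \<tau> (m - 1) > 0" using t(3)[of 1] t(3)[of "m - 1"] m by simp
      also have "\<tau> 1 * \<tau> (m - 1) \<le> S" unfolding S_def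
        by (rule member_le_sum[of 1]) (use m t(1) in auto)
      finally show ?thesis .
    qed
    ultimately show ?thesis by (intro exI[of _ "S / real (Suc m)"]) auto
  qed
qed

lemma sech2der_nonzero: "even n \<Longrightarrow> sech2der n 0 \<noteq> 0"
  using tanh_fps_sign[of "Suc n"] by (auto simp: sech2der_tanh simp del: fact_Suc)

section \<open>Bernoulli numbers as Taylor coefficients\<close>

lemma gen_Bernoulli_fps:
  assumes "N > 0"
  shows "\<exists>G :: complex fps. (\<forall>n. of_rat (gen_Bernoulli D N n) = fact n * fps_nth G n) \<and>
     G * (fps_exp (of_nat N) - 1) = fps_X * (\<Sum>j=1..N. fps_const (of_int (chi D j)) * fps_exp (of_nat j))"
proof -
  define H where "H = fps_X / (fps_exp (of_nat N) - 1) * (\<Sum>j=1..N. fps_const (of_int (chi D j)) * fps_exp (of_nat j :: rat))"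
  have 1: "of_rat (gen_Bernoulli D N n) = fact n * fps_nth (fps_of_rat H) n" for n
    by (simp add: gen_Bernoulli_def H_def of_rat_mult of_rat_fact)
  have "H * (fps_exp (of_nat N) - 1) = fps_X / (fps_exp (of_nat N) - 1) * (fps_exp (of_nat N) - 1) * (\<Sum>j=1..N. fps_const (of_int (chi D j)) * fps_exp (of_nat j))"
    unfolding H_def by (simp only: mult_ac)
  also have "fps_X / (fps_exp (of_nat N) - 1) * (fps_exp (of_nat N) - 1) = (fps_X :: rat fps)"
    using assms by (intro fps_exp_minus_1_div(1)) simp
  finally have "fps_of_rat (H * (fps_exp (of_nat N) - 1)) = fps_of_rat (fps_X * (\<Sum>j=1..N. fps_const (of_int (chi D j)) * fps_exp (of_nat j)))"
    by simp
  then have "fps_of_rat H * (fps_exp (of_nat N) - 1) = fps_X * (\<Sum>j=1..N. fps_const (of_int (chi D j)) * fps_exp (of_nat j))"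
    by (simp add: fps_of_rat_mult fps_of_rat_diff fps_of_rat_sum)
  with 1 show ?thesis by blast
qed

text \<open>The generating function \<open>X * (exp X - exp (3 X)) / (exp (4 X) - 1)\<close>
  simplifies to \<open>- X / 2\<close> times \<open>sech X\<close>.\<close>

lemma gen_Bernoulli_4:
  "of_rat (gen_Bernoulli (-4) 4 (Suc n)) = - (of_nat (Suc n) / 2) * sechder n 0"
proof -
  obtain G :: "complex fps" where G: "\<And>n. of_rat (gen_Bernoulli (-4) 4 n) = fact n * fps_nth G n"
    "G * (fps_exp (of_nat 4) - 1) = fps_X * (\<Sum>j=1..4. fps_const (of_int (chi (-4) j)) * fps_exp (of_nat j))"
    using gen_Bernoulli_fps[of 4 "-4"] by auto
  have "{1..4} = {1, 2, 3, 4 :: nat}" by auto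
  then have "(\<Sum>j=1..4. fps_const (of_int (chi (-4) j)) * fps_exp (of_nat j)) = fps_exp 1 - (fps_exp 3 :: complex fps)"
    by (simp add: chi_minus4 chi4_def flip: fps_const_neg)
  then have G4: "G * (fps_exp 4 - 1) = fps_X * (fps_exp 1 - fps_exp 3)" using G(2) by simp
  have "(fps_const 2 * G + fps_X * sech_fps) * (fps_exp 4 - 1) = fps_const 2 * (G * (fps_exp 4 - 1)) + fps_X * (sech_fps * (fps_exp 4 - 1))"
    by (simp add: algebra_simps)
  also have "sech_fps * (fps_exp 4 - 1) = sech_fps * (fps_exp 1 + fps_exp (-1)) * (fps_exp 3 - fps_exp 1)"
    by (simp add: algebra_simps fps_exp_add')
  also have "\<dots> = fps_const 2 * (fps_exp 3 - fps_exp 1)" unfolding sech_fps by (simp add: numeral_fps_const)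
  finally have "(fps_const 2 * G + fps_X * sech_fps) * (fps_exp 4 - 1) = 0"
    unfolding G4 by (simp add: algebra_simps)
  moreover have "fps_exp 4 - 1 \<noteq> (0 :: complex fps)" by (rule fps_exp_minus_1_div(2)) simp
  ultimately have "fps_const 2 * G + fps_X * sech_fps = 0" by simp
  then have "fps_nth (fps_const 2 * G + fps_X * sech_fps) (Suc n) = 0" by simp
  then have "2 * fps_nth G (Suc n) = - fps_nth sech_fps n" by (simp add: eq_neg_iff_add_eq_0)
  then have "fps_nth G (Suc n) = - fps_nth sech_fps n / 2" by (simp add: field_simps)
  then show ?thesis unfolding G(1) by (simp add: sechder_fps)
qed

text \<open>The character sum factors as \<open>(exp X + exp (3 X)) * (1 - exp (4 X))\<close>, which
  leaves \<open>- X * cosh X / cosh (2 X)\<close>.\<close>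

lemma gen_Bernoulli_8:
  "of_rat (gen_Bernoulli (-2) 8 (Suc n)) = - of_nat (Suc n) * (fact n * fps_nth quart_fps n)"
proof -
  obtain G :: "complex fps" where G: "\<And>n. of_rat (gen_Bernoulli (-2) 8 n) = fact n * fps_nth G n"
    "G * (fps_exp (of_nat 8) - 1) = fps_X * (\<Sum>j=1..8. fps_const (of_int (chi (-2) j)) * fps_exp (of_nat j))"
    using gen_Bernoulli_fps[of 8 "-2"] by auto
  have "{1..8} = {1, 2, 3, 4, 5, 6, 7, 8 :: nat}" by auto
  then have "(\<Sum>j=1..8. fps_const (of_int (chi (-2) j)) * fps_exp (of_nat j)) = fps_exp 1 + fps_exp 3 - fps_exp 5 - (fps_exp 7 :: complex fps)"
    by (simp add: chi_minus2 chi8_def flip: fps_const_neg)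
  then have G8: "G * (fps_exp 8 - 1) = fps_X * (fps_exp 1 + fps_exp 3 - fps_exp 5 - fps_exp 7)" using G(2) by simp
  have "(G + fps_X * quart_fps) * (fps_exp 8 - 1) = G * (fps_exp 8 - 1) + fps_X * (quart_fps * (fps_exp 8 - 1))"
    by (simp add: algebra_simps)
  also have "quart_fps * (fps_exp 8 - 1) = quart_fps * (fps_exp 4 + 1) * (fps_exp 4 - 1)"
    by (simp add: algebra_simps fps_exp_add')
  also have "\<dots> = fps_exp 7 + fps_exp 5 - fps_exp 3 - fps_exp 1" unfolding quart_fps by (simp add: algebra_simps fps_exp_add')
  finally have "(G + fps_X * quart_fps) * (fps_exp 8 - 1) = 0"
    unfolding G8 by (simp add: algebra_simps)
  moreover have "fps_exp 8 - 1 \<noteq> (0 :: complex fps)" by (rule fps_exp_minus_1_div(2)) simp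
  ultimately have "G + fps_X * quart_fps = 0" by simp
  then have "fps_nth (G + fps_X * quart_fps) (Suc n) = 0" by simp
  then have "fps_nth G (Suc n) = - fps_nth quart_fps n" by (simp add: eq_neg_iff_add_eq_0)
  then show ?thesis unfolding G(1) by (simp add: algebra_simps)
qed

text \<open>With \<open>b(x) = x / (exp x - 1)\<close> one has
  \<open>x * tanh x = x - b(2 x) + b(4 x)\<close>, whence the factor \<open>4 ^ m - 2 ^ m\<close> at
  index \<open>m = n + 2\<close>.\<close>

lemma Bernoulli_tanh:
  "of_rat (Bernoulli (Suc (Suc n))) * (2 ^ (n + 2) * (2 ^ (n + 2) - 1)) = of_nat (n + 2) * sech2der n 0"
proof -
  define b where "b = fps_of_rat (fps_X / (fps_exp 1 - 1))"
  have B: "of_rat (Bernoulli m) = fact m * fps_nth b m" for m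
    by (simp add: Bernoulli_def b_def of_rat_mult of_rat_fact)
  have "fps_X / (fps_exp 1 - 1) * (fps_exp 1 - 1) = (fps_X :: rat fps)"
    by (rule fps_exp_minus_1_div(1)) simp
  then have "fps_of_rat (fps_X / (fps_exp 1 - 1) * (fps_exp 1 - 1)) = fps_X" by simp
  then have b: "b * (fps_exp 1 - 1) = fps_X" by (simp add: b_def fps_of_rat_mult fps_of_rat_diff)
  define bc where "bc = (\<lambda>c. fps_compose b (fps_const c * fps_X))"
  have bc: "bc c * (fps_exp c - 1) = fps_const c * fps_X" for c :: complex
    using arg_cong[OF b, of "\<lambda>f. fps_compose f (fps_const c * fps_X)"]
    by (simp add: bc_def fps_compose_mult_distrib fps_compose_sub_distrib fps_exp_compose_linear)
  have bn: "fps_nth (bc c) m = c ^ m * fps_nth b m" for c m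
    by (simp add: bc_def fps_nth_compose_linear)
  have "(fps_X * tanh_fps - (fps_X - bc 2 + bc 4)) * (fps_exp 4 - 1) = 0"
  proof -
    have e4: "fps_exp 4 - 1 = (fps_exp 2 - 1) * (fps_exp 2 + 1 :: complex fps)" by (simp add: algebra_simps fps_exp_add')
    have "(fps_X * tanh_fps - (fps_X - bc 2 + bc 4)) * (fps_exp 4 - 1) =
      fps_X * (tanh_fps * (fps_exp 2 + 1)) * (fps_exp 2 - 1) - fps_X * (fps_exp 2 - 1) * (fps_exp 2 + 1)
      + (bc 2 * (fps_exp 2 - 1)) * (fps_exp 2 + 1) - bc 4 * (fps_exp 4 - 1)"
      unfolding e4 by (simp add: algebra_simps)
    also have "\<dots> = fps_X * (fps_exp 2 - 1) * (fps_exp 2 - 1) - fps_X * (fps_exp 2 - 1) * (fps_exp 2 + 1)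
      + 2 * fps_X * (fps_exp 2 + 1) - 4 * fps_X"
      unfolding tanh_fps bc by (simp add: numeral_fps_const)
    also have "\<dots> = 0" by (simp add: algebra_simps)
    finally show ?thesis .
  qed
  moreover have "fps_exp 4 - 1 \<noteq> (0 :: complex fps)" by (rule fps_exp_minus_1_div(2)) simp
  ultimately have "fps_X * tanh_fps = fps_X - bc 2 + bc 4" by simp
  then have "fps_nth (fps_X * tanh_fps) (Suc (Suc n)) = fps_nth (fps_X - bc 2 + bc 4) (Suc (Suc n))" by simp
  then have t: "fps_nth tanh_fps (Suc n) = (4 ^ (n + 2) - 2 ^ (n + 2)) * fps_nth b (Suc (Suc n))"
    by (simp add: bn fps_X_nth algebra_simps)
  have "(4::complex) ^ (n + 2) = 2 ^ (n + 2) * 2 ^ (n + 2)" by (simp flip: power_mult_distrib)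
  then have "(4::complex) ^ (n + 2) - 2 ^ (n + 2) = 2 ^ (n + 2) * (2 ^ (n + 2) - 1)" by (simp only: right_diff_distrib mult_1_right)
  then show ?thesis unfolding B sech2der_tanh t by (simp add: mult_ac)
qed

section \<open>The four families of forms\<close>

text \<open>If \<open>D'' = (X\<^sup>2 + Y\<^sup>2) D - 2 D\<^sup>3\<close> and \<open>D = X\<close>, \<open>D' = 0\<close> at a point, then \<open>sechR n X Y\<close> and \<open>sechQ n X Y\<close>
  are the derivatives of order \<open>2 n\<close> of \<open>D\<close> and (for \<open>n \<ge> 1\<close>) of \<open>D\<^sup>2\<close> there. \<open>sechT\<close> is the value of
  \<open>D\<^sup>(\<^sup>2\<^sup>n\<^sup>) / D\<close> at the quarter point, where \<open>D\<close> is \<open>\<theta>(\<tau>) \<theta>(2 \<tau>)\<close>.\<close>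

definition sechR :: "nat \<Rightarrow> complex \<Rightarrow> complex \<Rightarrow> complex" where
  "sechR n X Y = X * ode_val 1 n (X\<^sup>2 + Y\<^sup>2) (- (X\<^sup>2 * Y\<^sup>2)) 1 (X\<^sup>2)"

definition sechQ :: "nat \<Rightarrow> complex \<Rightarrow> complex \<Rightarrow> complex" where
  "sechQ n X Y = ode_val 0 n (X\<^sup>2 + Y\<^sup>2) (- (X\<^sup>2 * Y\<^sup>2)) [:0, 1:] (X\<^sup>2)"

definition sechT :: "nat \<Rightarrow> complex \<Rightarrow> complex \<Rightarrow> complex" where
  "sechT n A B = ode_val 1 n ((A + B)\<^sup>2 / 4 + A * B) (- (A * B * ((A + B)\<^sup>2 / 4))) 1 (A * (A + B) / 2)"

text \<open>The cofactor of \<open>\<eta> - \<xi>\<close> in \<open>ode_val\<close> at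
  \<open>\<xi>\<close>: there the coefficient of the second derivative vanishes and the other two
  are \<open>\<eta> - \<xi>\<close> and \<open>2 * \<xi> * (\<eta> - \<xi>)\<close>.\<close>

definition sechH :: "nat \<Rightarrow> complex \<Rightarrow> complex \<Rightarrow> complex" where
  "sechH m \<xi> \<eta> = (let g = (ode_op 1 (\<xi> + \<eta>) (- (\<xi> * \<eta>)) ^^ m) 1 in poly g \<xi> + 2 * \<xi> * poly (pderiv g) \<xi>)"

lemma ode_val_scale_eq:
  assumes "\<alpha>' = t * \<alpha>" "\<gamma>' = t\<^sup>2 * \<gamma>" "x' = t * x" "\<And>x. poly p (t * x) = t ^ d * poly p x"
  shows "ode_val e n \<alpha>' \<gamma>' p x' = t ^ (n + d) * ode_val e n \<alpha> \<gamma> p x"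
  unfolding assms(1-3) by (rule ode_val_scale) (rule assms(4))

lemma sechR_scale: "sechR n (t * X) (t * Y) = t ^ (2 * n + 1) * sechR n X Y"
proof -
  have "ode_val 1 n ((t * X)\<^sup>2 + (t * Y)\<^sup>2) (- ((t * X)\<^sup>2 * (t * Y)\<^sup>2)) 1 ((t * X)\<^sup>2)
    = (t\<^sup>2) ^ (n + 0) * ode_val 1 n (X\<^sup>2 + Y\<^sup>2) (- (X\<^sup>2 * Y\<^sup>2)) 1 (X\<^sup>2)"
    by (rule ode_val_scale_eq) (simp_all add: power2_eq_square algebra_simps)
  then show ?thesis unfolding sechR_def by (simp add: power_mult)
qed

lemma sechQ_scale: "sechQ n (t * X) (t * Y) = t ^ (2 * n + 2) * sechQ n X Y"
proof -
  have "sechQ n (t * X) (t * Y) = (t\<^sup>2) ^ (n + 1) * sechQ n X Y"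
    unfolding sechQ_def by (rule ode_val_scale_eq) (simp_all add: power2_eq_square algebra_simps)
  then show ?thesis by (simp add: power_mult power2_eq_square)
qed

lemma sechT_scale: "sechT n (t * A) (t * B) = t ^ (2 * n) * sechT n A B"
proof -
  have "sechT n (t * A) (t * B) = (t\<^sup>2) ^ (n + 0) * sechT n A B"
    unfolding sechT_def by (rule ode_val_scale_eq) (simp_all add: power2_eq_square algebra_simps add_divide_distrib)
  then show ?thesis by (simp add: power_mult)
qed

lemma ode_val_Suc: "ode_val e (Suc n) \<alpha> \<gamma> p x = poly (ode_op e \<alpha> \<gamma> ((ode_op e \<alpha> \<gamma> ^^ n) p)) x"
  by (simp add: ode_val_def)

text \<open>In both cases the constant \<open>X\<close> solves the differential equation, so the
  derivatives of \<open>D\<^sup>2\<close> vanish.\<close>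

lemma sechQ_zero:
  assumes "n \<ge> 1" "X = 0 \<or> X\<^sup>2 = Y\<^sup>2"
  shows "sechQ n X Y = 0"
proof -
  obtain m where n: "n = Suc m" using assms(1) by (cases n) auto
  define \<xi> \<eta> where "\<xi> = X\<^sup>2" and "\<eta> = Y\<^sup>2"
  have "2 * - (\<xi> * \<eta>) + 4 * (\<xi> + \<eta>) * \<xi> - 6 * \<xi>\<^sup>2 = 0" "- (\<xi> * \<eta>) + (\<xi> + \<eta>) * \<xi> - \<xi>\<^sup>2 = 0"
    using assms(2) by (auto simp: \<xi>_def \<eta>_def power2_eq_square algebra_simps)
  then show ?thesis unfolding sechQ_def n ode_val_Suc poly_ode_op \<xi>_def[symmetric] \<eta>_def[symmetric] by simp
qed

lemma ode_val_at_root: "ode_val 1 (Suc m) (\<xi> + \<eta>) (- (\<xi> * \<eta>)) 1 \<xi> = (\<eta> - \<xi>) * sechH m \<xi> \<eta>"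
  unfolding ode_val_Suc poly_ode_op sechH_def Let_def by (simp add: power2_eq_square algebra_simps)

lemma sechR_Suc: "sechR (Suc m) X Y = X * ((Y\<^sup>2 - X\<^sup>2) * sechH m (X\<^sup>2) (Y\<^sup>2))"
  unfolding sechR_def ode_val_at_root ..

text \<open>At a double root \<open>ode_op\<close> annihilates the value and multiplies the
  remaining combination of value and derivative by \<open>- 4 * \<xi>\<close>. Needed to compare the
  first-order terms at \<open>u = - 1\<close>.\<close>

lemma sechH_diag: "sechH m \<xi> \<xi> = (- 4 * \<xi>) ^ m"
proof (induction m)
  case (Suc m)
  define g where "g = (ode_op 1 (\<xi> + \<xi>) (- (\<xi> * \<xi>)) ^^ m) 1"
  have "poly (ode_op 1 (\<xi> + \<xi>) (- (\<xi> * \<xi>)) g) \<xi> = 0"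
    unfolding poly_ode_op by (simp add: power2_eq_square algebra_simps)
  moreover have "poly (pderiv (ode_op 1 (\<xi> + \<xi>) (- (\<xi> * \<xi>)) g)) \<xi> = - 2 * poly g \<xi> - 4 * \<xi> * poly (pderiv g) \<xi>"
    unfolding ode_op_def pderiv_mult pderiv_add pderiv_pCons by (simp add: power2_eq_square algebra_simps)
  ultimately have "sechH (Suc m) \<xi> \<xi> = - 4 * \<xi> * sechH m \<xi> \<xi>"
    unfolding sechH_def Let_def funpow.simps o_apply g_def[symmetric] by (simp only:) (simp add: algebra_simps)
  then show ?case using Suc by simp
qed (simp add: sechH_def)

text \<open>Near the zero solution the equation linearises to
  \<open>D'' = \<alpha> * D\<close>.\<close>

lemma ode_val_gamma_0: "ode_val 1 n \<alpha> 0 1 0 = \<alpha> ^ n"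
proof (induction n)
  case (Suc n)
  then show ?case unfolding ode_val_Suc poly_ode_op by (simp add: ode_val_def)
qed (simp add: ode_val_def)

lemma ratpoly_sechH:
  assumes "ratpoly \<xi>" "ratpoly \<eta>"
  shows "ratpoly (\<lambda>u. sechH m (\<xi> u) (\<eta> u))"
proof -
  have P: "ratpolypoly (\<lambda>u. (ode_op 1 (\<xi> u + \<eta> u) (- (\<xi> u * \<eta> u)) ^^ m) 1)"
  proof (induction m)
    case 0
    then show ?case using ratpolypoly_const[of 1] by simp
  next
    case (Suc m)
    then show ?case using assms by (auto intro!: ratpolypoly_ode_op)
  qed
  show ?thesis unfolding sechH_def Let_def
    by (intro ratpoly_add ratpoly_mult ratpolypoly_poly[OF P] ratpolypoly_poly[OF ratpolypoly_pderiv[OF P]] assms ratpoly_const) simp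
qed

lemma ratpoly_sechQ: "ratpoly X \<Longrightarrow> ratpoly Y \<Longrightarrow> ratpoly (\<lambda>u. sechQ n (X u) (Y u))"
  unfolding sechQ_def
  by (intro ratpoly_ode_val ratpoly_add ratpoly_minus ratpoly_mult ratpoly_power ratcoeffs_intros) simp_all

lemma ratpoly_sechT: "ratpoly A \<Longrightarrow> ratpoly B \<Longrightarrow> ratpoly (\<lambda>u. sechT n (A u) (B u))"
  unfolding sechT_def
  by (intro ratpoly_ode_val ratpoly_add ratpoly_minus ratpoly_mult ratpoly_power ratpoly_divide) simp_all

text \<open>At \<open>u = - 1\<close> the first form has \<open>X\<^sup>2 = Y\<^sup>2\<close> and
  the second has \<open>X = 0\<close>, so both vanish; this saves one degree.\<close>

lemma form_linear_even:
  assumes n: "n \<ge> 1"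
  shows "\<exists>c. ratcoeffs c \<and> Polynomial.degree c \<le> n \<and> (\<forall>a b. a \<noteq> 0 \<longrightarrow> a + b \<noteq> 0 \<longrightarrow>
    sechQ n a b + sechQ n (a + b) (a - b) / 2 ^ (n + 1) = (a * (a + b) / 2) ^ (n + 1) * poly c (b * (a - b) / (2 * a * (a + b))))"
proof -
  have r: "ratpoly (\<lambda>u. sechQ n 1 u + sechQ n (1 + u) (1 - u) / 2 ^ (n + 1))"
    by (intro ratpoly_add ratpoly_divide ratpoly_sechQ ratpoly_const ratpoly_id ratpoly_diff) simp_all
  have z: "sechQ n 1 (- 1) + sechQ n (1 + - 1) (1 - - 1) / 2 ^ (n + 1) = 0"
    using n by (simp add: sechQ_zero)
  obtain \<xi> where \<xi>: "ratpoly \<xi>" "\<And>u. sechQ n 1 u + sechQ n (1 + u) (1 - u) / 2 ^ (n + 1) = (u - - 1) * \<xi> u"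
    using ratpoly_dvd[OF r _ z] by auto
  have s: "sechQ n (t * a) (t * b) = t ^ (2 * (n + 1)) * sechQ n a b" for t a b by (simp add: sechQ_scale)
  have "sechQ n 1 u + sechQ n (1 + u) (1 - u) / 2 ^ (n + 1) = (1 + u) ^ 1 * \<xi> u" for u
    unfolding \<xi>(2) by (simp add: add.commute)
  from form_symmetrization[of "sechQ n" "n + 1" 1, OF s _ \<xi>(1) this] show ?thesis by simp
qed

lemma form_quadratic_even:
  assumes n: "n \<ge> 1"
  shows "\<exists>c. ratcoeffs c \<and> Polynomial.degree c \<le> 2 * n + 1 \<and> (\<forall>a b. a \<noteq> 0 \<longrightarrow> a + b \<noteq> 0 \<longrightarrow>
    sechQ n (a\<^sup>2) (b\<^sup>2) + sechQ n ((a + b)\<^sup>2) ((a - b)\<^sup>2) / 2 ^ (2 * n + 2) = (a * (a + b) / 2) ^ (2 * n + 2) * poly c (b * (a - b) / (2 * a * (a + b))))"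
proof -
  define \<Phi> where "\<Phi> = (\<lambda>a b. sechQ n (a\<^sup>2) (b\<^sup>2))"
  have r: "ratpoly (\<lambda>u. \<Phi> 1 u + \<Phi> (1 + u) (1 - u) / 2 ^ (2 * n + 2))"
    unfolding \<Phi>_def by (intro ratpoly_add ratpoly_divide ratpoly_sechQ ratpoly_const ratpoly_id ratpoly_diff ratpoly_power) simp_all
  have z: "\<Phi> 1 (- 1) + \<Phi> (1 + - 1) (1 - - 1) / 2 ^ (2 * n + 2) = 0"
    using n by (simp add: \<Phi>_def sechQ_zero)
  obtain \<xi> where \<xi>: "ratpoly \<xi>" "\<And>u. \<Phi> 1 u + \<Phi> (1 + u) (1 - u) / 2 ^ (2 * n + 2) = (u - - 1) * \<xi> u"
    using ratpoly_dvd[OF r _ z] by auto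
  have s: "\<Phi> (t * a) (t * b) = t ^ (2 * (2 * n + 2)) * \<Phi> a b" for t a b
    unfolding \<Phi>_def power_mult_distrib sechQ_scale by (simp only: power_mult)
  have "\<Phi> 1 u + \<Phi> (1 + u) (1 - u) / 2 ^ (2 * n + 2) = (1 + u) ^ 1 * \<xi> u" for u
    unfolding \<xi>(2) by (simp add: add.commute)
  from form_symmetrization[of \<Phi> "2 * n + 2" 1, OF s _ \<xi>(1) this] show ?thesis unfolding \<Phi>_def by simp
qed

text \<open>The factor \<open>X\<close> of the derivative is the theta product itself and is already
  split off in \<open>sechT\<close>, so the weight is \<open>n\<close> and no zero at
  \<open>u = - 1\<close> has to be used.\<close>

lemma form_linear_odd:
  "\<exists>c. ratcoeffs c \<and> Polynomial.degree c \<le> n \<and> (\<forall>a b. a \<noteq> 0 \<longrightarrow> a + b \<noteq> 0 \<longrightarrow>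
    sechT n a b + sechT n (a + b) (a - b) / 2 ^ n = (a * (a + b) / 2) ^ n * poly c (b * (a - b) / (2 * a * (a + b))))"
proof -
  have r: "ratpoly (\<lambda>u. sechT n 1 u + sechT n (1 + u) (1 - u) / 2 ^ n)"
    by (intro ratpoly_add ratpoly_divide ratpoly_sechT ratpoly_const ratpoly_id ratpoly_diff) simp_all
  show ?thesis using form_symmetrization[of "sechT n" n 0, OF sechT_scale _ r] by simp
qed

text \<open>The first summand comes from the secant series for \<open>l\<close> at \<open>0\<close>,
  the second from the series for \<open>2 * l\<close> at \<open>\<i> * pi\<close>. The image under
  \<open>(a, b) \<mapsto> (a + b, a - b)\<close> will collect the dual series in
  \<open>F4\<close>.\<close>

definition sechM :: "nat \<Rightarrow> complex \<Rightarrow> complex \<Rightarrow> complex" where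
  "sechM n a b = sechR n (a\<^sup>2) (b\<^sup>2) / 4 ^ n + (-1) ^ (n + 1) * sechR n (a * b) ((a\<^sup>2 + b\<^sup>2) / 2)"

text \<open>At \<open>u = - 1\<close> the simple zeros of the first and the last term cancel to second order.\<close>

lemma form_quadratic_odd:
  assumes n: "n \<ge> 1"
  shows "\<exists>c. ratcoeffs c \<and> Polynomial.degree c \<le> 2 * n - 1 \<and> (\<forall>a b. a \<noteq> 0 \<longrightarrow> a + b \<noteq> 0 \<longrightarrow>
    sechM n a b + sechM n (a + b) (a - b) / 2 ^ (2 * n + 1) = (a * (a + b) / 2) ^ (2 * n + 1) * poly c (b * (a - b) / (2 * a * (a + b))))"
proof -
  obtain m where m: "n = Suc m" using n by (cases n) auto
  define r3 where "r3 = (\<lambda>u. ode_val 1 n (((1 + u)\<^sup>2)\<^sup>2 + ((1 - u)\<^sup>2)\<^sup>2) (- (((1 + u)\<^sup>2)\<^sup>2 * ((1 - u)\<^sup>2)\<^sup>2)) 1 (((1 + u)\<^sup>2)\<^sup>2))"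
  define r4 where "r4 = (\<lambda>u. ode_val 1 n (((1 + u) * (1 - u))\<^sup>2 + (1 + u\<^sup>2)\<^sup>2) (- (((1 + u) * (1 - u))\<^sup>2 * (1 + u\<^sup>2)\<^sup>2)) 1 (((1 + u) * (1 - u))\<^sup>2))"
  define G1 where "G1 = (\<lambda>u. (u - 1) * (u\<^sup>2 + 1) * sechH m 1 ((u\<^sup>2)\<^sup>2) / 4 ^ n
     + (-1) ^ (n + 1) * (u * (1 - u)\<^sup>2 * (1 + u) / 4 * sechH m (u\<^sup>2) (((1 + u\<^sup>2) / 2)\<^sup>2))
     + ((1 + u) * r3 u / 4 ^ n + (-1) ^ (n + 1) * ((1 - u) * r4 u)) / 2 ^ (2 * n + 1))"
  have r: "ratpoly G1" unfolding G1_def r3_def r4_def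
    by (intro ratpoly_add ratpoly_divide ratpoly_mult ratpoly_ode_val ratpoly_sechH ratpoly_const ratpoly_id ratpoly_diff ratpoly_power ratpoly_minus) simp_all
  have e1: "sechM n 1 u = (1 + u) * ((u - 1) * (u\<^sup>2 + 1) * sechH m 1 ((u\<^sup>2)\<^sup>2) / 4 ^ n
     + (-1) ^ (n + 1) * (u * (1 - u)\<^sup>2 * (1 + u) / 4 * sechH m (u\<^sup>2) (((1 + u\<^sup>2) / 2)\<^sup>2)))" for u
  proof -
    have "sechR n (1\<^sup>2) (u\<^sup>2) = (1 + u) * ((u - 1) * (u\<^sup>2 + 1) * sechH m 1 ((u\<^sup>2)\<^sup>2))"
      unfolding m sechR_Suc by (simp add: power2_eq_square algebra_simps)
    moreover have "sechR n (1 * u) ((1\<^sup>2 + u\<^sup>2) / 2) = (1 + u) * (u * (1 - u)\<^sup>2 * (1 + u) / 4 * sechH m (u\<^sup>2) (((1 + u\<^sup>2) / 2)\<^sup>2))"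
    proof -
      have "((1 + u\<^sup>2) / 2)\<^sup>2 - u\<^sup>2 = (1 + u) * (1 - u)\<^sup>2 * (1 + u) / 4"
        by (simp add: power2_eq_square field_simps)
      then show ?thesis unfolding m sechR_Suc by simp
    qed
    ultimately show ?thesis unfolding sechM_def by (simp only: distrib_left times_divide_eq_right mult_ac)
  qed
  have e2: "sechM n (1 + u) (1 - u) = (1 + u) * ((1 + u) * r3 u / 4 ^ n + (-1) ^ (n + 1) * ((1 - u) * r4 u))" for u
  proof -
    have "((1 + u)\<^sup>2 + (1 - u)\<^sup>2) / 2 = 1 + u\<^sup>2" by (simp add: power2_eq_square algebra_simps add_divide_distrib)
    then have s1: "sechR n ((1 + u) * (1 - u)) (((1 + u)\<^sup>2 + (1 - u)\<^sup>2) / 2) = (1 + u) * ((1 - u) * r4 u)"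
      by (simp only: sechR_def r4_def mult.assoc)
    have s2: "sechR n ((1 + u)\<^sup>2) ((1 - u)\<^sup>2) = (1 + u) * ((1 + u) * r3 u)"
      by (simp only: sechR_def r3_def mult.assoc power2_eq_square[of "1 + u"])
    show ?thesis unfolding sechM_def s1 s2 by (simp add: algebra_simps)
  qed
  have g: "sechM n 1 u + sechM n (1 + u) (1 - u) / 2 ^ (2 * n + 1) = (1 + u) * G1 u" for u
    unfolding e1 e2 G1_def by (simp only: distrib_left times_divide_eq_right mult_ac)
  \<comment> \<open>At \<open>u = - 1\<close> the parameters degenerate to
    \<open>\<alpha> = 4\<close> and \<open>\<gamma> = 0\<close>. The resulting contribution is
    opposite to that of \<open>sechH\<close> on the diagonal, so \<open>G1\<close> vanishes
    there.\<close>
  have "r4 (- 1) = 4 ^ n" unfolding r4_def using ode_val_gamma_0[of n 4] by simp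
  moreover have "(1 - - 1) * (4 :: complex) ^ n / 2 ^ (2 * n + 1) = 1" by (simp add: power_mult)
  moreover have "(- 1 - 1) * ((- 1)\<^sup>2 + 1) * (- 4) ^ m / (4 :: complex) ^ n = (- 1) ^ n"
    by (simp add: m power_minus[of "4 :: complex"])
  ultimately have z: "G1 (- 1) = 0"
    unfolding G1_def by (simp add: sechH_diag del: power_Suc) simp
  obtain \<xi> where \<xi>: "ratpoly \<xi>" "\<And>u. G1 u = (u - - 1) * \<xi> u"
    using ratpoly_dvd[OF r _ z] by auto
  have s: "sechM n (t * a) (t * b) = t ^ (2 * (2 * n + 1)) * sechM n a b" for t a b
  proof -
    have 1: "t * a * (t * b) = t\<^sup>2 * (a * b)" "((t * a)\<^sup>2 + (t * b)\<^sup>2) / 2 = t\<^sup>2 * ((a\<^sup>2 + b\<^sup>2) / 2)"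
      by (simp_all add: power2_eq_square algebra_simps add_divide_distrib)
    have s1: "sechR n ((t * a)\<^sup>2) ((t * b)\<^sup>2) = t ^ (2 * (2 * n + 1)) * sechR n (a\<^sup>2) (b\<^sup>2)"
      by (simp only: power_mult_distrib sechR_scale power_mult)
    have s2: "sechR n (t * a * (t * b)) (((t * a)\<^sup>2 + (t * b)\<^sup>2) / 2) = t ^ (2 * (2 * n + 1)) * sechR n (a * b) ((a\<^sup>2 + b\<^sup>2) / 2)"
      unfolding 1 by (simp only: sechR_scale power_mult)
    show ?thesis unfolding sechM_def s1 s2 by (simp only: distrib_left times_divide_eq_right mult_ac)
  qed
  have "sechM n 1 u + sechM n (1 + u) (1 - u) / 2 ^ (2 * n + 1) = (1 + u) ^ 2 * \<xi> u" for u
    unfolding g \<xi>(2) by (simp add: power2_eq_square algebra_simps)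
  from form_symmetrization[of "sechM n" "2 * n + 1" 2, OF s _ \<xi>(1) this] n show ?thesis by simp
qed

section \<open>Eisenstein series as forms in theta constants\<close>

definition lam :: "complex \<Rightarrow> complex" where "lam \<tau> = - (2 * of_real pi * \<i> * \<tau>)"

lemma nome_lam: "nome \<tau> = exp (- lam \<tau>)" by (simp add: nome_def lam_def)
lemma lam_mult: "lam (c * \<tau>) = c * lam \<tau>" by (simp add: lam_def)
lemma Re_lam: "Im \<tau> > 0 \<Longrightarrow> Re (lam \<tau>) > 0" by (simp add: lam_def)

lemma nome_props: "Im \<tau> > 0 \<Longrightarrow> norm (nome \<tau>) < 1" "nome \<tau> \<noteq> 0"
  using Re_lam[of \<tau>] by (simp_all add: nome_lam)

lemma nome_numeral: "nome (numeral m * \<tau>) = nome \<tau> ^ numeral m"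
proof -
  have "- (numeral m * lam \<tau>) = of_nat (numeral m) * (- lam \<tau>)" by simp
  then show ?thesis unfolding nome_lam lam_mult by (simp only: exp_of_nat_mult)
qed

lemma theta_nome: "theta \<tau> = thetaq (nome \<tau>)"
  unfolding theta_def thetaq_def by (intro infsum_cong) (simp add: power_int_def)

lemma eta_numeral: "eta (numeral m * \<tau>) = exp (2 * of_real pi * \<i> * \<tau> / 24) ^ numeral m * euler (nome \<tau> ^ numeral m)"
proof -
  have "2 * of_real pi * \<i> * (numeral m * \<tau>) / 24 = of_nat (numeral m) * (2 * of_real pi * \<i> * \<tau> / 24)"
    by (simp only: of_nat_numeral times_divide_eq_right mult_ac)
  then show ?thesis unfolding eta_def euler_def nome_numeral by (simp only: exp_of_nat_mult)
qed

lemma eta_1: "eta \<tau> = exp (2 * of_real pi * \<i> * \<tau> / 24) * euler (nome \<tau>)"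
  by (simp add: eta_def euler_def)

lemma nome_root: "exp (2 * of_real pi * \<i> * \<tau> / 24) ^ 24 = nome \<tau>"
  unfolding nome_def exp_of_nat_mult[symmetric] by (simp add: mult_ac)

text \<open>Elimination from the product formulas: \<open>a\<close>, \<open>b\<close>,
  \<open>a - b\<close>, \<open>a + b\<close> and \<open>t\<close> are all quotients of Euler
  products, so both invariants are as well.\<close>

lemma eta_quotient_x2:
  fixes q :: complex
  assumes "E1 \<noteq> 0" "E2 \<noteq> 0" "E4 \<noteq> 0" "E8 \<noteq> 0" "E16 \<noteq> 0"
    and "b * E2 = E1 ^ 2" "a * E1 ^ 2 * E4 ^ 2 = E2 ^ 5" "(a - b) * E8 = 4 * q * E16 ^ 2"
      "(a + b) / 2 * E4 ^ 2 * E16 ^ 2 = E8 ^ 5" "t * E2 ^ 2 * E8 ^ 2 = E4 ^ 5" "a ^ 2 + b ^ 2 = 2 * t ^ 2"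
  shows "b ^ 2 * (a ^ 2 - b ^ 2) / (4 * a ^ 2 * (a ^ 2 + b ^ 2)) = q * (E1 * E8 / (E2 * E4)) ^ 8"
    "b * (a - b) / (2 * a * (a + b)) = q * (E1 * E4 * E16) ^ 4 / (E2 * E8) ^ 6"
proof -
  have b: "b = E1 ^ 2 / E2" and a: "a = E2 ^ 5 / (E1 ^ 2 * E4 ^ 2)" and t: "t = E4 ^ 5 / (E2 ^ 2 * E8 ^ 2)"
    and d: "a - b = 4 * q * E16 ^ 2 / E8" and s: "a + b = 2 * E8 ^ 5 / (E4 ^ 2 * E16 ^ 2)"
    using assms by (simp_all add: field_simps)
  have "b ^ 2 * (a ^ 2 - b ^ 2) / (4 * a ^ 2 * (a ^ 2 + b ^ 2)) = b ^ 2 * ((a - b) * (a + b)) / (4 * a ^ 2 * (2 * t ^ 2))"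
    unfolding assms(11) by (simp add: power2_eq_square algebra_simps)
  also have "\<dots> = (E1 ^ 2 / E2) ^ 2 * ((4 * q * E16 ^ 2 / E8) * (2 * E8 ^ 5 / (E4 ^ 2 * E16 ^ 2))) /
      (4 * (E2 ^ 5 / (E1 ^ 2 * E4 ^ 2)) ^ 2 * (2 * (E4 ^ 5 / (E2 ^ 2 * E8 ^ 2)) ^ 2))"
    unfolding d s t unfolding a b ..
  also have "\<dots> = q * (E1 * E8 / (E2 * E4)) ^ 8"
    using assms(1-5) by (simp add: divide_simps power_mult_distrib) (simp add: eval_nat_numeral mult_ac)?
  finally show "b ^ 2 * (a ^ 2 - b ^ 2) / (4 * a ^ 2 * (a ^ 2 + b ^ 2)) = q * (E1 * E8 / (E2 * E4)) ^ 8" .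
  have "b * (a - b) / (2 * a * (a + b)) = (E1 ^ 2 / E2) * (4 * q * E16 ^ 2 / E8) / (2 * (E2 ^ 5 / (E1 ^ 2 * E4 ^ 2)) * (2 * E8 ^ 5 / (E4 ^ 2 * E16 ^ 2)))"
    unfolding d s unfolding a b ..
  also have "\<dots> = q * (E1 * E4 * E16) ^ 4 / (E2 * E8) ^ 6"
    using assms(1-5) by (simp add: divide_simps power_mult_distrib) (simp add: eval_nat_numeral mult_ac)?
  finally show "b * (a - b) / (2 * a * (a + b)) = q * (E1 * E4 * E16) ^ 4 / (E2 * E8) ^ 6" .
qed

lemma theta_values:
  assumes \<tau>: "Im \<tau> > 0"
  defines "q \<equiv> nome \<tau>"
  defines "a \<equiv> thetaq q" and "b \<equiv> thetaq (- q)"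
  shows "a \<noteq> 0" "a + b \<noteq> 0" "a ^ 2 + b ^ 2 \<noteq> 0"
    "(theta \<tau> * theta (2 * \<tau>)) ^ 2 = a ^ 2 * (a ^ 2 + b ^ 2) / 2"
    "theta \<tau> * theta (4 * \<tau>) = a * (a + b) / 2"
    "theta \<tau> * theta (2 * \<tau>) \<noteq> 0"
    "x2 \<tau> = b ^ 2 * (a ^ 2 - b ^ 2) / (4 * a ^ 2 * (a ^ 2 + b ^ 2))" "x2 \<tau> \<noteq> 0"
    "x4 \<tau> = b * (a - b) / (2 * a * (a + b))" "x4 \<tau> \<noteq> 0"
proof -
  have q: "norm q < 1" "q \<noteq> 0" using nome_props(1)[OF \<tau>] nome_props(2) by (simp_all add: q_def)
  have qn: "norm (q ^ m) < 1" if "m > 0" for m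
    unfolding norm_power using q that by (intro power_less_one_iff[THEN iffD2]) auto
  have E: "euler q \<noteq> 0" "euler (q ^ 2) \<noteq> 0" "euler (q ^ 4) \<noteq> 0" "euler (q ^ 8) \<noteq> 0" "euler (q ^ 16) \<noteq> 0"
    using qn q by (auto intro!: euler_lim(2))
  have t4: "(a + b) / 2 = thetaq (q ^ 4)" using thetaq_split(1)[OF q(1)] by (simp add: a_def b_def)
  have t2: "a ^ 2 + b ^ 2 = 2 * thetaq (q ^ 2) ^ 2" using thetaq_square_sum[OF q(1)] by (simp add: a_def b_def)
  have p1: "b * euler (q ^ 2) = euler q ^ 2" and p2: "a * euler q ^ 2 * euler (q ^ 4) ^ 2 = euler (q ^ 2) ^ 5"
    using theta_products[OF q] by (simp_all add: a_def b_def)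
  have p3: "(a - b) * euler (q ^ 8) = 4 * q * euler (q ^ 16) ^ 2"
    using theta_difference[OF q] by (simp add: a_def b_def)
  have p4: "(a + b) / 2 * euler (q ^ 4) ^ 2 * euler (q ^ 16) ^ 2 = euler (q ^ 8) ^ 5"
    using theta_products(2)[of "q ^ 4"] q(2) qn[of 4] by (simp add: t4 power_mult[symmetric])
  have p5: "thetaq (q ^ 2) * euler (q ^ 2) ^ 2 * euler (q ^ 8) ^ 2 = euler (q ^ 4) ^ 5"
    using theta_products(2)[of "q ^ 2"] q(2) qn[of 2] by (simp add: power_mult[symmetric])
  show a0: "a \<noteq> 0" using p2 E by auto
  show "a + b \<noteq> 0" using p4 E by auto
  have t20: "thetaq (q ^ 2) \<noteq> 0" using p5 E by auto
  then show "a ^ 2 + b ^ 2 \<noteq> 0" by (simp add: t2)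
  have th: "theta \<tau> = a" "theta (2 * \<tau>) = thetaq (q ^ 2)" "theta (4 * \<tau>) = (a + b) / 2"
    unfolding t4 by (simp_all add: theta_nome nome_numeral a_def q_def)
  show "(theta \<tau> * theta (2 * \<tau>)) ^ 2 = a ^ 2 * (a ^ 2 + b ^ 2) / 2"
    "theta \<tau> * theta (4 * \<tau>) = a * (a + b) / 2" "theta \<tau> * theta (2 * \<tau>) \<noteq> 0"
    using a0 t20 by (simp_all add: th t2 power_mult_distrib)
  \<comment> \<open>The powers of \<open>r\<close> add up to \<open>8 * (1 + 8 - 2 - 4) = 24\<close>
    in \<open>x2\<close> and to \<open>4 * (1 + 4 + 16) - 6 * (2 + 8) = 24\<close> in
    \<open>x4\<close>, which gives one factor \<open>q\<close> in each.\<close>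
  define r where "r = exp (2 * of_real pi * \<i> * \<tau> / 24)"
  have r: "r \<noteq> 0" "r ^ 24 = q" unfolding r_def q_def nome_root by simp_all
  have eta: "eta \<tau> = r * euler q" "eta (2 * \<tau>) = r ^ 2 * euler (q ^ 2)" "eta (4 * \<tau>) = r ^ 4 * euler (q ^ 4)"
    "eta (8 * \<tau>) = r ^ 8 * euler (q ^ 8)" "eta (16 * \<tau>) = r ^ 16 * euler (q ^ 16)"
    unfolding r_def q_def by (rule eta_1 eta_numeral)+
  have x2: "x2 \<tau> = q * (euler q * euler (q ^ 8) / (euler (q ^ 2) * euler (q ^ 4))) ^ 8"
  proof -
    have "(r * E1 * (r ^ 8 * E8) / (r ^ 2 * E2 * (r ^ 4 * E4))) ^ 8 = r ^ 24 * (E1 * E8 / (E2 * E4)) ^ 8"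
      if "E2 \<noteq> 0" "E4 \<noteq> 0" for E1 E2 E4 E8 :: complex
      using r(1) that by (simp add: divide_simps power_mult_distrib) (simp add: eval_nat_numeral mult_ac)?
    then show ?thesis unfolding x2_def eta r(2)[symmetric] using E unfolding r(2) by simp
  qed
  have x4: "x4 \<tau> = q * (euler q * euler (q ^ 4) * euler (q ^ 16)) ^ 4 / (euler (q ^ 2) * euler (q ^ 8)) ^ 6"
  proof -
    have "(r * E1 * (r ^ 4 * E4) * (r ^ 16 * E16)) ^ 4 / (r ^ 2 * E2 * (r ^ 8 * E8)) ^ 6 = r ^ 24 * (E1 * E4 * E16) ^ 4 / (E2 * E8) ^ 6"
      if "E2 \<noteq> 0" "E8 \<noteq> 0" for E1 E2 E4 E8 E16 :: complex
      using r(1) that by (simp add: divide_simps power_mult_distrib) (simp add: eval_nat_numeral mult_ac)?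
    then show ?thesis unfolding x4_def eta using E unfolding r(2) by simp
  qed
  note eq = eta_quotient_x2[OF E p1 p2 p3 p4 p5 t2]
  show "x2 \<tau> = b ^ 2 * (a ^ 2 - b ^ 2) / (4 * a ^ 2 * (a ^ 2 + b ^ 2))" unfolding x2 eq ..
  show "x4 \<tau> = b * (a - b) / (2 * a * (a + b))" unfolding x4 eq ..
  show "x2 \<tau> \<noteq> 0" "x4 \<tau> \<noteq> 0" unfolding x2 x4 using E q by simp_all
qed

section \<open>Eisenstein series as Lambert series\<close>

lemma two_power_ne_1: "(2 :: complex) ^ (2 * n + 2) \<noteq> 1"
proof
  assume "(2 :: complex) ^ (2 * n + 2) = 1"
  then have "norm ((2 :: complex) ^ (2 * n + 2)) = 1" by simp
  then have "(4 :: real) * 2 ^ (2 * n) = 1" by (simp add: norm_power norm_mult)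
  moreover have "(1 :: real) \<le> 2 ^ (2 * n)" by simp
  ultimately show False by linarith
qed

text \<open>The Bernoulli number is traded for \<open>sech2der (2 * n) 0\<close>, the middle term of
  the dual series, so that constant terms can be matched with it.\<close>

lemma Eis_lambert:
  assumes "Im \<tau> > 0"
  shows "Eis (2 * n + 2) \<tau> = 1 - 2 ^ (2 * n + 3) * (2 ^ (2 * n + 2) - 1) / sech2der (2 * n) 0 * lambert (npow (2 * n + 1)) one_fun (nome \<tau>)"
proof -
  have "(\<lambda>i. of_nat (div_sum (2 * n + 2 - 1) (Suc i)) * nome \<tau> ^ Suc i) sums lambert (npow (2 * n + 1)) one_fun (nome \<tau>)"
    using lambert_suminf[OF nome_props(1)[OF assms] npow_bound one_bound, of "2 * n + 1"] by (simp add: div_sum_def)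
  then have 1: "(\<Sum>i. of_nat (div_sum (2 * n + 2 - 1) (Suc i)) * nome \<tau> ^ Suc i) = lambert (npow (2 * n + 1)) one_fun (nome \<tau>)"
    by (simp add: sums_iff)
  define t where "t = sech2der (2 * n) 0"
  define B where "B = (of_rat (Bernoulli (2 * n + 2)) :: complex)"
  define N where "N = (of_nat (2 * n + 2) :: complex)"
  define M where "M = (2 ^ (2 * n + 2) - 1 :: complex)"
  have t: "t \<noteq> 0" unfolding t_def by (rule sech2der_nonzero) simp
  have "B * (2 ^ (2 * n + 2) * M) = N * t"
    using Bernoulli_tanh[of "2 * n"] by (simp add: B_def t_def N_def M_def)
  moreover have "N \<noteq> 0" unfolding N_def of_nat_eq_0_iff by simp
  ultimately have "2 * N / B = 2 * (2 ^ (2 * n + 2) * M) / t"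
    using t by (cases "B = 0") (auto simp: field_simps)
  also have "\<dots> = 2 ^ (2 * n + 3) * M / t" by (simp add: power_add)
  finally show ?thesis unfolding Eis_def 1 t_def[symmetric] B_def[symmetric] N_def[symmetric] M_def[symmetric] by simp
qed

lemma norm_of_int_le_1: "\<bar>m\<bar> \<le> 1 \<Longrightarrow> norm (of_int m :: complex) \<le> 1"
proof -
  assume "\<bar>m\<bar> \<le> 1"
  moreover have "norm (of_int m :: complex) = real_of_int \<bar>m\<bar>" by simp
  ultimately show ?thesis by linarith
qed

text \<open>Stated for an abstract character \<open>h\<close> and constant \<open>v\<close> so that
  the moduli 4 and 8 share the proof.\<close>

lemma Eis_character_lambert:
  assumes \<tau>: "Im \<tau> > 0"
    and B: "of_rat (gen_Bernoulli D N (Suc j)) = - of_nat (Suc j) * v" and v: "v \<noteq> 0"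
    and h: "\<And>n. n > 0 \<Longrightarrow> chi D n = h n" and h1: "\<And>n. \<bar>h n\<bar> \<le> 1"
  shows "Eis_inf D N (Suc j) \<tau> = 1 + 2 / v * lambert (\<lambda>n. of_int (h n) * npow j n) one_fun (nome \<tau>)"
    and "Eis_zero D N (Suc j) \<tau> = (if j = 0 then 1 else 0) + 2 / v * lambert (npow j) (\<lambda>n. of_int (h n)) (nome \<tau>)"
proof -
  have b1: "norm (of_int (h n) :: complex) \<le> 1" for n by (rule norm_of_int_le_1) (rule h1)
  have b2: "norm (of_int (h n) * npow j n :: complex) \<le> 1 * real n ^ j" for n
    unfolding norm_mult using b1[of n] by (intro mult_mono) (simp_all add: norm_power)
  have q: "norm (nome \<tau>) < 1" by (rule nome_props(1)[OF \<tau>])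
  have "chi D d = h d" if "d dvd Suc i" for i d
    using that by (intro h) (auto intro!: Nat.gr0I)
  then have "div_sum_inf D (Suc j - 1) (Suc i) = (\<Sum>d | d dvd Suc i. h d * int d ^ j)" for i
    unfolding div_sum_inf_def by (intro sum.cong refl) auto
  then have "(\<lambda>i. of_int (div_sum_inf D (Suc j - 1) (Suc i)) * nome \<tau> ^ Suc i) sums lambert (\<lambda>n. of_int (h n) * npow j n) one_fun (nome \<tau>)"
    using lambert_suminf[OF q b2 one_bound] by simp
  then have s1: "(\<Sum>i. of_int (div_sum_inf D (Suc j - 1) (Suc i)) * nome \<tau> ^ Suc i) = lambert (\<lambda>n. of_int (h n) * npow j n) one_fun (nome \<tau>)"
    by (simp add: sums_iff)
  have "chi D (Suc i div d) = h (Suc i div d)" if "d dvd Suc i" for i d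
    using that by (intro h) (auto elim!: dvdE intro!: Nat.gr0I split: if_splits)
  then have "div_sum_zero D (Suc j - 1) (Suc i) = (\<Sum>d | d dvd Suc i. int d ^ j * h (Suc i div d))" for i
    unfolding div_sum_zero_def by (intro sum.cong refl) (auto simp: mult.commute)
  then have "(\<lambda>i. of_int (div_sum_zero D (Suc j - 1) (Suc i)) * nome \<tau> ^ Suc i) sums lambert (npow j) (\<lambda>n. of_int (h n)) (nome \<tau>)"
    using lambert_suminf[OF q npow_bound b1] by simp
  then have s2: "(\<Sum>i. of_int (div_sum_zero D (Suc j - 1) (Suc i)) * nome \<tau> ^ Suc i) = lambert (npow j) (\<lambda>n. of_int (h n)) (nome \<tau>)"
    by (simp add: sums_iff)
  have N: "(of_nat (Suc j) :: complex) \<noteq> 0" by (simp del: of_nat_Suc)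
  have r: "2 * of_nat (Suc j) / (- of_nat (Suc j) * v) = - (2 / v)" using N v by (simp add: field_simps del: of_nat_Suc)
  show "Eis_inf D N (Suc j) \<tau> = 1 + 2 / v * lambert (\<lambda>n. of_int (h n) * npow j n) one_fun (nome \<tau>)"
    unfolding Eis_inf_def s1 B r by simp
  show "Eis_zero D N (Suc j) \<tau> = (if j = 0 then 1 else 0) + 2 / v * lambert (npow j) (\<lambda>n. of_int (h n)) (nome \<tau>)"
    unfolding Eis_zero_def s2 B r by simp
qed

text \<open>Symmetrizing \<open>sech\<close> around \<open>\<i> * pi / 4\<close> gives a multiple of
  \<open>cosh z / cosh (2 * z)\<close> and keeps the even derivatives, which links the middle term
  of the dual series to the Bernoulli numbers modulo 8.\<close>

lemma sechder_quarter:
  "sechder (2 * n) (\<i> * pi / 4) = sqrt 2 * (fact (2 * n) * fps_nth quart_fps (2 * n))"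
proof -
  define S where "S = {z::complex. \<bar>Im z\<bar> < pi / 4}"
  have S: "open S" unfolding S_def by (rule convex_strip_Im)
  define g where "g = (\<lambda>j z. sechder j (z + \<i> * pi / 4) + (-1) ^ j * sechder j (- z + \<i> * pi / 4))"
  have nz: "cosh (z + \<i> * pi / 4) \<noteq> 0" "cosh (- z + \<i> * pi / 4) \<noteq> 0" "cosh (2 * z) \<noteq> 0" if "z \<in> S" for z
    using that by (auto simp: S_def intro!: cosh_nz_Im)
  have dg: "(g j has_field_derivative g (Suc j) z) (at z)" if "z \<in> S" for j z
  proof -
    have "((\<lambda>z. sechder j (z + \<i> * pi / 4)) has_field_derivative sechder (Suc j) (z + \<i> * pi / 4) * 1) (at z)"
      by (rule DERIV_chain2[of "sechder j" _ "\<lambda>z. z + \<i> * pi / 4"], rule sechder_deriv(1)[OF nz(1)[OF that]]) (auto intro!: derivative_eq_intros)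
    moreover have "((\<lambda>z. sechder j (- z + \<i> * pi / 4)) has_field_derivative sechder (Suc j) (- z + \<i> * pi / 4) * (- 1)) (at z)"
      by (rule DERIV_chain2[of "sechder j" _ "\<lambda>z. - z + \<i> * pi / 4"], rule sechder_deriv(1)[OF nz(2)[OF that]]) (auto intro!: derivative_eq_intros)
    ultimately show ?thesis unfolding g_def by (auto intro!: derivative_eq_intros)
  qed
  define f where "f = (\<lambda>z::complex. of_real (2 * sqrt 2) * (cosh z / cosh (2 * z)))"
  have f: "(deriv ^^ j) f z = g j z" if "z \<in> S" for j z
    using that
  proof (induction j arbitrary: z)
    case 0
    show ?case using cosh_quarter[OF nz(3)[OF 0]] by (simp add: f_def g_def sechder_def)
  next
    case (Suc j)
    have "eventually (\<lambda>w. (deriv ^^ j) f w = g j w) (nhds z)"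
      using S Suc by (auto simp: eventually_nhds)
    then have "deriv ((deriv ^^ j) f) z = deriv (g j) z" by (rule deriv_cong_ev) simp
    also have "\<dots> = g (Suc j) z" by (rule DERIV_imp_deriv[OF dg[OF Suc.prems]])
    finally show ?case by simp
  qed
  have "f has_fps_expansion fps_const (of_real (2 * sqrt 2)) * quart_fps"
    unfolding f_def by (intro fps_expansion_intros quart_expansion)
  from fps_nth_fps_expansion[OF this, of "2 * n"]
  have "(deriv ^^ (2 * n)) f 0 = 2 * sqrt 2 * (fact (2 * n) * fps_nth quart_fps (2 * n))"
    by (simp add: field_simps)
  moreover have "(deriv ^^ (2 * n)) f 0 = 2 * sechder (2 * n) (\<i> * pi / 4)"
    using f[of 0 "2 * n"] by (simp add: S_def g_def)
  ultimately show ?thesis by simp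
qed

section \<open>The functions F2 and F4 as symmetrized forms\<close>

lemma theta_sech_values:
  assumes \<tau>: "Im \<tau> > 0"
  defines "q \<equiv> nome \<tau>" and "l \<equiv> lam \<tau>"
  defines "a \<equiv> thetaq q" and "b \<equiv> thetaq (- q)"
  shows "Re l > 0" "exp (- l) = q" "exp (- (numeral m * l)) = q ^ numeral m"
    "sechA l = a\<^sup>2" "sechB l = b\<^sup>2" "sechA (2 * l) = (a\<^sup>2 + b\<^sup>2) / 2" "sechB (2 * l) = a * b"
    "sechA (4 * l) = ((a + b) / 2)\<^sup>2" "sechS l = theta \<tau> * theta (2 * \<tau>)"
proof -
  have q: "norm q < 1" "q \<noteq> 0" using nome_props(1)[OF \<tau>] nome_props(2) by (simp_all add: q_def)
  show l: "Re l > 0" unfolding l_def by (rule Re_lam[OF \<tau>])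
  show e1: "exp (- l) = q" by (simp add: l_def q_def nome_lam)
  have e: "exp (- (numeral m * l)) = q ^ numeral m" for m
    using nome_numeral[of m \<tau>] by (simp add: nome_lam lam_mult l_def q_def)
  show "exp (- (numeral m * l)) = q ^ numeral m" by (rule e)
  show "sechA l = a\<^sup>2" "sechB l = b\<^sup>2" using sechA_theta[OF l] sechB_theta[OF l] by (simp_all add: e1 a_def b_def)
  show "sechA (2 * l) = (a\<^sup>2 + b\<^sup>2) / 2"
    using sechA_theta[of "2 * l"] l thetaq_square_sum[OF q(1)] unfolding e by (simp add: a_def b_def)
  show "sechB (2 * l) = a * b"
    using sechB_theta[of "2 * l"] l thetaq_mult_neg[OF q(1)] unfolding e by (simp add: a_def b_def)
  have th4: "thetaq (q ^ 4) = (a + b) / 2" using thetaq_split(1)[OF q(1)] by (simp add: a_def b_def)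
  show "sechA (4 * l) = ((a + b) / 2)\<^sup>2" using sechA_theta[of "4 * l"] l unfolding e th4 by simp
  show "sechS l = theta \<tau> * theta (2 * \<tau>)"
    using sechS_theta[OF l] by (simp add: e1 theta_nome nome_numeral q_def)
qed

text \<open>Common to both parts with \<open>K = 2 ^ k\<close> and \<open>X\<close> the respective
  power of \<open>2\<close>: the constants cancel in the first pair of Eisenstein series and leave
  \<open>X * t\<close> in the second, where \<open>t\<close> is the middle term of the dual
  series.\<close>

lemma even_weight_combination:
  fixes L1 :: complex
  assumes "\<kappa> = 2 * K * (K - 1) / t" "t \<noteq> 0" "K \<noteq> 1" "X \<noteq> 0"
  shows "(- s * (1 - \<kappa> * L1) - - s * (1 - \<kappa> * L2) - X * (1 - \<kappa> * Lu) + X * K * (1 - \<kappa> * Lv)) / (X * (K - 1)) * (t * X)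
    = s * (2 * K) * (L1 - L2) + X * (t + 2 * K * (Lu - K * Lv))"
proof -
  have "t * (- s * (1 - \<kappa> * L1) - - s * (1 - \<kappa> * L2) - X * (1 - \<kappa> * Lu) + X * K * (1 - \<kappa> * Lv))
    = (t * \<kappa>) * (s * (L1 - L2) + X * (Lu - K * Lv)) + X * (K - 1) * t" by (simp add: algebra_simps)
  also have "t * \<kappa> = 2 * K * (K - 1)" using assms by simp
  also have "2 * K * (K - 1) * (s * (L1 - L2) + X * (Lu - K * Lv)) + X * (K - 1) * t
    = (K - 1) * (s * (2 * K) * (L1 - L2) + X * (t + 2 * K * (Lu - K * Lv)))" by (simp add: algebra_simps)
  finally have e: "t * (- s * (1 - \<kappa> * L1) - - s * (1 - \<kappa> * L2) - X * (1 - \<kappa> * Lu) + X * K * (1 - \<kappa> * Lv)) = \<dots>" .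
  have r: "N / (X * (K - 1)) * (t * X) = t * N / (K - 1)" for N using assms(4) by simp
  show ?thesis unfolding r e using assms(3) by simp
qed

lemma sechQ_half: "sechQ n (X / 2) (Y / 2) = sechQ n X Y / 4 ^ (n + 1)"
proof -
  have "sechQ n (1 / 2 * X) (1 / 2 * Y) = (1 / 2) ^ (2 * (n + 1)) * sechQ n X Y" unfolding sechQ_scale by simp
  moreover have "(1 / 2 :: complex) ^ (2 * (n + 1)) = 1 / 4 ^ (n + 1)"
    by (simp only: power_mult) (simp add: power_divide)
  ultimately show ?thesis by (simp only: times_divide_eq_left mult_1_left)
qed

lemma sech2_chain:
  assumes "Re l > 0" "n \<ge> 1"
  shows "sech2der (2 * n) 0 + exp_series (geo_coeff sech2_coeff (2 * l)) (2 * n) 0 = sechQ n (sechA (2 * l)) (sechA l - sechA (2 * l))"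
  using bisech_derivatives(2)[of 0 "2 * l" n] assms
  by (simp add: bisech_0 bisech_alpha_def bisech_gamma_def sechQ_def)

lemma csch_chain:
  assumes "Re l > 0" "n \<ge> 1"
  shows "(- 4) ^ n * exp_series (hcsc l) (2 * n) 0 = sechQ n (sechA l) (sechB l)"
  using sech_series_square_derivatives[OF assms] by (simp add: sechQ_def)

text \<open>The pair at \<open>\<tau>\<close>, \<open>2 * \<tau>\<close> is the cosecant series at
  \<open>0\<close>; the pair at \<open>4 * \<tau>\<close>, \<open>8 * \<tau>\<close> is the squared
  dual series for \<open>2 * l\<close>, whose parameters are half of \<open>A + B\<close> and
  \<open>A - B\<close>.\<close>

lemma F2_even:
  assumes \<tau>: "Im \<tau> > 0" and n: "n \<ge> 1"
  defines "A \<equiv> thetaq (nome \<tau>) ^ 2" and "B \<equiv> thetaq (- nome \<tau>) ^ 2"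
  shows "F2 (2 * n + 2) \<tau> * (sech2der (2 * n) 0 * 2 ^ (n + 1)) = sechQ n A B + sechQ n (A + B) (A - B) / 2 ^ (n + 1)"
proof -
  note v = theta_sech_values[OF \<tau>]
  define L where "L = (\<lambda>q. lambert (npow (2 * n + 1)) one_fun q)"
  define K :: complex where "K = 2 ^ (2 * n + 2)"
  define t where "t = sech2der (2 * n) 0"
  define q where "q = nome \<tau>"
  define \<kappa> where "\<kappa> = 2 * K * (K - 1) / t"
  have E: "Eis (2 * n + 2) w = 1 - \<kappa> * L (nome w)" if "Im w > 0" for w
    unfolding Eis_lambert[OF that] \<kappa>_def K_def t_def L_def by (simp add: power_add)
  have t: "t \<noteq> 0" unfolding t_def by (rule sech2der_nonzero) simp
  have K1: "K \<noteq> 1" unfolding K_def by (rule two_power_ne_1)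
  have P0: "(2 :: complex) ^ (n + 1) \<noteq> 0" by simp
  have P: "(8 :: complex) ^ (n + 1) = 2 ^ (n + 1) * K"
  proof -
    have "(8 :: complex) = 2 * 4" by simp
    then show ?thesis unfolding K_def by (simp only: power_mult_distrib) (simp add: power_mult)
  qed
  have o: "\<not> odd (2 * n + 2)" "(2 * n + 2) div 2 = n + 1" "2 * n + 2 \<noteq> 1" by simp_all
  have m: "(- 1 :: complex) ^ (n + 1) = - ((- 1) ^ n)" by simp
  have Em: "Eis (2 * n + 2) \<tau> = 1 - \<kappa> * L q" "Eis (2 * n + 2) (numeral m * \<tau>) = 1 - \<kappa> * L (q ^ numeral m)" for m
    using E[OF \<tau>] E[of "numeral m * \<tau>"] \<tau> unfolding nome_numeral q_def by simp_all
  have "F2 (2 * n + 2) \<tau> = (- ((-1) ^ n) * (1 - \<kappa> * L q) - - ((-1) ^ n) * (1 - \<kappa> * L (q ^ 2)) - 2 ^ (n + 1) * (1 - \<kappa> * L (q ^ 4)) + 2 ^ (n + 1) * K * (1 - \<kappa> * L (q ^ 8))) / (2 ^ (n + 1) * (K - 1))"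
    unfolding F2_def if_not_P[OF o(1)] o(2) K_def[symmetric] P m Em ..
  then have "F2 (2 * n + 2) \<tau> * (t * 2 ^ (n + 1)) = (-1) ^ n * (2 * K) * (L q - L (q ^ 2)) + 2 ^ (n + 1) * (t + 2 * K * (L (q ^ 4) - K * L (q ^ 8)))"
    by (simp only: even_weight_combination[OF \<kappa>_def t K1 P0])
  also have "(-1) ^ n * (2 * K) * (L q - L (q ^ 2)) = (- 4) ^ n * exp_series (hcsc (lam \<tau>)) (2 * n) 0"
    using csch_lambert[OF v(1), of "2 * n"] unfolding v(2,3) L_def q_def K_def
    by (simp add: power_mult power_minus[of 4])
  also have "\<dots> = sechQ n A B" unfolding csch_chain[OF v(1) n] v A_def B_def ..
  also have "2 * K * (L (q ^ 4) - K * L (q ^ 8)) = exp_series (geo_coeff sech2_coeff (2 * lam \<tau>)) (2 * n) 0"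
    using sech2_dual_lambert[of "2 * lam \<tau>" "2 * n"] v(1) unfolding mult.assoc[symmetric]
    by (simp add: v L_def q_def K_def power_add)
  also have "t + \<dots> = sechQ n ((A + B) / 2) ((A - B) / 2)"
    unfolding t_def sech2_chain[OF v(1) n] unfolding v A_def B_def by (simp add: field_simps)
  also have "2 ^ (n + 1) * \<dots> = sechQ n (A + B) (A - B) / 2 ^ (n + 1)"
  proof -
    have "(4 :: complex) ^ (n + 1) = 2 ^ (n + 1) * 2 ^ (n + 1)" by (simp only: power_mult_distrib[symmetric]) simp
    then show ?thesis unfolding sechQ_half by simp
  qed
  finally show ?thesis unfolding t_def .
qed

text \<open>As for \<open>F2\<close>, but with the dual series for \<open>4 * l\<close>: its
  parameters are the squares of \<open>(a + b) / 2\<close> and \<open>(a - b) / 2\<close>, so the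
  substitution acts on \<open>a\<close> and \<open>b\<close> instead of their squares.\<close>

lemma F4_even:
  assumes \<tau>: "Im \<tau> > 0" and n: "n \<ge> 1"
  defines "a \<equiv> thetaq (nome \<tau>)" and "b \<equiv> thetaq (- nome \<tau>)"
  shows "F4 (2 * n + 2) \<tau> * (sech2der (2 * n) 0 * 2 ^ (2 * n + 2)) = sechQ n (a\<^sup>2) (b\<^sup>2) + sechQ n ((a + b)\<^sup>2) ((a - b)\<^sup>2) / 2 ^ (2 * n + 2)"
proof -
  note v = theta_sech_values[OF \<tau>]
  define L where "L = (\<lambda>q. lambert (npow (2 * n + 1)) one_fun q)"
  define K :: complex where "K = 2 ^ (2 * n + 2)"
  define t where "t = sech2der (2 * n) 0"
  define q where "q = nome \<tau>"
  define \<kappa> where "\<kappa> = 2 * K * (K - 1) / t"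
  have E: "Eis (2 * n + 2) w = 1 - \<kappa> * L (nome w)" if "Im w > 0" for w
    unfolding Eis_lambert[OF that] \<kappa>_def K_def t_def L_def by (simp add: power_add)
  have t: "t \<noteq> 0" unfolding t_def by (rule sech2der_nonzero) simp
  have K1: "K \<noteq> 1" unfolding K_def by (rule two_power_ne_1)
  have K0: "K \<noteq> 0" by (simp add: K_def)
  have P: "(4 :: complex) ^ (2 * n + 2) = K * K"
    unfolding K_def by (simp only: power_mult_distrib[symmetric]) simp
  have o: "\<not> odd (2 * n + 2)" "(2 * n + 2) div 2 = n + 1" "2 * n + 2 \<noteq> 1" by simp_all
  have m: "(- 1 :: complex) ^ (n + 1) = - ((- 1) ^ n)" by simp
  have Em: "Eis (2 * n + 2) \<tau> = 1 - \<kappa> * L q" "Eis (2 * n + 2) (numeral m * \<tau>) = 1 - \<kappa> * L (q ^ numeral m)" for m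
    using E[OF \<tau>] E[of "numeral m * \<tau>"] \<tau> unfolding nome_numeral q_def by simp_all
  have "F4 (2 * n + 2) \<tau> = (- ((-1) ^ n) * (1 - \<kappa> * L q) - - ((-1) ^ n) * (1 - \<kappa> * L (q ^ 2)) - K * (1 - \<kappa> * L (q ^ 8)) + K * K * (1 - \<kappa> * L (q ^ 16))) / (K * (K - 1))"
    unfolding F4_def if_not_P[OF o(1)] if_not_P[OF o(3)] o(2) K_def[symmetric] P m Em ..
  then have "F4 (2 * n + 2) \<tau> * (t * K) = (-1) ^ n * (2 * K) * (L q - L (q ^ 2)) + K * (t + 2 * K * (L (q ^ 8) - K * L (q ^ 16)))"
    by (simp only: even_weight_combination[OF \<kappa>_def t K1 K0])
  also have "(-1) ^ n * (2 * K) * (L q - L (q ^ 2)) = (- 4) ^ n * exp_series (hcsc (lam \<tau>)) (2 * n) 0"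
    using csch_lambert[OF v(1), of "2 * n"] unfolding v(2,3) L_def q_def K_def
    by (simp add: power_mult power_minus[of 4])
  also have "\<dots> = sechQ n (a\<^sup>2) (b\<^sup>2)" unfolding csch_chain[OF v(1) n] v a_def b_def ..
  also have "2 * K * (L (q ^ 8) - K * L (q ^ 16)) = exp_series (geo_coeff sech2_coeff (2 * (2 * lam \<tau>))) (2 * n) 0"
    using sech2_dual_lambert[of "2 * (2 * lam \<tau>)" "2 * n"] v(1) unfolding mult.assoc[symmetric]
    by (simp add: v L_def q_def K_def power_add)
  also have "t + \<dots> = sechQ n (((a + b) / 2)\<^sup>2) (((a - b) / 2)\<^sup>2)"
  proof -
    have l2: "Re (2 * lam \<tau>) > 0" using v(1) by simp
    have "2 * (2 * lam \<tau>) = 4 * lam \<tau>" by simp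
    then have "t + exp_series (geo_coeff sech2_coeff (2 * (2 * lam \<tau>))) (2 * n) 0 = sechQ n (sechA (4 * lam \<tau>)) (sechA (2 * lam \<tau>) - sechA (4 * lam \<tau>))"
      using sech2_chain[OF l2 n] by (simp add: t_def)
    also have "sechA (2 * lam \<tau>) - sechA (4 * lam \<tau>) = ((a - b) / 2)\<^sup>2"
      unfolding v a_def b_def by (simp add: power2_eq_square field_simps)
    finally show ?thesis unfolding v a_def b_def .
  qed
  also have "\<dots> = sechQ n ((a + b)\<^sup>2) ((a - b)\<^sup>2) / K / K"
  proof -
    have e: "((a + b) / 2)\<^sup>2 = (a + b)\<^sup>2 / 2 / 2" "((a - b) / 2)\<^sup>2 = (a - b)\<^sup>2 / 2 / 2" by (simp_all add: power_divide)
    have "K = 4 ^ (n + 1)" by (simp add: K_def power_mult)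
    then show ?thesis unfolding e sechQ_half by simp
  qed
  finally show ?thesis unfolding t_def using K0 by (simp add: K_def)
qed

lemma minus_4_power: "(- 4 :: complex) ^ n = (- 1) ^ n * 4 ^ n"
  by (rule power_minus)

lemma chi_abs: "\<bar>chi4 n\<bar> \<le> 1" "\<bar>chi8 n\<bar> \<le> 1"
  by (simp_all add: chi4_def chi8_def)

lemma gen_Bernoulli_4_half:
  "of_rat (gen_Bernoulli (- 4) 4 (Suc n)) = - of_nat (Suc n) * (sechder n 0 / 2)"
proof -
  have "- (c / 2) * x = - c * (x / 2)" for c x :: complex by simp
  then show ?thesis unfolding gen_Bernoulli_4 .
qed

lemma Eis_4_chain:
  fixes n :: nat
  assumes \<tau>: "Im \<tau> > 0"
  defines "s \<equiv> sechder (2 * n) 0"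
  shows "Eis_inf (-4) 4 (2 * n + 1) \<tau> * s = bisech_chain (lam \<tau>) (2 * n) 0"
    "n \<ge> 1 \<Longrightarrow> Eis_zero (-4) 4 (2 * n + 1) \<tau> * s = exp_series (hsec (lam \<tau>)) (2 * n) 0"
proof -
  have s: "s \<noteq> 0" unfolding s_def by (rule sechder_nonzero) simp
  have B: "of_rat (gen_Bernoulli (- 4) 4 (Suc (2 * n))) = - of_nat (Suc (2 * n)) * (s / 2)"
    unfolding s_def by (rule gen_Bernoulli_4_half)
  have l: "Re (lam \<tau>) > 0" by (rule Re_lam[OF \<tau>])
  have v: "s / 2 \<noteq> 0" using s by simp
  note E = Eis_character_lambert[OF \<tau> B v chi_minus4 chi_abs(1)]
  show "Eis_inf (-4) 4 (2 * n + 1) \<tau> * s = bisech_chain (lam \<tau>) (2 * n) 0"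
    using E(1) s sech_dual_lambert[OF l, of "2 * n"] by (simp add: bisech_chain_def s_def nome_lam distrib_right)
  show "Eis_zero (-4) 4 (2 * n + 1) \<tau> * s = exp_series (hsec (lam \<tau>)) (2 * n) 0" if "n \<ge> 1"
    using E(2) s sech_lambert[OF l, of "2 * n"] that by (simp add: nome_lam)
qed

lemma bisech_chain_sechR:
  assumes "Re l > 0"
  shows "bisech_chain (2 * l) (2 * n) 0 = sechR n (sechA (2 * l)) (sechA l - sechA (2 * l))"
  using bisech_derivatives(1)[of 0 "2 * l" n] assms
  by (simp add: bisech_0 bisech_alpha_def bisech_gamma_def sechR_def)

lemma bisech_difference_sechR:
  assumes "Re l > 0"
  shows "bisech_chain l (2 * n) 0 - bisech_chain (2 * l) (2 * n) 0 = sechR n (sechA l - sechA (2 * l)) (sechA (2 * l))"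
  using bisech_half_derivatives[OF assms, of n]
  by (simp add: bisech_chain_def bisech_alpha_def bisech_gamma_def sechR_def add.commute mult.commute)

lemma hsec_chain_sechR:
  assumes "Re l > 0"
  shows "(- 4) ^ n * exp_series (hsec l) (2 * n) 0 = sechR n (sechA l) (sechB l)"
    "(- 4) ^ n * exp_series (hsec l) (2 * n) (\<i> * pi) = sechR n (sechB l) (sechA l)"
  using sech_series_derivatives[of 0 l n] sech_series_derivatives[of "\<i> * pi" l n] assms
  by (simp_all add: exp_series_hsec_0 exp_series_pi sechR_def flip: sechB_def add: add.commute mult.commute)

text \<open>The alternating sum is twice the even part minus the whole, and the even part is the
  series for \<open>2 * l\<close>. This accounts for the terms with \<open>E\<^sup>0\<close> at
  \<open>2 * \<tau>\<close> and \<open>4 * \<tau>\<close>.\<close>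

lemma exp_series_hsec_pi:
  assumes l: "Re l > 0"
  shows "exp_series (hsec l) (2 * n) (\<i> * pi) = 2 * 4 ^ n * exp_series (hsec (2 * l)) (2 * n) 0 - exp_series (hsec l) (2 * n) 0"
proof -
  define h where "h = (\<lambda>m. hsec l m * of_int m ^ (2 * n))"
  have s: "h summable_on UNIV" unfolding h_def using exp_series_0_summable[OF exp_decay_hsec[OF l] l] .
  have "exp_series (hsec l) (2 * n) (\<i> * pi) = infsum (\<lambda>m. sgn1 m * h m) UNIV"
    unfolding exp_series_def h_def exp_int_pi by (simp add: mult_ac)
  moreover have "exp_series (hsec l) (2 * n) 0 = infsum h UNIV" by (simp add: exp_series_def h_def)
  moreover have "infsum (\<lambda>m. h (2 * m)) UNIV = 4 ^ n * exp_series (hsec (2 * l)) (2 * n) 0"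
  proof -
    have p: "of_int (2 * m) ^ (2 * n) = 4 ^ n * (of_int m ^ (2 * n) :: complex)" for m
      by (simp only: of_int_mult of_int_numeral power_mult power_mult_distrib) simp
    show ?thesis unfolding exp_series_def h_def hsec_double
      by (simp only: p mult.left_commute[of _ "4 ^ n"] infsum_cmult_right' mult_zero_right exp_zero mult_1_right)
  qed
  ultimately show ?thesis using infsum_add_sgn[OF s] by (simp add: algebra_simps)
qed

lemma sechR_half: "sechR n (X / 2) (Y / 2) = sechR n X Y / (2 * 4 ^ n)"
proof -
  have "sechR n (1 / 2 * X) (1 / 2 * Y) = (1 / 2) ^ (2 * n + 1) * sechR n X Y" unfolding sechR_scale ..
  moreover have "(1 / 2 :: complex) ^ (2 * n + 1) = 1 / (2 * 4 ^ n)"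
    by (simp add: power_mult power_divide)
  ultimately show ?thesis by (simp only: times_divide_eq_left mult_1_left)
qed

text \<open>The six Eisenstein series form four groups: the dual series at a half period, the dual
  series for \<open>4 * l\<close> at \<open>0\<close>, the secant series for \<open>l\<close> at
  \<open>0\<close>, and the one for \<open>2 * l\<close> at \<open>\<i> * pi\<close>.\<close>

lemma F4_odd:
  assumes \<tau>: "Im \<tau> > 0" and n: "n \<ge> 1"
  defines "a \<equiv> thetaq (nome \<tau>)" and "b \<equiv> thetaq (- nome \<tau>)"
  shows "F4 (2 * n + 1) \<tau> * (2 * sechder (2 * n) 0) = sechM n a b + sechM n (a + b) (a - b) / 2 ^ (2 * n + 1)"
proof -
  note v = theta_sech_values[OF \<tau>, folded a_def b_def]
  define l where "l = lam \<tau>"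
  note v = v[folded l_def]
  have l2: "Re (2 * l) > 0" using v(1) by simp
  have l4: "2 * (2 * l) = 4 * l" by simp
  define s where "s = sechder (2 * n) 0"
  define e :: complex where "e = (- 1) ^ (n + 1)"
  define T where "T = (\<lambda>m. bisech_chain (m * l) (2 * n) 0)"
  define S where "S = (\<lambda>m. exp_series (hsec (m * l)) (2 * n) 0)"
  have E: "Eis_inf (-4) 4 (2 * n + 1) \<tau> * s = T 1" "Eis_zero (-4) 4 (2 * n + 1) \<tau> * s = S 1"
    "Eis_inf (-4) 4 (2 * n + 1) (numeral m * \<tau>) * s = T (numeral m)" "Eis_zero (-4) 4 (2 * n + 1) (numeral m * \<tau>) * s = S (numeral m)" for m
    using Eis_4_chain[OF \<tau>, of n] Eis_4_chain[of "numeral m * \<tau>" n] \<tau> n by (simp_all add: s_def T_def S_def l_def lam_mult)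
  have F4_eq: "F4 (2 * n + 1) \<tau> = 1 / 2 * (e * Eis_inf (-4) 4 (2 * n + 1) \<tau> - e * Eis_inf (-4) 4 (2 * n + 1) (2 * \<tau>)
      + 2 * Eis_inf (-4) 4 (2 * n + 1) (4 * \<tau>) - e * Eis_zero (-4) 4 (2 * n + 1) \<tau>
      + 4 ^ n * Eis_zero (-4) 4 (2 * n + 1) (2 * \<tau>) - 2 * 4 ^ n * 4 ^ n * Eis_zero (-4) 4 (2 * n + 1) (4 * \<tau>))"
  proof -
    have o: "2 * n + 1 \<noteq> 1" "odd (2 * n + 1)" "(2 * n + 1 + 1) div 2 = n + 1" "2 * n + 1 - 1 = 2 * n" "2 * (2 * n + 1) - 1 = Suc (2 * n + 2 * n)"
      using n by simp_all
    have p: "(2 :: complex) ^ (2 * n) = 4 ^ n" "(2 :: complex) ^ Suc (2 * n + 2 * n) = 2 * 4 ^ n * 4 ^ n"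
      by (simp_all only: power_Suc power_add power_mult) simp_all
    show ?thesis unfolding F4_def if_not_P[OF o(1)] if_P[OF o(2)] o(3-5) p e_def ..
  qed
  have "F4 (2 * n + 1) \<tau> * (2 * s) = e * (Eis_inf (-4) 4 (2 * n + 1) \<tau> * s) - e * (Eis_inf (-4) 4 (2 * n + 1) (2 * \<tau>) * s)
      + 2 * (Eis_inf (-4) 4 (2 * n + 1) (4 * \<tau>) * s) - e * (Eis_zero (-4) 4 (2 * n + 1) \<tau> * s)
      + 4 ^ n * (Eis_zero (-4) 4 (2 * n + 1) (2 * \<tau>) * s) - 2 * 4 ^ n * 4 ^ n * (Eis_zero (-4) 4 (2 * n + 1) (4 * \<tau>) * s)"
  proof -
    have "1 / 2 * (e * x1 - e * x2 + 2 * x3 - e * y1 + c * y2 - d * y3) * (2 * s)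
      = e * (x1 * s) - e * (x2 * s) + 2 * (x3 * s) - e * (y1 * s) + c * (y2 * s) - d * (y3 * s)" for x1 x2 x3 y1 y2 y3 c d
      by (simp add: algebra_simps)
    then show ?thesis unfolding F4_eq .
  qed
  also have "\<dots> = e * (T 1 - T 2) + 2 * T 4 - e * S 1 + 4 ^ n * (S 2 - 2 * 4 ^ n * S 4)"
    unfolding E by (simp add: algebra_simps)
  also have "T 1 - T 2 = sechR n ((a + b) * (a - b)) (a\<^sup>2 + b\<^sup>2) / (2 * 4 ^ n)"
  proof -
    have "T 1 - T 2 = sechR n ((a + b) * (a - b) / 2) ((a\<^sup>2 + b\<^sup>2) / 2)"
      using bisech_difference_sechR[OF v(1), of n] unfolding T_def v
      by (simp add: power2_eq_square algebra_simps add_divide_distrib diff_divide_distrib)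
    then show ?thesis unfolding sechR_half .
  qed
  also have "T 4 = sechR n ((a + b)\<^sup>2) ((a - b)\<^sup>2) / (2 * 4 ^ n) / (2 * 4 ^ n)"
  proof -
    have e1: "(a\<^sup>2 + b\<^sup>2) / 2 - ((a + b) / 2)\<^sup>2 = (a - b)\<^sup>2 / 2 / 2" "((a + b) / 2)\<^sup>2 = (a + b)\<^sup>2 / 2 / 2"
      by (simp_all add: power2_eq_square field_simps)
    have "T 4 = sechR n (((a + b) / 2)\<^sup>2) ((a\<^sup>2 + b\<^sup>2) / 2 - ((a + b) / 2)\<^sup>2)"
      using bisech_chain_sechR[OF l2, of n] unfolding l4 v T_def .
    then show ?thesis unfolding e1(1) unfolding e1(2) sechR_half .
  qed
  also have "S 1 = sechR n (a\<^sup>2) (b\<^sup>2) / (- 4) ^ n"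
    using hsec_chain_sechR(1)[OF v(1), of n] unfolding v S_def by (simp add: field_simps)
  also have "S 2 - 2 * 4 ^ n * S 4 = - (sechR n (a * b) ((a\<^sup>2 + b\<^sup>2) / 2) / (- 4) ^ n)"
    using hsec_chain_sechR(2)[OF l2, of n] unfolding exp_series_hsec_pi[OF l2] l4 v S_def by (simp add: field_simps)
  finally have F: "F4 (2 * n + 1) \<tau> * (2 * s) = e * (sechR n ((a + b) * (a - b)) (a\<^sup>2 + b\<^sup>2) / (2 * 4 ^ n))
     + 2 * (sechR n ((a + b)\<^sup>2) ((a - b)\<^sup>2) / (2 * 4 ^ n) / (2 * 4 ^ n)) - e * (sechR n (a\<^sup>2) (b\<^sup>2) / (- 4) ^ n)
     + 4 ^ n * - (sechR n (a * b) ((a\<^sup>2 + b\<^sup>2) / 2) / (- 4) ^ n)" .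
  have m: "((a + b)\<^sup>2 + (a - b)\<^sup>2) / 2 = a\<^sup>2 + b\<^sup>2" by (simp add: power2_eq_square field_simps)
  have p: "(2 :: complex) ^ (2 * n + 1) = 2 * 4 ^ n" by (simp add: power_mult)
  have c: "- e * (x / (- 4) ^ n) = x / 4 ^ n" "4 ^ n * - (x / (- 4) ^ n) = e * x" for x
    unfolding e_def minus_4_power by (cases "even n"; simp)+
  have "F4 (2 * n + 1) \<tau> * (2 * s) = e * (sechR n ((a + b) * (a - b)) (a\<^sup>2 + b\<^sup>2) / (2 * 4 ^ n))
     + sechR n ((a + b)\<^sup>2) ((a - b)\<^sup>2) / 4 ^ n / (2 * 4 ^ n) + - e * (sechR n (a\<^sup>2) (b\<^sup>2) / (- 4) ^ n)
     + 4 ^ n * - (sechR n (a * b) ((a\<^sup>2 + b\<^sup>2) / 2) / (- 4) ^ n)" unfolding F by simp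
  also have "\<dots> = sechM n a b + sechM n (a + b) (a - b) / 2 ^ (2 * n + 1)"
    unfolding c sechM_def m p e_def[symmetric] by (simp add: add_divide_distrib)
  finally show ?thesis unfolding s_def .
qed

lemma F4_1:
  assumes \<tau>: "Im \<tau> > 0"
  shows "F4 1 \<tau> = theta \<tau> * theta (4 * \<tau>)"
proof -
  define a where "a = thetaq (nome \<tau>)"
  define b where "b = thetaq (- nome \<tau>)"
  note v = theta_sech_values[OF \<tau>, folded a_def b_def]
  have E: "Eis_inf (-4) 4 1 w = sechA (lam w)" if "Im w > 0" for w
    using Eis_4_chain(1)[OF that, of 0] Re_lam[OF that] by (simp add: sechder_def bisech_chain_0 bisech_0)
  have Im: "Im (numeral m * \<tau>) > 0" for m using \<tau> by simp
  have "F4 1 \<tau> = 1 / 2 * (a\<^sup>2 - (a\<^sup>2 + b\<^sup>2) / 2 + 2 * ((a + b) / 2)\<^sup>2)"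
    unfolding F4_def E[OF \<tau>] E[OF Im] lam_mult v by simp
  also have "\<dots> = a * (a + b) / 2" by (simp add: power2_eq_square field_simps)
  also have "\<dots> = theta \<tau> * theta (4 * \<tau>)" using theta_values(5)[OF \<tau>] by (simp add: a_def b_def)
  finally show ?thesis .
qed

text \<open>In weight two the constants \<open>sechK\<close> and \<open>cschH\<close> are not
  removed by differentiation; they are matched through the square and product relations of the
  secant series.\<close>

lemma F_weight_2:
  assumes \<tau>: "Im \<tau> > 0"
  shows "F2 2 \<tau> = (theta \<tau> * theta (2 * \<tau>)) ^ 2"
    "F4 2 \<tau> = (theta \<tau> * theta (4 * \<tau>)) ^ 2 * (1 - 2 * x4 \<tau>)"
proof -
  define a where "a = thetaq (nome \<tau>)"
  define b where "b = thetaq (- nome \<tau>)"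
  define l where "l = lam \<tau>"
  define q where "q = nome \<tau>"
  note v = theta_sech_values[OF \<tau>, folded a_def b_def l_def q_def]
  note w = theta_values[OF \<tau>, folded a_def b_def]
  define L where "L = (\<lambda>q. lambert (npow 1) one_fun q)"
  have l: "Re (numeral m * l) > 0" for m using v(1) by simp
  have "sech2der 0 0 = 1" by (simp add: sech2der_def)
  then have E: "Eis 2 w = 1 - 24 * L (nome w)" if "Im w > 0" for w
    using Eis_lambert[OF that, of 0] by (simp add: L_def numeral_2_eq_2)
  have E1: "Eis 2 \<tau> = 1 - 24 * L q" "Eis 2 (numeral m * \<tau>) = 1 - 24 * L (q ^ numeral m)" for m
    using E[OF \<tau>] E[of "numeral m * \<tau>"] \<tau> unfolding nome_numeral q_def by simp_all
  have e: "2 * (2 * l) = 4 * l" "2 * (4 * l) = 8 * l" "4 * (2 * l) = 8 * l" "4 * (4 * l) = 16 * l" by simp_all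
  note v2 = v(2) v(3)
  have K1: "sechK l = 1 + 8 * (L (q ^ 2) - 4 * L (q ^ 4))" using sechK_lambert[OF v(1)] unfolding v2 L_def .
  have K2: "sechK (2 * l) = 1 + 8 * (L (q ^ 4) - 4 * L (q ^ 8))" using sechK_lambert[OF l[of "num.Bit0 num.One"]] unfolding e v2 L_def .
  have K4: "sechK (4 * l) = 1 + 8 * (L (q ^ 8) - 4 * L (q ^ 16))" using sechK_lambert[OF l[of "num.Bit0 (num.Bit0 num.One)"]] unfolding e v2 L_def .
  have H: "cschH l = 8 * (L q - L (q ^ 2))" using cschH_lambert[OF v(1)] unfolding v2 L_def .
  have r1: "(a\<^sup>2)\<^sup>2 = sechK l + cschH l" using sechA_square[OF v(1)] unfolding v .
  have r2: "a\<^sup>2 * b\<^sup>2 = 2 * sechK (2 * l) - sechK l" using sechA_mult_sechB[OF v(1)] unfolding v .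
  have r3: "(a\<^sup>2 + b\<^sup>2) / 2 * (a * b) = 2 * sechK (4 * l) - sechK (2 * l)"
    using sechA_mult_sechB[OF l[of "num.Bit0 num.One"]] unfolding e v .
  have "F2 2 \<tau> = (cschH l + 2 * sechK (2 * l)) / 2"
    unfolding F2_def K2 H by (simp add: E1, (simp add: field_simps)?)
  also have "\<dots> = ((a\<^sup>2)\<^sup>2 + a\<^sup>2 * b\<^sup>2) / 2" unfolding r1 r2 by simp
  also have "\<dots> = (theta \<tau> * theta (2 * \<tau>)) ^ 2" unfolding w(4) by (simp add: power2_eq_square algebra_simps)
  finally show "F2 2 \<tau> = (theta \<tau> * theta (2 * \<tau>)) ^ 2" .
  have "F4 2 \<tau> = (cschH l + 4 * sechK (4 * l)) / 4"
    unfolding F4_def K4 H by (simp add: E1, (simp add: field_simps)?)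
  also have "\<dots> = ((a\<^sup>2)\<^sup>2 + a\<^sup>2 * b\<^sup>2 + 2 * ((a\<^sup>2 + b\<^sup>2) / 2 * (a * b))) / 4" unfolding r1 r2 r3 by simp
  also have "\<dots> = (a * (a + b) / 2) ^ 2 * (1 - 2 * (b * (a - b) / (2 * a * (a + b))))"
  proof -
    have e1: "1 - 2 * (b * (a - b) / (2 * a * (a + b))) = (a\<^sup>2 + b\<^sup>2) / (a * (a + b))"
    proof -
      have "a * (a + b) / (a * (a + b)) = 1" using w(1,2) by simp
      moreover have "2 * (b * (a - b) / (2 * a * (a + b))) = b * (a - b) / (a * (a + b))" by simp
      moreover have "a\<^sup>2 + b\<^sup>2 = a * (a + b) - b * (a - b)" by (simp add: power2_eq_square algebra_simps)
      ultimately show ?thesis by (simp only: diff_divide_distrib)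
    qed
    have e2: "(a * (a + b) / 2) ^ 2 * ((a\<^sup>2 + b\<^sup>2) / (a * (a + b))) = a * (a + b) * (a\<^sup>2 + b\<^sup>2) / 4"
    proof -
      have "(c / 2) ^ 2 * (d / c) = c * d / 4" if "c \<noteq> 0" for c d :: complex
        using that by (simp add: power2_eq_square)
      then show ?thesis using w(1,2) by simp
    qed
    show ?thesis unfolding e1 e2 by (simp add: power2_eq_square algebra_simps)
  qed
  also have "\<dots> = (theta \<tau> * theta (4 * \<tau>)) ^ 2 * (1 - 2 * x4 \<tau>)" unfolding w(5,9) ..
  finally show "F4 2 \<tau> = (theta \<tau> * theta (4 * \<tau>)) ^ 2 * (1 - 2 * x4 \<tau>)" .
qed

text \<open>\<open>E\<^sup>\<infinity>\<close> is the dual series at \<open>\<i> * pi / 4\<close>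
  and \<open>E\<^sup>0\<close> the secant series for \<open>2 * l\<close> at \<open>z = l\<close>;
  both have the theta product as value. The conditional factor clears the denominator of
  \<open>F2\<close>.\<close>

lemma F2_odd:
  assumes \<tau>: "Im \<tau> > 0"
  defines "A \<equiv> thetaq (nome \<tau>) ^ 2" and "B \<equiv> thetaq (- nome \<tau>) ^ 2"
  shows "F2 (2 * n + 1) \<tau> * ((1 + (if n = 0 then 1 else 0)) * (fact (2 * n) * fps_nth quart_fps (2 * n)))
    = theta \<tau> * theta (2 * \<tau>) * 2 ^ n * (sechT n A B + sechT n (A + B) (A - B) / 2 ^ n)"
proof -
  define v where "v = (fact (2 * n) * fps_nth quart_fps (2 * n) :: complex)"
  define l where "l = lam \<tau>"
  define s where "s = sechS l"
  note w = theta_sech_values[OF \<tau>, folded A_def B_def l_def]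
  have v0: "v \<noteq> 0" unfolding v_def by (rule quart_nonzero) simp
  have B8: "of_rat (gen_Bernoulli (- 2) 8 (Suc (2 * n))) = - of_nat (Suc (2 * n)) * v"
    unfolding v_def by (rule gen_Bernoulli_8)
  have l: "Re l > 0" by (rule w(1))
  note E = Eis_character_lambert[OF \<tau> B8 v0 chi_minus2 chi_abs(2)]
  have vn: "v = 1" if "n = 0"
    using has_fps_expansion_imp_0_eq_fps_nth_0[OF quart_expansion] that by (simp add: v_def)
  have s2: "s ^ 2 = A * (A + B) / 2" using sechS_square[OF l] unfolding s_def w by simp
  have r2: "complex_of_real (sqrt 2) * complex_of_real (sqrt 2) = 2"
    by (simp flip: of_real_mult)
  have E1: "Eis_inf (-2) 8 (2 * n + 1) \<tau> * v = s * sechT n (A + B) (A - B)"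
  proof -
    \<comment> \<open>\<open>A\<close> and \<open>B\<close> are the arithmetic and geometric means
      of the values at \<open>l / 2\<close>, so this is the square of half their difference.\<close>
    have hh: "(sechA (l / 2) - A) ^ 2 = A ^ 2 - B ^ 2"
    proof -
      have l2: "Re (l / 2) > 0" using l by simp
      have h1: "sechB l ^ 2 = sechA (l / 2) * sechB (l / 2)" using sechB_double_square[OF l2] by simp
      have h2: "sechA l = (sechA (l / 2) + sechB (l / 2)) / 2" using sechA_double[OF l2] by simp
      have "(sechA (l / 2) - sechA l) ^ 2 = sechA l ^ 2 - sechB l ^ 2"
        unfolding h1 h2 by (simp add: power2_eq_square field_simps)
      then show ?thesis unfolding w .
    qed
    have ag: "bisech_alpha l = (A + B + (A - B)) ^ 2 / 4 + (A + B) * (A - B)"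
      "bisech_gamma l = - ((A + B) * (A - B) * ((A + B + (A - B)) ^ 2 / 4))"
      unfolding bisech_alpha_def bisech_gamma_def w hh by (simp_all add: power2_eq_square algebra_simps)
    have "sqrt 2 * (Eis_inf (-2) 8 (2 * n + 1) \<tau> * v) = bisech_chain l (2 * n) (\<i> * pi / 4)"
      using E(1) v0 sech_dual_quarter_lambert[OF l, of "2 * n"] sechder_quarter[of n]
      by (simp add: bisech_chain_def v_def[symmetric] nome_lam l_def distrib_right distrib_left)
    also have "\<dots> = sqrt 2 * s * ode_val 1 n (bisech_alpha l) (bisech_gamma l) 1 ((sqrt 2 * s) ^ 2)"
      using bisech_derivatives(1)[of "\<i> * pi / 4" l n] l pi_gt_zero by (simp add: bisech_quarter[OF l] s_def)
    also have "(sqrt 2 * s) ^ 2 = (A + B) * (A + B + (A - B)) / 2"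
      using s2 r2 by (simp add: power_mult_distrib power2_eq_square[of "complex_of_real (sqrt 2)"] mult.commute)
    also have "sqrt 2 * s * ode_val 1 n (bisech_alpha l) (bisech_gamma l) 1 ((A + B) * (A + B + (A - B)) / 2) = sqrt 2 * (s * sechT n (A + B) (A - B))"
      unfolding ag sechT_def by (simp only: mult.assoc)
    finally show ?thesis by simp
  qed
  have E0: "Eis_zero (-2) 8 (2 * n + 1) \<tau> * v = exp_series (hsec (2 * l)) (2 * n) l"
    using E(2) v0 vn sechS_lambert[OF l, of "2 * n"] by (auto simp: nome_lam l_def distrib_right)
  have E0': "(- 4) ^ n * (Eis_zero (-2) 8 (2 * n + 1) \<tau> * v) = s * sechT n A B"
  proof -
    have "(- 4) ^ n * exp_series (hsec (2 * l)) (2 * n) l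
      = s * ode_val 1 n (sechA (2 * l) ^ 2 + sechB (2 * l) ^ 2) (- (sechA (2 * l) ^ 2 * sechB (2 * l) ^ 2)) 1 (s ^ 2)"
      using sech_series_derivatives[of l "2 * l" n] l by (simp add: exp_series_hsec_quarter[OF l] s_def)
    also have "sechA (2 * l) ^ 2 = (A + B)\<^sup>2 / 4" unfolding w by (simp add: power_divide)
    also have "sechB (2 * l) ^ 2 = A * B" using sechB_double_square[OF l] unfolding w .
    also have "- ((A + B)\<^sup>2 / 4 * (A * B)) = - (A * B * ((A + B)\<^sup>2 / 4))" by simp
    finally show ?thesis unfolding E0 s2 sechT_def .
  qed
  have "(- 8) ^ n = 2 ^ n * (- 4 :: complex) ^ n" by (simp flip: power_mult_distrib)
  moreover have "F2 (2 * n + 1) \<tau> = (Eis_inf (-2) 8 (2 * n + 1) \<tau> + (- 8) ^ n * Eis_zero (-2) 8 (2 * n + 1) \<tau>) / (1 + (if n = 0 then 1 else 0))"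
    unfolding F2_def by simp
  ultimately have "F2 (2 * n + 1) \<tau> * ((1 + (if n = 0 then 1 else 0)) * v)
    = Eis_inf (-2) 8 (2 * n + 1) \<tau> * v + 2 ^ n * ((- 4) ^ n * (Eis_zero (-2) 8 (2 * n + 1) \<tau> * v))"
    by (simp add: algebra_simps)
  also have "\<dots> = s * 2 ^ n * (sechT n A B + sechT n (A + B) (A - B) / 2 ^ n)"
    unfolding E1 E0' by (simp add: algebra_simps)
  finally show ?thesis unfolding v_def s_def w .
qed

section \<open>Limits at the cusp and uniqueness\<close>

lemma even_index: "k \<ge> 1 \<Longrightarrow> \<not> odd k \<Longrightarrow> \<exists>n. k = 2 * n + 2" for k :: nat
  by presburger

text \<open>Points \<open>\<i> * (N + 1)\<close> of the upper half plane that tend to the cusp where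
  \<open>q = 0\<close>.\<close>

definition ray :: "nat \<Rightarrow> complex" where "ray N = \<i> * of_nat (Suc N)"

lemma Im_ray: "Im (ray N) > 0" by (simp add: ray_def)

lemma nome_ray: "filterlim (\<lambda>N. nome (ray N)) (at 0) sequentially"
proof -
  have "nome (ray N) = of_real (exp (- (2 * pi))) ^ Suc N" for N
  proof -
    have "2 * of_real pi * \<i> * ray N = of_nat (Suc N) * (- (2 * of_real pi))"
      by (simp add: ray_def algebra_simps)
    then have "nome (ray N) = exp (- (2 * of_real pi)) ^ Suc N" unfolding nome_def by (simp only: exp_of_nat_mult)
    then show ?thesis by (simp flip: exp_of_real)
  qed
  moreover have "(\<lambda>N. of_real (exp (- (2 * pi))) ^ Suc N :: complex) \<longlonglongrightarrow> 0"
    by (intro LIMSEQ_Suc LIMSEQ_power_zero) simp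
  ultimately show ?thesis using nome_props(2) by (simp add: filterlim_at)
qed

lemma nome_ray_numeral: "filterlim (\<lambda>N. nome (numeral m * ray N)) (at 0) sequentially"
proof -
  have "((\<lambda>q::complex. q ^ numeral m) \<longlongrightarrow> 0 ^ numeral m) (at 0)" by (intro tendsto_intros)
  then have "(\<lambda>N. nome (ray N) ^ numeral m) \<longlonglongrightarrow> 0"
    using filterlim_compose[OF _ nome_ray] by force
  then show ?thesis using nome_props(2) by (simp add: filterlim_at nome_numeral)
qed

lemma pseries_tendsto:
  assumes "pseries f g"
  shows "(f \<longlongrightarrow> fps_nth g 0) (at 0)"
proof (rule powser_limit_0[of 1])
  fix q :: complex assume "norm q < 1"
  then show "(\<lambda>n. fps_nth g n * q ^ n) sums f q"
    using assms has_sum_imp_sums by (auto simp: pseries_def)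
qed simp

lemma lambert_tendsto:
  assumes "\<And>n. norm (\<alpha> n) \<le> K * real n ^ p" "\<And>n. norm (\<beta> n) \<le> M"
  shows "(lambert \<alpha> \<beta> \<longlongrightarrow> 0) (at 0)"
  using pseries_tendsto[OF pseries_lambert[OF assms, of 0 1]] by simp

lemma thetaq_tendsto: "(thetaq \<longlongrightarrow> 1) (at 0)"
  using pseries_tendsto[OF pseries_theta] by (simp add: theta_fps_0_1)

lemma thetaq_ray: "(\<lambda>N. thetaq (nome (ray N))) \<longlonglongrightarrow> 1" "(\<lambda>N. thetaq (- nome (ray N))) \<longlonglongrightarrow> 1"
proof -
  show "(\<lambda>N. thetaq (nome (ray N))) \<longlonglongrightarrow> 1" by (rule filterlim_compose[OF thetaq_tendsto nome_ray])
  have "filterlim (\<lambda>N. - nome (ray N)) (at 0) sequentially"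
    using nome_ray tendsto_minus_cancel_left[of "\<lambda>N. nome (ray N)" 0 sequentially] by (simp add: filterlim_at)
  then show "(\<lambda>N. thetaq (- nome (ray N))) \<longlonglongrightarrow> 1" by (rule filterlim_compose[OF thetaq_tendsto])
qed

lemma theta_ray: "(\<lambda>N. theta (ray N)) \<longlonglongrightarrow> 1" "(\<lambda>N. theta (numeral m * ray N)) \<longlonglongrightarrow> 1"
  unfolding theta_nome
  by (rule filterlim_compose[OF thetaq_tendsto nome_ray] filterlim_compose[OF thetaq_tendsto nome_ray_numeral])+

lemma x_ray: "(\<lambda>N. x2 (ray N)) \<longlonglongrightarrow> 0" "(\<lambda>N. x4 (ray N)) \<longlonglongrightarrow> 0"
proof -
  let ?a = "\<lambda>N. thetaq (nome (ray N))" and ?b = "\<lambda>N. thetaq (- nome (ray N))"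
  have "(\<lambda>N. ?b N ^ 2 * (?a N ^ 2 - ?b N ^ 2) / (4 * ?a N ^ 2 * (?a N ^ 2 + ?b N ^ 2))) \<longlonglongrightarrow> 1 ^ 2 * (1 ^ 2 - 1 ^ 2) / (4 * 1 ^ 2 * (1 ^ 2 + 1 ^ 2))"
    by (intro tendsto_intros thetaq_ray) simp
  then show "(\<lambda>N. x2 (ray N)) \<longlonglongrightarrow> 0" unfolding theta_values(7)[OF Im_ray] by simp
  have "(\<lambda>N. ?b N * (?a N - ?b N) / (2 * ?a N * (?a N + ?b N))) \<longlonglongrightarrow> 1 * (1 - 1) / (2 * 1 * (1 + 1))"
    by (intro tendsto_intros thetaq_ray) simp
  then show "(\<lambda>N. x4 (ray N)) \<longlonglongrightarrow> 0" unfolding theta_values(9)[OF Im_ray] by simp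
qed

lemma Eis_ray:
  "(\<lambda>N. Eis (2 * n + 2) (ray N)) \<longlonglongrightarrow> 1" "(\<lambda>N. Eis (2 * n + 2) (numeral m * ray N)) \<longlonglongrightarrow> 1"
proof -
  have Im: "Im (numeral m * ray N) > 0" for N using Im_ray[of N] by simp
  have *: "(\<lambda>N. 1 - C * lambert (npow (2 * n + 1)) one_fun (w N)) \<longlonglongrightarrow> 1"
    if "filterlim w (at 0) sequentially" for C w
  proof -
    have "(\<lambda>N. 1 - C * lambert (npow (2 * n + 1)) one_fun (w N)) \<longlonglongrightarrow> 1 - C * 0"
      by (intro tendsto_intros filterlim_compose[OF lambert_tendsto[OF npow_bound one_bound] that])
    then show ?thesis by simp
  qed
  show "(\<lambda>N. Eis (2 * n + 2) (ray N)) \<longlonglongrightarrow> 1"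
    unfolding Eis_lambert[OF Im_ray] by (rule *[OF nome_ray])
  show "(\<lambda>N. Eis (2 * n + 2) (numeral m * ray N)) \<longlonglongrightarrow> 1"
    unfolding Eis_lambert[OF Im] by (rule *[OF nome_ray_numeral])
qed

lemma Eis_character_ray:
  fixes v :: complex
  assumes B: "of_rat (gen_Bernoulli D M (Suc j)) = - of_nat (Suc j) * v" and v: "v \<noteq> 0"
    and h: "\<And>n. n > 0 \<Longrightarrow> chi D n = h n" and h1: "\<And>n. \<bar>h n\<bar> \<le> 1"
  shows "(\<lambda>N. Eis_inf D M (Suc j) (ray N)) \<longlonglongrightarrow> 1" "(\<lambda>N. Eis_inf D M (Suc j) (numeral m * ray N)) \<longlonglongrightarrow> 1"
    "(\<lambda>N. Eis_zero D M (Suc j) (ray N)) \<longlonglongrightarrow> (if j = 0 then 1 else 0)"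
    "(\<lambda>N. Eis_zero D M (Suc j) (numeral m * ray N)) \<longlonglongrightarrow> (if j = 0 then 1 else 0)"
proof -
  have Im: "Im (numeral m * ray N) > 0" for N using Im_ray[of N] by simp
  have b1: "norm (of_int (h n) :: complex) \<le> 1" for n by (rule norm_of_int_le_1) (rule h1)
  have b2: "norm (of_int (h n) * npow j n :: complex) \<le> 1 * real n ^ j" for n
    unfolding norm_mult using b1[of n] by (intro mult_mono) (simp_all add: norm_power)
  have 1: "(\<lambda>N. 1 + C * lambert (\<lambda>n. of_int (h n) * npow j n) one_fun (w N)) \<longlonglongrightarrow> 1 + C * 0"
    if "filterlim w (at 0) sequentially" for C w
    by (intro tendsto_intros filterlim_compose[OF lambert_tendsto[OF b2 one_bound] that])
  have 2: "(\<lambda>N. d + C * lambert (npow j) (\<lambda>n. of_int (h n)) (w N)) \<longlonglongrightarrow> d + C * 0"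
    if "filterlim w (at 0) sequentially" for C d w
    by (intro tendsto_intros filterlim_compose[OF lambert_tendsto[OF npow_bound b1] that])
  have E: "Eis_inf D M (Suc j) w = 1 + 2 / v * lambert (\<lambda>n. of_int (h n) * npow j n) one_fun (nome w)"
    "Eis_zero D M (Suc j) w = (if j = 0 then 1 else 0) + 2 / v * lambert (npow j) (\<lambda>n. of_int (h n)) (nome w)" if "Im w > 0" for w
    by (rule Eis_character_lambert[OF that B v]; use h h1 in blast)+
  show "(\<lambda>N. Eis_inf D M (Suc j) (ray N)) \<longlonglongrightarrow> 1" "(\<lambda>N. Eis_inf D M (Suc j) (numeral m * ray N)) \<longlonglongrightarrow> 1"
    "(\<lambda>N. Eis_zero D M (Suc j) (ray N)) \<longlonglongrightarrow> (if j = 0 then 1 else 0)"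
    "(\<lambda>N. Eis_zero D M (Suc j) (numeral m * ray N)) \<longlonglongrightarrow> (if j = 0 then 1 else 0)"
    unfolding E(1)[OF Im_ray] E(2)[OF Im_ray] E(1)[OF Im] E(2)[OF Im]
    using 1[OF nome_ray] 1[OF nome_ray_numeral] 2[OF nome_ray] 2[OF nome_ray_numeral] by (simp_all only: mult_zero_right add_0_right)
qed

lemma F2_ray: "k \<ge> 1 \<Longrightarrow> (\<lambda>N. F2 k (ray N)) \<longlonglongrightarrow> 1"
proof (cases "odd k")
  case True
  then obtain n where k: "k = 2 * n + 1" by (elim oddE)
  note E = Eis_character_ray[OF gen_Bernoulli_8 quart_nonzero chi_minus2 chi_abs(2), of "2 * n"]
  have "(\<lambda>N. (Eis_inf (- 2) 8 (Suc (2 * n)) (ray N) + (- 8) ^ n * Eis_zero (- 2) 8 (Suc (2 * n)) (ray N)) / (1 + (if n = 0 then 1 else 0)))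
    \<longlonglongrightarrow> (1 + (- 8) ^ n * (if 2 * n = 0 then 1 else 0)) / (1 + (if n = 0 then 1 else 0))"
    by (intro tendsto_intros E) auto
  then show ?thesis unfolding F2_def k by (cases "n = 0") simp_all
next
  case False
  assume "k \<ge> 1"
  with False obtain n where k: "k = 2 * n + 2" using even_index by blast
  have o: "\<not> odd (2 * n + 2)" "(2 * n + 2) div 2 = n + 1" by simp_all
  have K: "(2 :: complex) ^ (2 * n + 2) - 1 \<noteq> 0" using two_power_ne_1[of n] by simp
  have "(\<lambda>N. ((- 1) ^ (n + 1) * Eis (2 * n + 2) (ray N) - (- 1) ^ (n + 1) * Eis (2 * n + 2) (2 * ray N) - 2 ^ (n + 1) * Eis (2 * n + 2) (4 * ray N)
      + 8 ^ (n + 1) * Eis (2 * n + 2) (8 * ray N)) / (2 ^ (n + 1) * (2 ^ (2 * n + 2) - 1)))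
    \<longlonglongrightarrow> ((- 1) ^ (n + 1) * 1 - (- 1) ^ (n + 1) * 1 - 2 ^ (n + 1) * 1 + 8 ^ (n + 1) * 1) / (2 ^ (n + 1) * (2 ^ (2 * n + 2) - 1))"
    by (intro tendsto_intros Eis_ray) (use K in simp)
  also have P: "(8 :: complex) ^ (n + 1) = 2 ^ (n + 1) * 2 ^ (2 * n + 2)"
  proof -
    have "(8 :: complex) = 2 * 4" "2 * n + 2 = 2 * (n + 1)" by simp_all
    then show ?thesis by (simp only: power_mult_distrib power_mult) simp
  qed
  also have "((- 1) ^ (n + 1) * 1 - (- 1) ^ (n + 1) * 1 - 2 ^ (n + 1) * 1 + 2 ^ (n + 1) * 2 ^ (2 * n + 2) * 1) / (2 ^ (n + 1) * (2 ^ (2 * n + 2) - 1)) = (1 :: complex)"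
  proof -
    have r: "(x * 1 - x * 1 - P * 1 + P * K * 1) / (P * (K - 1)) = 1" if "P \<noteq> 0" "K - 1 \<noteq> 0" for x P K :: complex
      using that by (simp add: field_simps)
    show ?thesis by (rule r) (use K in simp_all)
  qed
  finally show ?thesis unfolding F2_def k if_not_P[OF o(1)] o(2) P .
qed

lemma F4_ray: "k \<ge> 1 \<Longrightarrow> (\<lambda>N. F4 k (ray N)) \<longlonglongrightarrow> 1"
proof (cases "odd k")
  case True
  then obtain n where k: "k = 2 * n + 1" by (elim oddE)
  have B: "of_rat (gen_Bernoulli (- 4) 4 (Suc (2 * n))) = - of_nat (Suc (2 * n)) * (sechder (2 * n) 0 / 2)"
    by (rule gen_Bernoulli_4_half)
  have s: "sechder (2 * n) 0 / 2 \<noteq> 0" using sechder_nonzero[of "2 * n"] by simp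
  note E = Eis_character_ray[OF B s chi_minus4 chi_abs(1)]
  show ?thesis
  proof (cases "n = 0")
    case True
    have "(\<lambda>N. 1 / 2 * (Eis_inf (- 4) 4 (Suc (2 * n)) (ray N) - Eis_inf (- 4) 4 (Suc (2 * n)) (2 * ray N) + 2 * Eis_inf (- 4) 4 (Suc (2 * n)) (4 * ray N)))
      \<longlonglongrightarrow> 1 / 2 * (1 - 1 + 2 * 1)" by (intro tendsto_intros E) auto
    then show ?thesis unfolding F4_def k True by simp
  next
    case False
    have "(\<lambda>N. 1 / 2 * (c * Eis_inf (-4) 4 (Suc (2 * n)) (ray N) - c * Eis_inf (-4) 4 (Suc (2 * n)) (2 * ray N)
      + 2 * Eis_inf (-4) 4 (Suc (2 * n)) (4 * ray N) - c * Eis_zero (-4) 4 (Suc (2 * n)) (ray N)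
      + d * Eis_zero (-4) 4 (Suc (2 * n)) (2 * ray N) - e * Eis_zero (-4) 4 (Suc (2 * n)) (4 * ray N)))
      \<longlonglongrightarrow> 1 / 2 * (c * 1 - c * 1 + 2 * 1 - c * (if 2 * n = 0 then 1 else 0) + d * (if 2 * n = 0 then 1 else 0) - e * (if 2 * n = 0 then 1 else 0))" for c d e
      by (intro tendsto_intros E) auto
    then have *: "(\<lambda>N. 1 / 2 * (c * Eis_inf (-4) 4 (2 * n + 1) (ray N) - c * Eis_inf (-4) 4 (2 * n + 1) (2 * ray N)
      + 2 * Eis_inf (-4) 4 (2 * n + 1) (4 * ray N) - c * Eis_zero (-4) 4 (2 * n + 1) (ray N)
      + d * Eis_zero (-4) 4 (2 * n + 1) (2 * ray N) - e * Eis_zero (-4) 4 (2 * n + 1) (4 * ray N))) \<longlonglongrightarrow> 1" for c d e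
      using False by simp
    have o: "2 * n + 1 \<noteq> 1" "odd (2 * n + 1)" using False by simp_all
    show ?thesis unfolding F4_def k if_not_P[OF o(1)] if_P[OF o(2)] by (rule *)
  qed
next
  case False
  assume "k \<ge> 1"
  with False obtain n where k: "k = 2 * n + 2" using even_index by blast
  have o: "\<not> odd (2 * n + 2)" "(2 * n + 2) div 2 = n + 1" "2 * n + 2 \<noteq> 1" by simp_all
  have K: "(2 :: complex) ^ (2 * n + 2) - 1 \<noteq> 0" using two_power_ne_1[of n] by simp
  have "(\<lambda>N. ((- 1) ^ (n + 1) * Eis (2 * n + 2) (ray N) - (- 1) ^ (n + 1) * Eis (2 * n + 2) (2 * ray N) - 2 ^ (2 * n + 2) * Eis (2 * n + 2) (8 * ray N)
      + 4 ^ (2 * n + 2) * Eis (2 * n + 2) (16 * ray N)) / (2 ^ (2 * n + 2) * (2 ^ (2 * n + 2) - 1)))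
    \<longlonglongrightarrow> ((- 1) ^ (n + 1) * 1 - (- 1) ^ (n + 1) * 1 - 2 ^ (2 * n + 2) * 1 + 4 ^ (2 * n + 2) * 1) / (2 ^ (2 * n + 2) * (2 ^ (2 * n + 2) - 1))"
    by (intro tendsto_intros Eis_ray) (use K in simp)
  also have P: "(4 :: complex) ^ (2 * n + 2) = 2 ^ (2 * n + 2) * 2 ^ (2 * n + 2)"
    by (simp only: power_mult_distrib[symmetric]) simp
  also have "((- 1) ^ (n + 1) * 1 - (- 1) ^ (n + 1) * 1 - 2 ^ (2 * n + 2) * 1 + 2 ^ (2 * n + 2) * 2 ^ (2 * n + 2) * 1) / (2 ^ (2 * n + 2) * (2 ^ (2 * n + 2) - 1)) = (1 :: complex)"
  proof -
    have r: "(x * 1 - x * 1 - P * 1 + P * K * 1) / (P * (K - 1)) = 1" if "P \<noteq> 0" "K - 1 \<noteq> 0" for x P K :: complex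
      using that by (simp add: field_simps)
    show ?thesis by (rule r) (use K in simp_all)
  qed
  finally show ?thesis unfolding F4_def k if_not_P[OF o(1)] if_not_P[OF o(3)] o(2) P .
qed

text \<open>The limit at the cusp identifies \<open>M\<close> with the constant coefficient of
  \<open>c\<close>, and division by it gives the required normalisation. Two coefficient families
  differ by a polynomial that vanishes at all values of \<open>x\<close>.\<close>

lemma unique_expansion:
  fixes F Z x :: "complex \<Rightarrow> complex"
  assumes Z: "\<And>\<tau>. Im \<tau> > 0 \<Longrightarrow> Z \<tau> \<noteq> 0" and x: "\<And>\<tau>. Im \<tau> > 0 \<Longrightarrow> x \<tau> \<noteq> 0"
    and xl: "(\<lambda>N. x (ray N)) \<longlonglongrightarrow> 0" and Zl: "(\<lambda>N. Z (ray N)) \<longlonglongrightarrow> 1" and Fl: "(\<lambda>N. F (ray N)) \<longlonglongrightarrow> 1"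
    and c: "ratcoeffs c" "Polynomial.degree c \<le> L" and M: "M \<noteq> 0"
    and eq: "\<And>\<tau>. Im \<tau> > 0 \<Longrightarrow> F \<tau> * M = Z \<tau> ^ k * poly c (x \<tau>)"
  shows "\<exists>!d. d \<in> {1..L} \<rightarrow>\<^sub>E (\<rat> :: complex set) \<and>
    (\<forall>\<tau>. Im \<tau> > 0 \<longrightarrow> Z \<tau> ^ k = F \<tau> + Z \<tau> ^ k * (\<Sum>j=1..L. d j * x \<tau> ^ j))"
proof -
  have "(\<lambda>N. Z (ray N) ^ k * poly c (x (ray N))) \<longlonglongrightarrow> 1 ^ k * poly c 0"
    by (intro tendsto_intros Zl isCont_tendsto_compose[OF poly_isCont xl])
  moreover have "(\<lambda>N. F (ray N) * M) \<longlonglongrightarrow> 1 * M" by (intro tendsto_intros Fl)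
  ultimately have "1 ^ k * poly c 0 = 1 * M" using LIMSEQ_unique eq[OF Im_ray] by simp
  then have c0: "poly.coeff c 0 = M" by (simp add: poly_0_coeff_0)
  have pc: "poly c y = M + (\<Sum>j=1..L. poly.coeff c j * y ^ j)" for y
  proof -
    have "poly c y = (\<Sum>j\<le>L. poly.coeff c j * y ^ j)"
      unfolding poly_altdef using c(2) by (intro sum.mono_neutral_left) (auto simp: coeff_eq_0)
    also have "{..L} = insert 0 {1..L}" by auto
    finally show ?thesis by (simp add: c0)
  qed
  have rc: "poly.coeff c j \<in> \<rat>" for j using c(1) by (simp add: ratcoeffs_def)
  \<comment> \<open>Rationality of the transcendentally defined \<open>M\<close> comes from its
    being a coefficient of \<open>c\<close>.\<close>
  have MQ: "M \<in> \<rat>" using rc[of 0] by (simp add: c0)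
  define d where "d = restrict (\<lambda>j. - (poly.coeff c j / M)) {1..L}"
  have d: "d \<in> {1..L} \<rightarrow>\<^sub>E \<rat>" unfolding d_def using rc MQ by auto
  have deq: "Z \<tau> ^ k = F \<tau> + Z \<tau> ^ k * (\<Sum>j=1..L. d j * x \<tau> ^ j)" if "Im \<tau> > 0" for \<tau>
  proof -
    have "(\<Sum>j=1..L. d j * x \<tau> ^ j) = - ((\<Sum>j=1..L. poly.coeff c j * x \<tau> ^ j) / M)"
      unfolding sum_divide_distrib sum_negf[symmetric] by (intro sum.cong) (simp_all add: d_def)
    also have "\<dots> = 1 - poly c (x \<tau>) / M" unfolding pc using M by (simp add: field_simps)
    finally have s: "(\<Sum>j=1..L. d j * x \<tau> ^ j) = 1 - poly c (x \<tau>) / M" .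
    have "F \<tau> = Z \<tau> ^ k * poly c (x \<tau>) / M" using eq[OF that] M by (simp add: field_simps)
    then show ?thesis unfolding s by (simp add: algebra_simps)
  qed
  \<comment> \<open>The values along the ray are nonzero and tend to \<open>0\<close>, so they
    cannot form a finite set.\<close>
  have inf: "infinite (range (\<lambda>N. x (ray N)))"
  proof
    assume "finite (range (\<lambda>N. x (ray N)))"
    then have "closed (range (\<lambda>N. x (ray N)))" by (rule finite_imp_closed)
    then have "0 \<in> range (\<lambda>N. x (ray N))" by (rule closed_sequentially[OF _ _ xl]) auto
    then show False using x[OF Im_ray] by force
  qed
  show ?thesis
  proof (rule ex1I[of _ d])
    show "d \<in> {1..L} \<rightarrow>\<^sub>E \<rat> \<and> (\<forall>\<tau>. Im \<tau> > 0 \<longrightarrow> Z \<tau> ^ k = F \<tau> + Z \<tau> ^ k * (\<Sum>j=1..L. d j * x \<tau> ^ j))"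
      using d deq by blast
    fix e assume e: "e \<in> {1..L} \<rightarrow>\<^sub>E \<rat> \<and> (\<forall>\<tau>. Im \<tau> > 0 \<longrightarrow> Z \<tau> ^ k = F \<tau> + Z \<tau> ^ k * (\<Sum>j=1..L. e j * x \<tau> ^ j))"
    define p where "p = (\<Sum>j=1..L. Polynomial.monom (e j - d j) j)"
    have "poly p (x \<tau>) = 0" if "Im \<tau> > 0" for \<tau>
    proof -
      have "F \<tau> + Z \<tau> ^ k * (\<Sum>j=1..L. e j * x \<tau> ^ j) = F \<tau> + Z \<tau> ^ k * (\<Sum>j=1..L. d j * x \<tau> ^ j)"
        using e deq[OF that] that by metis
      then have "(\<Sum>j=1..L. e j * x \<tau> ^ j) = (\<Sum>j=1..L. d j * x \<tau> ^ j)" using Z[OF that] by simp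
      then show ?thesis by (simp add: p_def poly_sum poly_monom left_diff_distrib sum_subtractf)
    qed
    then have "range (\<lambda>N. x (ray N)) \<subseteq> {y. poly p y = 0}" using Im_ray by auto
    then have p: "p = 0" using inf finite_subset poly_roots_finite by blast
    have "e j = d j" if "j \<in> {1..L}" for j
    proof -
      have "poly.coeff p j = (\<Sum>i=1..L. if i = j then e i - d i else 0)"
        unfolding p_def coeff_sum by (intro sum.cong) simp_all
      also have "\<dots> = e j - d j" using that by simp
      finally show ?thesis using p by simp
    qed
    then show "e = d" using e d by (intro PiE_ext[of e "{1..L}" "\<lambda>_. \<rat>" d]) auto
  qed
qed

section \<open>Existence of the polynomials and conclusion\<close>

lemma ratcoeffs_rescale: "ratcoeffs c \<Longrightarrow> ratcoeffs (pcompose c [:0, 2:])"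
  by (simp add: ratcoeffs_def coeff_pcompose_linear)

text \<open>The forms are used at the squares \<open>A\<close> and \<open>B\<close>, where the
  weight factor is the square of the theta product and the invariant is \<open>2 * x2\<close>; the
  composition with \<open>[:0, 2:]\<close> absorbs this \<open>2\<close>.\<close>

lemma F2_polynomial:
  assumes k: "k \<ge> 1"
  shows "\<exists>c M. ratcoeffs c \<and> Polynomial.degree c \<le> ell2 k \<and> M \<noteq> 0 \<and>
    (\<forall>\<tau>. Im \<tau> > 0 \<longrightarrow> F2 k \<tau> * M = (theta \<tau> * theta (2 * \<tau>)) ^ k * poly c (x2 \<tau>))"
proof -
  let ?A = "\<lambda>\<tau>. thetaq (nome \<tau>) ^ 2" and ?B = "\<lambda>\<tau>. thetaq (- nome \<tau>) ^ 2"
  have nz: "?A \<tau> \<noteq> 0" "?A \<tau> + ?B \<tau> \<noteq> 0" if "Im \<tau> > 0" for \<tau> using theta_values(1,3)[OF that] by auto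
  have Z: "?A \<tau> * (?A \<tau> + ?B \<tau>) / 2 = (theta \<tau> * theta (2 * \<tau>)) ^ 2" if "Im \<tau> > 0" for \<tau>
    using theta_values(4)[OF that] by simp
  have X: "?B \<tau> * (?A \<tau> - ?B \<tau>) / (2 * ?A \<tau> * (?A \<tau> + ?B \<tau>)) = x2 \<tau> * 2" if "Im \<tau> > 0" for \<tau>
    using theta_values(7)[OF that] by simp
  show ?thesis
  proof (cases "odd k")
    case True
    then obtain n where k: "k = 2 * n + 1" by (elim oddE)
    obtain c where c: "ratcoeffs c" "Polynomial.degree c \<le> n"
      "\<And>a b. a \<noteq> 0 \<Longrightarrow> a + b \<noteq> 0 \<Longrightarrow> sechT n a b + sechT n (a + b) (a - b) / 2 ^ n = (a * (a + b) / 2) ^ n * poly c (b * (a - b) / (2 * a * (a + b)))"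
      using form_linear_odd[of n] by auto
    \<comment> \<open>The factor \<open>2 ^ n\<close> produced by
      \<open>(- 8) ^ (n) = 2 ^ n * (- 4) ^ n\<close> is moved to this side, which leaves the
      symmetrized form times one theta product; together with the weight \<open>n\<close> in its
      square this gives the exponent \<open>k\<close>.\<close>
    define M where "M = (1 + (if n = 0 then 1 else 0)) * (fact (2 * n) * fps_nth quart_fps (2 * n)) / (2 :: complex) ^ n"
    have "F2 k \<tau> * M = (theta \<tau> * theta (2 * \<tau>)) ^ k * poly (pcompose c [:0, 2:]) (x2 \<tau>)" if \<tau>: "Im \<tau> > 0" for \<tau>
    proof -
      have "F2 k \<tau> * M = theta \<tau> * theta (2 * \<tau>) * (sechT n (?A \<tau>) (?B \<tau>) + sechT n (?A \<tau> + ?B \<tau>) (?A \<tau> - ?B \<tau>) / 2 ^ n)"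
      proof -
        have "x * (m / 2 ^ n) = z * w" if "x * m = z * 2 ^ n * w" for x m z w :: complex
          using that by (simp add: field_simps)
        from this[OF F2_odd[OF \<tau>, of n]] show ?thesis unfolding k M_def .
      qed
      then show ?thesis unfolding c(3)[OF nz[OF \<tau>]] Z[OF \<tau>] X[OF \<tau>] k by (simp add: poly_pcompose power_mult)
    qed
    moreover have "M \<noteq> 0" unfolding M_def using quart_nonzero[of "2 * n"] by auto
    moreover have "Polynomial.degree (pcompose c [:0, 2:]) \<le> ell2 k" using c(2) by (simp add: k ell2_def degree_pcompose)
    ultimately show ?thesis using ratcoeffs_rescale[OF c(1)] by blast
  next
    case False
    then obtain n where k: "k = 2 * n + 2" using even_index[OF k] by blast
    show ?thesis
    proof (cases "n = 0")
      case True
      have "F2 k \<tau> * 1 = (theta \<tau> * theta (2 * \<tau>)) ^ k * poly 1 (x2 \<tau>)" if "Im \<tau> > 0" for \<tau>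
        using F_weight_2(1)[OF that] by (simp add: k True numeral_2_eq_2[symmetric])
      then show ?thesis by (intro exI[of _ "1 :: complex poly"] exI[of _ "1 :: complex"]) simp
    next
      case False
      then have n: "n \<ge> 1" by simp
      obtain c where c: "ratcoeffs c" "Polynomial.degree c \<le> n"
        "\<And>a b. a \<noteq> 0 \<Longrightarrow> a + b \<noteq> 0 \<Longrightarrow> sechQ n a b + sechQ n (a + b) (a - b) / 2 ^ (n + 1) = (a * (a + b) / 2) ^ (n + 1) * poly c (b * (a - b) / (2 * a * (a + b)))"
        using form_linear_even[OF n] by auto
      define M where "M = sech2der (2 * n) 0 * 2 ^ (n + 1)"
      have "F2 k \<tau> * M = (theta \<tau> * theta (2 * \<tau>)) ^ k * poly (pcompose c [:0, 2:]) (x2 \<tau>)" if \<tau>: "Im \<tau> > 0" for \<tau>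
      proof -
        have "k = 2 * (n + 1)" by (simp add: k)
        then show ?thesis unfolding k M_def F2_even[OF \<tau> n] c(3)[OF nz[OF \<tau>]] Z[OF \<tau>] X[OF \<tau>]
          by (simp only: poly_pcompose power_mult[symmetric]) simp
      qed
      moreover have "M \<noteq> 0" unfolding M_def using sech2der_nonzero[of "2 * n"] by simp
      moreover have "Polynomial.degree (pcompose c [:0, 2:]) \<le> ell2 k" using c(2) by (simp add: k ell2_def degree_pcompose)
      ultimately show ?thesis using ratcoeffs_rescale[OF c(1)] by blast
    qed
  qed
qed

lemma F4_polynomial:
  assumes k: "k \<ge> 1"
  shows "\<exists>c M. ratcoeffs c \<and> Polynomial.degree c \<le> ell4 k \<and> M \<noteq> 0 \<and>
    (\<forall>\<tau>. Im \<tau> > 0 \<longrightarrow> F4 k \<tau> * M = (theta \<tau> * theta (4 * \<tau>)) ^ k * poly c (x4 \<tau>))"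
proof (cases "odd k")
  case True
  then obtain n where k: "k = 2 * n + 1" by (elim oddE)
  show ?thesis
  proof (cases "n = 0")
    case True
    have "F4 k \<tau> * 1 = (theta \<tau> * theta (4 * \<tau>)) ^ k * poly 1 (x4 \<tau>)" if "Im \<tau> > 0" for \<tau>
      using F4_1[OF that] by (simp add: k True)
    then show ?thesis by (intro exI[of _ "1 :: complex poly"] exI[of _ "1 :: complex"]) simp
  next
    case False
    then have n: "n \<ge> 1" by simp
    obtain c where c: "ratcoeffs c" "Polynomial.degree c \<le> 2 * n - 1"
      "\<And>a b. a \<noteq> 0 \<Longrightarrow> a + b \<noteq> 0 \<Longrightarrow> sechM n a b + sechM n (a + b) (a - b) / 2 ^ (2 * n + 1) = (a * (a + b) / 2) ^ (2 * n + 1) * poly c (b * (a - b) / (2 * a * (a + b)))"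
      using form_quadratic_odd[OF n] by auto
    have "F4 k \<tau> * (2 * sechder (2 * n) 0) = (theta \<tau> * theta (4 * \<tau>)) ^ k * poly c (x4 \<tau>)" if \<tau>: "Im \<tau> > 0" for \<tau>
      unfolding k F4_odd[OF \<tau> n] c(3)[OF theta_values(1,2)[OF \<tau>]] theta_values(5,9)[OF \<tau>] ..
    moreover have "2 * sechder (2 * n) 0 \<noteq> 0" using sechder_nonzero[of "2 * n"] by simp
    moreover have "Polynomial.degree c \<le> ell4 k" using c(2) by (simp add: k ell4_def)
    ultimately show ?thesis using c(1) by blast
  qed
next
  case False
  then obtain n where k: "k = 2 * n + 2" using even_index[OF k] by blast
  show ?thesis
  proof (cases "n = 0")
    case True
    \<comment> \<open>In weight two the bound \<open>ell4 2 = 1\<close> is attained: the polynomial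
      is \<open>1 - 2 * x\<close>.\<close>
    have "F4 k \<tau> * 1 = (theta \<tau> * theta (4 * \<tau>)) ^ k * poly [:1, - 2:] (x4 \<tau>)" if "Im \<tau> > 0" for \<tau>
      using F_weight_2(2)[OF that] by (simp add: k True numeral_2_eq_2[symmetric] mult.commute)
    moreover have "ratcoeffs [:1, - 2:]" by (intro ratcoeffs_intros) simp_all
    ultimately show ?thesis
      by (intro exI[of _ "[:1, - 2:] :: complex poly"] exI[of _ "1 :: complex"]) (simp add: k True ell4_def)
  next
    case False
    then have n: "n \<ge> 1" by simp
    obtain c where c: "ratcoeffs c" "Polynomial.degree c \<le> 2 * n + 1"
      "\<And>a b. a \<noteq> 0 \<Longrightarrow> a + b \<noteq> 0 \<Longrightarrow> sechQ n (a\<^sup>2) (b\<^sup>2) + sechQ n ((a + b)\<^sup>2) ((a - b)\<^sup>2) / 2 ^ (2 * n + 2) = (a * (a + b) / 2) ^ (2 * n + 2) * poly c (b * (a - b) / (2 * a * (a + b)))"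
      using form_quadratic_even[OF n] by auto
    have "F4 k \<tau> * (sech2der (2 * n) 0 * 2 ^ (2 * n + 2)) = (theta \<tau> * theta (4 * \<tau>)) ^ k * poly c (x4 \<tau>)" if \<tau>: "Im \<tau> > 0" for \<tau>
      unfolding k F4_even[OF \<tau> n] c(3)[OF theta_values(1,2)[OF \<tau>]] theta_values(5,9)[OF \<tau>] ..
    moreover have "sech2der (2 * n) 0 * 2 ^ (2 * n + 2) \<noteq> 0" using sech2der_nonzero[of "2 * n"] by simp
    moreover have "Polynomial.degree c \<le> ell4 k" using c(2) by (simp add: k ell4_def)
    ultimately show ?thesis using c(1) by blast
  qed
qed

text \<open>The extensional function space \<open>\<rightarrow>\<^sub>E\<close> fixes the values
  outside the index range, so that unique existence of the function is uniqueness of the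
  coefficients; for an empty range it asserts the identity without a sum.\<close>

theorem theorem2p2:
  fixes k :: nat
  assumes "k \<ge> 1"
  shows "(\<exists>!c. c \<in> {1..ell2 k} \<rightarrow>\<^sub>E (\<rat> :: complex set) \<and>
            (\<forall>\<tau>. Im \<tau> > 0 \<longrightarrow>
               (theta \<tau> * theta (2 * \<tau>)) ^ k =
                 F2 k \<tau> + (theta \<tau> * theta (2 * \<tau>)) ^ k * (\<Sum>j=1..ell2 k. c j * x2 \<tau> ^ j))) \<and>
         (\<exists>!c. c \<in> {1..ell4 k} \<rightarrow>\<^sub>E (\<rat> :: complex set) \<and>
            (\<forall>\<tau>. Im \<tau> > 0 \<longrightarrow>
               (theta \<tau> * theta (4 * \<tau>)) ^ k =
                 F4 k \<tau> + (theta \<tau> * theta (4 * \<tau>)) ^ k * (\<Sum>j=1..ell4 k. c j * x4 \<tau> ^ j)))"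
proof (rule conjI)
  have Zl: "(\<lambda>N. theta (ray N) * theta (numeral m * ray N)) \<longlonglongrightarrow> 1" for m
    using tendsto_mult[OF theta_ray(1) theta_ray(2)] by simp
  obtain c M where c: "ratcoeffs c" "Polynomial.degree c \<le> ell2 k" "M \<noteq> 0"
    "\<And>\<tau>. Im \<tau> > 0 \<Longrightarrow> F2 k \<tau> * M = (theta \<tau> * theta (2 * \<tau>)) ^ k * poly c (x2 \<tau>)"
    using F2_polynomial[OF assms] by blast
  show "\<exists>!c. c \<in> {1..ell2 k} \<rightarrow>\<^sub>E (\<rat> :: complex set) \<and>
            (\<forall>\<tau>. Im \<tau> > 0 \<longrightarrow>
               (theta \<tau> * theta (2 * \<tau>)) ^ k =
                 F2 k \<tau> + (theta \<tau> * theta (2 * \<tau>)) ^ k * (\<Sum>j=1..ell2 k. c j * x2 \<tau> ^ j))"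
    by (rule unique_expansion[OF theta_values(6) theta_values(8) x_ray(1) Zl F2_ray[OF assms] c])
  obtain c M where c: "ratcoeffs c" "Polynomial.degree c \<le> ell4 k" "M \<noteq> 0"
    "\<And>\<tau>. Im \<tau> > 0 \<Longrightarrow> F4 k \<tau> * M = (theta \<tau> * theta (4 * \<tau>)) ^ k * poly c (x4 \<tau>)"
    using F4_polynomial[OF assms] by blast
  have Z: "theta \<tau> * theta (4 * \<tau>) \<noteq> 0" if "Im \<tau> > 0" for \<tau>
    using theta_values(1,2)[OF that] unfolding theta_values(5)[OF that] by simp
  show "\<exists>!c. c \<in> {1..ell4 k} \<rightarrow>\<^sub>E (\<rat> :: complex set) \<and>
            (\<forall>\<tau>. Im \<tau> > 0 \<longrightarrow>
               (theta \<tau> * theta (4 * \<tau>)) ^ k =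
                 F4 k \<tau> + (theta \<tau> * theta (4 * \<tau>)) ^ k * (\<Sum>j=1..ell4 k. c j * x4 \<tau> ^ j))"
    by (rule unique_expansion[OF Z theta_values(10) x_ray(2) Zl F4_ray[OF assms] c])
qed

end
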